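(* Let $d\ge 2$ and let $D$ be a bounded $C^{1,1}$ open set in $\mathbb{R}^d$. Let $X=\{X_t\}_{t\ge 0}$ be an isotropic Lévy process in $\mathbb{R}^d$ whose characteristic exponent $\psi$ is regularly varying at infinity with index $\alpha\in(1,2]$. Then $$\lim_{t\to 0^+}\psi^{-1}(1/t)\,\bigl(|D|-Q_D^X(t)\bigr)=|\partial D|\,\mathbb{E}\bigl[\overline{Y}^{(\alpha)}_1\bigr],$$ where $\overline{Y}^{(\alpha)}_t=\sup_{0\le s\le t}Y^{(\alpha)}_s$ is the supremum process of a symmetric $\alpha$-stable process $Y^{(\alpha)}$ in $\mathbb{R}$ started at $0$.
   Context: A Lévy process $X$ in $\mathbb{R}^d$ (with càdlàg paths) is isotropic if its law is invariant under rotations. $\mathbb{P}_x$ denotes the law of the process started at $x$, and $\mathbb{P}=\mathbb{P}_0$, $\mathbb{E}=\mathbb{E}_0$. The characteristic exponent $\psi$ is defined by $\mathbb{E}[e^{i\xi\cdot X_t}]=e^{-t\psi(\xi)}$, $\xi\in\mathbb{R}^d$. By isotropy $\psi$ is radial, and one writes $\psi(b)=\psi(\xi)$ whenever $|\xi|=b\ge 0$. A real-valued function $f$ is regularly varying at infinity with index $\alpha$ if $\lim_{y\to\infty} f(xy)/f(y)=x^\alpha$ for all $x>0$; for $\psi$ this refers to the radial function $b\mapsto\psi(b)$. $\psi^{-1}$ is the (generalized) inverse of $b\mapsto\psi(b)$, $\psi^{-1}(s)=\inf\{b\ge 0:\psi(b)>s\}$. For an open set $D$, $\tau_D^X=\inf\{t>0: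 X_t\notin D\}$ is the first exit time, and the spectral heat content is $Q_D^X(t)=\int_D\mathbb{P}_x(\tau_D^X>t)\,dx$, $t>0$. $|D|$ is the Lebesgue measure of $D$ and $|\partial D|$ is the perimeter, i.e. the $(d-1)$-dimensional surface measure of $\partial D$. An open set $D\subset\mathbb{R}^d$ is $C^{1,1}$ if there exist $R>0$ and $\Lambda>0$ such that for every $z\in\partial D$ there exist a $C^{1,1}$ function $\phi=\phi_z:\mathbb{R}^{d-1}\to\mathbb{R}$ with $\phi(0)=0$, $\nabla\phi(0)=0$, $\|\nabla\phi\|_\infty\le\Lambda$, $|\nabla\phi(x_1)-\nabla\phi(x_2)|\le\Lambda|x_1-x_2|$ for all $x_1,x_2\in\mathbb{R}^{d-1}$, and an orthonormal coordinate system $CS_z: y=(\tilde y,y_d)$ with origin at $z$ such that $B(z,R)\cap D=B(z,R)\cap\{y=(\tilde y,y_d)\text{ in }CS_z: y_d>\phi(\tilde y)\}$. The symmetric $\alpha$-stable process $Y^{(\alpha)}$ in $\mathbb{R}$ is the Lévy process with $\mathbb{E}[e^{i\xi Y^{(\alpha)}_t}]=e^{-t|\xi|^\alpha}$ (for $\alpha=2$, a Brownian motion running at twice the standard speed). *)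

theory Defs
  imports "HOL-Probability.Probability"
begin

definition cadlag :: "(real \<Rightarrow> 'a::topological_space) \<Rightarrow> bool" where
  "cadlag f \<longleftrightarrow> (\<forall>t\<ge>0. (f \<longlongrightarrow> f t) (at_right t)) \<and> (\<forall>t>0. \<exists>l. (f \<longlongrightarrow> l) (at_left t))"

text \<open>
  A process is indexed by \<^typ>\<open>real\<close>, but only times \<open>t \<ge> 0\<close> matter.  The process starts at \<open>0\<close>,
  so \<open>M\<close> plays the role of \<open>P = P\<^sub>0\<close>, and the law \<open>P\<^sub>x\<close> is that of \<open>\<lambda>t. x + X t\<close>.
\<close>
locale levy_process = prob_space M for M :: "'w measure" +
  fixes X :: "real \<Rightarrow> 'w \<Rightarrow> 'a::euclidean_space"
  assumes measurable_X: "\<And>t. 0 \<le> t \<Longrightarrow> X t \<in> borel_measurable M"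
    and start_0: "AE \<omega> in M. X 0 \<omega> = 0"
    and indep_increments: "\<And>(t::nat \<Rightarrow> real) n. 0 \<le> t 0 \<Longrightarrow> (\<And>i. i < n \<Longrightarrow> t i \<le> t (Suc i)) \<Longrightarrow>
      indep_vars (\<lambda>_. borel) (\<lambda>i \<omega>. X (t (Suc i)) \<omega> - X (t i) \<omega>) {..<n}"
    and stationary_increments: "\<And>s t. 0 \<le> s \<Longrightarrow> s \<le> t \<Longrightarrow>
      distr M borel (\<lambda>\<omega>. X t \<omega> - X s \<omega>) = distr M borel (X (t - s))"
    and cadlag_paths: "\<And>\<omega>. \<omega> \<in> space M \<Longrightarrow> cadlag (\<lambda>t. X t \<omega>)"

definition process_law :: "'w measure \<Rightarrow> (real \<Rightarrow> 'w \<Rightarrow> 'a::topological_space) \<Rightarrow> (real \<Rightarrow> 'a) measure"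
  where "process_law M X = distr M (\<Pi>\<^sub>M t\<in>{0..}. borel) (\<lambda>\<omega>. \<lambda>t\<in>{0..}. X t \<omega>)"

definition isotropic :: "'w measure \<Rightarrow> (real \<Rightarrow> 'w \<Rightarrow> real^'n) \<Rightarrow> bool" where
  "isotropic M X \<longleftrightarrow>
    (\<forall>Q. rotation_matrix Q \<longrightarrow> process_law M (\<lambda>t \<omega>. Q *v X t \<omega>) = process_law M X)"

definition char_exponent ::
  "'w measure \<Rightarrow> (real \<Rightarrow> 'w \<Rightarrow> 'a::euclidean_space) \<Rightarrow> ('a \<Rightarrow> complex) \<Rightarrow> bool" where
  "char_exponent M X \<psi> \<longleftrightarrow> (\<forall>t\<ge>0. \<forall>\<xi>.
    integral\<^sup>L M (\<lambda>\<omega>. exp (\<i> * complex_of_real (\<xi> \<bullet> X t \<omega>))) = exp (- (complex_of_real t * \<psi> \<xi>)))"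

text \<open>
  The exponent of an isotropic process in dimension at least 2 is real and radial, so that neither
  \<^const>\<open>Re\<close> nor the choice of \<open>\<xi>\<close> loses information.  Only arguments \<open>b \<ge> 0\<close> are meaningful.
\<close>
definition radial_profile :: "('a::euclidean_space \<Rightarrow> complex) \<Rightarrow> real \<Rightarrow> real" where
  "radial_profile \<psi> b = Re (\<psi> (SOME \<xi>. norm \<xi> = b))"

definition regularly_varying :: "real \<Rightarrow> (real \<Rightarrow> real) \<Rightarrow> bool" where
  "regularly_varying \<alpha> f \<longleftrightarrow> (\<forall>x>0. ((\<lambda>y. f (x * y) / f y) \<longlongrightarrow> x powr \<alpha>) at_top)"

definition gen_inverse :: "(real \<Rightarrow> real) \<Rightarrow> real \<Rightarrow> real" where
  "gen_inverse f s = Inf {b. 0 \<le> b \<and> f b > s}"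

definition exit_time :: "'a set \<Rightarrow> (real \<Rightarrow> 'a) \<Rightarrow> ereal" where
  "exit_time D f = Inf {ereal t | t. 0 < t \<and> f t \<notin> D}"

text \<open>
  The exit time of an open set need not be measurable before completion: the path may have a left
  limit outside \<open>D\<close> without leaving \<open>D\<close>.  As \<^const>\<open>measure\<close> vanishes on sets that are not
  measurable, the probability is taken with respect to the completion of \<open>M\<close>.
\<close>
definition spectral_heat_content ::
  "'w measure \<Rightarrow> (real \<Rightarrow> 'w \<Rightarrow> 'a::euclidean_space) \<Rightarrow> 'a set \<Rightarrow> real \<Rightarrow> real" where
  "spectral_heat_content M X D t =
    set_lebesgue_integral lebesgue D
      (\<lambda>x. measure (completion M) {\<omega> \<in> space M. exit_time D (\<lambda>s. x + X s \<omega>) > ereal t})"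

text \<open>
  Hausdorff (outer) measure, normalised so that it agrees with Lebesgue measure in dimension \<open>k\<close>.
\<close>
definition hausdorff_premeasure :: "nat \<Rightarrow> real \<Rightarrow> 'a::metric_space set \<Rightarrow> ennreal" where
  "hausdorff_premeasure k \<delta> A =
    (INF U \<in> {U :: nat \<Rightarrow> 'a set. A \<subseteq> (\<Union>i. U i) \<and> (\<forall>i. bounded (U i) \<and> diameter (U i) \<le> \<delta>)}.
      \<Sum>i. if U i = {} then 0 else ennreal (unit_ball_vol (real k) * (diameter (U i) / 2) ^ k))"

definition hausdorff_measure :: "nat \<Rightarrow> 'a::metric_space set \<Rightarrow> ennreal" where
  "hausdorff_measure k A = (SUP \<delta>\<in>{0<..}. hausdorff_premeasure k \<delta> A)"

text \<open>
  Finite for bounded \<open>C\<^sup>1\<^sup>,\<^sup>1\<close> open sets, so that \<^const>\<open>enn2real\<close> is harmless there.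
\<close>
definition perimeter :: "(real^'n) set \<Rightarrow> real" where
  "perimeter D = enn2real (hausdorff_measure (CARD('n) - 1) (frontier D))"

text \<open>
  \<open>R\<^sup>d\<^sup>-\<^sup>1\<close> is identified with the coordinate hyperplane \<open>x\<^sub>k = 0\<close> of \<open>R\<^sup>d\<close>: \<open>k\<close> is the index of the
  coordinate \<open>y\<^sub>d\<close>, and the remaining coordinates form the vector \<open>drop_coord k y\<close>.
\<close>
definition coord_hyperplane :: "'n \<Rightarrow> (real^'n) set" where
  "coord_hyperplane k = {x. x $ k = 0}"

definition drop_coord :: "'n \<Rightarrow> real^'n \<Rightarrow> real^'n" where
  "drop_coord k y = (\<chi> i. if i = k then 0 else y $ i)"

text \<open>
  Here \<open>g\<close> is the gradient of \<open>\<phi>\<close> on the hyperplane, and \<open>T (y - z)\<close> are the coordinates of \<open>y\<close> in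
  the orthonormal coordinate system with origin \<open>z\<close>.
\<close>
definition c11_open :: "(real^'n) set \<Rightarrow> bool" where
  "c11_open D \<longleftrightarrow> open D \<and> (\<exists>R>0. \<exists>\<Lambda>>0. \<forall>z\<in>frontier D.
     \<exists>(k::'n) (\<phi> :: real^'n \<Rightarrow> real) (g :: real^'n \<Rightarrow> real^'n) (T :: real^'n \<Rightarrow> real^'n).
     \<phi> 0 = 0 \<and> g 0 = 0 \<and>
     (\<forall>x\<in>coord_hyperplane k. g x \<in> coord_hyperplane k \<and>
        (\<phi> has_derivative (\<lambda>h. g x \<bullet> h)) (at x within coord_hyperplane k) \<and> norm (g x) \<le> \<Lambda>) \<and>
     (\<forall>x\<^sub>1\<in>coord_hyperplane k. \<forall>x\<^sub>2\<in>coord_hyperplane k. norm (g x\<^sub>1 - g x\<^sub>2) \<le> \<Lambda> * norm (x\<^sub>1 - x\<^sub>2)) \<and>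
     orthogonal_transformation T \<and>
     ball z R \<inter> D = ball z R \<inter> {y. T (y - z) $ k > \<phi> (drop_coord k (T (y - z)))})"

definition sup_process :: "(real \<Rightarrow> 'w \<Rightarrow> real) \<Rightarrow> real \<Rightarrow> 'w \<Rightarrow> real" where
  "sup_process Y t \<omega> = (SUP s\<in>{0..t}. Y s \<omega>)"

definition symmetric_stable_process :: "real \<Rightarrow> 'w measure \<Rightarrow> (real \<Rightarrow> 'w \<Rightarrow> real) \<Rightarrow> bool" where
  "symmetric_stable_process \<alpha> N Y \<longleftrightarrow>
    levy_process N Y \<and> char_exponent N Y (\<lambda>\<xi>. complex_of_real (\<bar>\<xi>\<bar> powr \<alpha>))"

end

theory Submission
  imports Defs
begin

text \<open>
  The heat loss \<open>|D| - Q(t)\<close> is the expected volume of the set of starting points \<open>x\<close> in \<open>D\<close> from which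
  the translated path leaves \<open>D\<close> before time \<open>t\<close>.  Up to null sets this is decided at the countably many
  dyadic fractions of \<open>t\<close>, so \<open>|D| - Q(t) = E V(K)\<close>, where \<open>K\<close> is the set of the positions of \<open>X\<close> at these
  times and \<open>V(K)\<close> is the volume of \<open>{x \<in> D. \<exists>k\<in>K. x + k \<notin> D}\<close> (\<open>heat_content_deficit\<close>).

  Geometry.  A \<open>C\<^sup>1\<^sup>,\<^sup>1\<close> boundary is flat on small scales, uniformly over the boundary.  Hence if \<open>K\<close> lies in a
  small ball of radius \<open>r\<close>, the points counted by \<open>V(K)\<close> form, up to an error \<open>o(r)\<close>, a layer over the
  boundary whose thickness at a point with inner normal \<open>\<nu>\<close> is the largest displacement
  \<open>sup {- k \<bullet> \<nu> | k \<in> K}\<close> of \<open>K\<close> against the normal.  Cutting the boundary into finitely many nearly flat pieces gives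
  \<open>V(K) \<approx> (\<Sum>i. a\<^sub>i * sup {- k \<bullet> \<nu>\<^sub>i | k \<in> K})\<close> with \<open>\<Sum>i. a\<^sub>i \<approx> |\<partial>D|\<close> (\<open>boundary_layer_volume\<close>).  Here \<open>a\<^sub>i\<close> is the
  area of a projection of a piece, and it has to be compared with the Hausdorff measure in the perimeter.  That a
  projected area is at most the Hausdorff measure is the isodiametric inequality, which follows from
  Brunn-Minkowski; the converse for Lipschitz graphs comes from efficient coverings by cubes.

  Probability.  By isotropy, the displacement of the path against \<open>\<nu>\<^sub>i\<close> is the running maximum of a symmetric
  one-dimensional Levy process with exponent \<open>f = radial_profile \<psi>\<close>.  Let \<open>b = f\<^sup>-\<^sup>1(1/t)\<close>.  Regular variation
  gives \<open>t * f (b * x) \<rightarrow> x powr \<alpha>\<close>, so the increments of the process over times comparable to \<open>t\<close>, multiplied by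
  \<open>b\<close>, converge in law to those of the stable process.  The maximum over a fixed finite grid depends continuously on the
  law of the increments (\<open>weak_conv_maxlaw\<close>), and a decomposition at the first passage time shows that a coarse grid
  misses little of the running maximum, uniformly in \<open>t\<close> (\<open>coarse_grid_comparison\<close>).  This yields
  \<open>E min (b * max) A \<rightarrow> E min (sup Y) A\<close> for every truncation level \<open>A\<close> (\<open>truncated_sup_limit\<close>).

  The truncation is removed by one tail bound: for \<open>1 < \<beta> < \<alpha>\<close>, the probability that \<open>b * sup |X|\<close> exceeds \<open>x\<close> is
  at most a constant times \<open>x powr -\<beta>\<close> for all \<open>1 \<le> x < b\<close> (\<open>uniform_tail\<close>), by Levy's maximal inequality, the truncation inequality
  for characteristic functions, and a Potter bound for \<open>f\<close>.  Levels beyond \<open>b\<close>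
  are irrelevant because \<open>V\<close> is bounded by \<open>|D|\<close>.
\<close>

section \<open>The Brunn-Minkowski inequality for finite unions of boxes\<close>

definition box_family :: "'a::euclidean_space set set => bool" where
 "box_family \<A> \<longleftrightarrow> finite \<A> \<and> \<A> \<noteq> {} \<and> pairwise disjnt \<A> \<and> (\<forall>A\<in>\<A>. A \<noteq> {} \<and> (\<exists>a b. A = box a b))"

lemma box_Int_halfspace:
 fixes a b :: "'a::euclidean_space"
 assumes "i \<in> Basis"
 shows "box a b \<inter> {x. x \<bullet> i < c} = box a (\<Sum>j\<in>Basis. (if j = i then min (b \<bullet> i) c else b \<bullet> j) *\<^sub>R j)"
  and "box a b \<inter> {x. x \<bullet> i > c} = box (\<Sum>j\<in>Basis. (if j = i then max (a \<bullet> i) c else a \<bullet> j) *\<^sub>R j) b"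
proof -
 show "box a b \<inter> {x. x \<bullet> i < c} = box a (\<Sum>j\<in>Basis. (if j = i then min (b \<bullet> i) c else b \<bullet> j) *\<^sub>R j)"
 proof (rule set_eqI)
  fix x
  show "x \<in> box a b \<inter> {x. x \<bullet> i < c} \<longleftrightarrow> x \<in> box a (\<Sum>j\<in>Basis. (if j = i then min (b \<bullet> i) c else b \<bullet> j) *\<^sub>R j)"
   unfolding Int_iff mem_Collect_eq mem_box using assms by (auto split: if_splits)
 qed
 show "box a b \<inter> {x. x \<bullet> i > c} = box (\<Sum>j\<in>Basis. (if j = i then max (a \<bullet> i) c else a \<bullet> j) *\<^sub>R j) b"
 proof (rule set_eqI)
  fix x
  show "x \<in> box a b \<inter> {x. x \<bullet> i > c} \<longleftrightarrow> x \<in> box (\<Sum>j\<in>Basis. (if j = i then max (a \<bullet> i) c else a \<bullet> j) *\<^sub>R j) b"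
   unfolding Int_iff mem_Collect_eq mem_box using assms by (auto split: if_splits)
 qed
qed

definition cut_below :: "'a::euclidean_space set set => 'a => real => 'a set set" where
 "cut_below \<A> i c = (\<lambda>A. A \<inter> {x. x \<bullet> i < c}) ` \<A> - {{}}"

definition cut_above :: "'a::euclidean_space set set => 'a => real => 'a set set" where
 "cut_above \<A> i c = (\<lambda>A. A \<inter> {x. x \<bullet> i > c}) ` \<A> - {{}}"

lemma Union_cut: "\<Union>(cut_below \<A> i c) = \<Union>\<A> \<inter> {x. x \<bullet> i < c}"
  "\<Union>(cut_above \<A> i c) = \<Union>\<A> \<inter> {x. x \<bullet> i > c}"
 unfolding cut_below_def cut_above_def by auto

text \<open>Cutting along a coordinate hyperplane loses only a null set and keeps the family one of disjoint boxes; this is what makes an induction on the number of boxes possible.\<close>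
lemma box_family_cut:
 assumes "box_family \<A>" "i \<in> Basis"
 shows "cut_below \<A> i c \<noteq> {} ==> box_family (cut_below \<A> i c)"
  and "cut_above \<A> i c \<noteq> {} ==> box_family (cut_above \<A> i c)"
proof -
 have fin: "finite \<A>" and disj: "pairwise disjnt \<A>" and bx: "\<And>A. A \<in> \<A> ==> \<exists>a b. A = box a b"
  using assms(1) unfolding box_family_def by auto
 have d: "pairwise disjnt ((\<lambda>A. A \<inter> H) ` \<A> - {{}})" for H
  using disj unfolding pairwise_def disjnt_def by (auto; blast)
 have b: "\<exists>a b. A \<inter> {x. x \<bullet> i < c} = box a b" "\<exists>a b. A \<inter> {x. x \<bullet> i > c} = box a b" if "A \<in> \<A>" for A
 proof -
  obtain a b where ab: "A = box a b" using bx[OF \<open>A \<in> \<A>\<close>] by metis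
  then show "\<exists>a b. A \<inter> {x. x \<bullet> i < c} = box a b" "\<exists>a b. A \<inter> {x. x \<bullet> i > c} = box a b"
   using box_Int_halfspace(1)[OF assms(2), of a b c] box_Int_halfspace(2)[OF assms(2), of a b c] by blast+
 qed
 show "cut_below \<A> i c \<noteq> {} ==> box_family (cut_below \<A> i c)"
  unfolding box_family_def using fin d[of "{x. x \<bullet> i < c}"] b by (auto simp: cut_below_def)
 show "cut_above \<A> i c \<noteq> {} ==> box_family (cut_above \<A> i c)"
  unfolding box_family_def using fin d[of "{x. x \<bullet> i > c}"] b by (auto simp: cut_above_def)
qed

lemma card_cut_le:
 assumes "finite \<A>"
 shows "card (cut_below \<A> i c) \<le> card \<A>" "card (cut_above \<A> i c) \<le> card \<A>"
proof -
 have *: "card (f ` \<A> - {{}}) \<le> card \<A>" for f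
  using card_mono[of "f ` \<A>" "f ` \<A> - {{}}"] card_image_le[of \<A> f] assms by fastforce
 show "card (cut_below \<A> i c) \<le> card \<A>" "card (cut_above \<A> i c) \<le> card \<A>"
  unfolding cut_below_def cut_above_def by (rule *)+
qed

lemma card_cut_less:
 assumes "finite \<A>" "A \<in> \<A>"
 shows "A \<inter> {x. x \<bullet> i < c} = {} ==> card (cut_below \<A> i c) < card \<A>"
  and "A \<inter> {x. x \<bullet> i > c} = {} ==> card (cut_above \<A> i c) < card \<A>"
proof -
 have *: "card ((\<lambda>A. A \<inter> H) ` \<A> - {{}}) < card \<A>" if "A \<inter> H = {}" for H
 proof -
  have "(\<lambda>A. A \<inter> H) ` \<A> - {{}} \<subseteq> (\<lambda>A. A \<inter> H) ` (\<A> - {A})"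
   using that by auto
  then have "card ((\<lambda>A. A \<inter> H) ` \<A> - {{}}) \<le> card (\<A> - {A})"
   using assms by (meson card_image_le card_mono dual_order.trans finite_Diff finite_imageI)
  also have "\<dots> < card \<A>"
   using assms by (intro card_Diff1_less)
  finally show ?thesis .
 qed
 show "A \<inter> {x. x \<bullet> i < c} = {} ==> card (cut_below \<A> i c) < card \<A>"
  unfolding cut_below_def by (rule *)
 show "A \<inter> {x. x \<bullet> i > c} = {} ==> card (cut_above \<A> i c) < card \<A>"
  unfolding cut_above_def by (rule *)
qed

lemma box_family_Union:
 assumes "box_family \<A>"
 shows "open (\<Union>\<A>)" "bounded (\<Union>\<A>)" "\<Union>\<A> \<noteq> {}" "\<Union>\<A> \<in> lmeasurable" "measure lebesgue (\<Union>\<A>) > 0"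
proof -
 show o: "open (\<Union>\<A>)"
  using assms unfolding box_family_def by (metis open_Union open_box)
 show b: "bounded (\<Union>\<A>)"
  using assms unfolding box_family_def by (metis bounded_Union bounded_box)
 show ne: "\<Union>\<A> \<noteq> {}"
  using assms unfolding box_family_def by auto
 show m: "\<Union>\<A> \<in> lmeasurable"
  using o b by (rule lmeasurable_open[rotated])
 show "measure lebesgue (\<Union>\<A>) > 0"
  using o ne m open_not_negligible[OF o ne]
  by (metis negligible_iff_measure zero_less_measure_iff)
qed

lemma negligible_level: "i \<in> Basis ==> negligible {x::'a::euclidean_space. x \<bullet> i = c}"
 by (rule negligible_standard_hyperplane)

lemma measure_cut:
 assumes "box_family \<A>" "i \<in> Basis"
 shows "measure lebesgue (\<Union>\<A>) = measure lebesgue (\<Union>(cut_below \<A> i c)) + measure lebesgue (\<Union>(cut_above \<A> i c))"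
proof -
 note m = box_family_Union[OF assms(1)]
 have o: "open (\<Union>\<A> \<inter> {x. x \<bullet> i < c})" "open (\<Union>\<A> \<inter> {x. x \<bullet> i > c})"
  using m(1) by (auto intro!: open_Int open_halfspace_component_lt open_halfspace_component_gt)
 have l: "\<Union>\<A> \<inter> {x. x \<bullet> i < c} \<in> lmeasurable" "\<Union>\<A> \<inter> {x. x \<bullet> i > c} \<in> lmeasurable"
  using o m(2) by (auto intro!: lmeasurable_open bounded_Int)
 have "measure lebesgue (\<Union>\<A>) = measure lebesgue (\<Union>\<A> \<inter> {x. x \<bullet> i < c} \<union> \<Union>\<A> \<inter> {x. x \<bullet> i > c})"
 proof (rule measure_negligible_symdiff[symmetric])
  show "\<Union>\<A> \<in> lmeasurable" by (rule m(4))
  show "negligible (sym_diff (\<Union>\<A>) (\<Union>\<A> \<inter> {x. x \<bullet> i < c} \<union> \<Union>\<A> \<inter> {x. x \<bullet> i > c}))"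
   by (rule negligible_subset[OF negligible_level[OF assms(2), of c]]) auto
 qed
 also have "\<dots> = measure lebesgue (\<Union>\<A> \<inter> {x. x \<bullet> i < c}) + measure lebesgue (\<Union>\<A> \<inter> {x. x \<bullet> i > c})"
 proof -
  have "(\<Union>\<A> \<inter> {x. x \<bullet> i < c}) \<inter> (\<Union>\<A> \<inter> {x. x \<bullet> i > c}) = {}" by fastforce
  then show ?thesis using measure_Un3[OF l] by simp
 qed
 finally show ?thesis unfolding Union_cut .
qed

text \<open>The mass below a moving hyperplane is a continuous function of its level, so the intermediate value theorem applies.\<close>
lemma cut_level_exists:
 fixes B :: "'a::euclidean_space set"
 assumes "B \<in> lmeasurable" "bounded B" "i \<in> Basis" "0 \<le> m" "m \<le> measure lebesgue B"
 obtains c where "measure lebesgue (B \<inter> {x. x \<bullet> i < c}) = m"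
proof -
 let ?N = "distr (restrict_space lebesgue B) borel (\<lambda>x. x \<bullet> i)"
 have Bs: "B \<in> sets lebesgue" using assms(1) by auto
 have ms: "(\<lambda>x. x \<bullet> i) \<in> restrict_space lebesgue B \<rightarrow>\<^sub>M borel"
  by (intro measurable_restrict_space1 measurable_completion) simp
 have e: "measure ?N S = measure lebesgue (B \<inter> {x. x \<bullet> i \<in> S})" if "S \<in> sets borel" for S
 proof -
  have "measure ?N S = measure (restrict_space lebesgue B) ((\<lambda>x. x \<bullet> i) -` S \<inter> B)"
   using that by (subst measure_distr[OF ms]) (auto simp: space_restrict_space)
  also have "\<dots> = measure lebesgue ((\<lambda>x. x \<bullet> i) -` S \<inter> B)"
   using Bs by (subst measure_restrict_space) auto
  also have "(\<lambda>x. x \<bullet> i) -` S \<inter> B = B \<inter> {x. x \<bullet> i \<in> S}" by auto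
  finally show ?thesis .
 qed
 have fin: "emeasure (restrict_space lebesgue B) B \<noteq> \<infinity>"
  using Bs assms(1) by (subst emeasure_restrict_space) (auto simp: fmeasurable_def)
 have fR: "finite_measure (restrict_space lebesgue B)"
  by (rule finite_measureI) (use fin in \<open>simp add: space_restrict_space\<close>)
 have fN: "finite_measure ?N"
  by (rule finite_measure.finite_measure_distr[OF fR ms])
 interpret N: finite_borel_measure ?N
  by (intro finite_borel_measure.intro fN finite_borel_measure_axioms.intro) simp
 have cont: "isCont (cdf ?N) x" for x
 proof -
  have "measure ?N {x} = measure lebesgue (B \<inter> {y. y \<bullet> i = x})" using e[of "{x}"] by simp
  also have "\<dots> = 0"
  proof (rule negligible_imp_measure0)
   show "negligible (B \<inter> {y. y \<bullet> i = x})"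
    by (rule negligible_subset[OF negligible_level[OF assms(3), of x]]) auto
  qed
  finally show ?thesis by (simp add: N.isCont_cdf)
 qed
 obtain K where K: "\<And>x. x \<in> B ==> norm x \<le> K" using assms(2) bounded_iff by blast
 have ab: "\<bar>x \<bullet> i\<bar> \<le> \<bar>K\<bar>" if "x \<in> B" for x
  using K[OF that] assms(3) Basis_le_norm[OF assms(3), of x] by linarith
 have lo: "cdf ?N (- \<bar>K\<bar> - 1) = 0"
 proof -
  have "B \<inter> {x. x \<bullet> i \<in> {..- \<bar>K\<bar> - 1}} = {}" using ab by fastforce
  then show ?thesis unfolding cdf_def using e by simp
 qed
 have hi: "cdf ?N (\<bar>K\<bar> + 1) = measure lebesgue B"
 proof -
  have "B \<inter> {x. x \<bullet> i \<in> {..\<bar>K\<bar> + 1}} = B" using ab by fastforce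
  then show ?thesis unfolding cdf_def using e by simp
 qed
 obtain c where c: "cdf ?N c = m"
  using IVT[of "cdf ?N" "- \<bar>K\<bar> - 1" m "\<bar>K\<bar> + 1"] lo hi assms cont by auto
 have "measure lebesgue (B \<inter> {x. x \<bullet> i \<le> c}) = measure lebesgue (B \<inter> {x. x \<bullet> i < c})"
 proof (rule measure_negligible_symdiff[symmetric])
  have "closed {x. x \<bullet> i \<le> c}" by (rule closed_halfspace_component_le)
  then show "B \<inter> {x. x \<bullet> i \<le> c} \<in> lmeasurable" using assms(1)
   by (intro fmeasurable_Int_fmeasurable) auto
  show "negligible (sym_diff (B \<inter> {x. x \<bullet> i \<le> c}) (B \<inter> {x. x \<bullet> i < c}))"
   by (rule negligible_subset[OF negligible_level[OF assms(3), of c]]) auto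
 qed
 moreover have "measure lebesgue (B \<inter> {x. x \<bullet> i \<le> c}) = m" using c e[of "{..c}"] unfolding cdf_def by simp
 ultimately show ?thesis using that by simp
qed

definition mink_sum :: "'a::real_vector set => 'a set => 'a set" where
 "mink_sum A B = (\<Union>x\<in>A. \<Union>y\<in>B. {x + y})"

lemma mink_sum_commute: "mink_sum A B = mink_sum B A"
 unfolding mink_sum_def by (auto simp: add.commute)

lemma mink_sum_mono: "A \<subseteq> A' ==> B \<subseteq> B' ==> mink_sum A B \<subseteq> mink_sum A' B'"
 unfolding mink_sum_def by blast

lemma mink_sum_lmeasurable:
 fixes A B :: "'a::euclidean_space set"
 assumes "open A" "bounded A" "bounded B"
 shows "open (mink_sum A B)" "mink_sum A B \<in> lmeasurable"
proof -
 show o: "open (mink_sum A B)"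
  unfolding mink_sum_def by (rule open_sums) (use assms in auto)
 have "bounded (mink_sum A B)"
  unfolding mink_sum_def by (rule bounded_sums[OF assms(2,3)])
 then show "mink_sum A B \<in> lmeasurable" using o by (rule lmeasurable_open)
qed

lemma box_sum_subset:
 fixes a b c d :: "'a::euclidean_space"
 assumes "box a b \<noteq> {}" "box c d \<noteq> {}"
 shows "box (a + c) (b + d) \<subseteq> mink_sum (box a b) (box c d)"
proof
 fix x assume x: "x \<in> box (a + c) (b + d)"
 have p: "a \<bullet> i < b \<bullet> i" "c \<bullet> i < d \<bullet> i" if "i \<in> Basis" for i
  using assms that by (auto simp: box_ne_empty)
 define s where "s i = (x \<bullet> i - a \<bullet> i - c \<bullet> i) / ((b \<bullet> i - a \<bullet> i) + (d \<bullet> i - c \<bullet> i))" for i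
 have s: "0 < s i" "s i < 1" if "i \<in> Basis" for i
  using x p[OF that] that unfolding s_def by (auto simp: mem_box inner_add_left field_simps dest!: bspec[of _ _ i])
 have eq: "x \<bullet> i - a \<bullet> i - c \<bullet> i = s i * (b \<bullet> i - a \<bullet> i) + s i * (d \<bullet> i - c \<bullet> i)" if "i \<in> Basis" for i
 proof -
  have "(b \<bullet> i - a \<bullet> i) + (d \<bullet> i - c \<bullet> i) \<noteq> 0" using p[OF that] by linarith
  then have "x \<bullet> i - a \<bullet> i - c \<bullet> i = s i * ((b \<bullet> i - a \<bullet> i) + (d \<bullet> i - c \<bullet> i))"
   unfolding s_def by simp
  then show ?thesis by (simp only: distrib_left)
 qed
 let ?y = "\<Sum>i\<in>Basis. (a \<bullet> i + s i * (b \<bullet> i - a \<bullet> i)) *\<^sub>R i"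
 let ?z = "\<Sum>i\<in>Basis. (c \<bullet> i + s i * (d \<bullet> i - c \<bullet> i)) *\<^sub>R i"
 have r: "0 < u * v \<and> u * v < v" if "0 < u" "u < 1" "0 < v" for u v :: real
  using that by simp
 have yi: "?y \<bullet> i = a \<bullet> i + s i * (b \<bullet> i - a \<bullet> i)" and zi: "?z \<bullet> i = c \<bullet> i + s i * (d \<bullet> i - c \<bullet> i)"
  if "i \<in> Basis" for i
  using that by simp_all
 have "a \<bullet> i < ?y \<bullet> i \<and> ?y \<bullet> i < b \<bullet> i" "c \<bullet> i < ?z \<bullet> i \<and> ?z \<bullet> i < d \<bullet> i" if "i \<in> Basis" for i
  unfolding yi[OF that] zi[OF that]
  using r[OF s(1,2)[OF that], of "b \<bullet> i - a \<bullet> i"] r[OF s(1,2)[OF that], of "d \<bullet> i - c \<bullet> i"] p[OF that] by linarith+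
 then have "?y \<in> box a b" "?z \<in> box c d"
  unfolding mem_box by blast+
 moreover have "x = ?y + ?z"
 proof (rule euclidean_eqI)
  fix i :: 'a assume i: "i \<in> Basis"
  show "x \<bullet> i = (?y + ?z) \<bullet> i"
   unfolding inner_add_left yi[OF i] zi[OF i] using eq[OF i] by linarith
 qed
 ultimately show "x \<in> mink_sum (box a b) (box c d)" unfolding mink_sum_def by blast
qed

lemma measure_box_prod:
 fixes a b :: "'a::euclidean_space"
 assumes "box a b \<noteq> {}"
 shows "measure lebesgue (box a b) = (\<Prod>i\<in>Basis. b \<bullet> i - a \<bullet> i)"
proof -
 have "a \<bullet> i \<le> b \<bullet> i" if "i \<in> Basis" for i using assms that by (auto simp: box_ne_empty less_imp_le)
 then show ?thesis by (simp add: inner_diff_left)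
qed

text \<open>Each factor satisfies \<open>(p + q)\<^sup>2 \<ge> 4 * p * q\<close>; multiplying these and using that the two products agree gives the square of the claim.\<close>
lemma prod_add_ge:
 fixes p q :: "'i => real"
 assumes "finite I" "\<And>i. i \<in> I ==> 0 < p i" "\<And>i. i \<in> I ==> 0 < q i" "prod p I = prod q I"
 shows "(\<Prod>i\<in>I. p i + q i) \<ge> 2 ^ card I * prod p I"
proof -
 have "(2 ^ card I * prod p I)\<^sup>2 = (\<Prod>i\<in>I. 4 * (p i * q i))"
  using assms(1,4) by (simp add: prod.distrib power2_eq_square power_mult_distrib[symmetric] mult_ac)
 also have "\<dots> \<le> (\<Prod>i\<in>I. (p i + q i)\<^sup>2)"
 proof (rule prod_mono)
  fix i assume i: "i \<in> I"
  have "0 \<le> (p i - q i)\<^sup>2" by simp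
  then show "0 \<le> 4 * (p i * q i) \<and> 4 * (p i * q i) \<le> (p i + q i)\<^sup>2"
   using assms(2,3)[OF i] by (auto simp: power2_eq_square algebra_simps)
 qed
 also have "\<dots> = (\<Prod>i\<in>I. p i + q i)\<^sup>2" by (simp only: prod_power_distrib)
 finally show ?thesis
  by (rule power2_le_imp_le) (use assms in \<open>auto intro!: prod_nonneg simp: less_imp_le add_pos_pos\<close>)
qed

lemma brunn_minkowski_box:
 fixes a b c d :: "'a::euclidean_space"
 assumes "box a b \<noteq> {}" "box c d \<noteq> {}" "measure lebesgue (box a b) = measure lebesgue (box c d)"
 shows "measure lebesgue (mink_sum (box a b) (box c d)) \<ge> 2 ^ DIM('a) * measure lebesgue (box a b)"
proof -
 have p: "a \<bullet> i < b \<bullet> i" "c \<bullet> i < d \<bullet> i" if "i \<in> Basis" for i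
  using assms that by (auto simp: box_ne_empty)
 have ne: "box (a + c) (b + d) \<noteq> {}" using p by (auto simp: box_ne_empty inner_add_left add_strict_mono)
 have "2 ^ DIM('a) * measure lebesgue (box a b) \<le> (\<Prod>i\<in>Basis. (b \<bullet> i - a \<bullet> i) + (d \<bullet> i - c \<bullet> i))"
  unfolding measure_box_prod[OF assms(1)]
  by (rule prod_add_ge) (use p assms(3) measure_box_prod[OF assms(1)] measure_box_prod[OF assms(2)] in auto)
 also have "\<dots> = measure lebesgue (box (a + c) (b + d))"
  unfolding measure_box_prod[OF ne] by (intro prod.cong) (auto simp: inner_add_left)
 also have "\<dots> \<le> measure lebesgue (mink_sum (box a b) (box c d))"
  by (intro measure_mono_fmeasurable box_sum_subset assms mink_sum_lmeasurable) auto
 finally show ?thesis .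
qed

text \<open>The inductive step of the argument of Hadwiger and Ohmann.  Two boxes of the first family are separated
by a coordinate hyperplane; a parallel hyperplane cuts the second family in the same proportion.  Both halves have
fewer boxes in total, and the sums of the lower halves and of the upper halves lie on different sides of a third
parallel hyperplane, so that their volumes add.\<close>
lemma brunn_minkowski_box_families_step:
 fixes \<A> \<B> :: "'a::euclidean_space set set"
 assumes IH: "\<And>\<A>' \<B>' :: 'a set set. card \<A>' + card \<B>' < card \<A> + card \<B> ==> box_family \<A>' ==> box_family \<B>' ==>
   measure lebesgue (\<Union>\<A>') = measure lebesgue (\<Union>\<B>') ==>
   measure lebesgue (mink_sum (\<Union>\<A>') (\<Union>\<B>')) \<ge> 2 ^ DIM('a) * measure lebesgue (\<Union>\<A>')"
  and \<A>: "box_family \<A>" and \<B>: "box_family \<B>"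
  and eq: "measure lebesgue (\<Union>\<A>) = measure lebesgue (\<Union>\<B>)" and c2: "card \<A> \<noteq> 1"
 shows "measure lebesgue (mink_sum (\<Union>\<A>) (\<Union>\<B>)) \<ge> 2 ^ DIM('a) * measure lebesgue (\<Union>\<A>)"
proof -
 have fin: "finite \<A>" "finite \<B>" using \<A> \<B> by (auto simp: box_family_def)
 obtain A0 where A0: "A0 \<in> \<A>" using \<A> by (auto simp: box_family_def)
 obtain A1 where A1: "A1 \<in> \<A>" "A1 \<noteq> A0"
  using c2 A0 by (metis card_1_singletonE is_singletonI' is_singleton_altdef equals0D)
 obtain a b c d where ab: "A0 = box a b" "A1 = box c d" "A0 \<noteq> {}" "A1 \<noteq> {}"
  using \<A> A0 A1 by (metis box_family_def)
 have "box a b \<inter> box c d = {}"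
  using \<A> A0 A1 ab unfolding box_family_def pairwise_def disjnt_def by metis
 then obtain i where i: "i \<in> Basis" "b \<bullet> i \<le> c \<bullet> i \<or> d \<bullet> i \<le> a \<bullet> i"
  using ab unfolding disjoint_interval(4) by (force simp: box_ne_empty)
 have "\<exists>L U e. L \<in> \<A> \<and> U \<in> \<A> \<and> L \<noteq> {} \<and> U \<noteq> {} \<and> (\<forall>x\<in>L. x \<bullet> i < e) \<and> (\<forall>x\<in>U. x \<bullet> i > e)"
 proof (cases "b \<bullet> i \<le> c \<bullet> i")
  case True
  then show ?thesis using A0 A1 ab i(1)
   by (intro exI[of _ A0] exI[of _ A1] exI[of _ "b \<bullet> i"]) (auto simp: mem_box dest!: bspec[of _ _ i])
 next
  case False
  then show ?thesis using A0 A1 ab i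
   by (intro exI[of _ A1] exI[of _ A0] exI[of _ "d \<bullet> i"]) (auto simp: mem_box dest!: bspec[of _ _ i])
 qed
 then obtain L U e where LU: "L \<in> \<A>" "U \<in> \<A>" "L \<noteq> {}" "U \<noteq> {}" "\<forall>x\<in>L. x \<bullet> i < e" "\<forall>x\<in>U. x \<bullet> i > e"
  by blast
 let ?AL = "cut_below \<A> i e" and ?AU = "cut_above \<A> i e"
 have "L \<inter> {x. x \<bullet> i < e} = L" "U \<inter> {x. x \<bullet> i > e} = U" using LU by auto
 then have "L \<in> ?AL" "U \<in> ?AU" using LU unfolding cut_below_def cut_above_def by force+
 then have fA: "box_family ?AL" "box_family ?AU" using box_family_cut[OF \<A> i(1)] by auto
 have eL: "L \<inter> {x. x \<bullet> i > e} = {}" using LU(5) by (meson disjoint_iff mem_Collect_eq order_less_asym)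
 have eU: "U \<inter> {x. x \<bullet> i < e} = {}" using LU(6) by (meson disjoint_iff mem_Collect_eq order_less_asym)
 have cA: "card ?AL < card \<A>" "card ?AU < card \<A>"
  using card_cut_less(1)[OF fin(1) LU(2) eU] card_cut_less(2)[OF fin(1) LU(1) eL] by simp_all
 have mA: "measure lebesgue (\<Union>\<A>) = measure lebesgue (\<Union>?AL) + measure lebesgue (\<Union>?AU)"
  by (rule measure_cut[OF \<A> i(1)])
 have pos: "measure lebesgue (\<Union>?AL) > 0" "measure lebesgue (\<Union>?AU) > 0"
  using box_family_Union(5) fA by auto
 obtain e' where e': "measure lebesgue (\<Union>\<B> \<inter> {x. x \<bullet> i < e'}) = measure lebesgue (\<Union>?AL)"
  using cut_level_exists[OF box_family_Union(4,2)[OF \<B>] i(1), of "measure lebesgue (\<Union>?AL)"] mA eq pos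
  by auto
 let ?BL = "cut_below \<B> i e'" and ?BU = "cut_above \<B> i e'"
 have mB: "measure lebesgue (\<Union>\<B>) = measure lebesgue (\<Union>?BL) + measure lebesgue (\<Union>?BU)"
  by (rule measure_cut[OF \<B> i(1)])
 have eL: "measure lebesgue (\<Union>?AL) = measure lebesgue (\<Union>?BL)" using e' by (simp add: Union_cut)
 have eU: "measure lebesgue (\<Union>?AU) = measure lebesgue (\<Union>?BU)" using eL mA mB eq by simp
 have fB: "box_family ?BL" "box_family ?BU"
 proof -
  have "?BL \<noteq> {}" "?BU \<noteq> {}" using eL eU pos by (metis Sup_empty measure_empty less_irrefl)+
  then show "box_family ?BL" "box_family ?BU" using box_family_cut[OF \<B> i(1)] by blast+
 qed
 have cB: "card ?BL \<le> card \<B>" "card ?BU \<le> card \<B>" using card_cut_le fin by auto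
 have L: "measure lebesgue (mink_sum (\<Union>?AL) (\<Union>?BL)) \<ge> 2 ^ DIM('a) * measure lebesgue (\<Union>?AL)"
  by (rule IH) (use fA fB cA cB eL in auto)
 have U: "measure lebesgue (mink_sum (\<Union>?AU) (\<Union>?BU)) \<ge> 2 ^ DIM('a) * measure lebesgue (\<Union>?AU)"
  by (rule IH) (use fA fB cA cB eU in auto)
 have lL: "mink_sum (\<Union>?AL) (\<Union>?BL) \<in> lmeasurable" and lU: "mink_sum (\<Union>?AU) (\<Union>?BU) \<in> lmeasurable"
  and lS: "mink_sum (\<Union>\<A>) (\<Union>\<B>) \<in> lmeasurable"
  using mink_sum_lmeasurable(2) box_family_Union(1,2) fA fB \<A> \<B> by metis+
 have disj: "mink_sum (\<Union>?AL) (\<Union>?BL) \<inter> mink_sum (\<Union>?AU) (\<Union>?BU) = {}"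
 proof -
  have "x \<bullet> i < e + e'" if x: "x \<in> mink_sum (\<Union>?AL) (\<Union>?BL)" for x
  proof -
   obtain y z where "x = y + z" "y \<bullet> i < e" "z \<bullet> i < e'" using x unfolding mink_sum_def Union_cut by blast
   then show ?thesis by (simp add: inner_add_left add_strict_mono)
  qed
  moreover have "x \<bullet> i > e + e'" if x: "x \<in> mink_sum (\<Union>?AU) (\<Union>?BU)" for x
  proof -
   obtain y z where "x = y + z" "y \<bullet> i > e" "z \<bullet> i > e'" using x unfolding mink_sum_def Union_cut by blast
   then show ?thesis by (simp add: inner_add_left add_strict_mono)
  qed
  ultimately show ?thesis by (meson disjoint_iff order_less_asym)
 qed
 have "2 ^ DIM('a) * measure lebesgue (\<Union>\<A>)
   \<le> measure lebesgue (mink_sum (\<Union>?AL) (\<Union>?BL)) + measure lebesgue (mink_sum (\<Union>?AU) (\<Union>?BU))"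
  using L U by (simp add: mA distrib_left)
 also have "\<dots> = measure lebesgue (mink_sum (\<Union>?AL) (\<Union>?BL) \<union> mink_sum (\<Union>?AU) (\<Union>?BU))"
  using measure_Un3[OF lL lU] disj by simp
 also have "\<dots> \<le> measure lebesgue (mink_sum (\<Union>\<A>) (\<Union>\<B>))"
 proof (rule measure_mono_fmeasurable)
  show "mink_sum (\<Union>?AL) (\<Union>?BL) \<union> mink_sum (\<Union>?AU) (\<Union>?BU) \<subseteq> mink_sum (\<Union>\<A>) (\<Union>\<B>)"
   unfolding Union_cut by (intro Un_least mink_sum_mono) auto
 qed (use lL lU lS in auto)
 finally show ?thesis .
qed

lemma brunn_minkowski_box_families:
 fixes \<A> \<B> :: "'a::euclidean_space set set"
 assumes "box_family \<A>" "box_family \<B>" "measure lebesgue (\<Union>\<A>) = measure lebesgue (\<Union>\<B>)"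
 shows "measure lebesgue (mink_sum (\<Union>\<A>) (\<Union>\<B>)) \<ge> 2 ^ DIM('a) * measure lebesgue (\<Union>\<A>)"
 using assms
proof (induction "card \<A> + card \<B>" arbitrary: \<A> \<B> rule: less_induct)
 case less
 show ?case
 proof (cases "card \<A> = 1 \<and> card \<B> = 1")
  case True
  then obtain A B where AB: "\<A> = {A}" "\<B> = {B}" by (metis card_1_singletonE)
  then show ?thesis using brunn_minkowski_box less.prems by (force simp: box_family_def)
 next
  case False
  consider "card \<A> \<noteq> 1" | "card \<B> \<noteq> 1" using False by blast
  then show ?thesis
  proof cases
   case 1
   show ?thesis by (rule brunn_minkowski_box_families_step[OF less.hyps less.prems 1])
  next
   case 2
   have "measure lebesgue (mink_sum (\<Union>\<B>) (\<Union>\<A>)) \<ge> 2 ^ DIM('a) * measure lebesgue (\<Union>\<B>)"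
    by (rule brunn_minkowski_box_families_step[OF less.hyps less.prems(2,1) less.prems(3)[symmetric] 2])
     (auto simp: add.commute)
   then show ?thesis using less.prems(3) by (simp add: mink_sum_commute)
  qed
 qed
qed

section \<open>Projected areas and integration along fibers\<close>

lemma emeasure_lborel_reflect:
 fixes A :: "'a::euclidean_space set"
 assumes "A \<in> sets borel"
 shows "emeasure lborel {y. x - y \<in> A} = emeasure lborel A"
proof -
 have "(\<lambda>y. x - y) -` A \<inter> space borel \<in> sets borel"
  using assms by (intro measurable_sets[of "\<lambda>y. x - y" borel borel]) auto
 then have m: "{y. x - y \<in> A} \<in> sets borel" by (simp add: vimage_def)
 have "{y. x - y \<in> A} = (\<lambda>z. (-1) *\<^sub>R z + x) ` A"
  by (auto simp: image_iff intro!: bexI[of _ "x - y" for y])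
 then have "emeasure lebesgue {y. x - y \<in> A} = emeasure lebesgue A"
  using emeasure_lebesgue_affine[of "-1" x A] by simp
 then show ?thesis using m assms by simp
qed

lemma emeasure_lborel_translate:
 fixes A :: "'a::euclidean_space set"
 assumes "A \<in> sets borel"
 shows "emeasure lborel {y. y + x \<in> A} = emeasure lborel A"
proof -
 have "emeasure lborel A = emeasure (distr lborel borel ((+) x)) A" by (simp add: lborel_distr_plus)
 also have "\<dots> = emeasure lborel {y. y + x \<in> A}"
  using assms by (subst emeasure_distr) (auto simp: vimage_def add.commute)
 finally show ?thesis by simp
qed

text \<open>Uniqueness of Haar measure: integrate \<open>1\<^sub>A(x) * 1\<^sub>B(x + y)\<close> over both measures in either order.\<close>
lemma translation_invariant_unique:
 fixes \<mu> :: "'a::euclidean_space measure"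
 assumes s: "sets \<mu> = sets borel" "sigma_finite_measure \<mu>"
  and inv: "\<And>A x. A \<in> sets borel ==> emeasure \<mu> {y. y + x \<in> A} = emeasure \<mu> A"
  and A[measurable]: "A \<in> sets borel" and B[measurable]: "B \<in> sets borel"
 shows "emeasure lborel B * emeasure \<mu> A = emeasure \<mu> B * emeasure lborel A"
proof -
 interpret \<mu>: sigma_finite_measure \<mu> by fact
 interpret P: pair_sigma_finite lborel \<mu> by (intro pair_sigma_finite.intro lborel.sigma_finite_measure_axioms s)
 note [measurable_cong] = s(1)
 have mB: "{y. y + x \<in> B} \<in> sets borel" for x
 proof -
  have "(\<lambda>y. y + x) -` B \<inter> space borel \<in> sets borel"
   by (intro measurable_sets[of "\<lambda>y. y + x" borel borel]) auto
  then show ?thesis by (simp add: vimage_def)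
 qed
 have "emeasure lborel B * emeasure \<mu> A = (\<integral>\<^sup>+x. emeasure lborel B * indicator A x \<partial>\<mu>)"
  by (subst nn_integral_cmult_indicator) (auto simp: s)
 also have "\<dots> = (\<integral>\<^sup>+x. (\<integral>\<^sup>+y. indicator A x * indicator B (y + x) \<partial>lborel) \<partial>\<mu>)"
 proof (rule nn_integral_cong)
  fix x
  have "(\<integral>\<^sup>+y. indicator A x * indicator B (y + x) \<partial>lborel)
    = (\<integral>\<^sup>+y. indicator A x * indicator {y. y + x \<in> B} y \<partial>lborel)"
   by (intro nn_integral_cong) (auto simp: indicator_def)
  also have "\<dots> = indicator A x * emeasure lborel {y. y + x \<in> B}"
   using mB by (subst nn_integral_cmult_indicator) auto
  finally show "emeasure lborel B * indicator A x = (\<integral>\<^sup>+y. indicator A x * indicator B (y + x) \<partial>lborel)"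
   by (simp add: emeasure_lborel_translate mult.commute)
 qed
 also have "\<dots> = (\<integral>\<^sup>+y. (\<integral>\<^sup>+x. indicator A x * indicator B (y + x) \<partial>\<mu>) \<partial>lborel)"
  by (rule P.Fubini') measurable
 also have "\<dots> = (\<integral>\<^sup>+y. (\<integral>\<^sup>+x. indicator A (x - y) * indicator B x \<partial>\<mu>) \<partial>lborel)"
 proof (rule nn_integral_cong)
  fix y :: 'a
  have mS: "A \<inter> {x. y + x \<in> B} \<in> sets borel" using mB[of y] by (simp add: add.commute)
  have mS2: "{x. x - y \<in> A \<inter> {x. y + x \<in> B}} \<in> sets borel"
  proof -
   have "(\<lambda>x. x - y) -` (A \<inter> {x. y + x \<in> B}) \<inter> space borel \<in> sets borel"
    using mS by (intro measurable_sets[of "\<lambda>x. x - y" borel borel]) auto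
   then show ?thesis by (simp add: vimage_def)
  qed
  have "(\<integral>\<^sup>+x. indicator A x * indicator B (y + x) \<partial>\<mu>) = (\<integral>\<^sup>+x. indicator (A \<inter> {x. y + x \<in> B}) x \<partial>\<mu>)"
   by (intro nn_integral_cong) (auto simp: indicator_def)
  also have "\<dots> = emeasure \<mu> (A \<inter> {x. y + x \<in> B})" using mS s by simp
  also have "\<dots> = emeasure \<mu> {x. x + (- y) \<in> A \<inter> {x. y + x \<in> B}}" by (rule inv[symmetric, OF mS])
  also have "\<dots> = (\<integral>\<^sup>+x. indicator {x. x - y \<in> A \<inter> {x. y + x \<in> B}} x \<partial>\<mu>)" using mS2 s by simp
  also have "\<dots> = (\<integral>\<^sup>+x. indicator A (x - y) * indicator B x \<partial>\<mu>)"
   by (intro nn_integral_cong) (auto simp: indicator_def)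
  finally show "(\<integral>\<^sup>+x. indicator A x * indicator B (y + x) \<partial>\<mu>) = (\<integral>\<^sup>+x. indicator A (x - y) * indicator B x \<partial>\<mu>)" .
 qed
 also have "\<dots> = (\<integral>\<^sup>+x. (\<integral>\<^sup>+y. indicator A (x - y) * indicator B x \<partial>lborel) \<partial>\<mu>)"
  by (rule P.Fubini'[symmetric]) measurable
 also have "\<dots> = (\<integral>\<^sup>+x. emeasure lborel A * indicator B x \<partial>\<mu>)"
 proof (rule nn_integral_cong)
  fix x :: 'a
  have m: "{y. x - y \<in> A} \<in> sets borel"
  proof -
   have "(\<lambda>y. x - y) -` A \<inter> space borel \<in> sets borel"
    by (intro measurable_sets[of "\<lambda>y. x - y" borel borel]) auto
   then show ?thesis by (simp add: vimage_def)
  qed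
  have "(\<integral>\<^sup>+y. indicator A (x - y) * indicator B x \<partial>lborel) = (\<integral>\<^sup>+y. indicator B x * indicator {y. x - y \<in> A} y \<partial>lborel)"
   by (intro nn_integral_cong) (auto simp: indicator_def)
  also have "\<dots> = indicator B x * emeasure lborel A"
   using m by (subst nn_integral_cmult_indicator) (auto simp: emeasure_lborel_reflect)
  finally show "(\<integral>\<^sup>+y. indicator A (x - y) * indicator B x \<partial>lborel) = emeasure lborel A * indicator B x"
   by (simp add: mult.commute)
 qed
 also have "\<dots> = emeasure \<mu> B * emeasure lborel A"
  by (subst nn_integral_cmult_indicator) (auto simp: s mult.commute)
 finally show ?thesis .
qed

text \<open>The image of Lebesgue measure under an isometry is translation invariant, hence a multiple of Lebesgue measure; the unit ball shows that the factor is one.\<close>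
lemma emeasure_lborel_orthogonal_vimage:
 fixes f :: "'a::euclidean_space => 'a"
 assumes f: "orthogonal_transformation f" and A: "A \<in> sets borel"
 shows "emeasure lborel (f -` A) = emeasure lborel A"
proof -
 let ?\<mu> = "distr lborel borel f"
 have lin: "linear f" using f orthogonal_transformation_linear by blast
 have cont: "continuous_on UNIV f" using lin linear_continuous_on linear_conv_bounded_linear by blast
 then have fm[measurable]: "f \<in> borel_measurable borel" by (rule borel_measurable_continuous_onI)
 have e: "emeasure ?\<mu> S = emeasure lborel (f -` S)" if "S \<in> sets borel" for S
  using that by (subst emeasure_distr) auto
 have bl: "f -` cball 0 r = cball 0 r" for r
  using orthogonal_transformation_norm[OF f] by auto
 have surj: "\<exists>x'. f x' = x" for x using orthogonal_transformation_surj[OF f] by (metis surjD)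
 have sf: "sigma_finite_measure ?\<mu>"
 proof (rule sigma_finite_measure.intro, intro exI conjI)
  let ?A = "range (\<lambda>n::nat. cball (0::'a) (real n))"
  show "countable ?A" by simp
  show "?A \<subseteq> sets ?\<mu>" by auto
  show "\<Union>?A = space ?\<mu>" by (auto simp: real_arch_simple)
  show "\<forall>a\<in>?A. emeasure ?\<mu> a \<noteq> \<infinity>"
   using emeasure_bounded_finite[OF bounded_cball] by (auto simp: e bl less_top)
 qed
 have inv: "emeasure ?\<mu> {y. y + x \<in> S} = emeasure ?\<mu> S" if S: "S \<in> sets borel" for S x
 proof -
  obtain x' where x': "f x' = x" using surj by blast
  have m: "{y. y + x \<in> S} \<in> sets borel"
  proof -
   have "(\<lambda>y. y + x) -` S \<inter> space borel \<in> sets borel"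
    using S by (intro measurable_sets[of "\<lambda>y. y + x" borel borel]) auto
   then show ?thesis by (simp add: vimage_def)
  qed
  have "f -` S \<in> sets borel" using measurable_sets[OF fm S] by simp
  then have "emeasure lborel {y. y + x' \<in> f -` S} = emeasure lborel (f -` S)" by (rule emeasure_lborel_translate)
  moreover have "{y. y + x' \<in> f -` S} = f -` {y. y + x \<in> S}"
   using x' linear_add[OF lin] by auto
  ultimately show ?thesis using S m by (simp add: e)
 qed
 have "emeasure lborel (cball (0::'a) 1) * emeasure ?\<mu> A = emeasure ?\<mu> (cball 0 1) * emeasure lborel A"
  by (rule translation_invariant_unique[OF _ sf inv A]) auto
 moreover have nz: "unit_ball_vol (real DIM('a)) \<noteq> 0"
  using unit_ball_vol_pos[OF of_nat_0_le_iff] by (metis less_irrefl)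
 moreover have "emeasure ?\<mu> (cball 0 1) = emeasure lborel (cball (0::'a) 1)" by (simp add: e bl)
 moreover have "emeasure lborel (cball (0::'a) 1) \<noteq> 0" "emeasure lborel (cball (0::'a) 1) \<noteq> \<infinity>"
  using nz by (auto simp: emeasure_cball)
 ultimately have "emeasure ?\<mu> A = emeasure lborel A"
  using ennreal_mult_cancel_left[of "emeasure lborel (cball (0::'a) 1)" "emeasure ?\<mu> A" "emeasure lborel A"] by auto
 then show ?thesis using A by (simp add: e)
qed

definition perp :: "'a::real_inner => 'a => 'a" where
 "perp \<nu> x = x - (x \<bullet> \<nu>) *\<^sub>R \<nu>"

text \<open>The cylinder of height one over the orthogonal projection of \<open>W\<close> along \<open>\<nu>\<close>.  It turns areas in a hyperplane into volumes, so that Lebesgue measure in the ambient space suffices.\<close>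
definition slab :: "'a::real_inner => 'a set => 'a set" where
 "slab \<nu> W = {y. 0 \<le> y \<bullet> \<nu> \<and> y \<bullet> \<nu> \<le> 1 \<and> perp \<nu> y \<in> perp \<nu> ` W}"

definition area :: "'a::euclidean_space => 'a set => ennreal" where
 "area \<nu> W = emeasure lborel (slab \<nu> W)"

lemma perp_add_line: "norm \<nu> = 1 ==> perp \<nu> (y + s *\<^sub>R \<nu>) = perp \<nu> y"
 by (simp add: perp_def inner_add_left algebra_simps norm_eq_1)

lemma perp_eqD: "perp \<nu> x = perp \<nu> y ==> x = y + ((x - y) \<bullet> \<nu>) *\<^sub>R \<nu>"
 by (simp add: perp_def inner_diff_left algebra_simps)

lemma linear_perp: "linear (perp \<nu>)"
 unfolding perp_def by (intro linearI) (auto simp: inner_add_left algebra_simps)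

lemma norm_perp: "norm \<nu> = 1 ==> (norm x)\<^sup>2 = (norm (perp \<nu> x))\<^sup>2 + (x \<bullet> \<nu>)\<^sup>2"
 unfolding power2_norm_eq_inner perp_def
 by (simp add: inner_diff_left inner_diff_right inner_commute norm_eq_1 power2_eq_square)

lemma norm_perp_le: "norm \<nu> = 1 ==> norm (perp \<nu> x) \<le> norm x"
 by (rule power2_le_imp_le) (simp_all add: norm_perp[of \<nu> x])

lemma continuous_perp [continuous_intros]: "continuous_on S f ==> continuous_on S (\<lambda>x. perp \<nu> (f x))"
 unfolding perp_def by (intro continuous_intros)

lemma measurable_perp[measurable]: "perp (\<nu>::'a::euclidean_space) \<in> borel_measurable borel"
 unfolding perp_def by measurable

lemma slab_empty [simp]: "slab \<nu> {} = {}" by (simp add: slab_def)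

lemma slab_Union: "slab \<nu> (\<Union>i\<in>I. W i) = (\<Union>i\<in>I. slab \<nu> (W i))"
 unfolding slab_def by auto

lemma slab_mono: "W \<subseteq> W' ==> slab \<nu> W \<subseteq> slab \<nu> W'"
 unfolding slab_def by auto

lemma slab_translate_image:
 assumes n: "norm \<nu> = 1"
 shows "slab \<nu> W = (\<lambda>(p, s). perp \<nu> p + s *\<^sub>R \<nu>) ` (W \<times> {0..1})"
proof (intro equalityI subsetI)
 fix y assume "y \<in> slab \<nu> W"
 then obtain p where "p \<in> W" "perp \<nu> y = perp \<nu> p" "0 \<le> y \<bullet> \<nu>" "y \<bullet> \<nu> \<le> 1" unfolding slab_def by auto
 moreover from this have "y = perp \<nu> p + (y \<bullet> \<nu>) *\<^sub>R \<nu>" by (simp add: perp_def algebra_simps)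
 ultimately show "y \<in> (\<lambda>(p, s). perp \<nu> p + s *\<^sub>R \<nu>) ` (W \<times> {0..1})" by force
next
 fix y assume "y \<in> (\<lambda>(p, s). perp \<nu> p + s *\<^sub>R \<nu>) ` (W \<times> {0..1})"
 then obtain p s where ps: "p \<in> W" "0 \<le> s" "s \<le> 1" "y = perp \<nu> p + s *\<^sub>R \<nu>" by auto
 have "perp \<nu> p \<bullet> \<nu> = 0" using n by (simp add: perp_def inner_diff_left norm_eq_1)
 then have "y \<bullet> \<nu> = s" using ps n by (simp add: inner_add_left norm_eq_1)
 moreover have "perp \<nu> y = perp \<nu> p"
  using perp_add_line[OF n, of "perp \<nu> p" s] perp_add_line[OF n, of p "- (p \<bullet> \<nu>)"] ps by (simp add: perp_def)
 ultimately show "y \<in> slab \<nu> W" using ps unfolding slab_def by auto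
qed

lemma compact_slab:
 assumes "norm \<nu> = 1" "compact W"
 shows "compact (slab \<nu> W)"
 unfolding slab_translate_image[OF assms(1)]
 by (intro compact_continuous_image compact_Times assms compact_Icc)
   (auto simp: case_prod_unfold intro!: continuous_intros)

text \<open>Fubini along the lines in direction \<open>\<nu>\<close>.  The integral over all of space is averaged over translations by multiples
of \<open>\<nu>\<close>; integrating over a slab of height one picks each line once.\<close>
lemma nn_integral_fibers:
 fixes f :: "'a::euclidean_space => ennreal"
 assumes n: "norm \<nu> = 1" and f[measurable]: "f \<in> borel_measurable borel"
 shows "(\<integral>\<^sup>+x. f x \<partial>lborel) =
  (\<integral>\<^sup>+y. indicator {y. 0 \<le> y \<bullet> \<nu> \<and> y \<bullet> \<nu> \<le> 1} y * (\<integral>\<^sup>+s. f (y + s *\<^sub>R \<nu>) \<partial>lborel) \<partial>lborel)"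
proof -
 have P: "pair_sigma_finite (lborel :: real measure) (lborel :: 'a measure)" ..
 note Fub = pair_sigma_finite.Fubini'[OF P]
 let ?S = "{y. 0 \<le> y \<bullet> \<nu> \<and> y \<bullet> \<nu> \<le> 1}"
 have S[measurable]: "?S \<in> sets borel" by measurable
 have "(\<integral>\<^sup>+y. indicator ?S y * (\<integral>\<^sup>+s. f (y + s *\<^sub>R \<nu>) \<partial>lborel) \<partial>lborel)
   = (\<integral>\<^sup>+y. (\<integral>\<^sup>+s. indicator ?S y * f (y + s *\<^sub>R \<nu>) \<partial>lborel) \<partial>lborel)"
  by (intro nn_integral_cong nn_integral_cmult[symmetric]) measurable
 also have "\<dots> = (\<integral>\<^sup>+s. (\<integral>\<^sup>+y. indicator ?S y * f (y + s *\<^sub>R \<nu>) \<partial>lborel) \<partial>lborel)"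
  by (rule Fub) measurable
 also have "\<dots> = (\<integral>\<^sup>+s. (\<integral>\<^sup>+x. indicator ?S (x - s *\<^sub>R \<nu>) * f x \<partial>lborel) \<partial>lborel)"
 proof (rule nn_integral_cong)
  fix s :: real
  have "(\<integral>\<^sup>+x. indicator ?S (x - s *\<^sub>R \<nu>) * f x \<partial>lborel)
    = (\<integral>\<^sup>+x. indicator ?S (x - s *\<^sub>R \<nu>) * f x \<partial>distr lborel borel ((+) (s *\<^sub>R \<nu>)))"
   by (simp add: lborel_distr_plus)
  also have "\<dots> = (\<integral>\<^sup>+y. indicator ?S y * f (y + s *\<^sub>R \<nu>) \<partial>lborel)"
   by (subst nn_integral_distr) (measurable, auto simp: add.commute)
  finally show "(\<integral>\<^sup>+y. indicator ?S y * f (y + s *\<^sub>R \<nu>) \<partial>lborel) = (\<integral>\<^sup>+x. indicator ?S (x - s *\<^sub>R \<nu>) * f x \<partial>lborel)" by simp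
 qed
 also have "\<dots> = (\<integral>\<^sup>+x. (\<integral>\<^sup>+s. indicator ?S (x - s *\<^sub>R \<nu>) * f x \<partial>lborel) \<partial>lborel)"
  by (rule Fub[symmetric]) measurable
 also have "\<dots> = (\<integral>\<^sup>+x. f x \<partial>lborel)"
 proof (rule nn_integral_cong)
  fix x :: 'a
  have "(\<integral>\<^sup>+s. indicator ?S (x - s *\<^sub>R \<nu>) * f x \<partial>lborel) = (\<integral>\<^sup>+s. f x * indicator {x \<bullet> \<nu> - 1 .. x \<bullet> \<nu>} s \<partial>lborel)"
   using n by (intro nn_integral_cong) (auto simp: indicator_def inner_diff_left norm_eq_1)
  also have "\<dots> = f x" by (subst nn_integral_cmult_indicator) auto
  finally show "(\<integral>\<^sup>+s. indicator ?S (x - s *\<^sub>R \<nu>) * f x \<partial>lborel) = f x" .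
 qed
 finally show ?thesis by simp
qed

lemma area_le_measure:
 fixes \<nu> :: "'a::euclidean_space"
 assumes n: "norm \<nu> = 1" and B[measurable]: "B \<in> sets borel" and W: "slab \<nu> W \<in> sets borel"
  and sub: "\<And>p s. p \<in> W ==> 0 < s ==> s < c ==> p + s *\<^sub>R \<nu> \<in> B" and c: "0 \<le> c"
 shows "ennreal c * area \<nu> W \<le> emeasure lborel B"
proof -
 have "ennreal c * area \<nu> W = (\<integral>\<^sup>+y. ennreal c * indicator (slab \<nu> W) y \<partial>lborel)"
  unfolding area_def using W by (subst nn_integral_cmult_indicator) auto
 also have "\<dots> \<le> (\<integral>\<^sup>+y. indicator {y. 0 \<le> y \<bullet> \<nu> \<and> y \<bullet> \<nu> \<le> 1} y * (\<integral>\<^sup>+s. indicator B (y + s *\<^sub>R \<nu>) \<partial>lborel) \<partial>lborel)"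
 proof (intro nn_integral_mono)
  fix y
  show "ennreal c * indicator (slab \<nu> W) y \<le> indicator {y. 0 \<le> y \<bullet> \<nu> \<and> y \<bullet> \<nu> \<le> 1} y * (\<integral>\<^sup>+s. indicator B (y + s *\<^sub>R \<nu>) \<partial>lborel)"
  proof (cases "y \<in> slab \<nu> W")
   case True
   then obtain p where p: "p \<in> W" "perp \<nu> p = perp \<nu> y" unfolding slab_def by auto
   define a where "a = (p - y) \<bullet> \<nu>"
   have eq: "p = y + a *\<^sub>R \<nu>" using perp_eqD[OF p(2)] by (simp add: a_def)
   have "ennreal c = (\<integral>\<^sup>+s. indicator {a<..<a + c} s \<partial>lborel)" using c by simp
   also have "\<dots> \<le> (\<integral>\<^sup>+s. indicator B (y + s *\<^sub>R \<nu>) \<partial>lborel)"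
   proof (intro nn_integral_mono)
    fix s :: real
    have "y + s *\<^sub>R \<nu> \<in> B" if "s \<in> {a<..<a + c}"
     using sub[OF p(1), of "s - a"] that by (simp add: eq algebra_simps)
    then show "indicator {a<..<a + c} s \<le> (indicator B (y + s *\<^sub>R \<nu>) :: ennreal)"
     by (auto simp: indicator_def)
   qed
   finally show ?thesis using True by (simp add: slab_def)
  qed simp
 qed
 also have "\<dots> = emeasure lborel B"
  by (subst nn_integral_fibers[OF n, symmetric]) auto
 finally show ?thesis .
qed

lemma measure_le_area:
 fixes \<nu> :: "'a::euclidean_space"
 assumes n: "norm \<nu> = 1" and B[measurable]: "B \<in> sets borel" and W: "slab \<nu> W \<in> sets borel"
  and inj: "inj_on (perp \<nu>) W"
  and sub: "\<And>x. x \<in> B ==> \<exists>p\<in>W. \<exists>s. 0 \<le> s \<and> s \<le> c \<and> x = p + s *\<^sub>R \<nu>" and c: "0 \<le> c"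
 shows "emeasure lborel B \<le> ennreal c * area \<nu> W"
proof -
 have "emeasure lborel B =
   (\<integral>\<^sup>+y. indicator {y. 0 \<le> y \<bullet> \<nu> \<and> y \<bullet> \<nu> \<le> 1} y * (\<integral>\<^sup>+s. indicator B (y + s *\<^sub>R \<nu>) \<partial>lborel) \<partial>lborel)"
  by (subst nn_integral_fibers[OF n, symmetric]) auto
 also have "\<dots> \<le> (\<integral>\<^sup>+y. ennreal c * indicator (slab \<nu> W) y \<partial>lborel)"
 proof (intro nn_integral_mono)
  fix y
  let ?S = "{y. 0 \<le> y \<bullet> \<nu> \<and> y \<bullet> \<nu> \<le> 1}"
  have hit: "\<exists>p\<in>W. perp \<nu> p = perp \<nu> y \<and> (p - y) \<bullet> \<nu> \<le> s \<and> s \<le> (p - y) \<bullet> \<nu> + c" if "y + s *\<^sub>R \<nu> \<in> B" for s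
  proof -
   obtain p s' where p: "p \<in> W" "0 \<le> s'" "s' \<le> c" "y + s *\<^sub>R \<nu> = p + s' *\<^sub>R \<nu>" using sub[OF \<open>y + s *\<^sub>R \<nu> \<in> B\<close>] by blast
   have "perp \<nu> p = perp \<nu> y" using perp_add_line[OF n] p(4) by metis
   moreover have "(p - y) \<bullet> \<nu> = s - s'"
   proof -
    have "p - y = (s - s') *\<^sub>R \<nu>" using p(4) by (simp add: algebra_simps)
    then show ?thesis using n by (simp add: norm_eq_1)
   qed
   ultimately show ?thesis using p by force
  qed
  show "indicator ?S y * (\<integral>\<^sup>+s. indicator B (y + s *\<^sub>R \<nu>) \<partial>lborel) \<le> ennreal c * indicator (slab \<nu> W) y"
  proof (cases "y \<in> ?S \<and> (\<exists>s. y + s *\<^sub>R \<nu> \<in> B)")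
   case False
   then have "indicator ?S y * (\<integral>\<^sup>+s. indicator B (y + s *\<^sub>R \<nu>) \<partial>lborel) = 0"
    by (auto simp: indicator_def)
   then show ?thesis by (simp only: zero_le)
  next
   case True
   then obtain p where p: "p \<in> W" "perp \<nu> p = perp \<nu> y" using hit by blast
   define a where "a = (p - y) \<bullet> \<nu>"
   have "(\<integral>\<^sup>+s. indicator B (y + s *\<^sub>R \<nu>) \<partial>lborel) \<le> (\<integral>\<^sup>+s. indicator {a..a + c} s \<partial>lborel)"
   proof (intro nn_integral_mono)
    fix s :: real
    have "s \<in> {a..a+c}" if sB: "y + s *\<^sub>R \<nu> \<in> B"
    proof -
     obtain q where q: "q \<in> W" "perp \<nu> q = perp \<nu> y" "(q - y) \<bullet> \<nu> \<le> s" "s \<le> (q - y) \<bullet> \<nu> + c" using hit[OF sB] by blast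
     then have "q = p" using inj p by (metis inj_onD)
     then show ?thesis using q by (simp add: a_def)
    qed
    then show "indicator B (y + s *\<^sub>R \<nu>) \<le> (indicator {a..a + c} s :: ennreal)"
     by (auto simp: indicator_def)
   qed
   also have "\<dots> = ennreal c" using c by simp
   finally have "(\<integral>\<^sup>+s. indicator B (y + s *\<^sub>R \<nu>) \<partial>lborel) \<le> ennreal c" .
   moreover have "y \<in> slab \<nu> W"
   proof -
    have "perp \<nu> y \<in> perp \<nu> ` W" using p by (metis imageI)
    then show ?thesis using True unfolding slab_def by simp
   qed
   ultimately show ?thesis using True by simp
  qed
 qed
 also have "\<dots> = ennreal c * area \<nu> W"
  unfolding area_def using W by (subst nn_integral_cmult_indicator) auto
 finally show ?thesis .
qed

text \<open>Splitting off the coordinate of \<open>b\<close> in the product measure leaves a ball in the remaining coordinates.\<close>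
lemma emeasure_cylinder_Basis:
 fixes b :: "'a::euclidean_space"
 assumes b: "b \<in> Basis" and r: "r > 0" and h: "a \<le> h"
 shows "emeasure lborel {z. a \<le> z \<bullet> b \<and> z \<bullet> b \<le> h \<and> norm (perp b z) \<le> r} =
  ennreal (h - a) * ennreal (unit_ball_vol (real (DIM('a) - 1)) * r ^ (DIM('a) - 1))"
proof -
 interpret product_sigma_finite "\<lambda>_::'a. lborel :: real measure" by standard
 let ?I = "Basis - {b} :: 'a set"
 let ?C = "{z. a \<le> z \<bullet> b \<and> z \<bullet> b \<le> h \<and> norm (perp b z) \<le> r}"
 let ?B = "{f. sqrt (\<Sum>i\<in>?I. (f i)\<^sup>2) \<le> r} \<inter> space (Pi\<^sub>M ?I (\<lambda>_. lborel))"
 have I: "insert b ?I = Basis" "finite ?I" "b \<notin> ?I" using b by auto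
 have C[measurable]: "?C \<in> sets borel" by measurable
 have g[measurable]: "(\<lambda>f. \<Sum>j\<in>Basis. f j *\<^sub>R j :: 'a) \<in> borel_measurable (Pi\<^sub>M Basis (\<lambda>_. lborel))" by measurable
 have np: "norm (perp b z) = sqrt (\<Sum>i\<in>?I. (z \<bullet> i)\<^sup>2)" for z :: 'a
 proof -
  have "(norm (perp b z))\<^sup>2 = (\<Sum>i\<in>Basis. (perp b z \<bullet> i)\<^sup>2)"
   by (simp only: power2_norm_eq_inner) (subst euclidean_inner, simp add: power2_eq_square)
  also have "\<dots> = (\<Sum>i\<in>insert b ?I. (perp b z \<bullet> i)\<^sup>2)" by (simp only: I)
  also have "\<dots> = (\<Sum>i\<in>?I. (z \<bullet> i)\<^sup>2)"
  proof -
   have "perp b z \<bullet> i = z \<bullet> i" if "i \<in> ?I" for i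
   proof -
    have "b \<bullet> i = 0" using b that by (auto simp: inner_Basis)
    then show ?thesis by (simp add: perp_def inner_diff_left)
   qed
   moreover have "perp b z \<bullet> b = 0" using b by (simp add: perp_def inner_diff_left)
   ultimately have "(\<Sum>i\<in>?I. (perp b z \<bullet> i)\<^sup>2) = (\<Sum>i\<in>?I. (z \<bullet> i)\<^sup>2)" "(perp b z \<bullet> b)\<^sup>2 = 0"
    by (auto intro!: sum.cong)
   then show ?thesis using sum.insert[OF I(2,3), of "\<lambda>i. (perp b z \<bullet> i)\<^sup>2"] by linarith
  qed
  finally have "sqrt (\<Sum>i\<in>?I. (z \<bullet> i)\<^sup>2) = sqrt ((norm (perp b z))\<^sup>2)" by simp
  then show ?thesis by simp
 qed
 have B: "?B \<in> sets (Pi\<^sub>M ?I (\<lambda>_. lborel))" by measurable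
 have "emeasure lborel ?C = (\<integral>\<^sup>+z. indicator ?C z \<partial>distr (Pi\<^sub>M Basis (\<lambda>_. lborel)) borel (\<lambda>f. \<Sum>j\<in>Basis. f j *\<^sub>R j))"
  by (subst lborel_eq) simp
 also have "\<dots> = (\<integral>\<^sup>+f. indicator ?C (\<Sum>j\<in>Basis. f j *\<^sub>R j) \<partial>Pi\<^sub>M (insert b ?I) (\<lambda>_. lborel))"
  by (subst nn_integral_distr[OF g]) (simp_all only: I, measurable)
 also have "\<dots> = (\<integral>\<^sup>+x. (\<integral>\<^sup>+y. indicator ?C (\<Sum>j\<in>Basis. (x(b := y)) j *\<^sub>R j) \<partial>lborel) \<partial>Pi\<^sub>M ?I (\<lambda>_. lborel))"
  by (rule product_nn_integral_insert[OF I(2,3)]) (simp only: I, measurable)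
 also have "\<dots> = (\<integral>\<^sup>+x. ennreal (h - a) * indicator ?B x \<partial>Pi\<^sub>M ?I (\<lambda>_. lborel))"
 proof (rule nn_integral_cong)
  fix x :: "'a => real" assume x: "x \<in> space (Pi\<^sub>M ?I (\<lambda>_. lborel))"
  let ?z = "\<lambda>y. \<Sum>j\<in>Basis. (x(b := y)) j *\<^sub>R j"
  have zi: "?z y \<bullet> i = (x(b := y)) i" if "i \<in> Basis" for y i
   using that by simp
  have "(\<Sum>i\<in>?I. (?z y \<bullet> i)\<^sup>2) = (\<Sum>i\<in>?I. (x i)\<^sup>2)" for y
  proof (rule sum.cong)
   fix i assume "i \<in> ?I"
   then have "?z y \<bullet> i = x i" using zi[of i y] by simp
   then show "(?z y \<bullet> i)\<^sup>2 = (x i)\<^sup>2" by (simp only:)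
  qed simp
  then have "norm (perp b (?z y)) = sqrt (\<Sum>i\<in>?I. (x i)\<^sup>2)" for y by (simp only: np)
  moreover have "?z y \<bullet> b = y" for y using zi[OF b] by simp
  ultimately have "?z y \<in> ?C \<longleftrightarrow> y \<in> {a..h} \<and> x \<in> ?B" for y using x by simp
  then have "indicator ?C (?z y) = indicator ?B x * (indicator {a..h} y :: ennreal)" for y
   by (simp only: indicator_def of_bool_conj mult.commute)
  then have "(\<integral>\<^sup>+y. indicator ?C (?z y) \<partial>lborel) = (\<integral>\<^sup>+y. indicator ?B x * indicator {a..h} y \<partial>lborel)"
   by (simp only:)
  also have "\<dots> = indicator ?B x * ennreal (h - a)"
   using h by (subst nn_integral_cmult_indicator) auto
  finally show "(\<integral>\<^sup>+y. indicator ?C (?z y) \<partial>lborel) = ennreal (h - a) * indicator ?B x" by (simp add: mult.commute)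
 qed
 also have "\<dots> = ennreal (h - a) * emeasure (Pi\<^sub>M ?I (\<lambda>_. lborel)) ?B"
  by (rule nn_integral_cmult_indicator[OF B])
 also have "emeasure (Pi\<^sub>M ?I (\<lambda>_. lborel)) ?B = ennreal (unit_ball_vol (real (card ?I)) * r ^ card ?I)"
  by (rule emeasure_cball_aux) (use r in auto)
 also have "card ?I = DIM('a) - 1" using b by simp
 finally show ?thesis .
qed

lemma emeasure_cylinder:
 fixes \<nu> :: "real^'n"
 assumes n: "norm \<nu> = 1" and r: "r > 0" and h: "a \<le> h"
 shows "emeasure lborel {z. a \<le> z \<bullet> \<nu> \<and> z \<bullet> \<nu> \<le> h \<and> norm (perp \<nu> z) \<le> r} =
  ennreal (h - a) * ennreal (unit_ball_vol (real (CARD('n) - 1)) * r ^ (CARD('n) - 1))"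
proof -
 obtain b :: "real^'n" where b: "b \<in> Basis" using nonempty_Basis by blast
 then have nb: "norm b = 1" by simp
 obtain f where f: "orthogonal_transformation f" "f \<nu> = b"
  using orthogonal_transformation_exists_1[OF n nb] by blast
 have fi: "f x \<bullet> b = x \<bullet> \<nu>" for x using f by (metis orthogonal_transformation_def)
 have lin: "linear f" using f(1) orthogonal_transformation_linear by blast
 have "f (perp \<nu> x) = perp b (f x)" for x
  by (simp add: perp_def linear_diff[OF lin] linear_scale[OF lin] fi f(2))
 then have fp: "norm (perp b (f x)) = norm (perp \<nu> x)" for x
  using orthogonal_transformation_norm[OF f(1)] by metis
 let ?C = "{z. a \<le> z \<bullet> b \<and> z \<bullet> b \<le> h \<and> norm (perp b z) \<le> r}"
 have "?C \<in> sets borel" by measurable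
 then have "emeasure lborel (f -` ?C) = emeasure lborel ?C"
  by (rule emeasure_lborel_orthogonal_vimage[OF f(1)])
 also have "\<dots> = ennreal (h - a) * ennreal (unit_ball_vol (real (CARD('n) - 1)) * r ^ (CARD('n) - 1))"
  using emeasure_cylinder_Basis[OF b r h] by simp
 also have "f -` ?C = {z. a \<le> z \<bullet> \<nu> \<and> z \<bullet> \<nu> \<le> h \<and> norm (perp \<nu> z) \<le> r}"
  by (auto simp: fi fp)
 finally show ?thesis .
qed

section \<open>The isodiametric inequality\<close>

lemma box_family_between:
 fixes A G :: "'a::euclidean_space set"
 assumes A: "compact A" "A \<noteq> {}" and G: "open G" "A \<subseteq> G" and pos: "measure lebesgue A > 0"
 obtains \<A> where "box_family \<A>" "\<Union>\<A> \<subseteq> G" "measure lebesgue A \<le> measure lebesgue (\<Union>\<A>)"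
proof -
 have "\<exists>a b. x \<in> box a b \<and> cbox a b \<subseteq> G" if "x \<in> A" for x
 proof -
  have xG: "x \<in> G" using subsetD[OF G(2) \<open>x \<in> A\<close>] .
  obtain u v where "cbox u v \<subseteq> G" "x \<in> box u v" by (rule open_contains_cbox[OF G(1) xG])
  then show ?thesis by (intro exI conjI)
 qed
 then obtain a b where ab: "\<And>x. x \<in> A ==> x \<in> box (a x) (b x)" "\<And>x. x \<in> A ==> cbox (a x) (b x) \<subseteq> G"
  by metis
 obtain F where F: "F \<subseteq> A" "finite F" "A \<subseteq> (\<Union>x\<in>F. box (a x) (b x))"
 proof (rule compactE_image[OF A(1), of A "\<lambda>x. box (a x) (b x)"])
  show "A \<subseteq> (\<Union>x\<in>A. box (a x) (b x))" using ab(1) by blast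
 qed auto
 let ?\<F> = "(\<lambda>x. cbox (a x) (b x)) ` F"
 obtain p where p: "p division_of (\<Union>?\<F>)"
  using elementary_unions_intervals[of ?\<F>] F(2) by blast
 have cov: "A \<subseteq> \<Union>?\<F>" using F(3) box_subset_cbox by fastforce
 have subG: "\<Union>?\<F> \<subseteq> G" using ab(2) F(1) by blast
 define \<A> where "\<A> = interior ` p - {{}}"
 have un: "\<Union>p = \<Union>?\<F>" using p by (rule division_ofD(6))
 have fin: "finite p" using p by (rule division_ofD(1))
 have box: "\<exists>u v. K = cbox u v" if "K \<in> p" for K using division_ofD(4)[OF p that] .
 have sub: "\<Union>\<A> \<subseteq> G" using interior_subset subG un unfolding \<A>_def by blast
 have neg: "negligible (A - \<Union>\<A>)"
 proof (rule negligible_subset)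
  show "negligible (\<Union>K\<in>p. frontier K)"
  proof (rule negligible_Union)
   fix t assume "t \<in> frontier ` p"
   then obtain K where "K \<in> p" "t = frontier K" by blast
   moreover from this obtain u v where "K = cbox u v" using box by metis
   ultimately show "negligible t" using negligible_convex_frontier[OF convex_box(1)] by simp
  qed (use fin in simp)
  show "A - \<Union>\<A> \<subseteq> (\<Union>K\<in>p. frontier K)"
  proof
   fix x assume x: "x \<in> A - \<Union>\<A>"
   then obtain K where K: "K \<in> p" "x \<in> K" using cov un by (metis DiffD1 UnionE subsetD)
   have "x \<notin> interior K" using x K unfolding \<A>_def by blast
   then have "x \<in> frontier K" using K(2) closure_subset unfolding frontier_def by blast
   then show "x \<in> (\<Union>K\<in>p. frontier K)" using K(1) by blast
  qed
 qed
 have ne: "\<A> \<noteq> {}"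
 proof
  assume "\<A> = {}"
  then have "negligible A" using neg by simp
  then show False using pos negligible_imp_measure0[of A] by simp
 qed
 have fam: "box_family \<A>"
  unfolding box_family_def
 proof (intro conjI ballI ne)
  show "finite \<A>" using fin by (simp add: \<A>_def)
  show "pairwise disjnt \<A>"
  proof (rule pairwiseI)
   fix S T assume ST: "S \<in> \<A>" "T \<in> \<A>" "S \<noteq> T"
   obtain K L where "K \<in> p" "S = interior K" "L \<in> p" "T = interior L" using ST unfolding \<A>_def by blast
   then show "disjnt S T" using division_ofD(5)[OF p, of K L] ST(3) unfolding disjnt_def by metis
  qed
  fix K assume K: "K \<in> \<A>"
  then show "K \<noteq> {}" by (simp add: \<A>_def)
  from K obtain L where "L \<in> p" "K = interior L" by (auto simp: \<A>_def)
  then show "\<exists>a b. K = box a b" using box[of L] interior_cbox by metis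
 qed
 have "measure lebesgue A \<le> measure lebesgue (\<Union>\<A> \<union> (A - \<Union>\<A>))"
  using A(1) box_family_Union(4)[OF fam] lmeasurable_compact[OF A(1)] neg negligible_iff_measure
  by (intro measure_mono_fmeasurable) (auto intro!: fmeasurable.Un)
 also have "\<dots> = measure lebesgue (\<Union>\<A>)"
  by (rule measure_negligible_symdiff[OF box_family_Union(4)[OF fam]]) (rule negligible_subset[OF neg], auto)
 finally show ?thesis using that fam sub by blast
qed

text \<open>Approximate the compact set from outside by finitely many boxes and apply the Brunn-Minkowski inequality to these and their reflections.\<close>
lemma measure_difference_body_ge:
 fixes A :: "'a::euclidean_space set"
 assumes A: "compact A"
 shows "measure lebesgue (mink_sum A (uminus ` A)) \<ge> 2 ^ DIM('a) * measure lebesgue A"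
proof (cases "measure lebesgue A > 0")
 case False
 then have "measure lebesgue A = 0" by (simp add: zero_less_measure_iff)
 then show ?thesis by simp
next
 case True
 then have ne: "A \<noteq> {}" by auto
 let ?D = "mink_sum A (uminus ` A)"
 have cD: "compact ?D"
  using compact_sums'[of A "uminus ` A"] A compact_negations[OF A] unfolding mink_sum_def by simp
 show ?thesis
 proof (rule field_le_epsilon)
  fix e :: real assume e: "e > 0"
  have sD: "?D \<in> sets lebesgue" using lmeasurable_compact[OF cD] by auto
  obtain T where T: "open T" "?D \<subseteq> T" "T - ?D \<in> lmeasurable" "emeasure lebesgue (T - ?D) < ennreal e"
   using sets_lebesgue_outer_open[OF sD e] by blast
  have mT: "T \<in> lmeasurable"
  proof -
   have "T = ?D \<union> (T - ?D)" using T(2) by blast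
   then show ?thesis using T(3) lmeasurable_compact[OF cD] fmeasurable.Un by metis
  qed
  have mle: "measure lebesgue T \<le> measure lebesgue ?D + e"
  proof -
   have "measure lebesgue T = measure lebesgue ?D + measure lebesgue (T - ?D)"
    using T(2) measure_Un3[OF lmeasurable_compact[OF cD] T(3)] by (simp add: Un_absorb1)
   moreover have "measure lebesgue (T - ?D) < e"
    using T(3,4) e by (simp add: emeasure_eq_measure2 ennreal_less_iff)
   ultimately show ?thesis by simp
  qed
  obtain \<delta> where \<delta>: "\<delta> > 0" "(\<Union>x\<in>?D. ball x \<delta>) \<subseteq> T"
   using compact_subset_open_imp_ball_epsilon_subset[OF cD T(1,2)] by blast
  let ?G = "\<Union>x\<in>A. ball x (\<delta>/2)"
  have G: "open ?G" "A \<subseteq> ?G" using \<delta> by auto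
  obtain \<A> where \<A>: "box_family \<A>" "\<Union>\<A> \<subseteq> ?G" "measure lebesgue A \<le> measure lebesgue (\<Union>\<A>)"
   using box_family_between[OF A ne G True] by blast
  define \<B> where "\<B> = (\<lambda>S. uminus ` S) ` \<A>"
  have UB: "\<Union>\<B> = uminus ` (\<Union>\<A>)" unfolding \<B>_def by blast
  have box_um: "uminus ` box a b = box (- b) (- a)" for a b :: 'a
  proof -
   have "x \<in> uminus ` box a b \<longleftrightarrow> - x \<in> box a b" for x by (metis (no_types, lifting) image_iff minus_minus)
   moreover have "- x \<in> box a b \<longleftrightarrow> x \<in> box (- b) (- a)" for x
    unfolding mem_box by (auto simp: minus_less_iff less_minus_iff)
   ultimately show ?thesis by blast
  qed
  have fB: "box_family \<B>"
   unfolding box_family_def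
  proof (intro conjI ballI)
   show "finite \<B>" "\<B> \<noteq> {}" using \<A>(1) by (auto simp: \<B>_def box_family_def)
   show "pairwise disjnt \<B>"
   proof -
    have "pairwise disjnt \<A>" using \<A>(1) by (simp add: box_family_def)
    moreover have "disjnt (uminus ` S) (uminus ` S')" if "disjnt S S'" for S S' :: "'a set"
     using that unfolding disjnt_def by (metis image_Int inj_uminus image_empty)
    ultimately show ?thesis unfolding pairwise_def \<B>_def by blast
   qed
   fix K assume "K \<in> \<B>"
   then obtain S where S: "S \<in> \<A>" "K = uminus ` S" by (auto simp: \<B>_def)
   then show "K \<noteq> {}" using \<A>(1) by (auto simp: box_family_def)
   obtain a b where "S = box a b" using S(1) \<A>(1) unfolding box_family_def by metis
   then show "\<exists>a b. K = box a b" using S(2) box_um by metis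
  qed
  have "measure lebesgue (\<Union>\<B>) = measure lebesgue (\<Union>\<A>)"
   using measure_lebesgue_affine[of "-1" 0 "\<Union>\<A>"] unfolding UB by (simp add: image_def)
  then have "2 ^ DIM('a) * measure lebesgue (\<Union>\<A>) \<le> measure lebesgue (mink_sum (\<Union>\<A>) (\<Union>\<B>))"
   using brunn_minkowski_box_families[OF \<A>(1) fB] by simp
  also have "\<dots> \<le> measure lebesgue T"
  proof (rule measure_mono_fmeasurable)
   show "mink_sum (\<Union>\<A>) (\<Union>\<B>) \<subseteq> T"
   proof
    fix z assume "z \<in> mink_sum (\<Union>\<A>) (\<Union>\<B>)"
    then obtain x y where xy: "x \<in> \<Union>\<A>" "y \<in> \<Union>\<A>" "z = x - y" unfolding mink_sum_def UB by auto
    have xG: "x \<in> ?G" and yG: "y \<in> ?G" using subsetD[OF \<A>(2)] xy(1,2) by simp_all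
    obtain x' where x1: "x' \<in> A" "x \<in> ball x' (\<delta>/2)" using xG by (rule UN_E)
    obtain y' where y1: "y' \<in> A" "y \<in> ball y' (\<delta>/2)" using yG by (rule UN_E)
    have x': "x' \<in> A" "y' \<in> A" "dist x' x < \<delta>/2" "dist y' y < \<delta>/2" using x1 y1 by simp_all
    have "dist (x' - y') z < \<delta>"
    proof -
     have "dist (x' - y') z = norm ((x' - x) - (y' - y))" by (simp add: dist_norm xy algebra_simps)
     also have "\<dots> \<le> norm (x' - x) + norm (y' - y)" by (rule norm_triangle_ineq4)
     finally show ?thesis using x' by (simp add: dist_norm)
    qed
    then have zb: "z \<in> ball (x' - y') \<delta>" by simp
    have "x' + (- y') \<in> ?D" unfolding mink_sum_def using x'(1,2) by blast
    then have "x' - y' \<in> ?D" by simp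
    then have "z \<in> (\<Union>x\<in>?D. ball x \<delta>)" using zb by (rule UN_I)
    then show "z \<in> T" by (rule subsetD[OF \<delta>(2)])
   qed
   show "mink_sum (\<Union>\<A>) (\<Union>\<B>) \<in> sets lebesgue"
    using mink_sum_lmeasurable(2)[OF box_family_Union(1,2)[OF \<A>(1)] box_family_Union(2)[OF fB]] by auto
  qed (rule mT)
  finally have "2 ^ DIM('a) * measure lebesgue (\<Union>\<A>) \<le> measure lebesgue ?D + e" using mle by linarith
  moreover have "2 ^ DIM('a) * measure lebesgue A \<le> 2 ^ DIM('a) * measure lebesgue (\<Union>\<A>)" using \<A>(3) by simp
  ultimately show "2 ^ DIM('a) * measure lebesgue A \<le> measure lebesgue ?D + e" by linarith
 qed
qed

text \<open>The difference body of the cylinder over \<open>C\<close> is contained in a cylinder of height two over a ball of radius \<open>d\<close>, while its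
volume is at least \<open>2\<^sup>n\<close> times that of the cylinder over \<open>C\<close>.\<close>
lemma area_le_isodiametric_pos:
 fixes \<nu> :: "real^'n"
 assumes n: "norm \<nu> = 1" and C: "compact C" and d: "\<And>x y. x \<in> C ==> y \<in> C ==> dist x y \<le> d" and d0: "0 < d"
 shows "area \<nu> C \<le> ennreal (unit_ball_vol (real (CARD('n) - 1)) * (d / 2) ^ (CARD('n) - 1))"
proof -
 let ?S = "slab \<nu> C" and ?k = "CARD('n) - 1"
 let ?Z = "{z. - 1 \<le> z \<bullet> \<nu> \<and> z \<bullet> \<nu> \<le> 1 \<and> norm (perp \<nu> z) \<le> d}"
 let ?w = "unit_ball_vol (real ?k)"
 have cS: "compact ?S" by (rule compact_slab[OF n C])
 have sub: "mink_sum ?S (uminus ` ?S) \<subseteq> ?Z"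
 proof
  fix z assume "z \<in> mink_sum ?S (uminus ` ?S)"
  then obtain x y where xy: "x \<in> ?S" "y \<in> ?S" "z = x - y" unfolding mink_sum_def by auto
  then obtain p q where pq: "p \<in> C" "q \<in> C" "perp \<nu> x = perp \<nu> p" "perp \<nu> y = perp \<nu> q" unfolding slab_def by auto
  have "perp \<nu> z = perp \<nu> (p - q)" unfolding xy linear_diff[OF linear_perp] pq by simp
  also have "norm \<dots> \<le> norm (p - q)" by (rule norm_perp_le[OF n])
  also have "\<dots> \<le> d" using d[OF pq(1,2)] by (simp add: dist_norm)
  finally have "norm (perp \<nu> z) \<le> d" .
  moreover have "- 1 \<le> z \<bullet> \<nu>" "z \<bullet> \<nu> \<le> 1" using xy unfolding slab_def by (auto simp: inner_diff_left)
  ultimately show "z \<in> ?Z" by simp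
 qed
 have eZ: "emeasure lborel ?Z = ennreal (2 * (?w * d ^ ?k))"
 proof -
  have "emeasure lborel ?Z = ennreal (1 - - 1) * ennreal (?w * d ^ ?k)"
   by (rule emeasure_cylinder[OF n d0]) simp
  also have "\<dots> = ennreal ((1 - - 1) * (?w * d ^ ?k))"
   by (rule ennreal_mult'[symmetric]) simp
  finally show ?thesis by simp
 qed
 have Zb: "?Z \<in> sets borel" by measurable
 have Zm: "?Z \<in> lmeasurable" using eZ Zb by (intro fmeasurableI) auto
 have mZ: "measure lebesgue ?Z = 2 * (?w * d ^ ?k)"
  using eZ Zb d0 by (simp add: measure_def)
 have "2 ^ CARD('n) * measure lebesgue ?S \<le> measure lebesgue (mink_sum ?S (uminus ` ?S))"
  using measure_difference_body_ge[OF cS] by simp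
 also have "\<dots> \<le> measure lebesgue ?Z"
 proof (rule measure_mono_fmeasurable[OF sub _ Zm])
  have "compact (mink_sum ?S (uminus ` ?S))"
   using compact_sums'[of ?S "uminus ` ?S"] cS compact_negations[OF cS] unfolding mink_sum_def by simp
  then show "mink_sum ?S (uminus ` ?S) \<in> sets lebesgue" using lmeasurable_compact by auto
 qed
 also have "\<dots> = 2 ^ CARD('n) * (?w * (d / 2) ^ ?k)"
 proof -
  have "(2::real) ^ CARD('n) = 2 * 2 ^ ?k" by (metis One_nat_def Suc_pred power_Suc zero_less_card_finite)
  then show ?thesis unfolding mZ by (simp add: power_divide)
 qed
 finally have "measure lebesgue ?S \<le> ?w * (d / 2) ^ ?k" by simp
 moreover have "area \<nu> C = ennreal (measure lebesgue ?S)"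
 proof -
  have "emeasure lborel ?S \<noteq> \<infinity>" using emeasure_bounded_finite[OF compact_imp_bounded[OF cS]] by simp
  then have "emeasure lborel ?S = ennreal (measure lborel ?S)" by (intro emeasure_eq_ennreal_measure) simp
  moreover have "measure lebesgue ?S = measure lborel ?S"
   using cS by (intro measure_completion) (simp add: borel_closed compact_imp_closed)
  ultimately show ?thesis by (simp add: area_def)
 qed
 ultimately show ?thesis by (simp add: ennreal_leI)
qed

lemma area_le_isodiametric:
 fixes \<nu> :: "real^'n"
 assumes n: "norm \<nu> = 1" and C: "compact C" and d: "\<And>x y. x \<in> C ==> y \<in> C ==> dist x y \<le> d" and d0: "0 \<le> d"
 shows "area \<nu> C \<le> ennreal (unit_ball_vol (real (CARD('n) - 1)) * (d / 2) ^ (CARD('n) - 1))"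
proof (rule tendsto_lowerbound)
 let ?f = "\<lambda>e. ennreal (unit_ball_vol (real (CARD('n) - 1)) * ((d + e) / 2) ^ (CARD('n) - 1))"
 have "((\<lambda>e. unit_ball_vol (real (CARD('n) - 1)) * ((d + e) / 2) ^ (CARD('n) - 1)) \<longlongrightarrow>
   unit_ball_vol (real (CARD('n) - 1)) * ((d + 0) / 2) ^ (CARD('n) - 1)) (at_right 0)"
  by (intro tendsto_intros) auto
 then show "(?f \<longlongrightarrow> ennreal (unit_ball_vol (real (CARD('n) - 1)) * (d / 2) ^ (CARD('n) - 1))) (at_right 0)"
  by (intro tendsto_ennrealI) simp
 show "\<forall>\<^sub>F e in at_right 0. area \<nu> C \<le> ?f e"
  using eventually_at_right_less[of "0::real"]
 proof eventually_elim
  case (elim e)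
  show ?case by (rule area_le_isodiametric_pos[OF n C]) (use d d0 elim in \<open>force+\<close>)
 qed
qed simp

section \<open>Hausdorff measure\<close>

definition hausdorff_gauge :: "nat => 'a::metric_space set => ennreal" where
 "hausdorff_gauge k U = (if U = {} then 0 else ennreal (unit_ball_vol (real k) * (diameter U / 2) ^ k))"

definition delta_cover :: "real => 'a::metric_space set => (nat => 'a set) => bool" where
 "delta_cover \<delta> A U \<longleftrightarrow> A \<subseteq> (\<Union>i. U i) \<and> (\<forall>i. bounded (U i) \<and> diameter (U i) \<le> \<delta>)"

lemma hausdorff_premeasure_alt:
 "hausdorff_premeasure k \<delta> A = (INF U\<in>{U. delta_cover \<delta> A U}. \<Sum>i. hausdorff_gauge k (U i))"
 unfolding hausdorff_premeasure_def hausdorff_gauge_def delta_cover_def by simp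

lemma hausdorff_premeasure_le: "delta_cover \<delta> A U ==> hausdorff_premeasure k \<delta> A \<le> (\<Sum>i. hausdorff_gauge k (U i))"
 unfolding hausdorff_premeasure_alt by (rule INF_lower) simp

lemma hausdorff_premeasure_ge:
 "(\<And>U. delta_cover \<delta> A U ==> x \<le> (\<Sum>i. hausdorff_gauge k (U i))) ==> x \<le> hausdorff_premeasure k \<delta> A"
 unfolding hausdorff_premeasure_alt by (rule INF_greatest) simp

lemma hausdorff_premeasure_mono: "A \<subseteq> B ==> hausdorff_premeasure k \<delta> A \<le> hausdorff_premeasure k \<delta> B"
 by (rule hausdorff_premeasure_ge, rule hausdorff_premeasure_le) (auto simp: delta_cover_def)

lemma hausdorff_premeasure_antimono: "\<delta> \<le> \<delta>' ==> hausdorff_premeasure k \<delta>' A \<le> hausdorff_premeasure k \<delta> A"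
 by (rule hausdorff_premeasure_ge, rule hausdorff_premeasure_le) (auto simp: delta_cover_def intro: order_trans)

lemma hausdorff_premeasure_le_measure: "0 < \<delta> ==> hausdorff_premeasure k \<delta> A \<le> hausdorff_measure k A"
 unfolding hausdorff_measure_def by (rule SUP_upper) simp

lemma hausdorff_measure_le:
 "(\<And>\<delta>. 0 < \<delta> ==> hausdorff_premeasure k \<delta> A \<le> x) ==> hausdorff_measure k A \<le> x"
 unfolding hausdorff_measure_def by (rule SUP_least) simp

lemma hausdorff_measure_mono: "A \<subseteq> B ==> hausdorff_measure k A \<le> hausdorff_measure k B"
 by (rule hausdorff_measure_le)
  (meson hausdorff_premeasure_mono hausdorff_premeasure_le_measure order_trans)

lemma diameter_le_metric:
 fixes S :: "'a::metric_space set"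
 assumes "\<And>x y. x \<in> S ==> y \<in> S ==> dist x y \<le> d" "0 \<le> d"
 shows "diameter S \<le> d"
 unfolding diameter_def using assms by (auto intro!: cSUP_least)

text \<open>Choose nearly optimal covers of the \<open>n\<close>th set with error \<open>e / 2\<^sup>n\<close> and enumerate all of them by pairs.\<close>
lemma hausdorff_premeasure_UN:
 fixes A :: "nat => 'a::metric_space set"
 shows "hausdorff_premeasure k \<delta> (\<Union>n. A n) \<le> (\<Sum>n. hausdorff_premeasure k \<delta> (A n))"
proof (rule ennreal_le_epsilon)
 fix e :: real assume e: "0 < e" and fin: "(\<Sum>n. hausdorff_premeasure k \<delta> (A n)) < top"
 have fin1: "hausdorff_premeasure k \<delta> (A n) < top" for n
  using ennreal_suminf_lessD[OF fin] by simp
 have "\<exists>U. delta_cover \<delta> (A n) U \<and>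
   (\<Sum>i. hausdorff_gauge k (U i)) \<le> hausdorff_premeasure k \<delta> (A n) + ennreal (e * (1/2) ^ Suc n)" for n
 proof -
  have "0 < ennreal (e * (1/2) ^ Suc n)" using e by simp
  then have "hausdorff_premeasure k \<delta> (A n) < hausdorff_premeasure k \<delta> (A n) + ennreal (e * (1/2) ^ Suc n)"
   using fin1[of n] by (metis add.right_neutral ennreal_add_left_cancel_less infinity_ennreal_def less_irrefl)
  then obtain U where "delta_cover \<delta> (A n) U"
    "(\<Sum>i. hausdorff_gauge k (U i)) < hausdorff_premeasure k \<delta> (A n) + ennreal (e * (1/2) ^ Suc n)"
   unfolding hausdorff_premeasure_alt[of k \<delta> "A n"] INF_less_iff by auto
  then show ?thesis using less_imp_le by blast
 qed
 then obtain U where U: "\<And>n. delta_cover \<delta> (A n) (U n)"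
   "\<And>n. (\<Sum>i. hausdorff_gauge k (U n i)) \<le> hausdorff_premeasure k \<delta> (A n) + ennreal (e * (1/2) ^ Suc n)"
  by metis
 define V where "V j = (case prod_decode j of (n, i) => U n i)" for j
 have "delta_cover \<delta> (\<Union>n. A n) V"
  unfolding delta_cover_def
 proof (intro conjI allI)
  show "(\<Union>n. A n) \<subseteq> (\<Union>j. V j)"
  proof
   fix x assume "x \<in> (\<Union>n. A n)"
   then obtain n where "x \<in> A n" by blast
   then obtain i where "x \<in> U n i" using U(1)[of n] unfolding delta_cover_def by blast
   then have "x \<in> V (prod_encode (n, i))" by (simp add: V_def)
   then show "x \<in> (\<Union>j. V j)" by blast
  qed
  fix j
  show "bounded (V j)" "diameter (V j) \<le> \<delta>"
   using U(1) unfolding delta_cover_def V_def by (auto split: prod.split)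
 qed
 then have "hausdorff_premeasure k \<delta> (\<Union>n. A n) \<le> (\<Sum>j. hausdorff_gauge k (V j))"
  by (rule hausdorff_premeasure_le)
 also have "\<dots> = (\<Sum>j. (\<lambda>(n, i). hausdorff_gauge k (U n i)) (prod_decode j))"
  by (intro suminf_cong) (simp add: V_def case_prod_unfold)
 also have "\<dots> = (\<Sum>n. \<Sum>i. hausdorff_gauge k (U n i))"
  by (rule suminf_ennreal_2dimen) simp
 also have "\<dots> \<le> (\<Sum>n. hausdorff_premeasure k \<delta> (A n) + ennreal (e * (1/2) ^ Suc n))"
  by (intro suminf_le U(2)) auto
 also have "\<dots> = (\<Sum>n. hausdorff_premeasure k \<delta> (A n)) + (\<Sum>n. ennreal (e * (1/2) ^ Suc n))"
  by (rule suminf_add[symmetric]) auto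
 also have "(\<Sum>n. ennreal (e * (1/2) ^ Suc n)) = ennreal e"
 proof -
  have "(\<lambda>n. e * (1/2) ^ Suc n) sums (e * 1)" by (intro sums_mult power_half_series)
  then show ?thesis using e by (intro suminf_ennreal_eq) auto
 qed
 finally show "hausdorff_premeasure k \<delta> (\<Union>n. A n) \<le> (\<Sum>n. hausdorff_premeasure k \<delta> (A n)) + ennreal e" .
qed

lemma hausdorff_measure_UN:
 fixes A :: "nat => 'a::metric_space set"
 shows "hausdorff_measure k (\<Union>n. A n) \<le> (\<Sum>n. hausdorff_measure k (A n))"
proof (rule hausdorff_measure_le)
 fix \<delta> :: real assume "0 < \<delta>"
 then show "hausdorff_premeasure k \<delta> (\<Union>n. A n) \<le> (\<Sum>n. hausdorff_measure k (A n))"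
  by (intro order_trans[OF hausdorff_premeasure_UN] suminf_le hausdorff_premeasure_le_measure) auto
qed

lemma hausdorff_premeasure_empty [simp]: "0 < \<delta> ==> hausdorff_premeasure k \<delta> {} = 0"
 using hausdorff_premeasure_le[of \<delta> "{}" "\<lambda>_. {}" k] by (simp add: delta_cover_def hausdorff_gauge_def diameter_def)

lemma hausdorff_measure_empty [simp]: "hausdorff_measure k {} = 0"
 using hausdorff_measure_le[of k "{}" 0] by simp

lemma hausdorff_premeasure_Un:
 assumes "0 < \<delta>"
 shows "hausdorff_premeasure k \<delta> (A \<union> B) \<le> hausdorff_premeasure k \<delta> A + hausdorff_premeasure k \<delta> B"
proof -
 let ?F = "\<lambda>n::nat. if n = 0 then A else if n = 1 then B else {}"
 have "A \<union> B = (\<Union>n. ?F n)" by (auto split: if_splits)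
 then have "hausdorff_premeasure k \<delta> (A \<union> B) \<le> (\<Sum>n. hausdorff_premeasure k \<delta> (?F n))"
  using hausdorff_premeasure_UN[of k \<delta> ?F] by simp
 also have "\<dots> = (\<Sum>n\<in>{0,1}. hausdorff_premeasure k \<delta> (?F n))"
  by (rule suminf_finite) (use assms in auto)
 finally show ?thesis by simp
qed

lemma hausdorff_measure_UN_finite:
 assumes "finite I"
 shows "hausdorff_measure k (\<Union>i\<in>I. A i) \<le> (\<Sum>i\<in>I. hausdorff_measure k (A i))"
 using assms
proof induction
 case (insert i I)
 let ?F = "\<lambda>n::nat. if n = 0 then A i else if n = 1 then (\<Union>i\<in>I. A i) else {}"
 have "(\<Union>i\<in>insert i I. A i) = (\<Union>n. ?F n)" by (auto split: if_splits)
 then have "hausdorff_measure k (\<Union>i\<in>insert i I. A i) \<le> (\<Sum>n. hausdorff_measure k (?F n))"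
  using hausdorff_measure_UN[of k ?F] by simp
 also have "\<dots> = (\<Sum>n\<in>{0,1}. hausdorff_measure k (?F n))"
  by (rule suminf_finite) auto
 also have "\<dots> \<le> (\<Sum>i\<in>insert i I. hausdorff_measure k (A i))"
  using insert by (simp add: add_left_mono)
 finally show ?case .
qed simp

lemma diameter_image_le:
 fixes f :: "'a::metric_space => 'b::metric_space"
 assumes L: "0 \<le> L" "\<And>x y. x \<in> S ==> y \<in> S ==> dist (f x) (f y) \<le> L * dist x y" and S: "S \<subseteq> U" "bounded U"
 shows "diameter (f ` S) \<le> L * diameter U" "bounded (f ` S)"
proof -
 have d: "dist (f x) (f y) \<le> L * diameter U" if "x \<in> S" "y \<in> S" for x y
  using L(2)[OF that] diameter_bounded_bound[OF S(2), of x y] that S(1) L(1)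
  by (meson mult_left_mono order_trans subsetD)
 show "diameter (f ` S) \<le> L * diameter U"
  by (rule diameter_le_metric) (use d L(1) diameter_ge_0[OF S(2)] in auto)
 show "bounded (f ` S)"
 proof (cases "S = {}")
  case False
  then obtain x where "x \<in> S" by blast
  then show ?thesis using d unfolding bounded_def by blast
 qed simp
qed

lemma hausdorff_measure_lipschitz_image:
 fixes f :: "'a::metric_space => 'b::metric_space"
 assumes L: "0 < L" "\<And>x y. x \<in> A ==> y \<in> A ==> dist (f x) (f y) \<le> L * dist x y"
 shows "hausdorff_measure k (f ` A) \<le> ennreal (L ^ k) * hausdorff_measure k A"
proof (rule hausdorff_measure_le)
 fix \<delta> :: real assume \<delta>: "0 < \<delta>"
 let ?c = "unit_ball_vol (real k)"
 have "ennreal (1 / L ^ k) * hausdorff_premeasure k \<delta> (f ` A) \<le> hausdorff_premeasure k (\<delta> / L) A"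
 proof (rule hausdorff_premeasure_ge)
  fix U assume U: "delta_cover (\<delta> / L) A U"
  let ?V = "\<lambda>i. f ` (U i \<inter> A)"
  have V: "diameter (?V i) \<le> L * diameter (U i)" "bounded (?V i)" for i
   using diameter_image_le[of L "U i \<inter> A" f "U i"] L U unfolding delta_cover_def by auto
  have "delta_cover \<delta> (f ` A) ?V"
   unfolding delta_cover_def
  proof (intro conjI allI V(2))
   show "f ` A \<subseteq> (\<Union>i. ?V i)" using U unfolding delta_cover_def by blast
   fix i
   have "L * diameter (U i) \<le> \<delta>" using U L(1) unfolding delta_cover_def by (simp add: field_simps)
   then show "diameter (?V i) \<le> \<delta>" using V(1)[of i] by linarith
  qed
  then have "hausdorff_premeasure k \<delta> (f ` A) \<le> (\<Sum>i. hausdorff_gauge k (?V i))" by (rule hausdorff_premeasure_le)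
  also have "\<dots> \<le> (\<Sum>i. ennreal (L ^ k) * hausdorff_gauge k (U i))"
  proof (intro suminf_le allI)
   fix i
   show "hausdorff_gauge k (?V i) \<le> ennreal (L ^ k) * hausdorff_gauge k (U i)"
   proof (cases "U i \<inter> A = {}")
    case False
    have "?c * (diameter (?V i) / 2) ^ k \<le> ?c * (L * diameter (U i) / 2) ^ k"
     using V(1)[of i] diameter_ge_0[OF V(2)[of i]] by (intro mult_left_mono power_mono) auto
    also have "\<dots> = L ^ k * (?c * (diameter (U i) / 2) ^ k)"
     by (simp add: power_mult_distrib power_divide)
    finally have *: "?c * (diameter (?V i) / 2) ^ k \<le> L ^ k * (?c * (diameter (U i) / 2) ^ k)" .
    have "U i \<noteq> {}" using False by blast
    then show ?thesis using False ennreal_leI[OF *] L(1)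
     unfolding hausdorff_gauge_def by (simp add: ennreal_mult')
   qed (simp add: hausdorff_gauge_def)
  qed auto
  also have "\<dots> = ennreal (L ^ k) * (\<Sum>i. hausdorff_gauge k (U i))" by simp
  finally have "ennreal (1 / L ^ k) * hausdorff_premeasure k \<delta> (f ` A)
    \<le> ennreal (1 / L ^ k) * (ennreal (L ^ k) * (\<Sum>i. hausdorff_gauge k (U i)))"
   by (rule mult_left_mono) simp
  also have "\<dots> = (\<Sum>i. hausdorff_gauge k (U i))"
   using L(1) by (simp add: mult.assoc[symmetric] ennreal_mult'[symmetric])
  finally show "ennreal (1 / L ^ k) * hausdorff_premeasure k \<delta> (f ` A) \<le> (\<Sum>i. hausdorff_gauge k (U i))" .
 qed
 also have "\<dots> \<le> hausdorff_measure k A" using \<delta> L(1) by (intro hausdorff_premeasure_le_measure) simp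
 finally have "ennreal (L ^ k) * (ennreal (1 / L ^ k) * hausdorff_premeasure k \<delta> (f ` A)) \<le> ennreal (L ^ k) * hausdorff_measure k A"
  by (rule mult_left_mono) simp
 then show "hausdorff_premeasure k \<delta> (f ` A) \<le> ennreal (L ^ k) * hausdorff_measure k A"
  using L(1) by (simp add: mult.assoc[symmetric] ennreal_mult'[symmetric])
qed

lemma hausdorff_premeasure_separated:
 assumes sep: "\<And>x y. x \<in> A ==> y \<in> B ==> s \<le> dist x y" and \<delta>: "\<delta> < s"
 shows "hausdorff_premeasure k \<delta> A + hausdorff_premeasure k \<delta> B \<le> hausdorff_premeasure k \<delta> (A \<union> B)"
proof (rule hausdorff_premeasure_ge)
 fix U assume U: "delta_cover \<delta> (A \<union> B) U"
 then have bd: "\<And>i. bounded (U i)" "\<And>i. diameter (U i) \<le> \<delta>" by (auto simp: delta_cover_def)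
 have d0: "0 \<le> \<delta>" using bd diameter_ge_0 order_trans by metis
 have d0e: "diameter ({} :: 'a set) \<le> \<delta>" using d0 by (simp add: diameter_def)
 let ?UA = "\<lambda>i. if U i \<inter> A = {} then {} else U i" and ?UB = "\<lambda>i. if U i \<inter> B = {} then {} else U i"
 have one: "U i \<inter> A = {} \<or> U i \<inter> B = {}" for i
 proof (rule ccontr)
  assume "\<not> ?thesis"
  then obtain x y where "x \<in> U i" "x \<in> A" "y \<in> U i" "y \<in> B" by blast
  then have "s \<le> dist x y" "dist x y \<le> \<delta>" using sep diameter_bounded_bound[OF bd(1)] bd(2) order_trans by blast+
  then show False using \<delta> by linarith
 qed
 have "delta_cover \<delta> A ?UA"
  unfolding delta_cover_def
 proof (intro conjI allI)
  show "A \<subseteq> (\<Union>i. ?UA i)"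
  proof
   fix x assume x: "x \<in> A"
   then obtain i where i: "x \<in> U i" using U unfolding delta_cover_def by blast
   then have "x \<in> ?UA i" using x by auto
   then show "x \<in> (\<Union>i. ?UA i)" by blast
  qed
 qed (use bd d0e in auto)
 moreover have "delta_cover \<delta> B ?UB"
  unfolding delta_cover_def
 proof (intro conjI allI)
  show "B \<subseteq> (\<Union>i. ?UB i)"
  proof
   fix x assume x: "x \<in> B"
   then obtain i where i: "x \<in> U i" using U unfolding delta_cover_def by blast
   then have "x \<in> ?UB i" using x by auto
   then show "x \<in> (\<Union>i. ?UB i)" by blast
  qed
 qed (use bd d0e in auto)
 ultimately have "hausdorff_premeasure k \<delta> A + hausdorff_premeasure k \<delta> B
   \<le> (\<Sum>i. hausdorff_gauge k (?UA i)) + (\<Sum>i. hausdorff_gauge k (?UB i))"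
  by (intro add_mono hausdorff_premeasure_le)
 also have "\<dots> = (\<Sum>i. hausdorff_gauge k (?UA i) + hausdorff_gauge k (?UB i))"
  by (rule suminf_add) auto
 also have "\<dots> \<le> (\<Sum>i. hausdorff_gauge k (U i))"
 proof (intro suminf_le allI)
  fix i
  have e: "hausdorff_gauge k {} = 0" by (simp add: hausdorff_gauge_def)
  show "hausdorff_gauge k (?UA i) + hausdorff_gauge k (?UB i) \<le> hausdorff_gauge k (U i)"
   using one[of i] by (cases "U i \<inter> A = {}"; cases "U i \<inter> B = {}") (simp_all add: e)
 qed auto
 finally show "hausdorff_premeasure k \<delta> A + hausdorff_premeasure k \<delta> B \<le> (\<Sum>i. hausdorff_gauge k (U i))" .
qed

lemma hausdorff_measure_seq: "hausdorff_measure k A = (SUP n. hausdorff_premeasure k (1 / real (Suc n)) A)"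
proof (rule antisym)
 show "hausdorff_measure k A \<le> (SUP n. hausdorff_premeasure k (1 / real (Suc n)) A)"
 proof (rule hausdorff_measure_le)
  fix \<delta> :: real assume "0 < \<delta>"
  then obtain n where "1 / real (Suc n) < \<delta>" by (rule nat_approx_posE)
  then have "hausdorff_premeasure k \<delta> A \<le> hausdorff_premeasure k (1 / real (Suc n)) A"
   by (intro hausdorff_premeasure_antimono) simp
  also have "\<dots> \<le> (SUP n. hausdorff_premeasure k (1 / real (Suc n)) A)" by (rule SUP_upper) simp
  finally show "hausdorff_premeasure k \<delta> A \<le> (SUP n. hausdorff_premeasure k (1 / real (Suc n)) A)" .
 qed
qed (intro SUP_least hausdorff_premeasure_le_measure, simp)

text \<open>A set of diameter below the distance of \<open>A\<close> and \<open>B\<close> meets only one of them, so fine covers of the union split.\<close>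
lemma hausdorff_measure_separated:
 assumes sep: "\<And>x y. x \<in> A ==> y \<in> B ==> s \<le> dist x y" and s: "0 < s"
 shows "hausdorff_measure k A + hausdorff_measure k B \<le> hausdorff_measure k (A \<union> B)"
proof -
 have inc: "incseq (\<lambda>n. hausdorff_premeasure k (1 / real (Suc n)) C)" for C :: "'a set"
  by (intro monoI hausdorff_premeasure_antimono) (simp add: field_simps)
 have "hausdorff_measure k A + hausdorff_measure k B =
   (SUP n. hausdorff_premeasure k (1 / real (Suc n)) A + hausdorff_premeasure k (1 / real (Suc n)) B)"
  unfolding hausdorff_measure_seq by (rule ennreal_SUP_add[OF inc inc, symmetric])
 also have "\<dots> \<le> hausdorff_measure k (A \<union> B)"
 proof (rule SUP_least)
  fix n
  obtain m where m: "1 / real (Suc m) < s" using s by (rule nat_approx_posE)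
  let ?d = "min (1 / real (Suc n)) (1 / real (Suc m))"
  have "hausdorff_premeasure k (1 / real (Suc n)) A + hausdorff_premeasure k (1 / real (Suc n)) B
    \<le> hausdorff_premeasure k ?d A + hausdorff_premeasure k ?d B"
   by (intro add_mono hausdorff_premeasure_antimono) auto
  also have "\<dots> \<le> hausdorff_premeasure k ?d (A \<union> B)"
   by (rule hausdorff_premeasure_separated[OF sep]) (use m in auto)
  also have "\<dots> \<le> hausdorff_measure k (A \<union> B)"
   by (rule hausdorff_premeasure_le_measure) simp
  finally show "hausdorff_premeasure k (1 / real (Suc n)) A + hausdorff_premeasure k (1 / real (Suc n)) B \<le> hausdorff_measure k (A \<union> B)" .
 qed
 finally show ?thesis .
qed

lemma hausdorff_measure_disjoint_compacts:
 fixes C :: "'i => 'a::heine_borel set"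
 assumes "finite I" "\<And>i. i \<in> I ==> compact (C i)" "\<And>i j. i \<in> I ==> j \<in> I ==> i \<noteq> j ==> C i \<inter> C j = {}"
 shows "(\<Sum>i\<in>I. hausdorff_measure k (C i)) \<le> hausdorff_measure k (\<Union>i\<in>I. C i)"
 using assms
proof (induction I)
 case (insert i I)
 have c: "compact (C i)" "compact (\<Union>j\<in>I. C j)" using insert by auto
 have "C i \<inter> (\<Union>j\<in>I. C j) = {}" using insert.prems(2) insert.hyps(2) by blast
 then obtain s where s: "0 < s" "\<And>x y. x \<in> C i ==> y \<in> (\<Union>j\<in>I. C j) ==> s \<le> dist x y"
  using separate_compact_closed[OF c(1) compact_imp_closed[OF c(2)]] by blast
 have "(\<Sum>i\<in>insert i I. hausdorff_measure k (C i)) \<le> hausdorff_measure k (C i) + hausdorff_measure k (\<Union>j\<in>I. C j)"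
  using insert by (simp add: add_left_mono)
 also have "\<dots> \<le> hausdorff_measure k (C i \<union> (\<Union>j\<in>I. C j))"
  by (rule hausdorff_measure_separated[OF s(2,1)])
 finally show ?case by simp
qed simp

section \<open>Hausdorff measure and projected area\<close>

text \<open>By the isodiametric inequality each set of a cover has projected area at most its gauge, and area is countably subadditive.\<close>
lemma area_le_hausdorff_measure:
 fixes \<nu> :: "real^'n"
 assumes n: "norm \<nu> = 1" and C: "compact C"
 shows "area \<nu> C \<le> hausdorff_measure (CARD('n) - 1) C"
proof -
 let ?k = "CARD('n) - 1"
 have "area \<nu> C \<le> hausdorff_premeasure ?k 1 C"
 proof (rule hausdorff_premeasure_ge)
  fix U assume U: "delta_cover 1 C U"
  then have bd: "\<And>i. bounded (U i)" by (auto simp: delta_cover_def)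
  let ?D = "\<lambda>i. C \<inter> closure (U i)"
  have cD: "compact (?D i)" for i using C by (intro compact_Int_closed) auto
  have sD: "slab \<nu> (?D i) \<in> sets borel" for i
   using compact_slab[OF n cD] by (simp add: borel_closed compact_imp_closed)
  have "C \<subseteq> (\<Union>i. ?D i)"
  proof
   fix x assume x: "x \<in> C"
   then obtain i where "x \<in> U i" using U unfolding delta_cover_def by blast
   then have "x \<in> ?D i" using x closure_subset[of "U i"] by blast
   then show "x \<in> (\<Union>i. ?D i)" by blast
  qed
  then have "C = (\<Union>i. ?D i)" by blast
  then have "slab \<nu> C = (\<Union>i. slab \<nu> (?D i))" using slab_Union[of \<nu> ?D UNIV] by metis
  then have "area \<nu> C = emeasure lborel (\<Union>i. slab \<nu> (?D i))" by (simp add: area_def)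
  also have "\<dots> \<le> (\<Sum>i. emeasure lborel (slab \<nu> (?D i)))"
   by (rule emeasure_subadditive_countably) (use sD in auto)
  also have "\<dots> \<le> (\<Sum>i. hausdorff_gauge ?k (U i))"
  proof (intro suminf_le allI)
   fix i
   show "emeasure lborel (slab \<nu> (?D i)) \<le> hausdorff_gauge ?k (U i)"
   proof (cases "U i = {}")
    case False
    have "area \<nu> (?D i) \<le> ennreal (unit_ball_vol (real ?k) * (diameter (U i) / 2) ^ ?k)"
    proof (rule area_le_isodiametric[OF n cD])
     fix x y assume "x \<in> ?D i" "y \<in> ?D i"
     then have "x \<in> closure (U i)" "y \<in> closure (U i)" by auto
     then have "dist x y \<le> diameter (closure (U i))"
      using bounded_closure[OF bd] diameter_bounded_bound by blast
     then show "dist x y \<le> diameter (U i)" using diameter_closure[OF bd] by simp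
    qed (rule diameter_ge_0[OF bd])
    then show ?thesis using False by (simp add: hausdorff_gauge_def area_def)
   qed simp
  qed auto
  finally show "area \<nu> C \<le> (\<Sum>i. hausdorff_gauge ?k (U i))" .
 qed
 also have "\<dots> \<le> hausdorff_measure ?k C" by (rule hausdorff_premeasure_le_measure) simp
 finally show ?thesis .
qed

definition hcube :: "'a::euclidean_space => 'a => real => 'a set" where
 "hcube b x s = {y. y \<bullet> b = 0 \<and> (\<forall>i\<in>Basis - {b}. x \<bullet> i \<le> y \<bullet> i \<and> y \<bullet> i \<le> x \<bullet> i + s)}"

lemma perp_plane: "x \<bullet> b = 0 ==> perp b x = x"
 by (simp add: perp_def)

lemma slab_plane: "W \<subseteq> {x. x \<bullet> b = 0} ==> slab b W = {y. 0 \<le> y \<bullet> b \<and> y \<bullet> b \<le> 1 \<and> perp b y \<in> W}"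
proof -
 assume W: "W \<subseteq> {x. x \<bullet> b = 0}"
 have "perp b ` W = (\<lambda>x. x) ` W" by (rule image_cong) (use W perp_plane in auto)
 then show ?thesis unfolding slab_def by simp
qed

lemma emeasure_lborel_box_side:
 fixes c d :: "'a::euclidean_space"
 assumes "0 \<le> s" "\<And>i. i \<in> Basis ==> d \<bullet> i - c \<bullet> i = s"
 shows "emeasure lborel (box c d) = ennreal (s ^ DIM('a))"
proof -
 have "emeasure lborel (box c d) = ennreal (\<Prod>i\<in>Basis. (d - c) \<bullet> i)"
  by (rule emeasure_lborel_box) (use assms in \<open>force simp: algebra_simps\<close>)
 also have "(\<Prod>i\<in>Basis. (d - c) \<bullet> i) = (\<Prod>i\<in>(Basis::'a set). s)"
  by (rule prod.cong) (use assms(2) in \<open>auto simp: inner_diff_left\<close>)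
 finally show ?thesis by simp
qed

text \<open>Cover the cylinder over \<open>A\<close> by dyadic cubes of nearly the same total volume.  Averaging over the height shows that
some horizontal section of these cubes has total area at most that volume, and it still covers \<open>A\<close>.\<close>
lemma hcube_cover:
 fixes b :: "'a::euclidean_space"
 assumes b: "b \<in> Basis" and dim: "DIM('a) \<ge> 2" and A: "A \<subseteq> {x. x \<bullet> b = 0}" "bounded A"
  and S: "slab b A \<in> sets borel" and e: "0 < e" and \<delta>: "0 < \<delta>"
 obtains x :: "nat => 'a" and s :: "nat => real" where
  "\<And>n. 0 \<le> s n" "\<And>n. s n \<le> \<delta>" "A \<subseteq> (\<Union>n. hcube b (x n) (s n))"
  "(\<Sum>n. ennreal (s n ^ (DIM('a) - 1))) \<le> area b A + ennreal e"
proof -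
 let ?k = "DIM('a) - 1" and ?S = "slab b A"
 have k: "Suc ?k = DIM('a)" "?k > 0" using dim by auto
 have nb: "norm b = 1" "b \<bullet> b = 1" using b by (auto simp: inner_Basis)
 obtain M where M: "\<And>x. x \<in> A ==> norm x \<le> M" using A(2) bounded_iff by blast
 define N where "N = \<bar>M\<bar> + 1"
 have N: "N > 0" by (simp add: N_def)
 have nS: "norm y \<le> N" if "y \<in> ?S" for y
 proof -
  have y: "0 \<le> y \<bullet> b" "y \<bullet> b \<le> 1" "perp b y \<in> A" using that slab_plane[OF A(1)] by auto
  have "y = perp b y + (y \<bullet> b) *\<^sub>R b" by (simp add: perp_def)
  then have "norm y \<le> norm (perp b y) + norm ((y \<bullet> b) *\<^sub>R b)"
   using norm_triangle_ineq[of "perp b y" "(y \<bullet> b) *\<^sub>R b"] by simp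
  also have "\<dots> \<le> \<bar>M\<bar> + 1" using M[OF y(3)] y nb by simp
  finally show ?thesis by (simp add: N_def)
 qed
 let ?l = "- (N *\<^sub>R One) :: 'a" and ?u = "N *\<^sub>R One :: 'a"
 have Sc: "?S \<subseteq> cbox ?l ?u"
 proof
  fix y assume "y \<in> ?S"
  then have "\<bar>y \<bullet> i\<bar> \<le> N" if "i \<in> Basis" for i using nS Basis_le_norm[OF that, of y] by fastforce
  then show "y \<in> cbox ?l ?u" unfolding mem_box by (auto simp: abs_le_iff) (metis minus_le_iff)
 qed
 have ne: "box ?l ?u \<noteq> {}" using N by (simp add: box_ne_empty)
 have Sl: "?S \<in> sets lebesgue" using S by simp
 have "e / 2 > 0" using e by simp
 then obtain T where T: "open T" "?S \<subseteq> T" "emeasure lebesgue (T - ?S) < ennreal (e/2)"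
  using sets_lebesgue_outer_open[OF Sl] by metis
 have bS: "bounded ?S" using nS bounded_iff by blast
 have fin: "area b A < \<infinity>" unfolding area_def using emeasure_bounded_finite[OF bS] by simp
 have eT: "emeasure lborel T \<le> area b A + ennreal (e/2)"
 proof -
  have "emeasure lborel T = emeasure lborel (?S \<union> (T - ?S))" using T(2) by (simp add: Un_absorb1)
  also have "\<dots> \<le> emeasure lborel ?S + emeasure lborel (T - ?S)"
   using S T(1) by (intro emeasure_subadditive) auto
  also have "\<dots> \<le> area b A + ennreal (e/2)"
   using T(1,3) S by (intro add_mono) (auto simp: area_def less_imp_le)
  finally show ?thesis .
 qed
 define g where "g x = (if x \<in> T then T \<inter> ball x (\<delta>/2) else ball x 1)" for x
 have g: "gauge g" unfolding gauge_def g_def using T(1) \<delta> by auto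
 obtain \<D> where \<D>: "countable \<D>" "\<Union>\<D> \<subseteq> cbox ?l ?u"
   "\<And>K. K \<in> \<D> ==> interior K \<noteq> {} \<and> (\<exists>c d. K = cbox c d)"
   "pairwise (\<lambda>A B. interior A \<inter> interior B = {}) \<D>"
   "\<And>K. K \<in> \<D> ==> \<exists>x \<in> ?S \<inter> K. K \<subseteq> g x"
   "\<And>u v. cbox u v \<in> \<D> ==> \<exists>n. \<forall>i \<in> Basis. v \<bullet> i - u \<bullet> i = (?u \<bullet> i - ?l \<bullet> i) / 2^n"
   "?S \<subseteq> \<Union>\<D>"
  by (rule covering_lemma[OF Sc ne g]) blast
 define J where "J = to_nat_on \<D> ` \<D>"
 have "\<forall>K\<in>\<D>. \<exists>c d. K = cbox c d" using \<D>(3) by blast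
 then obtain cc dd where cd: "\<And>K. K \<in> \<D> ==> K = cbox (cc K) (dd K)" by metis
 define D where "D n = from_nat_into \<D> n" for n
 define c where "c n = cc (D n)" for n
 define d where "d n = dd (D n)" for n
 have DJ: "D n \<in> \<D>" "to_nat_on \<D> (D n) = n" if "n \<in> J" for n
  using that \<D>(1) unfolding J_def D_def by auto
 have Dn: "D n = cbox (c n) (d n)" if "n \<in> J" for n
  using cd[OF DJ(1)[OF that]] by (simp add: c_def d_def)
 define s where "s n = (if n \<in> J then (d n - c n) \<bullet> b else 0)" for n
 have side: "d n \<bullet> i - c n \<bullet> i = s n" if nJ: "n \<in> J" and iB: "i \<in> Basis" for n i
 proof -
  obtain m where m: "\<And>i. i \<in> Basis ==> d n \<bullet> i - c n \<bullet> i = (?u \<bullet> i - ?l \<bullet> i) / 2^m"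
   using \<D>(6)[of "c n" "d n"] DJ(1)[OF nJ] Dn[OF nJ] by auto
  have "d n \<bullet> j - c n \<bullet> j = 2 * N / 2 ^ m" if "j \<in> Basis" for j using m[OF that] that by simp
  then show ?thesis using nJ iB b by (simp add: s_def inner_diff_left)
 qed
 have spos: "s n \<ge> 0" for n
 proof (cases "n \<in> J")
  case True
  have "interior (D n) \<noteq> {}" using \<D>(3) DJ[OF True] by blast
  then have "box (c n) (d n) \<noteq> {}" using Dn[OF True] by (simp add: interior_cbox)
  then have "c n \<bullet> b < d n \<bullet> b" using b by (auto simp: box_ne_empty)
  then show ?thesis using side[OF True b] by simp
 qed (simp add: s_def)
 have DT: "D n \<subseteq> T \<and> s n \<le> \<delta>" if J: "n \<in> J" for n
 proof -
  obtain x where x: "x \<in> ?S" "x \<in> D n" "D n \<subseteq> g x" using \<D>(5)[OF DJ(1)[OF J]] by blast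
  have xT: "x \<in> T" using T(2) x(1) by blast
  have sub: "D n \<subseteq> T" "D n \<subseteq> ball x (\<delta>/2)" using x(3) xT by (auto simp: g_def)
  have "c n \<in> D n" "d n \<in> D n" using x(2) unfolding Dn[OF J] mem_box by force+
  then have "dist x (c n) < \<delta>/2" "dist x (d n) < \<delta>/2" using sub(2) by auto
  then have "dist (d n) (c n) < \<delta>" using dist_triangle_half_r[of x "d n" \<delta> "c n"] by simp
  moreover have "s n \<le> norm (d n - c n)"
   using Basis_le_norm[OF b, of "d n - c n"] J by (simp add: s_def)
  ultimately show ?thesis using sub(1) by (simp add: dist_norm)
 qed
 have sum_le: "(\<Sum>n. ennreal (s n ^ DIM('a))) \<le> emeasure lborel T"
 proof -
  define I where "I n = (if n \<in> J then box (c n) (d n) else {})" for n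
  have "(\<Sum>n. ennreal (s n ^ DIM('a))) = (\<Sum>n. emeasure lborel (I n))"
  proof (rule suminf_cong)
   fix n show "ennreal (s n ^ DIM('a)) = emeasure lborel (I n)"
   proof (cases "n \<in> J")
    case True
    then show ?thesis using emeasure_lborel_box_side[OF spos[of n], of "d n" "c n"] side[OF True] by (simp add: I_def)
   next
    case False
    then show ?thesis using k by (simp add: I_def s_def)
   qed
  qed
  also have "\<dots> = emeasure lborel (\<Union>n. I n)"
  proof (rule suminf_emeasure)
   show "disjoint_family I"
    unfolding disjoint_family_on_def
   proof (intro ballI impI)
    fix m n :: nat assume "m \<noteq> n"
    show "I m \<inter> I n = {}"
    proof (cases "m \<in> J \<and> n \<in> J")
     case True
     then have "D m \<noteq> D n" using DJ(2) \<open>m \<noteq> n\<close> by metis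
     then have "interior (D m) \<inter> interior (D n) = {}" using \<D>(4) DJ(1) True unfolding pairwise_def by blast
     then show ?thesis using True Dn by (simp add: I_def interior_cbox)
    qed (auto simp: I_def)
   qed
  qed (auto simp: I_def)
  also have "\<dots> \<le> emeasure lborel T"
  proof (rule emeasure_mono)
   have "I n \<subseteq> T" for n using DT[of n] Dn[of n] box_subset_cbox[of "c n" "d n"] by (auto simp: I_def)
   then show "(\<Union>n. I n) \<subseteq> T" by blast
  qed (use T(1) in auto)
  finally show ?thesis .
 qed
 define f where "f t = (\<Sum>n. ennreal (s n ^ ?k) * indicator {c n \<bullet> b .. d n \<bullet> b} t)" for t :: real
 have "(\<integral>\<^sup>+t. f t \<partial>lborel) = (\<Sum>n. \<integral>\<^sup>+t. ennreal (s n ^ ?k) * indicator {c n \<bullet> b .. d n \<bullet> b} t \<partial>lborel)"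
  unfolding f_def by (rule nn_integral_suminf) measurable
 also have "\<dots> = (\<Sum>n. ennreal (s n ^ DIM('a)))"
 proof (rule suminf_cong)
  fix n
  have "(\<integral>\<^sup>+t. ennreal (s n ^ ?k) * indicator {c n \<bullet> b .. d n \<bullet> b} t \<partial>lborel)
    = ennreal (s n ^ ?k) * emeasure lborel {c n \<bullet> b .. d n \<bullet> b}"
   by (rule nn_integral_cmult_indicator) simp
  also have "\<dots> = ennreal (s n ^ DIM('a))"
  proof (cases "n \<in> J")
   case True
   have "c n \<bullet> b \<le> d n \<bullet> b" using side[OF True b] spos[of n] by linarith
   then have "emeasure lborel {c n \<bullet> b .. d n \<bullet> b} = ennreal (s n)" using side[OF True b] by simp
   moreover have "s n ^ DIM('a) = s n ^ ?k * s n" by (subst k(1)[symmetric]) (rule power_Suc2)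
   moreover have "ennreal (s n ^ ?k * s n) = ennreal (s n ^ ?k) * ennreal (s n)" by (rule ennreal_mult''[OF spos])
   ultimately show ?thesis by (simp only:)
  next
   case False
   then have s0: "s n = 0" by (simp add: s_def)
   have z: "(0::real) ^ ?k = 0" "(0::real) ^ DIM('a) = 0" by (rule zero_power, rule k(2)) (rule zero_power, simp)
   show ?thesis unfolding s0 z by simp
  qed
  finally show "(\<integral>\<^sup>+t. ennreal (s n ^ ?k) * indicator {c n \<bullet> b .. d n \<bullet> b} t \<partial>lborel) = ennreal (s n ^ DIM('a))" .
 qed
 also have "\<dots> \<le> area b A + ennreal (e/2)" using sum_le eT by (rule order_trans)
 finally have If: "(\<integral>\<^sup>+t. f t \<partial>lborel) \<le> area b A + ennreal (e/2)" .
 have "\<exists>t\<in>{0..1}. f t \<le> area b A + ennreal e"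
 proof (rule ccontr)
  assume "\<not> ?thesis"
  then have gt: "area b A + ennreal e \<le> f t" if "t \<in> {0..1}" for t using that by (meson linear)
  have "area b A + ennreal e = (\<integral>\<^sup>+t. (area b A + ennreal e) * indicator {0..1::real} t \<partial>lborel)"
   by (subst nn_integral_cmult_indicator) auto
  also have "\<dots> \<le> (\<integral>\<^sup>+t. f t \<partial>lborel)"
   using gt by (intro nn_integral_mono) (auto simp: indicator_def)
  also have "\<dots> \<le> area b A + ennreal (e/2)" by (rule If)
  finally have "ennreal e \<le> ennreal (e/2)" using fin by (auto simp: ennreal_add_left_cancel_le)
  then show False using e by (simp add: ennreal_le_iff)
 qed
 then obtain t where t: "0 \<le> t" "t \<le> 1" "f t \<le> area b A + ennreal e" by auto
 define s' where "s' n = (if t \<in> {c n \<bullet> b .. d n \<bullet> b} then s n else 0)" for n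
 show ?thesis
 proof (rule that)
  show "0 \<le> s' n" for n using spos by (simp add: s'_def)
  show "s' n \<le> \<delta>" for n using DT[of n] \<delta> by (auto simp: s'_def s_def)
  show "A \<subseteq> (\<Union>n. hcube b (c n) (s' n))"
  proof
   fix a assume a: "a \<in> A"
   then have ab: "a \<bullet> b = 0" using A(1) by auto
   define y where "y = a + t *\<^sub>R b"
   have yb: "y \<bullet> b = t" using ab nb by (simp add: y_def inner_add_left)
   have "perp b y = a" using yb by (simp add: perp_def) (simp add: y_def)
   then have "y \<in> ?S" using slab_plane[OF A(1)] a t yb by simp
   then obtain K where K: "K \<in> \<D>" "y \<in> K" using \<D>(7) by blast
   define n where "n = to_nat_on \<D> K"
   have n: "n \<in> J" "D n = K" using K(1) \<D>(1) by (auto simp: n_def J_def D_def)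
   then have yc: "y \<in> cbox (c n) (d n)" using Dn K by metis
   then have "t \<in> {c n \<bullet> b .. d n \<bullet> b}" using b yb by (force simp: mem_box)
   then have "s' n = s n" by (simp add: s'_def)
   moreover have "c n \<bullet> i \<le> a \<bullet> i \<and> a \<bullet> i \<le> c n \<bullet> i + s n" if i: "i \<in> Basis - {b}" for i
   proof -
    have "b \<bullet> i = 0" using i b by (auto simp: inner_Basis)
    then have "y \<bullet> i = a \<bullet> i" by (simp add: y_def inner_add_left)
    moreover have "c n \<bullet> i \<le> y \<bullet> i" "y \<bullet> i \<le> d n \<bullet> i" using yc i by (auto simp: mem_box)
    ultimately show ?thesis using side[OF n(1), of i] i by auto
   qed
   ultimately have "a \<in> hcube b (c n) (s' n)" using ab by (simp add: hcube_def)
   then show "a \<in> (\<Union>n. hcube b (c n) (s' n))" by blast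
  qed
  have "(\<Sum>n. ennreal (s' n ^ ?k)) = f t"
   unfolding f_def by (rule suminf_cong) (use k in \<open>auto simp: s'_def indicator_def\<close>)
  then show "(\<Sum>n. ennreal (s' n ^ ?k)) \<le> area b A + ennreal e" using t(3) by simp
 qed
qed

lemma hcube_image:
 fixes b :: "'a::euclidean_space"
 assumes b: "b \<in> Basis" and s: "0 < s"
 shows "hcube b x s \<subseteq> (\<lambda>y. perp b x + s *\<^sub>R y) ` hcube b 0 1"
proof
 fix z assume z: "z \<in> hcube b x s"
 define y where "y = (1/s) *\<^sub>R (z - perp b x)"
 have nb: "b \<bullet> b = 1" using b by (simp add: inner_Basis)
 have "perp b x \<bullet> b = 0" using nb by (simp add: perp_def inner_diff_left)
 then have "y \<bullet> b = 0" using z by (simp add: y_def hcube_def inner_diff_left)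
 moreover have "0 \<le> y \<bullet> i \<and> y \<bullet> i \<le> 1" if i: "i \<in> Basis - {b}" for i
 proof -
  have "b \<bullet> i = 0" using i b by (auto simp: inner_Basis)
  then have "perp b x \<bullet> i = x \<bullet> i" by (simp add: perp_def inner_diff_left)
  moreover have "x \<bullet> i \<le> z \<bullet> i" "z \<bullet> i \<le> x \<bullet> i + s" using z i by (auto simp: hcube_def)
  ultimately show ?thesis using s by (simp add: y_def inner_diff_left)
 qed
 ultimately have "y \<in> hcube b 0 1" by (simp add: hcube_def)
 moreover have "z = perp b x + s *\<^sub>R y" using s by (simp add: y_def)
 ultimately show "z \<in> (\<lambda>y. perp b x + s *\<^sub>R y) ` hcube b 0 1" by blast
qed

lemma hcube_zero:
 assumes b: "b \<in> Basis"
 shows "hcube b x 0 \<subseteq> {perp b x}"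
proof
 fix z assume z: "z \<in> hcube b x 0"
 have "z = perp b x"
 proof (rule euclidean_eqI)
  fix i :: 'a assume i: "i \<in> Basis"
  show "z \<bullet> i = perp b x \<bullet> i"
  proof (cases "i = b")
   case True
   then show ?thesis using z b by (simp add: hcube_def perp_def inner_diff_left inner_Basis)
  next
   case False
   then have "b \<bullet> i = 0" using i b by (auto simp: inner_Basis)
   moreover have "x \<bullet> i \<le> z \<bullet> i" "z \<bullet> i \<le> x \<bullet> i + 0" using z i False by (auto simp: hcube_def)
   ultimately show ?thesis by (simp add: perp_def inner_diff_left)
  qed
 qed
 then show "z \<in> {perp b x}" by simp
qed

lemma hausdorff_premeasure_single:
 assumes "bounded U" "diameter U \<le> \<delta>" "0 < \<delta>" "diameter U \<le> d" "0 \<le> d"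
 shows "hausdorff_premeasure k \<delta> U \<le> ennreal (unit_ball_vol (real k) * (d / 2) ^ k)"
proof -
 let ?V = "\<lambda>n::nat. if n = 0 then U else {}"
 have "delta_cover \<delta> U ?V" using assms by (auto simp: delta_cover_def diameter_def[of "{}"] split: if_splits)
 then have "hausdorff_premeasure k \<delta> U \<le> (\<Sum>n. hausdorff_gauge k (?V n))" by (rule hausdorff_premeasure_le)
 also have "\<dots> = (\<Sum>n\<in>{0}. hausdorff_gauge k (?V n))"
  by (rule suminf_finite) (auto simp: hausdorff_gauge_def)
 also have "\<dots> \<le> ennreal (unit_ball_vol (real k) * (d / 2) ^ k)"
  using assms diameter_ge_0[OF assms(1)]
  by (auto simp: hausdorff_gauge_def intro!: ennreal_leI mult_left_mono power_mono)
 finally show ?thesis .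
qed

lemma hausdorff_measure_singleton:
 assumes "0 < k"
 shows "hausdorff_measure k {p} = 0"
proof -
 have "hausdorff_measure k {p} \<le> 0"
 proof (rule hausdorff_measure_le)
  fix \<delta> :: real assume "0 < \<delta>"
  then show "hausdorff_premeasure k \<delta> {p} \<le> 0"
   using hausdorff_premeasure_single[of "{p}" \<delta> 0 k] assms by (simp add: diameter_def zero_power)
 qed
 then show ?thesis by simp
qed

lemma bounded_hcube:
 assumes "b \<in> Basis"
 shows "bounded (hcube b x s)"
proof (rule bounded_subset[OF bounded_cbox])
 let ?m = "\<Sum>i\<in>Basis. (- \<bar>x \<bullet> i\<bar>) *\<^sub>R i" and ?M = "\<Sum>i\<in>Basis. (\<bar>x \<bullet> i\<bar> + \<bar>s\<bar>) *\<^sub>R i"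
 show "hcube b x s \<subseteq> cbox ?m ?M"
 proof
  fix y assume y: "y \<in> hcube b x s"
  have "?m \<bullet> i \<le> y \<bullet> i \<and> y \<bullet> i \<le> ?M \<bullet> i" if i: "i \<in> Basis" for i
  proof (cases "i = b")
   case True
   then have "y \<bullet> i = 0" using y by (simp add: hcube_def)
   moreover have "?m \<bullet> i = - \<bar>x \<bullet> i\<bar>" "?M \<bullet> i = \<bar>x \<bullet> i\<bar> + \<bar>s\<bar>" by (rule inner_sum_left_Basis[OF i])+
   ultimately show ?thesis by simp
  next
   case False
   then have "x \<bullet> i \<le> y \<bullet> i" "y \<bullet> i \<le> x \<bullet> i + s" using y i by (auto simp: hcube_def)
   moreover have "?m \<bullet> i = - \<bar>x \<bullet> i\<bar>" "?M \<bullet> i = \<bar>x \<bullet> i\<bar> + \<bar>s\<bar>" by (rule inner_sum_left_Basis[OF i])+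
   ultimately show ?thesis by linarith
  qed
  then show "y \<in> cbox ?m ?M" by (simp only: mem_box) blast
 qed
qed

lemma dist_hcube_le:
 fixes b :: "'a::euclidean_space"
 assumes "b \<in> Basis" "y \<in> hcube b x s" "z \<in> hcube b x s" "0 \<le> s"
 shows "dist y z \<le> real DIM('a) * s"
proof -
 have "\<bar>(y - z) \<bullet> i\<bar> \<le> s" if "i \<in> Basis" for i
 proof (cases "i = b")
  case True
  then show ?thesis using assms by (simp add: hcube_def inner_diff_left)
 next
  case False
  then have "x \<bullet> i \<le> y \<bullet> i" "y \<bullet> i \<le> x \<bullet> i + s" "x \<bullet> i \<le> z \<bullet> i" "z \<bullet> i \<le> x \<bullet> i + s"
   using assms that by (auto simp: hcube_def)
  then show ?thesis by (simp add: inner_diff_left abs_le_iff)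
 qed
 then have "(\<Sum>i\<in>Basis. \<bar>(y - z) \<bullet> i\<bar>) \<le> (\<Sum>i\<in>(Basis::'a set). s)" by (rule sum_mono)
 then show ?thesis using norm_le_l1[of "y - z"] by (simp add: dist_norm)
qed

context
 fixes b :: "'a::euclidean_space"
 assumes b: "b \<in> Basis" and dim: "DIM('a) \<ge> 2"
begin

private lemma k: "DIM('a) - 1 > 0" using dim by simp

text \<open>The cubes of an efficient cover have diameter at most the dimension times their side.\<close>
lemma hausdorff_measure_plane_finite:
 assumes A: "A \<subseteq> {x. x \<bullet> b = 0}" "bounded A" "slab b A \<in> sets borel"
 shows "hausdorff_measure (DIM('a) - 1) A < \<infinity>"
proof -
 let ?k = "DIM('a) - 1"
 let ?C = "unit_ball_vol (real ?k) * (real DIM('a) / 2) ^ ?k"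
 have C0: "0 \<le> ?C" by simp
 have bd: "bounded (slab b A)"
 proof -
  obtain M where M: "\<And>x. x \<in> A ==> norm x \<le> M" using A(2) bounded_iff by blast
  have "norm y \<le> M + 1" if "y \<in> slab b A" for y
  proof -
   have y: "0 \<le> y \<bullet> b" "y \<bullet> b \<le> 1" "perp b y \<in> A" using that slab_plane[OF A(1)] by auto
   have "y = perp b y + (y \<bullet> b) *\<^sub>R b" by (simp add: perp_def)
   then have "norm y \<le> norm (perp b y) + norm ((y \<bullet> b) *\<^sub>R b)"
    using norm_triangle_ineq[of "perp b y" "(y \<bullet> b) *\<^sub>R b"] by simp
   also have "\<dots> \<le> M + 1" using M[OF y(3)] y b by simp
   finally show ?thesis .
  qed
  then show ?thesis using bounded_iff by blast
 qed
 have "hausdorff_measure ?k A \<le> ennreal ?C * (area b A + 1)"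
 proof (rule hausdorff_measure_le)
  fix \<delta> :: real assume \<delta>: "0 < \<delta>"
  have dp: "0 < \<delta> / real DIM('a)" using \<delta> by simp
  obtain x :: "nat => 'a" and s :: "nat => real" where xs: "\<And>n. 0 \<le> s n" "\<And>n. s n \<le> \<delta> / real DIM('a)" "A \<subseteq> (\<Union>n. hcube b (x n) (s n))"
    "(\<Sum>n. ennreal (s n ^ ?k)) \<le> area b A + ennreal 1"
   by (rule hcube_cover[OF b dim A zero_less_one dp]) (rule that)
  have dia: "diameter (hcube b (x n) (s n)) \<le> real DIM('a) * s n" for n
   by (rule diameter_le_metric) (use dist_hcube_le[OF b] xs(1) in auto)
  have "hausdorff_premeasure ?k \<delta> A \<le> hausdorff_premeasure ?k \<delta> (\<Union>n. hcube b (x n) (s n))"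
   by (rule hausdorff_premeasure_mono[OF xs(3)])
  also have "\<dots> \<le> (\<Sum>n. hausdorff_premeasure ?k \<delta> (hcube b (x n) (s n)))" by (rule hausdorff_premeasure_UN)
  also have "\<dots> \<le> (\<Sum>n. ennreal ?C * ennreal (s n ^ ?k))"
  proof (intro suminf_le allI)
   fix n
   have "real DIM('a) * s n \<le> \<delta>" using xs(2)[of n] by (simp add: field_simps)
   then have "hausdorff_premeasure ?k \<delta> (hcube b (x n) (s n)) \<le> ennreal (unit_ball_vol (real ?k) * (real DIM('a) * s n / 2) ^ ?k)"
    using dia[of n] xs(1)[of n] \<delta> by (intro hausdorff_premeasure_single bounded_hcube b) auto
   also have "unit_ball_vol (real ?k) * (real DIM('a) * s n / 2) ^ ?k = ?C * s n ^ ?k"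
    by (simp add: power_mult_distrib power_divide)
   also have "ennreal (?C * s n ^ ?k) = ennreal ?C * ennreal (s n ^ ?k)" by (rule ennreal_mult'[OF C0])
   finally show "hausdorff_premeasure ?k \<delta> (hcube b (x n) (s n)) \<le> ennreal ?C * ennreal (s n ^ ?k)" .
  qed auto
  also have "\<dots> = ennreal ?C * (\<Sum>n. ennreal (s n ^ ?k))" by simp
  also have "\<dots> \<le> ennreal ?C * (area b A + 1)" using xs(4) by (intro mult_left_mono) auto
  finally show "hausdorff_premeasure ?k \<delta> A \<le> ennreal ?C * (area b A + 1)" .
 qed
 also have "\<dots> < \<infinity>"
  using emeasure_bounded_finite[OF bd] by (simp add: area_def ennreal_mult_less_top)
 finally show ?thesis .
qed

abbreviation (input) "unit_cube \<equiv> hausdorff_measure (DIM('a) - 1) (hcube b 0 1)"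

lemma hausdorff_measure_hcube_le:
 assumes "0 \<le> s"
 shows "hausdorff_measure (DIM('a) - 1) (hcube b x s) \<le> ennreal (s ^ (DIM('a) - 1)) * unit_cube"
proof (cases "s = 0")
 case True
 have "hausdorff_measure (DIM('a) - 1) (hcube b x s) \<le> hausdorff_measure (DIM('a) - 1) {perp b x}"
  using hcube_zero[OF b] True by (intro hausdorff_measure_mono) simp
 then show ?thesis unfolding hausdorff_measure_singleton[OF k] by (simp only: le_zero_eq zero_le)
next
 case False
 then have s: "0 < s" using assms by simp
 have "hausdorff_measure (DIM('a) - 1) (hcube b x s) \<le> hausdorff_measure (DIM('a) - 1) ((\<lambda>y. perp b x + s *\<^sub>R y) ` hcube b 0 1)"
  by (rule hausdorff_measure_mono[OF hcube_image[OF b s]])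
 also have "\<dots> \<le> ennreal (s ^ (DIM('a) - 1)) * unit_cube"
  by (rule hausdorff_measure_lipschitz_image[OF s]) (use s in \<open>simp add: dist_norm scaleR_diff_right[symmetric]\<close>)
 finally show ?thesis .
qed

lemma hausdorff_measure_plane_le_scaled_area:
 assumes A: "A \<subseteq> {x. x \<bullet> b = 0}" "bounded A" "slab b A \<in> sets borel" and unit_cube: "unit_cube < \<infinity>"
 shows "hausdorff_measure (DIM('a) - 1) A \<le> unit_cube * area b A"
proof -
 let ?k = "DIM('a) - 1"
 obtain c where c: "unit_cube = ennreal c" "0 \<le> c" using unit_cube by (metis infinity_ennreal_def less_top_ennreal)
 have *: "hausdorff_measure ?k A \<le> unit_cube * (area b A + ennreal e)" if e: "0 < e" for e
 proof -
  obtain x :: "nat => 'a" and s :: "nat => real" where xs: "\<And>n. 0 \<le> s n" "\<And>n. s n \<le> 1" "A \<subseteq> (\<Union>n. hcube b (x n) (s n))"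
    "(\<Sum>n. ennreal (s n ^ ?k)) \<le> area b A + ennreal e"
   by (rule hcube_cover[OF b dim A e zero_less_one]) (rule that)
  have "hausdorff_measure ?k A \<le> hausdorff_measure ?k (\<Union>n. hcube b (x n) (s n))"
   by (rule hausdorff_measure_mono[OF xs(3)])
  also have "\<dots> \<le> (\<Sum>n. hausdorff_measure ?k (hcube b (x n) (s n)))" by (rule hausdorff_measure_UN)
  also have "\<dots> \<le> (\<Sum>n. ennreal (s n ^ ?k) * unit_cube)"
   by (intro suminf_le allI hausdorff_measure_hcube_le xs) auto
  also have "\<dots> = (\<Sum>n. ennreal (s n ^ ?k)) * unit_cube" by simp
  also have "\<dots> \<le> (area b A + ennreal e) * unit_cube" using xs(4) by (intro mult_right_mono) auto
  finally show ?thesis by (simp add: mult.commute)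
 qed
 show ?thesis
 proof (rule ennreal_le_epsilon)
  fix e :: real assume e: "0 < e"
  have "hausdorff_measure ?k A \<le> unit_cube * (area b A + ennreal (e / (c + 1)))"
   by (rule *) (use e c in simp)
  also have "\<dots> = unit_cube * area b A + ennreal (c * (e / (c + 1)))"
   unfolding c(1) by (simp only: distrib_left ennreal_mult'[OF c(2)])
  also have "\<dots> \<le> unit_cube * area b A + ennreal e"
   using c e by (intro add_left_mono ennreal_leI) (simp add: field_simps)
  finally show "hausdorff_measure ?k A \<le> unit_cube * area b A + ennreal e" .
 qed
qed

lemma hcube_unit:
 shows "hcube b 0 1 \<subseteq> {x. x \<bullet> b = 0}" "slab b (hcube b 0 1) = cbox 0 One"
  "area b (hcube b 0 1) = 1"
proof -
 show pl: "hcube b 0 1 \<subseteq> {x. x \<bullet> b = 0}" by (auto simp: hcube_def)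
 have "perp b y \<bullet> b = 0" for y using b by (simp add: perp_def inner_diff_left inner_Basis)
 moreover have "perp b y \<bullet> i = y \<bullet> i" if "i \<in> Basis - {b}" for i y
 proof -
  have "b \<bullet> i = 0" using that b by (auto simp: inner_Basis)
  then show ?thesis by (simp add: perp_def inner_diff_left)
 qed
 ultimately show sl: "slab b (hcube b 0 1) = cbox 0 One"
  unfolding slab_plane[OF pl] using b by (auto simp: hcube_def mem_box)
 show "area b (hcube b 0 1) = 1"
  unfolding area_def sl by (subst emeasure_lborel_cbox) auto
qed

text \<open>Let \<open>c\<close> be the measure of the unit cube and \<open>\<theta>\<close> the area of its inscribed ball.  Cover the unit cube by small cubes and each
of these by its inscribed ball and the rest.  The gauge of a ball is exactly its area, and the rest costs at most \<open>c * (1 - \<theta>)\<close>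
times the area of the small cube.  Hence \<open>c \<le> \<theta> + c * (1 - \<theta>)\<close>, which forces \<open>c \<le> 1\<close>.\<close>
lemma unit_cube_measure_le_1: "unit_cube \<le> 1"
proof -
 let ?k = "DIM('a) - 1" and ?Q = "hcube b 0 1"
 \<comment> \<open>The area of the ball inscribed in the unit cube.\<close>
 define \<theta> where "\<theta> = unit_ball_vol (real ?k) * (1/2) ^ ?k"
 have \<theta>: "0 < \<theta>" unfolding \<theta>_def by (intro mult_pos_pos unit_ball_vol_pos) auto
 \<comment> \<open>The centre of the unit cube.\<close>
 define h where "h = (\<Sum>i\<in>Basis - {b}. (1/2) *\<^sub>R i)"
 have hb: "h \<bullet> b = 0" using b by (auto simp: h_def inner_sum_left inner_Basis intro!: sum.neutral)
 have hi: "h \<bullet> i = 1/2" if i: "i \<in> Basis - {b}" for i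
 proof -
  have "h \<bullet> i = (\<Sum>j\<in>Basis - {b}. if j = i then 1/2 else 0)"
   unfolding h_def inner_sum_left by (rule sum.cong) (use i in \<open>auto simp: inner_Basis\<close>)
  then show ?thesis using i by simp
 qed
 define B where "B = {y. y \<bullet> b = 0 \<and> norm (y - h) \<le> 1/2}"
 define R where "R = ?Q - B"
 have nb: "norm b = 1" using b by simp
 have BQ: "B \<subseteq> ?Q"
 proof
  fix y assume y: "y \<in> B"
  have "0 \<le> y \<bullet> i \<and> y \<bullet> i \<le> 1" if i: "i \<in> Basis - {b}" for i
  proof -
   have "\<bar>(y - h) \<bullet> i\<bar> \<le> 1/2" using Basis_le_norm[of i "y - h"] y i by (auto simp: B_def)
   then have "\<bar>y \<bullet> i - 1/2\<bar> \<le> 1/2" by (simp only: inner_diff_left hi[OF i])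
   then show ?thesis by linarith
  qed
  then show "y \<in> ?Q" using y by (simp add: hcube_def B_def)
 qed
 have plB: "B \<subseteq> {x. x \<bullet> b = 0}" and plR: "R \<subseteq> {x. x \<bullet> b = 0}" using hcube_unit(1) by (auto simp: B_def R_def)
 have slB: "slab b B = {z. z + (- h) \<in> {z. 0 \<le> z \<bullet> b \<and> z \<bullet> b \<le> 1 \<and> norm (perp b z) \<le> 1/2}}"
 proof -
  have "perp b (z - h) = perp b z - h" "perp b z \<bullet> b = 0" for z
   using hb b by (simp_all add: perp_def inner_diff_left inner_Basis)
  then show ?thesis unfolding slab_plane[OF plB] using hb by (auto simp: B_def inner_diff_left)
 qed
 have cylb: "{z. 0 \<le> z \<bullet> b \<and> z \<bullet> b \<le> 1 \<and> norm (perp b z) \<le> 1/2} \<in> sets borel" by measurable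
 have aB: "area b B = ennreal \<theta>"
  unfolding area_def slB emeasure_lborel_translate[OF cylb]
  using emeasure_cylinder_Basis[OF b, of "1/2" 0 1] by (simp add: \<theta>_def)
 have slBb: "slab b B \<in> sets borel"
 proof -
  have "(\<lambda>z. z + (- h)) -` {z. 0 \<le> z \<bullet> b \<and> z \<bullet> b \<le> 1 \<and> norm (perp b z) \<le> 1/2} \<inter> space borel \<in> sets borel"
   by (rule measurable_sets[of _ borel borel]) (use cylb in auto)
  then show ?thesis unfolding slB by (simp add: vimage_def)
 qed
 have slR: "slab b R = slab b ?Q - slab b B"
  unfolding slab_plane[OF plR] slab_plane[OF plB] slab_plane[OF hcube_unit(1)] by (auto simp: R_def)
 have slQb: "slab b ?Q \<in> sets borel" by (simp add: hcube_unit(2))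
 have slRb: "slab b R \<in> sets borel" unfolding slR using slQb slBb by blast
 have "slab b B \<subseteq> slab b ?Q" by (rule slab_mono[OF BQ])
 then have aR: "area b R = 1 - ennreal \<theta>"
  unfolding area_def slR using slQb slBb aB hcube_unit(3)
  by (subst emeasure_Diff) (auto simp: area_def)
 have "ennreal \<theta> \<le> 1" using emeasure_mono[OF \<open>slab b B \<subseteq> slab b ?Q\<close>, of lborel] slQb aB hcube_unit(3)
  by (simp add: area_def)
 then have \<theta>1: "\<theta> \<le> 1" by simp
 have bQ: "bounded ?Q" by (rule bounded_hcube[OF b])
 have bR: "bounded R" using bQ bounded_subset R_def by blast
 have c0fin: "unit_cube < \<infinity>" by (rule hausdorff_measure_plane_finite[OF hcube_unit(1) bQ slQb])
 then obtain c where c: "unit_cube = ennreal c" "0 \<le> c" by (metis infinity_ennreal_def less_top_ennreal)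
 have "hausdorff_measure ?k R \<le> unit_cube * area b R"
  by (rule hausdorff_measure_plane_le_scaled_area[OF plR bR slRb c0fin])
 also have "\<dots> = ennreal (c * (1 - \<theta>))"
  using c \<theta> \<theta>1 by (simp add: aR ennreal_mult'' flip: ennreal_1 ennreal_minus)
 finally have HR: "hausdorff_measure ?k R \<le> ennreal (c * (1 - \<theta>))" .
 define K where "K = \<theta> + c * (1 - \<theta>)"
 have K0: "0 \<le> K" using \<theta> \<theta>1 c by (simp add: K_def)
 have piece: "hausdorff_premeasure ?k \<delta> (hcube b x s) \<le> ennreal (s ^ ?k) * ennreal K"
  if \<delta>: "0 < \<delta>" and s: "0 \<le> s" "s \<le> \<delta>" for \<delta> x s
 proof (cases "s = 0")
  case True
  have "hausdorff_premeasure ?k \<delta> (hcube b x s) \<le> hausdorff_measure ?k {perp b x}"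
   using hcube_zero[OF b] True \<delta>
   by (meson hausdorff_measure_mono hausdorff_premeasure_le_measure order_trans)
  then show ?thesis unfolding hausdorff_measure_singleton[OF k] by (simp only: le_zero_eq zero_le)
 next
  case False
  then have sp: "0 < s" using s by simp
  let ?g = "\<lambda>y. perp b x + s *\<^sub>R y"
  have lip: "dist (?g y) (?g z) \<le> s * dist y z" for y z
   using sp by (simp add: dist_norm scaleR_diff_right[symmetric])
  have dB: "dist y z \<le> 1" if "y \<in> B" "z \<in> B" for y z
  proof -
   have "dist y h \<le> 1/2" "dist z h \<le> 1/2" using that by (auto simp: B_def dist_norm)
   then show ?thesis using dist_triangle2[of y z h] by linarith
  qed
  have bB: "bounded B" using bQ BQ bounded_subset by blast
  have dgB: "diameter (?g ` B) \<le> s"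
  proof (rule diameter_le_metric)
   fix u v assume "u \<in> ?g ` B" "v \<in> ?g ` B"
   then obtain y z where "y \<in> B" "z \<in> B" "u = ?g y" "v = ?g z" by blast
   then have "dist u v \<le> s * dist y z" using lip[of y z] by simp
   also have "\<dots> \<le> s * 1" using dB[OF \<open>y \<in> B\<close> \<open>z \<in> B\<close>] sp by (intro mult_left_mono) auto
   finally show "dist u v \<le> s" by simp
  qed (use s in simp)
  have "hcube b x s \<subseteq> ?g ` B \<union> ?g ` R"
   using hcube_image[OF b sp, of x] BQ unfolding R_def by blast
  then have "hausdorff_premeasure ?k \<delta> (hcube b x s) \<le> hausdorff_premeasure ?k \<delta> (?g ` B \<union> ?g ` R)"
   by (rule hausdorff_premeasure_mono)
  also have "\<dots> \<le> hausdorff_premeasure ?k \<delta> (?g ` B) + hausdorff_premeasure ?k \<delta> (?g ` R)"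
   by (rule hausdorff_premeasure_Un[OF \<delta>])
  also have "\<dots> \<le> ennreal (unit_ball_vol (real ?k) * (s / 2) ^ ?k) + ennreal (s ^ ?k) * ennreal (c * (1 - \<theta>))"
  proof (rule add_mono)
   have "bounded (?g ` B)" using diameter_image_le(2)[of s B ?g B] sp lip bB by simp
   then show "hausdorff_premeasure ?k \<delta> (?g ` B) \<le> ennreal (unit_ball_vol (real ?k) * (s / 2) ^ ?k)"
    using dgB s \<delta> by (intro hausdorff_premeasure_single) auto
   have "hausdorff_premeasure ?k \<delta> (?g ` R) \<le> hausdorff_measure ?k (?g ` R)"
    by (rule hausdorff_premeasure_le_measure[OF \<delta>])
   also have "\<dots> \<le> ennreal (s ^ ?k) * hausdorff_measure ?k R"
    by (rule hausdorff_measure_lipschitz_image[OF sp lip])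
   also have "\<dots> \<le> ennreal (s ^ ?k) * ennreal (c * (1 - \<theta>))" by (rule mult_left_mono[OF HR]) simp
   finally show "hausdorff_premeasure ?k \<delta> (?g ` R) \<le> ennreal (s ^ ?k) * ennreal (c * (1 - \<theta>))" .
  qed
  also have "unit_ball_vol (real ?k) * (s / 2) ^ ?k = s ^ ?k * \<theta>" by (simp add: \<theta>_def power_divide)
  also have "ennreal (s ^ ?k * \<theta>) + ennreal (s ^ ?k) * ennreal (c * (1 - \<theta>)) = ennreal (s ^ ?k) * ennreal K"
  proof -
   have "ennreal K = ennreal \<theta> + ennreal (c * (1 - \<theta>))"
    unfolding K_def using \<theta> \<theta>1 c by (intro ennreal_plus) auto
   moreover have "ennreal (s ^ ?k * \<theta>) = ennreal (s ^ ?k) * ennreal \<theta>" using s by (intro ennreal_mult') simp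
   ultimately show ?thesis by (simp only: distrib_left)
  qed
  finally show ?thesis .
 qed
 have "unit_cube \<le> ennreal K"
 proof (rule hausdorff_measure_le)
  fix \<delta> :: real assume \<delta>: "0 < \<delta>"
  show "hausdorff_premeasure ?k \<delta> ?Q \<le> ennreal K"
  proof (rule ennreal_le_epsilon)
   fix e :: real assume e: "0 < e"
   have e': "0 < e / (K + 1)" using e K0 by simp
   obtain x :: "nat => 'a" and s :: "nat => real" where xs: "\<And>n. 0 \<le> s n" "\<And>n. s n \<le> \<delta>" "?Q \<subseteq> (\<Union>n. hcube b (x n) (s n))"
    "(\<Sum>n. ennreal (s n ^ ?k)) \<le> area b ?Q + ennreal (e / (K + 1))"
    by (rule hcube_cover[OF b dim hcube_unit(1) bQ slQb e' \<delta>]) (rule that)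
   have "hausdorff_premeasure ?k \<delta> ?Q \<le> hausdorff_premeasure ?k \<delta> (\<Union>n. hcube b (x n) (s n))"
    by (rule hausdorff_premeasure_mono[OF xs(3)])
   also have "\<dots> \<le> (\<Sum>n. hausdorff_premeasure ?k \<delta> (hcube b (x n) (s n)))" by (rule hausdorff_premeasure_UN)
   also have "\<dots> \<le> (\<Sum>n. ennreal (s n ^ ?k) * ennreal K)"
    by (intro suminf_le allI piece \<delta> xs) auto
   also have "\<dots> = (\<Sum>n. ennreal (s n ^ ?k)) * ennreal K" by simp
   also have "\<dots> \<le> (1 + ennreal (e / (K + 1))) * ennreal K"
    using xs(4) hcube_unit(3) by (intro mult_right_mono) auto
   also have "\<dots> = ennreal K + ennreal (e / (K + 1) * K)"
    by (simp only: distrib_right mult_1_left ennreal_mult''[OF K0])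
   also have "\<dots> \<le> ennreal K + ennreal e"
    using K0 e by (intro add_left_mono ennreal_leI) (simp add: field_simps)
   finally show "hausdorff_premeasure ?k \<delta> ?Q \<le> ennreal K + ennreal e" .
  qed
 qed
 then have "c \<le> \<theta> + c * (1 - \<theta>)" using c K0 by (simp add: K_def)
 then have "\<theta> * c \<le> \<theta> * 1" by (simp add: algebra_simps)
 then have "c \<le> 1" using \<theta> by simp
 then show ?thesis using c by simp
qed

lemma hausdorff_measure_plane_le_area:
 assumes A: "A \<subseteq> {x. x \<bullet> b = 0}" "bounded A" "slab b A \<in> sets borel"
 shows "hausdorff_measure (DIM('a) - 1) A \<le> area b A"
proof -
 have "unit_cube < \<infinity>" using unit_cube_measure_le_1 by (rule le_less_trans) simp
 then have "hausdorff_measure (DIM('a) - 1) A \<le> unit_cube * area b A" by (rule hausdorff_measure_plane_le_scaled_area[OF A])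
 also have "\<dots> \<le> 1 * area b A" using unit_cube_measure_le_1 by (rule mult_right_mono) simp
 finally show ?thesis by simp
qed

end

text \<open>Rotate \<open>\<nu>\<close> to a unit vector of the basis; the graph is then an \<open>L\<close>-Lipschitz image of its projection.\<close>
lemma hausdorff_measure_graph_le_area:
 fixes \<nu> :: "real^'n"
 assumes n: "norm \<nu> = 1" and dim: "CARD('n) \<ge> 2" and W: "bounded W" "slab \<nu> W \<in> sets borel"
  and L: "0 < L" "\<And>p q. p \<in> W ==> q \<in> W ==> dist p q \<le> L * dist (perp \<nu> p) (perp \<nu> q)"
 shows "hausdorff_measure (CARD('n) - 1) W \<le> ennreal (L ^ (CARD('n) - 1)) * area \<nu> W"
proof -
 obtain b :: "real^'n" where b: "b \<in> Basis" using nonempty_Basis by blast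
 then have nb: "norm b = 1" by simp
 obtain f where f: "orthogonal_transformation f" "f \<nu> = b"
  using orthogonal_transformation_exists_1[OF n nb] by blast
 have fi: "f x \<bullet> b = x \<bullet> \<nu>" for x using f by (metis orthogonal_transformation_def)
 have lin: "linear f" using f(1) orthogonal_transformation_linear by blast
 have inj: "inj f" using orthogonal_transformation_inj[OF f(1)] .
 have fn: "norm (f x) = norm x" for x using orthogonal_transformation_norm[OF f(1)] .
 have fd: "dist (f x) (f y) = dist x y" for x y by (simp add: dist_norm linear_diff[OF lin, symmetric] fn)
 have fp: "f (perp \<nu> x) = perp b (f x)" for x
  by (simp add: perp_def linear_diff[OF lin] linear_scale[OF lin] fi f(2))
 have cont: "continuous_on UNIV f" using lin linear_continuous_on linear_conv_bounded_linear by blast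
 define A where "A = (\<lambda>p. f (perp \<nu> p)) ` W"
 have pl: "A \<subseteq> {x. x \<bullet> b = 0}"
  using n by (auto simp: A_def fi perp_def inner_diff_left norm_eq_1)
 have bA: "bounded A"
 proof -
  obtain M where M: "\<And>x. x \<in> W ==> norm x \<le> M" using W(1) bounded_iff by blast
  have "norm y \<le> M" if "y \<in> A" for y
  proof -
   obtain p where p: "p \<in> W" "y = f (perp \<nu> p)" using \<open>y \<in> A\<close> by (auto simp: A_def)
   then have "norm y = norm (perp \<nu> p)" by (simp add: fn)
   also have "\<dots> \<le> norm p" by (rule norm_perp_le[OF n])
   finally show ?thesis using M[OF p(1)] by simp
  qed
  then show ?thesis using bounded_iff by blast
 qed
 have sl: "y \<in> slab \<nu> W \<longleftrightarrow> f y \<in> slab b A" for y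
 proof -
  have "perp b (f y) \<in> A \<longleftrightarrow> perp \<nu> y \<in> perp \<nu> ` W"
   unfolding A_def fp[symmetric] using inj by (auto simp: inj_eq)
  then show ?thesis unfolding slab_plane[OF pl] slab_def[of \<nu> W] by (simp add: fi)
 qed
 have surj: "surj f" using orthogonal_transformation_surj[OF f(1)] .
 have im: "slab b A = f ` slab \<nu> W"
 proof (intro equalityI subsetI)
  fix z assume z: "z \<in> slab b A"
  obtain y where "z = f y" using surj by blast
  then show "z \<in> f ` slab \<nu> W" using z sl by blast
 qed (use sl in auto)
 have slb: "slab b A \<in> sets borel"
 proof -
  have g: "orthogonal_transformation (inv f)" using orthogonal_transformation_inv[OF f(1)] .
  have "linear (inv f)" using g orthogonal_transformation_linear by blast
  then have "continuous_on UNIV (inv f)" using linear_continuous_on linear_conv_bounded_linear by blast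
  then have "inv f \<in> borel_measurable borel" by (rule borel_measurable_continuous_onI)
  then have "inv f -` slab \<nu> W \<inter> space borel \<in> sets borel" using W(2) by (rule measurable_sets)
  moreover have "inv f -` slab \<nu> W = slab b A"
  proof -
   have "bij f" using inj surj by (simp add: bij_def)
   then show ?thesis unfolding im by (rule bij_vimage_eq_inv_image[OF bij_imp_bij_inv, unfolded inv_inv_eq, of f "slab \<nu> W" , simplified inv_inv_eq])
  qed
  ultimately show ?thesis by simp
 qed
 have ar: "area b A = area \<nu> W"
 proof -
  have "f -` slab b A = slab \<nu> W" using sl by auto
  then show ?thesis unfolding area_def using emeasure_lborel_orthogonal_vimage[OF f(1) slb] by simp
 qed
 define h where "h = inv_into W (\<lambda>p. f (perp \<nu> p))"
 have injW: "inj_on (\<lambda>p. f (perp \<nu> p)) W"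
 proof (rule inj_onI)
  fix p q assume pq: "p \<in> W" "q \<in> W" "f (perp \<nu> p) = f (perp \<nu> q)"
  then have "perp \<nu> p = perp \<nu> q" using inj by (simp add: inj_eq)
  then show "p = q" using L(2)[OF pq(1,2)] by simp
 qed
 have hW: "h ` A = W" unfolding A_def h_def by (rule inv_into_image_cancel[OF injW]) simp
 have "hausdorff_measure (CARD('n) - 1) (h ` A) \<le> ennreal (L ^ (CARD('n) - 1)) * hausdorff_measure (CARD('n) - 1) A"
 proof (rule hausdorff_measure_lipschitz_image[OF L(1)])
  fix x y assume "x \<in> A" "y \<in> A"
  then obtain p q where pq: "p \<in> W" "q \<in> W" "x = f (perp \<nu> p)" "y = f (perp \<nu> q)" by (auto simp: A_def)
  have "h x = p" "h y = q" unfolding h_def pq(3,4) using inv_into_f_f[OF injW] pq(1,2) by blast+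
  then show "dist (h x) (h y) \<le> L * dist x y" using L(2)[OF pq(1,2)] pq by (simp add: fd)
 qed
 also have "\<dots> \<le> ennreal (L ^ (CARD('n) - 1)) * area \<nu> W"
  using hausdorff_measure_plane_le_area[OF b _ pl bA slb] dim unfolding ar by (intro mult_left_mono) auto
 finally show ?thesis by (simp add: hW)
qed

section \<open>Uniformly flat boundaries\<close>

text \<open>Locally \<open>D\<close> is closed under moves in directions of the cone of opening \<open>\<epsilon>\<close> around \<open>\<nu>\<close>: small \<open>\<epsilon>\<close> means that the boundary is nearly a hyperplane with inner normal \<open>\<nu>\<close>.\<close>
definition cone_at :: "'a::euclidean_space set => real => real => 'a => 'a => bool" where
 "cone_at D \<epsilon> \<rho> z \<nu> \<longleftrightarrow> norm \<nu> = 1 \<and>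
  (\<forall>x\<in>ball z \<rho>. \<forall>y\<in>ball z \<rho>. x \<in> D \<longrightarrow> \<epsilon> * norm (y - x) \<le> (y - x) \<bullet> \<nu> \<longrightarrow> y \<in> D)"

definition flat_boundary :: "'a::euclidean_space set => bool" where
 "flat_boundary D \<longleftrightarrow> (\<forall>\<epsilon>>0. \<exists>\<rho>>0. \<forall>z\<in>frontier D. \<exists>\<nu>. cone_at D \<epsilon> \<rho> z \<nu>)"

lemma drop_coord_diff: "drop_coord k x - drop_coord k y = drop_coord k (x - y)"
 by (simp add: drop_coord_def vec_eq_iff)

lemma norm_drop_coord_le: "norm (drop_coord k x) \<le> norm x"
 by (rule norm_le_componentwise_cart) (simp add: drop_coord_def)

lemma drop_coord_mem: "drop_coord k x \<in> coord_hyperplane k"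
 by (simp add: drop_coord_def coord_hyperplane_def)

text \<open>The gradient of the graph function vanishes at the origin and is Lipschitz, so by the mean value theorem the graph function has Lipschitz constant \<open>\<epsilon>\<close> on a ball whose radius does not depend on the boundary point.\<close>
lemma c11_open_imp_flat_boundary:
 fixes D :: "(real^'n) set"
 assumes "c11_open D"
 shows "flat_boundary D"
 unfolding flat_boundary_def
proof (intro allI impI)
 fix \<epsilon> :: real assume \<epsilon>: "0 < \<epsilon>"
 obtain R \<Lambda> where R: "R > 0" and \<Lambda>: "\<Lambda> > 0" and ch: "\<forall>z\<in>frontier D.
   \<exists>(k::'n) (\<phi> :: real^'n => real) (g :: real^'n => real^'n) (T :: real^'n => real^'n).
   \<phi> 0 = 0 \<and> g 0 = 0 \<and>
   (\<forall>x\<in>coord_hyperplane k. g x \<in> coord_hyperplane k \<and>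
    (\<phi> has_derivative (\<lambda>h. g x \<bullet> h)) (at x within coord_hyperplane k) \<and> norm (g x) \<le> \<Lambda>) \<and>
   (\<forall>x\<^sub>1\<in>coord_hyperplane k. \<forall>x\<^sub>2\<in>coord_hyperplane k. norm (g x\<^sub>1 - g x\<^sub>2) \<le> \<Lambda> * norm (x\<^sub>1 - x\<^sub>2)) \<and>
   orthogonal_transformation T \<and>
   ball z R \<inter> D = ball z R \<inter> {y. T (y - z) $ k > \<phi> (drop_coord k (T (y - z)))}"
  using assms unfolding c11_open_def by (elim conjE exE) (rule that)
 define \<rho> where "\<rho> = min R (\<epsilon> / \<Lambda>)"
 have \<rho>: "\<rho> > 0" "\<rho> \<le> R" "\<Lambda> * \<rho> \<le> \<epsilon>"
  using R \<Lambda> \<epsilon> by (auto simp: \<rho>_def min_def field_simps)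
 show "\<exists>\<rho>>0. \<forall>z\<in>frontier D. \<exists>\<nu>. cone_at D \<epsilon> \<rho> z \<nu>"
 proof (rule exI[of _ \<rho>], intro conjI ballI)
  show "\<rho> > 0" by fact
  fix z assume "z \<in> frontier D"
  note chz = bspec[OF ch this]
  obtain k \<phi> g T where g0: "g 0 = (0::real^'n)"
    and c1: "\<forall>x\<in>coord_hyperplane k. g x \<in> coord_hyperplane k \<and>
    (\<phi> has_derivative (\<lambda>h. g x \<bullet> h)) (at x within coord_hyperplane k) \<and> norm (g x) \<le> \<Lambda>"
    and c2: "\<forall>x\<^sub>1\<in>coord_hyperplane k. \<forall>x\<^sub>2\<in>coord_hyperplane k. norm (g x\<^sub>1 - g x\<^sub>2) \<le> \<Lambda> * norm (x\<^sub>1 - x\<^sub>2)"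
    and T: "orthogonal_transformation T"
    and D: "ball z R \<inter> D = ball z R \<inter> {y. T (y - z) $ k > \<phi> (drop_coord k (T (y - z)))}"
   using chz by (elim conjE exE) (rule that)
  have der: "(\<phi> has_derivative (\<lambda>h. g x \<bullet> h)) (at x within coord_hyperplane k)" if "x \<in> coord_hyperplane k" for x
   using bspec[OF c1 that] by (elim conjE)
  have lip: "norm (g x - g y) \<le> \<Lambda> * norm (x - y)" if "x \<in> coord_hyperplane k" "y \<in> coord_hyperplane k" for x y
   by (rule bspec[OF bspec[OF c2 that(1)] that(2)])
  have lin: "linear T" using T orthogonal_transformation_linear by blast
  obtain \<nu> where \<nu>: "T \<nu> = axis k 1" using orthogonal_transformation_surj[OF T] by (metis surjD)
  have nn: "norm \<nu> = 1" using orthogonal_transformation_norm[OF T, of \<nu>] \<nu> by (simp add: norm_axis_1)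
  have Tk: "T v $ k = v \<bullet> \<nu>" for v
  proof -
   have "T v $ k = T v \<bullet> axis k 1" by (simp add: inner_axis)
   also have "\<dots> = v \<bullet> \<nu>" using T \<nu> by (metis orthogonal_transformation_def)
   finally show ?thesis .
  qed
  have TN: "norm (T v) = norm v" for v by (rule orthogonal_transformation_norm[OF T])
  let ?S = "coord_hyperplane k \<inter> ball 0 \<rho>"
  have zero: "0 \<in> coord_hyperplane k" by (simp add: coord_hyperplane_def)
  have cv: "convex (coord_hyperplane k :: (real^'n) set)"
   by (auto simp: convex_def coord_hyperplane_def)
  have mvt: "norm (\<phi> x - \<phi> y) \<le> \<epsilon> * norm (x - y)" if xy: "x \<in> ?S" "y \<in> ?S" for x y
  proof (rule differentiable_bound[OF _ _ _ xy])
   show "convex ?S" using cv by (intro convex_Int convex_ball)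
   fix u assume u: "u \<in> ?S"
   show "(\<phi> has_derivative (\<lambda>h. g u \<bullet> h)) (at u within ?S)"
    by (rule has_derivative_subset[OF der]) (use u in auto)
   show "onorm (\<lambda>h. g u \<bullet> h) \<le> \<epsilon>"
   proof (rule onorm_bound)
    fix h :: "real^'n"
    have "norm (g u) \<le> \<Lambda> * norm u" using lip[of u 0] u zero g0 by simp
    also have "\<dots> \<le> \<Lambda> * \<rho>" using u \<Lambda> by (intro mult_left_mono) auto
    finally have "norm (g u) \<le> \<epsilon>" using \<rho>(3) by linarith
    then have "norm (g u) * norm h \<le> \<epsilon> * norm h" by (rule mult_right_mono) simp
    then show "norm (g u \<bullet> h) \<le> \<epsilon> * norm h" using Cauchy_Schwarz_ineq2[of "g u" h] by simp
   qed (use \<epsilon> in simp)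
  qed
  show "\<exists>\<nu>. cone_at D \<epsilon> \<rho> z \<nu>"
  proof (rule exI[of _ \<nu>], unfold cone_at_def, intro conjI nn ballI impI)
   fix x y assume x: "x \<in> ball z \<rho>" and y: "y \<in> ball z \<rho>" and xD: "x \<in> D" and cone: "\<epsilon> * norm (y - x) \<le> (y - x) \<bullet> \<nu>"
   let ?w = "\<lambda>x. drop_coord k (T (x - z))"
   have wS: "?w x \<in> ?S" if "x \<in> ball z \<rho>" for x
   proof -
    have "norm (?w x) \<le> norm (x - z)" using norm_drop_coord_le[of k "T (x - z)"] TN by simp
    also have "\<dots> < \<rho>" using that by (simp add: dist_norm norm_minus_commute)
    finally show ?thesis using drop_coord_mem by simp
   qed
   have "norm (?w y - ?w x) \<le> norm (T (y - z) - T (x - z))"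
    unfolding drop_coord_diff by (rule norm_drop_coord_le)
   also have "\<dots> = norm (y - x)" by (simp add: linear_diff[OF lin, symmetric] TN)
   finally have "\<epsilon> * norm (?w y - ?w x) \<le> \<epsilon> * norm (y - x)" using \<epsilon> by (intro mult_left_mono) auto
   then have "\<phi> (?w y) - \<phi> (?w x) \<le> \<epsilon> * norm (y - x)"
    using mvt[OF wS[OF y] wS[OF x]] by simp
   moreover have "\<phi> (?w x) < (x - z) \<bullet> \<nu>"
   proof -
    have "x \<in> ball z R \<inter> D" using x xD \<rho>(2) by auto
    then show ?thesis unfolding D Tk by simp
   qed
   ultimately have "\<phi> (?w y) < (y - z) \<bullet> \<nu>" using cone by (simp add: inner_diff_left)
   then have "y \<in> ball z R \<inter> {y. T (y - z) $ k > \<phi> (drop_coord k (T (y - z)))}"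
    using y \<rho>(2) by (simp add: Tk)
   then show "y \<in> D" unfolding D[symmetric] by simp
  qed
 qed
qed

text \<open>The support function of \<open>K\<close> in direction \<open>- \<nu>\<close>: how far \<open>K\<close> reaches against the inner normal.\<close>
definition hgt :: "'a::euclidean_space set => 'a => real" where
 "hgt K \<nu> = (SUP k\<in>K. - (k \<bullet> \<nu>))"

text \<open>The points that some displacement in \<open>K\<close> carries out of \<open>D\<close>.\<close>
definition bad :: "'a::euclidean_space set => 'a set => 'a set" where
 "bad D K = {x\<in>D. \<exists>k\<in>K. x + k \<notin> D}"

lemma inner_unit_le: "norm \<nu> = 1 ==> \<bar>x \<bullet> \<nu>\<bar> \<le> norm (x::'a::real_inner)"
 using Cauchy_Schwarz_ineq2[of x \<nu>] by simp

lemma bdd_above_hgt: "norm \<nu> = 1 ==> K \<subseteq> cball 0 r ==> bdd_above ((\<lambda>k. - (k \<bullet> \<nu>)) ` K)"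
proof (rule bdd_aboveI2[of _ _ r])
 fix k assume "norm \<nu> = 1" "K \<subseteq> cball 0 r" "k \<in> K"
 then have "\<bar>k \<bullet> \<nu>\<bar> \<le> norm k" "norm k \<le> r" using inner_unit_le[of \<nu> k] by auto
 then show "- (k \<bullet> \<nu>) \<le> r" by linarith
qed

lemma hgt_bounds:
 assumes "norm \<nu> = 1" "K \<subseteq> cball 0 r" "0 \<in> K"
 shows "0 \<le> hgt K \<nu>" "hgt K \<nu> \<le> r" "\<And>k. k \<in> K ==> - (k \<bullet> \<nu>) \<le> hgt K \<nu>"
proof -
 show *: "- (k \<bullet> \<nu>) \<le> hgt K \<nu>" if "k \<in> K" for k
  unfolding hgt_def by (rule cSUP_upper[OF that bdd_above_hgt[OF assms(1,2)]])
 show "0 \<le> hgt K \<nu>" using *[OF assms(3)] by simp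
 show "hgt K \<nu> \<le> r" unfolding hgt_def
 proof (rule cSUP_least)
  show "K \<noteq> {}" using assms(3) by blast
  fix k assume "k \<in> K"
  then have "\<bar>k \<bullet> \<nu>\<bar> \<le> norm k" "norm k \<le> r" using inner_unit_le[OF assms(1), of k] assms(2) by auto
  then show "- (k \<bullet> \<nu>) \<le> r" by linarith
 qed
qed

lemma bad_near_frontier:
 fixes D :: "'a::euclidean_space set"
 assumes "x \<in> bad D K" "K \<subseteq> cball 0 r"
 shows "\<exists>q\<in>frontier D. dist x q \<le> r"
proof -
 obtain k where k: "x \<in> D" "k \<in> K" "x + k \<notin> D" using assms(1) by (auto simp: bad_def)
 have "closed_segment x (x + k) \<inter> frontier D \<noteq> {}"
  by (rule connected_Int_frontier) (use k in auto)
 then obtain q where q: "q \<in> closed_segment x (x + k)" "q \<in> frontier D" by blast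
 have "dist x q \<le> dist x (x + k)" using dist_in_closed_segment[OF q(1)] by (simp add: dist_commute)
 also have "\<dots> \<le> r" using k(2) assms(2) by (auto simp: dist_norm)
 finally show ?thesis using q by blast
qed

lemma bad_borel:
 fixes D :: "'a::euclidean_space set"
 assumes "open D" "countable K"
 shows "bad D K \<in> sets borel"
proof -
 have "{x. x + k \<notin> D} \<in> sets borel" for k
 proof -
  have "(\<lambda>x. x + k) -` (- D) \<inter> space borel \<in> sets borel"
   by (rule measurable_sets[of _ borel borel]) (use assms in auto)
  then show ?thesis by (simp add: vimage_def)
 qed
 then have "D \<inter> (\<Union>k\<in>K. {x. x + k \<notin> D}) \<in> sets borel"
  using assms by (intro sets.Int sets.countable_UN') auto
 moreover have "bad D K = D \<inter> (\<Union>k\<in>K. {x. x + k \<notin> D})" by (auto simp: bad_def)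
 ultimately show ?thesis by simp
qed

context
 fixes D :: "'a::euclidean_space set" and \<epsilon> \<rho> z \<nu>
 assumes oD: "open D" and \<epsilon>: "0 < \<epsilon>" "\<epsilon> \<le> 1/4" and cone: "cone_at D \<epsilon> \<rho> z \<nu>"
begin

lemma coneD: "x \<in> ball z \<rho> ==> y \<in> ball z \<rho> ==> x \<in> D ==> \<epsilon> * norm (y - x) \<le> (y - x) \<bullet> \<nu> ==> y \<in> D"
proof -
 assume a: "x \<in> ball z \<rho>" "y \<in> ball z \<rho>" "x \<in> D" "\<epsilon> * norm (y - x) \<le> (y - x) \<bullet> \<nu>"
 have "\<forall>x\<in>ball z \<rho>. \<forall>y\<in>ball z \<rho>. x \<in> D \<longrightarrow> \<epsilon> * norm (y - x) \<le> (y - x) \<bullet> \<nu> \<longrightarrow> y \<in> D"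
  using cone unfolding cone_at_def by (rule conjunct2)
 from bspec[OF bspec[OF this a(1)] a(2)] show "y \<in> D" using a(3,4) by (rule mp[OF mp])
qed

lemma cone_norm: "norm \<nu> = 1" using cone by (simp add: cone_at_def)

lemma frontier_notin: "p \<in> frontier D ==> p \<notin> D"
 using oD by (auto simp: frontier_def interior_open)

lemma frontier_above:
 assumes p: "p \<in> frontier D" "p \<in> ball z \<rho>" and y: "y \<in> ball z \<rho>" "\<epsilon> * norm (y - p) < (y - p) \<bullet> \<nu>"
 shows "y \<in> D"
proof -
 define U where "U = ball z \<rho> \<inter> {x. 0 < (y - x) \<bullet> \<nu> - \<epsilon> * norm (y - x)}"
 have "open U" unfolding U_def by (intro open_Int open_ball open_Collect_less continuous_intros)
 moreover have "p \<in> U" using p y unfolding U_def by simp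
 moreover have "p \<in> closure D" using p(1) by (simp add: frontier_def)
 ultimately have "U \<inter> D \<noteq> {}" using open_Int_closure_eq_empty[of U D] by blast
 then obtain x where xU: "x \<in> U" "x \<in> D" by blast
 have x: "x \<in> ball z \<rho>" "x \<in> D" "\<epsilon> * norm (y - x) \<le> (y - x) \<bullet> \<nu>" using xU unfolding U_def by simp_all
 show ?thesis by (rule coneD[OF x(1) y(1) x(2,3)])
qed

lemma frontier_below:
 assumes p: "p \<in> frontier D" "p \<in> ball z \<rho>" and y: "y \<in> ball z \<rho>" "\<epsilon> * norm (y - p) \<le> (p - y) \<bullet> \<nu>"
 shows "y \<notin> D"
proof
 assume "y \<in> D"
 then have "p \<in> D" by (rule coneD[OF y(1) p(2)]) (use y(2) in \<open>simp add: norm_minus_commute\<close>)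
 then show False using frontier_notin[OF p(1)] by blast
qed

text \<open>A steeper chord would place one of its endpoints in the open set \<open>D\<close>.\<close>
lemma frontier_lipschitz:
 assumes p: "p \<in> frontier D" "p \<in> ball z \<rho>" and q: "q \<in> frontier D" "q \<in> ball z \<rho>"
 shows "\<bar>(q - p) \<bullet> \<nu>\<bar> \<le> \<epsilon> * norm (q - p)"
  and "dist p q \<le> (1 / sqrt (1 - \<epsilon>\<^sup>2)) * dist (perp \<nu> p) (perp \<nu> q)"
proof -
 have a: "(q - p) \<bullet> \<nu> \<le> \<epsilon> * norm (q - p)"
  using frontier_above[OF p q(2)] frontier_notin[OF q(1)] by (meson not_le)
 have b: "(p - q) \<bullet> \<nu> \<le> \<epsilon> * norm (q - p)"
  using frontier_above[OF q p(2)] frontier_notin[OF p(1)] unfolding norm_minus_commute[of q p] by (meson not_le)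
 show *: "\<bar>(q - p) \<bullet> \<nu>\<bar> \<le> \<epsilon> * norm (q - p)" using a b by (simp add: inner_diff_left abs_le_iff)
 have e1: "\<epsilon>\<^sup>2 < 1"
 proof -
  have "\<epsilon> < 1" using \<epsilon> by linarith
  then show ?thesis using \<epsilon> by (simp add: abs_square_less_1)
 qed
 have "((q - p) \<bullet> \<nu>)\<^sup>2 \<le> (\<epsilon> * norm (q - p))\<^sup>2" using * by (metis abs_ge_zero power2_abs power_mono)
 then have "(1 - \<epsilon>\<^sup>2) * (norm (q - p))\<^sup>2 \<le> (norm (perp \<nu> (q - p)))\<^sup>2"
  using norm_perp[OF cone_norm, of "q - p"] by (simp add: power_mult_distrib algebra_simps)
 then have "sqrt ((1 - \<epsilon>\<^sup>2) * (norm (q - p))\<^sup>2) \<le> norm (perp \<nu> (q - p))"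
  by (rule real_le_lsqrt[OF norm_ge_zero])
 moreover have "dist p q = norm (q - p)" by (simp add: dist_norm norm_minus_commute)
 moreover have "dist (perp \<nu> p) (perp \<nu> q) = norm (perp \<nu> (q - p))"
  by (simp add: dist_norm norm_minus_commute linear_diff[OF linear_perp])
 ultimately have "sqrt (1 - \<epsilon>\<^sup>2) * dist p q \<le> dist (perp \<nu> p) (perp \<nu> q)"
  by (simp add: real_sqrt_mult)
 then show "dist p q \<le> (1 / sqrt (1 - \<epsilon>\<^sup>2)) * dist (perp \<nu> p) (perp \<nu> q)"
  using e1 by (simp add: field_simps)
qed

lemma inj_perp_frontier: "inj_on (perp \<nu>) (frontier D \<inter> ball z \<rho>)"
proof (rule inj_onI)
 fix p q assume "p \<in> frontier D \<inter> ball z \<rho>" "q \<in> frontier D \<inter> ball z \<rho>" "perp \<nu> p = perp \<nu> q"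
 then show "p = q" using frontier_lipschitz(2)[of p q] by simp
qed

text \<open>Far enough above \<open>x\<close> the line is in \<open>D\<close>, far enough below it is outside, so a connected segment crosses the boundary.\<close>
lemma line_meets_frontier:
 assumes q: "q \<in> frontier D" "q \<in> ball z (\<rho>/4)" and x: "dist x q \<le> r" and r: "0 < r" "r \<le> \<rho>/16"
 shows "\<exists>s. \<bar>s\<bar> \<le> 2 * r \<and> x + s *\<^sub>R \<nu> \<in> frontier D"
proof -
 have qb: "q \<in> ball z \<rho>" using q(2) r by simp
 have nn: "\<nu> \<bullet> \<nu> = 1" using cone_norm by (simp add: norm_eq_1)
 have xq: "norm (x - q) \<le> r" using x by (simp add: dist_norm)
 have inq: "\<bar>(x - q) \<bullet> \<nu>\<bar> \<le> r" using inner_unit_le[OF cone_norm, of "x - q"] xq by linarith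
 have near: "x + s *\<^sub>R \<nu> \<in> ball z \<rho>" "norm (x + s *\<^sub>R \<nu> - q) \<le> 3 * r" if "\<bar>s\<bar> \<le> 2 * r" for s
 proof -
  have "norm (x + s *\<^sub>R \<nu> - q) = norm ((x - q) + s *\<^sub>R \<nu>)" by (simp add: algebra_simps)
  also have "\<dots> \<le> norm (x - q) + \<bar>s\<bar>" using norm_triangle_ineq[of "x - q" "s *\<^sub>R \<nu>"] cone_norm by simp
  finally show n: "norm (x + s *\<^sub>R \<nu> - q) \<le> 3 * r" using xq that by linarith
  then have "dist q (x + s *\<^sub>R \<nu>) \<le> 3 * r" by (simp add: dist_norm norm_minus_commute)
  then have "dist z (x + s *\<^sub>R \<nu>) < \<rho>"
   using dist_triangle[of z "x + s *\<^sub>R \<nu>" q] q(2) r by simp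
  then show "x + s *\<^sub>R \<nu> \<in> ball z \<rho>" by simp
 qed
 have up: "x + (2 * r) *\<^sub>R \<nu> \<in> D"
 proof (rule frontier_above[OF q(1) qb])
  show "x + (2 * r) *\<^sub>R \<nu> \<in> ball z \<rho>" using near(1)[of "2 * r"] r by simp
  have "norm (x + (2 * r) *\<^sub>R \<nu> - q) \<le> 3 * r" using near(2)[of "2 * r"] r by simp
  then have "\<epsilon> * norm (x + (2 * r) *\<^sub>R \<nu> - q) \<le> 1/4 * (3 * r)" using \<epsilon> by (intro mult_mono) auto
  moreover have "(x + (2 * r) *\<^sub>R \<nu> - q) \<bullet> \<nu> = (x - q) \<bullet> \<nu> + 2 * r"
   by (simp add: inner_diff_left inner_add_left nn)
  ultimately show "\<epsilon> * norm (x + (2 * r) *\<^sub>R \<nu> - q) < (x + (2 * r) *\<^sub>R \<nu> - q) \<bullet> \<nu>" using inq r by linarith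
 qed
 have dn: "x + (- (2 * r)) *\<^sub>R \<nu> \<notin> D"
 proof (rule frontier_below[OF q(1) qb])
  show "x + (- (2 * r)) *\<^sub>R \<nu> \<in> ball z \<rho>" using near(1)[of "- (2 * r)"] r by simp
  have "norm (x + (- (2 * r)) *\<^sub>R \<nu> - q) \<le> 3 * r" using near(2)[of "- (2 * r)"] r by simp
  then have "\<epsilon> * norm (x + (- (2 * r)) *\<^sub>R \<nu> - q) \<le> 1/4 * (3 * r)" using \<epsilon> by (intro mult_mono) auto
  moreover have "(q - (x + (- (2 * r)) *\<^sub>R \<nu>)) \<bullet> \<nu> = 2 * r - (x - q) \<bullet> \<nu>"
   by (simp add: inner_diff_left inner_add_left nn)
  ultimately show "\<epsilon> * norm (x + (- (2 * r)) *\<^sub>R \<nu> - q) \<le> (q - (x + (- (2 * r)) *\<^sub>R \<nu>)) \<bullet> \<nu>" using inq r by linarith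
 qed
 have "closed_segment (x + (2 * r) *\<^sub>R \<nu>) (x + (- (2 * r)) *\<^sub>R \<nu>) \<inter> frontier D \<noteq> {}"
  by (rule connected_Int_frontier) (use up dn in auto)
 then obtain p where p: "p \<in> frontier D" "p \<in> closed_segment (x + (2 * r) *\<^sub>R \<nu>) (x + (- (2 * r)) *\<^sub>R \<nu>)" by blast
 obtain u where u: "0 \<le> u" "u \<le> 1" "p = (1 - u) *\<^sub>R (x + (2 * r) *\<^sub>R \<nu>) + u *\<^sub>R (x + (- (2 * r)) *\<^sub>R \<nu>)"
  using p(2) unfolding closed_segment_def by blast
 have "p = ((1 - u) *\<^sub>R x + u *\<^sub>R x) + ((1 - u) * (2 * r) + u * (- (2 * r))) *\<^sub>R \<nu>"
  unfolding u(3) scaleR_add_right scaleR_left_distrib scaleR_scaleR by (simp only: ac_simps)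
 moreover have "(1 - u) * (2 * r) + u * (- (2 * r)) = (1 - 2 * u) * (2 * r)" by (simp add: algebra_simps)
 moreover have "(1 - u) *\<^sub>R x + u *\<^sub>R x = x" by (simp flip: scaleR_left_distrib)
 ultimately have "p = x + ((1 - 2 * u) * (2 * r)) *\<^sub>R \<nu>" by (simp only:)
 moreover have "\<bar>(1 - 2 * u) * (2 * r)\<bar> \<le> 1 * (2 * r)"
  unfolding abs_mult using u r by (intro mult_mono) auto
 ultimately show ?thesis using p(1) by (intro exI[of _ "(1 - 2 * u) * (2 * r)"]) simp
qed

text \<open>Move from \<open>x\<close> along the normal line down to the boundary point \<open>p\<close>.  If the height of \<open>x\<close> over \<open>p\<close> exceeded the reach of \<open>K\<close> by more than the error of flatness, then \<open>x + k\<close> would be in the cone over \<open>p\<close> for every \<open>k\<close>.\<close>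
lemma bad_subset_tube:
 assumes K: "K \<subseteq> cball 0 r" "0 \<in> K" and x: "x \<in> bad D K"
  and q: "q \<in> frontier D" "q \<in> ball z (\<rho>/4)" "dist x q \<le> r" and r: "0 < r" "r \<le> \<rho>/16"
 shows "\<exists>p\<in>frontier D. \<exists>s. dist p q \<le> 3 * r \<and> 0 \<le> s \<and> s \<le> hgt K \<nu> + 3 * \<epsilon> * r \<and> x = p + s *\<^sub>R \<nu>"
proof -
 obtain s0 where s0: "\<bar>s0\<bar> \<le> 2 * r" "x + s0 *\<^sub>R \<nu> \<in> frontier D"
  using line_meets_frontier[OF q r] by blast
 define p where "p = x + s0 *\<^sub>R \<nu>"
 define s where "s = - s0"
 have nn: "\<nu> \<bullet> \<nu> = 1" using cone_norm by (simp add: norm_eq_1)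
 have xp: "x = p + s *\<^sub>R \<nu>" by (simp add: p_def s_def)
 have pF: "p \<in> frontier D" using s0 by (simp add: p_def)
 have xps: "norm (x - p) = \<bar>s\<bar>" using cone_norm by (simp add: xp)
 have s2: "\<bar>s\<bar> \<le> 2 * r" using s0 by (simp add: s_def)
 have pq: "dist p q \<le> 3 * r"
  using dist_triangle[of p q x] xps s2 q(3) by (simp add: dist_norm norm_minus_commute)
 have inb: "y \<in> ball z \<rho>" if "dist y q \<le> 4 * r" for y
  using dist_triangle[of z y q] that q(2) r by (simp add: dist_commute)
 have pb: "p \<in> ball z \<rho>" using inb[of p] pq r by simp
 have xb: "x \<in> ball z \<rho>" using inb[of x] q(3) r by simp
 obtain k where k: "x \<in> D" "k \<in> K" "x + k \<notin> D" using x by (auto simp: bad_def)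
 have nk: "norm k \<le> r" using k(2) K(1) by auto
 have s_nonneg: "0 \<le> s"
 proof (rule ccontr)
  assume "\<not> 0 \<le> s"
  then have "\<epsilon> * norm (x - p) \<le> (p - x) \<bullet> \<nu>" using \<epsilon> unfolding xps by (simp add: xp nn mult_le_cancel_right2)
  then show False using frontier_below[OF pF pb xb] k(1) by blast
 qed
 have xkb: "x + k \<in> ball z \<rho>"
  by (rule inb) (use norm_triangle_ineq[of "x - q" k] q(3) nk r in \<open>simp add: dist_norm algebra_simps\<close>)
 have "(x + k - p) \<bullet> \<nu> \<le> \<epsilon> * norm (x + k - p)"
  using frontier_above[OF pF pb xkb] k(3) by (meson not_le)
 also have "\<dots> \<le> \<epsilon> * (3 * r)"
 proof (rule mult_left_mono)
  have "norm (x + k - p) \<le> norm (x - p) + norm k" using norm_triangle_ineq[of "x - p" k] by (simp add: algebra_simps)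
  then show "norm (x + k - p) \<le> 3 * r" using xps s2 nk by linarith
 qed (use \<epsilon> in simp)
 finally have "s + k \<bullet> \<nu> \<le> 3 * \<epsilon> * r" by (simp add: xp inner_add_left inner_diff_left nn)
 then have "s \<le> hgt K \<nu> + 3 * \<epsilon> * r" using hgt_bounds(3)[OF cone_norm K k(2)] by linarith
 then show ?thesis using pF pq s_nonneg xp by blast
qed

text \<open>The converse: an element of \<open>K\<close> that almost attains the reach carries a point of smaller height below the boundary.\<close>
lemma tube_subset_bad:
 assumes K: "K \<subseteq> cball 0 r" "0 \<in> K" and p: "p \<in> frontier D" "p \<in> ball z (\<rho>/4)" and r: "0 < r" "r \<le> \<rho>/16"
  and s: "0 < s" "s < hgt K \<nu> - 3 * \<epsilon> * r"
 shows "p + s *\<^sub>R \<nu> \<in> bad D K"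
proof -
 have nn: "\<nu> \<bullet> \<nu> = 1" using cone_norm by (simp add: norm_eq_1)
 have "hgt K \<nu> \<le> r" by (rule hgt_bounds(2)[OF cone_norm K])
 then have sr: "s < r" using s \<epsilon> r mult_nonneg_nonneg[of \<epsilon> r] by linarith
 have inb: "y \<in> ball z \<rho>" if "dist y p \<le> 4 * r" for y
  using dist_triangle[of z y p] that p(2) r by (simp add: dist_commute)
 have pb: "p \<in> ball z \<rho>" using inb[of p] r by simp
 have "p + s *\<^sub>R \<nu> \<in> D"
 proof (rule frontier_above[OF p(1) pb])
  show "p + s *\<^sub>R \<nu> \<in> ball z \<rho>" by (rule inb) (use s sr r cone_norm in \<open>simp add: dist_norm\<close>)
  show "\<epsilon> * norm (p + s *\<^sub>R \<nu> - p) < (p + s *\<^sub>R \<nu> - p) \<bullet> \<nu>" using s \<epsilon> cone_norm by (simp add: nn)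
 qed
 moreover obtain k where k: "k \<in> K" "s + 3 * \<epsilon> * r < - (k \<bullet> \<nu>)"
 proof -
  have "s + 3 * \<epsilon> * r < (SUP k\<in>K. - (k \<bullet> \<nu>))" using s unfolding hgt_def by simp
  moreover have "K \<noteq> {}" using K(2) by blast
  ultimately show ?thesis using less_cSUP_iff[OF _ bdd_above_hgt[OF cone_norm K(1)]] that by blast
 qed
 have "p + s *\<^sub>R \<nu> + k \<notin> D"
 proof (rule frontier_below[OF p(1) pb])
  have nk: "norm k \<le> r" using k(1) K(1) by auto
  have n: "norm (p + s *\<^sub>R \<nu> + k - p) \<le> 2 * r"
  proof -
   have "norm (p + s *\<^sub>R \<nu> + k - p) \<le> norm (s *\<^sub>R \<nu>) + norm k" using norm_triangle_ineq[of "s *\<^sub>R \<nu>" k] by simp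
   then show ?thesis using nk sr s cone_norm by simp
  qed
  show "p + s *\<^sub>R \<nu> + k \<in> ball z \<rho>" by (rule inb) (use n r in \<open>simp add: dist_norm\<close>)
  have "\<epsilon> * norm (p + s *\<^sub>R \<nu> + k - p) \<le> \<epsilon> * (2 * r)" using n \<epsilon> by (intro mult_left_mono) auto
  moreover have "(p - (p + s *\<^sub>R \<nu> + k)) \<bullet> \<nu> = - s - k \<bullet> \<nu>" by (simp add: inner_diff_left inner_add_left nn)
  moreover have "0 \<le> \<epsilon> * r" using \<epsilon> r by simp
  ultimately show "\<epsilon> * norm (p + s *\<^sub>R \<nu> + k - p) \<le> (p - (p + s *\<^sub>R \<nu> + k)) \<bullet> \<nu>" using k(2) by linarith
 qed
 ultimately show ?thesis using k(1) unfolding bad_def by blast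
qed

end

section \<open>Decomposition of the boundary into charts\<close>

lemma bounded_slab:
 assumes n: "norm \<nu> = 1" and W: "bounded W"
 shows "bounded (slab \<nu> W)"
proof -
 obtain M where M: "\<And>x. x \<in> W ==> norm x \<le> M" using W bounded_iff by blast
 have "norm y \<le> M + 1" if y: "y \<in> slab \<nu> W" for y
 proof -
  obtain p where p: "p \<in> W" "perp \<nu> y = perp \<nu> p" and s: "0 \<le> y \<bullet> \<nu>" "y \<bullet> \<nu> \<le> 1" using y unfolding slab_def by auto
  have "norm y \<le> norm (perp \<nu> y) + norm ((y \<bullet> \<nu>) *\<^sub>R \<nu>)"
   using norm_triangle_ineq[of "perp \<nu> y" "(y \<bullet> \<nu>) *\<^sub>R \<nu>"] by (simp add: perp_def)
  also have "\<dots> \<le> norm p + 1" using norm_perp_le[OF n, of p] s n by (simp add: p(2))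
  finally show ?thesis using M[OF p(1)] by simp
 qed
 then show ?thesis using bounded_iff by blast
qed

lemma area_finite: "norm \<nu> = 1 ==> bounded W ==> area \<nu> W < \<infinity>"
 unfolding area_def using emeasure_bounded_finite[OF bounded_slab] by simp

lemma slab_UN_compact_borel:
 fixes C :: "nat => 'a::euclidean_space set"
 assumes "norm \<nu> = 1" "\<And>n. compact (C n)"
 shows "slab \<nu> (\<Union>n. C n) \<in> sets borel"
proof -
 have "slab \<nu> (C n) \<in> sets borel" for n
  using compact_slab[OF assms] by (simp add: borel_closed compact_imp_closed)
 then show ?thesis unfolding slab_Union by blast
qed

lemma compact_Int_open_UN:
 fixes G O' :: "'a::euclidean_space set"
 assumes "compact G" "open O'"
 obtains C where "\<And>n::nat. compact (C n)" "G \<inter> O' = (\<Union>n. C n)"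
proof -
 obtain C where C: "\<And>n::nat. compact (C n)" "\<Union>(range C) = O'"
  using open_Union_compact_subsets[OF assms(2)] by metis
 show ?thesis
 proof (rule that)
  show "compact (G \<inter> C n)" for n using assms(1) C(1) by (intro compact_Int)
  show "G \<inter> O' = (\<Union>n. G \<inter> C n)" using C(2) by blast
 qed
qed

lemma area_tendsto_increasing:
 fixes C :: "nat => 'a::euclidean_space set"
 assumes n: "norm \<nu> = 1" and C: "\<And>n. compact (C n)" "incseq C"
 shows "(\<lambda>n. area \<nu> (C n)) \<longlonglongrightarrow> area \<nu> (\<Union>n. C n)"
 unfolding area_def slab_Union
proof (rule Lim_emeasure_incseq)
 show "range (\<lambda>n. slab \<nu> (C n)) \<subseteq> sets lborel"
  using compact_slab[OF n C(1)] by (auto simp: borel_closed compact_imp_closed)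
 show "incseq (\<lambda>n. slab \<nu> (C n))" using C(2) slab_mono unfolding incseq_def by blast
qed

lemma area_tendsto_decreasing:
 fixes V :: "nat => 'a::euclidean_space set"
 assumes n: "norm \<nu> = 1" and V: "\<And>n. slab \<nu> (V n) \<in> sets borel" "decseq V" "bounded (V 0)"
  and inj: "inj_on (perp \<nu>) (V 0)"
 shows "(\<lambda>n. area \<nu> (V n)) \<longlonglongrightarrow> area \<nu> (\<Inter>n. V n)"
proof -
 have eq: "slab \<nu> (\<Inter>n. V n) = (\<Inter>n. slab \<nu> (V n))"
 proof (intro equalityI subsetI)
  fix y assume y: "y \<in> (\<Inter>n. slab \<nu> (V n))"
  then have "\<forall>n. \<exists>p\<in>V n. perp \<nu> y = perp \<nu> p" unfolding slab_def by auto
  then obtain p where p: "\<And>n. p n \<in> V n" "\<And>n. perp \<nu> y = perp \<nu> (p n)" by metis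
  have V0: "V n \<subseteq> V 0" for n using V(2) by (simp add: decseqD)
  have "p n = p 0" for n using inj p V0 by (metis inj_onD subsetD)
  then have "p 0 \<in> (\<Inter>n. V n)" using p(1) by (metis INT_I)
  then show "y \<in> slab \<nu> (\<Inter>n. V n)" using y p(2)[of 0] unfolding slab_def by auto
 qed (auto simp: slab_def)
 show ?thesis
  unfolding area_def eq
 proof (rule Lim_emeasure_decseq)
  show "range (\<lambda>n. slab \<nu> (V n)) \<subseteq> sets lborel" using V(1) by auto
  show "decseq (\<lambda>n. slab \<nu> (V n))" using V(2) slab_mono unfolding decseq_def by blast
  have "V n \<subseteq> V 0" for n using V(2) by (simp add: decseqD)
  then have "bounded (V n)" for n using V(3) bounded_subset by blast
  then show "emeasure lborel (slab \<nu> (V n)) \<noteq> \<infinity>" for n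
   using area_finite[OF n] unfolding area_def by (metis less_irrefl)
 qed
qed

definition chart_cover :: "'a::euclidean_space set => real => real => nat => (nat => 'a) => (nat => 'a) => bool" where
 "chart_cover D \<epsilon> \<rho> N z \<nu> \<longleftrightarrow> 0 < \<rho> \<and> (\<forall>i<N. cone_at D \<epsilon> \<rho> (z i) (\<nu> i)) \<and> frontier D \<subseteq> (\<Union>i<N. ball (z i) (\<rho>/8))"

lemma chart_cover_exists:
 fixes D :: "'a::euclidean_space set"
 assumes "bounded D" "flat_boundary D" "0 < \<epsilon>"
 obtains \<rho> N z \<nu> where "chart_cover D \<epsilon> \<rho> N z \<nu>"
proof -
 obtain \<rho> where \<rho>: "0 < \<rho>" "\<forall>z\<in>frontier D. \<exists>\<nu>. cone_at D \<epsilon> \<rho> z \<nu>"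
  using assms(2,3) unfolding flat_boundary_def by blast
 have cF: "compact (frontier D)" using assms(1) by (rule compact_frontier_bounded)
 obtain F where F: "F \<subseteq> frontier D" "finite F" "frontier D \<subseteq> (\<Union>z\<in>F. ball z (\<rho>/8))"
 proof (rule compactE_image[OF cF, of "frontier D" "\<lambda>z. ball z (\<rho>/8)"])
  show "frontier D \<subseteq> (\<Union>z\<in>frontier D. ball z (\<rho>/8))" using \<rho>(1) by force
 qed auto
 obtain z and N :: nat where z: "F = z ` {i. i < N}" using finite_imp_nat_seg_image_inj_on[OF F(2)] by metis
 define \<nu> where "\<nu> i = (SOME v. cone_at D \<epsilon> \<rho> (z i) v)" for i
 have "cone_at D \<epsilon> \<rho> (z i) (\<nu> i)" if "i < N" for i
 proof -
  have "z i \<in> frontier D" using that z F(1) by blast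
  then have "\<exists>v. cone_at D \<epsilon> \<rho> (z i) v" using \<rho>(2) by blast
  then show ?thesis unfolding \<nu>_def by (rule someI_ex)
 qed
 moreover have "frontier D \<subseteq> (\<Union>i<N. ball (z i) (\<rho>/8))" using F(3) z by auto
 ultimately have "chart_cover D \<epsilon> \<rho> N z \<nu>" using \<rho>(1) by (simp add: chart_cover_def)
 then show ?thesis by (rule that)
qed

text \<open>A disjoint partition of the boundary.  The pieces are approximated from inside by compact sets, which have positive distance from each other, and from outside by relatively open sets, which contain neighbourhoods of the pieces.\<close>
definition piece :: "'a::euclidean_space set => real => (nat => 'a) => nat => 'a set" where
 "piece D \<rho> z i = {p \<in> frontier D. dist (z i) p < \<rho>/8 \<and> (\<forall>j<i. \<rho>/8 \<le> dist (z j) p)}"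

definition piece_inner :: "'a::euclidean_space set => real => (nat => 'a) => nat => nat => 'a set" where
 "piece_inner D \<rho> z i n = {p \<in> frontier D. dist (z i) p \<le> \<rho>/8 - 1 / real (Suc n) \<and> (\<forall>j<i. \<rho>/8 \<le> dist (z j) p)}"

definition piece_outer :: "real => (nat => 'a::euclidean_space) => nat => nat => 'a set" where
 "piece_outer \<rho> z i n = {p. dist (z i) p < \<rho>/8 \<and> (\<forall>j<i. \<rho>/8 - 1 / real (Suc n) < dist (z j) p)}"

lemma one_over_Suc_antimono: "m \<le> n ==> 1 / real (Suc n) \<le> 1 / real (Suc m)"
 by (simp add: field_simps)

lemma open_piece_outer: "open (piece_outer \<rho> z i n)"
proof -
 have "piece_outer \<rho> z i n = ball (z i) (\<rho>/8) \<inter> (\<Inter>j\<in>{..<i}. - cball (z j) (\<rho>/8 - 1 / real (Suc n)))"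
  by (auto simp: piece_outer_def Ball_def not_le)
 also have "open \<dots>" by (intro open_Int open_INT) (auto simp: open_Compl)
 finally show ?thesis .
qed

lemma compact_piece_inner:
 assumes "bounded D"
 shows "compact (piece_inner D \<rho> z i n)"
proof -
 have "piece_inner D \<rho> z i n = frontier D \<inter> (cball (z i) (\<rho>/8 - 1 / real (Suc n)) \<inter> (\<Inter>j\<in>{..<i}. - ball (z j) (\<rho>/8)))"
  by (auto simp: piece_inner_def Ball_def not_less)
 also have "compact \<dots>"
  using assms by (intro compact_Int_closed compact_frontier_bounded closed_Int closed_INT) auto
 finally show ?thesis .
qed

lemma piece_inner_incseq: "incseq (piece_inner D \<rho> z i)"
 unfolding incseq_def piece_inner_def using one_over_Suc_antimono by (force intro: order_trans)

lemma piece_outer_decseq: "decseq (piece_outer \<rho> z i)"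
 unfolding decseq_def piece_outer_def using one_over_Suc_antimono by (force intro: le_less_trans)

lemma piece_eq_UN: "piece D \<rho> z i = (\<Union>n. piece_inner D \<rho> z i n)"
proof (intro equalityI subsetI)
 fix p assume p: "p \<in> piece D \<rho> z i"
 then have "0 < \<rho>/8 - dist (z i) p" by (simp add: piece_def)
 then obtain n where "1 / real (Suc n) < \<rho>/8 - dist (z i) p" by (rule nat_approx_posE)
 then have "p \<in> piece_inner D \<rho> z i n" using p by (simp add: piece_def piece_inner_def)
 then show "p \<in> (\<Union>n. piece_inner D \<rho> z i n)" by blast
next
 fix p assume "p \<in> (\<Union>n. piece_inner D \<rho> z i n)"
 then obtain n where n: "p \<in> piece_inner D \<rho> z i n" by blast
 have "0 < 1 / real (Suc n)" by simp
 moreover have "dist (z i) p \<le> \<rho>/8 - 1 / real (Suc n)" using n unfolding piece_inner_def by blast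
 ultimately have "dist (z i) p < \<rho>/8" by linarith
 then show "p \<in> piece D \<rho> z i" using n unfolding piece_inner_def piece_def by blast
qed

lemma piece_eq_INT: "piece D \<rho> z i = (\<Inter>n. frontier D \<inter> piece_outer \<rho> z i n)"
proof (intro equalityI subsetI)
 fix p assume p: "p \<in> piece D \<rho> z i"
 have "\<rho>/8 - 1 / real (Suc n) < dist (z j) p" if "j < i" for n j
 proof -
  have "0 < 1 / real (Suc n)" by simp
  moreover have "\<rho>/8 \<le> dist (z j) p" using p that unfolding piece_def by blast
  ultimately show ?thesis by linarith
 qed
 then show "p \<in> (\<Inter>n. frontier D \<inter> piece_outer \<rho> z i n)" using p by (auto simp: piece_def piece_outer_def)
next
 fix p assume p: "p \<in> (\<Inter>n. frontier D \<inter> piece_outer \<rho> z i n)"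
 have "\<rho>/8 \<le> dist (z j) p" if j: "j < i" for j
 proof (rule ccontr)
  assume "\<not> ?thesis"
  then have "0 < \<rho>/8 - dist (z j) p" by simp
  then obtain n where "1 / real (Suc n) < \<rho>/8 - dist (z j) p" by (rule nat_approx_posE)
  moreover have "p \<in> piece_outer \<rho> z i n" using p by blast
  then have "\<rho>/8 - 1 / real (Suc n) < dist (z j) p" using j unfolding piece_outer_def by blast
  ultimately show False by linarith
 qed
 then show "p \<in> piece D \<rho> z i" using p by (auto simp: piece_def piece_outer_def)
qed

lemma frontier_eq_pieces:
 assumes "chart_cover D \<epsilon> \<rho> N z \<nu>"
 shows "frontier D = (\<Union>i<N. piece D \<rho> z i)"
proof (intro equalityI subsetI)
 fix p assume p: "p \<in> frontier D"
 have "frontier D \<subseteq> (\<Union>i<N. ball (z i) (\<rho>/8))" using assms unfolding chart_cover_def by blast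
 then obtain i where "i < N" "p \<in> ball (z i) (\<rho>/8)" using p by blast
 then have ex: "\<exists>i. i < N \<and> dist (z i) p < \<rho>/8" by (metis mem_ball)
 define i where "i = (LEAST i. i < N \<and> dist (z i) p < \<rho>/8)"
 have i: "i < N" "dist (z i) p < \<rho>/8" using LeastI_ex[OF ex] by (auto simp: i_def)
 have "\<rho>/8 \<le> dist (z j) p" if "j < i" for j
  using not_less_Least[of j "\<lambda>i. i < N \<and> dist (z i) p < \<rho>/8"] that i(1) unfolding i_def by (meson less_trans not_le)
 then have "p \<in> piece D \<rho> z i" using p i by (simp add: piece_def)
 then show "p \<in> (\<Union>i<N. piece D \<rho> z i)" using i by blast
qed (auto simp: piece_def)

lemma piece_disjoint: "i < j ==> piece D \<rho> z i \<inter> piece D \<rho> z j = {}"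
 unfolding piece_def by force

context
 fixes D :: "(real^'n) set" and \<epsilon> \<rho> N z \<nu>
 assumes oD: "open D" and bD: "bounded D" and dim: "CARD('n) \<ge> 2"
  and \<epsilon>: "0 < \<epsilon>" "\<epsilon> \<le> 1/4" and cc: "chart_cover D \<epsilon> \<rho> N z \<nu>"
begin

abbreviation (input) "chart \<equiv> piece D \<rho> z"

lemma chart_cone: "i < N ==> cone_at D \<epsilon> \<rho> (z i) (\<nu> i)" and rho_pos: "0 < \<rho>"
 using cc by (simp_all add: chart_cover_def)

lemma chart_norm: "i < N ==> norm (\<nu> i) = 1"
 using chart_cone unfolding cone_at_def by blast

lemma outer_in_ball: "frontier D \<inter> piece_outer \<rho> z i n \<subseteq> frontier D \<inter> ball (z i) \<rho>"
 using rho_pos by (auto simp: piece_outer_def)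

lemma piece_in_ball: "chart i \<subseteq> frontier D \<inter> ball (z i) \<rho>"
 using rho_pos by (auto simp: piece_def)

lemma slab_piece_borel:
 assumes i: "i < N"
 shows "slab (\<nu> i) (chart i) \<in> sets borel"
 unfolding piece_eq_UN by (rule slab_UN_compact_borel[OF chart_norm[OF i] compact_piece_inner[OF bD]])

lemma slab_outer_borel:
 assumes i: "i < N"
 shows "slab (\<nu> i) (frontier D \<inter> piece_outer \<rho> z i n) \<in> sets borel"
proof -
 obtain C where C: "\<And>n::nat. compact (C n)" "frontier D \<inter> piece_outer \<rho> z i n = (\<Union>n. C n)"
  using compact_Int_open_UN[OF compact_frontier_bounded[OF bD] open_piece_outer] by blast
 show ?thesis unfolding C(2) by (rule slab_UN_compact_borel[OF chart_norm[OF i] C(1)])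
qed

lemma bounded_outer: "bounded (frontier D \<inter> piece_outer \<rho> z i n)"
 using outer_in_ball bounded_subset[OF bounded_ball] by (meson Int_lower2 order_trans)

lemma bounded_piece: "bounded (chart i)"
 using piece_in_ball bounded_subset[OF bounded_ball] by (meson Int_lower2 order_trans)

lemma inner_tendsto:
 assumes i: "i < N"
 shows "(\<lambda>n. area (\<nu> i) (piece_inner D \<rho> z i n)) \<longlonglongrightarrow> area (\<nu> i) (chart i)"
 unfolding piece_eq_UN
 by (rule area_tendsto_increasing[OF chart_norm[OF i] compact_piece_inner[OF bD] piece_inner_incseq])

lemma outer_tendsto:
 assumes i: "i < N"
 shows "(\<lambda>n. area (\<nu> i) (frontier D \<inter> piece_outer \<rho> z i n)) \<longlonglongrightarrow> area (\<nu> i) (chart i)"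
 unfolding piece_eq_INT
proof (rule area_tendsto_decreasing[OF chart_norm[OF i] slab_outer_borel[OF i] _ bounded_outer])
 show "decseq (\<lambda>n. frontier D \<inter> piece_outer \<rho> z i n)"
  using piece_outer_decseq[of \<rho> z i] unfolding decseq_def by blast
 show "inj_on (perp (\<nu> i)) (frontier D \<inter> piece_outer \<rho> z i 0)"
  by (rule inj_on_subset[OF inj_perp_frontier[OF oD \<epsilon> chart_cone[OF i]] outer_in_ball])
qed

lemma hausdorff_le_pieces:
 "hausdorff_measure (CARD('n) - 1) (frontier D)
  \<le> ennreal ((1 / sqrt (1 - \<epsilon>\<^sup>2)) ^ (CARD('n) - 1)) * (\<Sum>i<N. area (\<nu> i) (chart i))"
proof -
 let ?L = "1 / sqrt (1 - \<epsilon>\<^sup>2)"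
 have "\<epsilon>\<^sup>2 < 1" using \<epsilon> by (simp add: abs_square_less_1)
 then have L: "0 < ?L" by simp
 have "hausdorff_measure (CARD('n) - 1) (frontier D) \<le> (\<Sum>i<N. hausdorff_measure (CARD('n) - 1) (chart i))"
  unfolding frontier_eq_pieces[OF cc] by (rule hausdorff_measure_UN_finite) simp
 also have "\<dots> \<le> (\<Sum>i<N. ennreal (?L ^ (CARD('n) - 1)) * area (\<nu> i) (chart i))"
 proof (rule sum_mono)
  fix i assume "i \<in> {..<N}"
  then have i: "i < N" by simp
  show "hausdorff_measure (CARD('n) - 1) (chart i) \<le> ennreal (?L ^ (CARD('n) - 1)) * area (\<nu> i) (chart i)"
  proof (rule hausdorff_measure_graph_le_area[OF chart_norm[OF i] dim bounded_piece slab_piece_borel[OF i] L])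
   fix p q assume "p \<in> chart i" "q \<in> chart i"
   then show "dist p q \<le> ?L * dist (perp (\<nu> i) p) (perp (\<nu> i) q)"
    using frontier_lipschitz(2)[OF oD \<epsilon> chart_cone[OF i]] piece_in_ball by blast
  qed
 qed
 finally show ?thesis by (simp add: sum_distrib_left)
qed

text \<open>Compact inner approximations of distinct pieces are separated, so their Hausdorff measures add.\<close>
lemma pieces_le_hausdorff:
 "(\<Sum>i<N. area (\<nu> i) (chart i)) \<le> hausdorff_measure (CARD('n) - 1) (frontier D)"
proof (rule LIMSEQ_le_const2)
 show "(\<lambda>n. \<Sum>i<N. area (\<nu> i) (piece_inner D \<rho> z i n)) \<longlonglongrightarrow> (\<Sum>i<N. area (\<nu> i) (chart i))"
  by (intro tendsto_sum inner_tendsto) simp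
 have "(\<Sum>i<N. area (\<nu> i) (piece_inner D \<rho> z i n)) \<le> hausdorff_measure (CARD('n) - 1) (frontier D)" for n
 proof -
  have sub: "piece_inner D \<rho> z i n \<subseteq> chart i" for i unfolding piece_eq_UN by blast
  have "(\<Sum>i<N. area (\<nu> i) (piece_inner D \<rho> z i n)) \<le> (\<Sum>i<N. hausdorff_measure (CARD('n) - 1) (piece_inner D \<rho> z i n))"
   by (intro sum_mono area_le_hausdorff_measure chart_norm compact_piece_inner bD) simp
  also have "\<dots> \<le> hausdorff_measure (CARD('n) - 1) (\<Union>i<N. piece_inner D \<rho> z i n)"
  proof (rule hausdorff_measure_disjoint_compacts)
   fix i j :: nat assume "i \<noteq> j"
   then have "chart i \<inter> chart j = {}" using piece_disjoint[of i j D] piece_disjoint[of j i D] by (metis inf_commute nat_neq_iff)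
   then show "piece_inner D \<rho> z i n \<inter> piece_inner D \<rho> z j n = {}" using sub by blast
  qed (auto intro: compact_piece_inner bD)
  also have "\<dots> \<le> hausdorff_measure (CARD('n) - 1) (frontier D)"
   by (rule hausdorff_measure_mono) (auto simp: piece_inner_def)
  finally show ?thesis .
 qed
 then show "\<exists>n0. \<forall>n\<ge>n0. (\<Sum>i<N. area (\<nu> i) (piece_inner D \<rho> z i n)) \<le> hausdorff_measure (CARD('n) - 1) (frontier D)" by blast
qed

lemma hausdorff_frontier_finite: "hausdorff_measure (CARD('n) - 1) (frontier D) < \<infinity>"
proof -
 have "(\<Sum>i<N. area (\<nu> i) (chart i)) < \<infinity>"
  using area_finite[OF chart_norm bounded_piece] by (auto simp: less_top[symmetric] ennreal_sum_less_top)
 then have "ennreal ((1 / sqrt (1 - \<epsilon>\<^sup>2)) ^ (CARD('n) - 1)) * (\<Sum>i<N. area (\<nu> i) (chart i)) < \<infinity>"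
  by (simp only: ennreal_mult_less_top infinity_ennreal_def ennreal_less_top simp_thms)
 with hausdorff_le_pieces show ?thesis by (rule le_less_trans)
qed

text \<open>Every bad point lies in a tube over an outer approximation, because the foot of its normal line is within \<open>3 * r\<close> of a boundary point.\<close>
lemma bad_volume_upper:
 assumes n: "frontier D \<subseteq> (\<Union>i<N. {q. ball q \<l> \<subseteq> piece_outer \<rho> z i n})"
  and K: "K \<subseteq> cball 0 r" "0 \<in> K" and r: "0 < r" "r \<le> \<rho>/16" "3 * r < \<l>"
 shows "emeasure lborel (bad D K) \<le> (\<Sum>i<N. ennreal (hgt K (\<nu> i) + 3 * \<epsilon> * r) * area (\<nu> i) (frontier D \<inter> piece_outer \<rho> z i n))"
proof -
 let ?c = "\<lambda>i. hgt K (\<nu> i) + 3 * \<epsilon> * r"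
 let ?O = "\<lambda>i. frontier D \<inter> piece_outer \<rho> z i n"
 let ?T = "\<lambda>i. (\<lambda>(p, s). p + s *\<^sub>R \<nu> i) ` (?O i \<times> {0..?c i})"
 have c0: "0 \<le> ?c i" if "i < N" for i
  using hgt_bounds(1)[OF chart_norm[OF that] K] \<epsilon> r by simp
 have Tb: "?T i \<in> sets borel" for i
 proof -
  obtain C where C: "\<And>n::nat. compact (C n)" "?O i = (\<Union>n. C n)"
   using compact_Int_open_UN[OF compact_frontier_bounded[OF bD] open_piece_outer] by blast
  have "?T i = (\<Union>n. (\<lambda>(p, s). p + s *\<^sub>R \<nu> i) ` (C n \<times> {0..?c i}))" unfolding C(2) by blast
  moreover have "compact ((\<lambda>(p, s). p + s *\<^sub>R \<nu> i) ` (C n \<times> {0..?c i}))" for n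
   by (intro compact_continuous_image compact_Times C compact_Icc) (auto simp: case_prod_unfold intro!: continuous_intros)
  ultimately show ?thesis by (simp add: borel_closed compact_imp_closed)
 qed
 have "bad D K \<subseteq> (\<Union>i<N. ?T i)"
 proof
  fix x assume x: "x \<in> bad D K"
  obtain q where q: "q \<in> frontier D" "dist x q \<le> r" using bad_near_frontier[OF x K(1)] by blast
  obtain i where i: "i < N" "ball q \<l> \<subseteq> piece_outer \<rho> z i n" using n q(1) by blast
  have "q \<in> ball q \<l>" using r by simp
  then have "q \<in> piece_outer \<rho> z i n" using i(2) by blast
  then have qz: "q \<in> ball (z i) (\<rho>/4)" using rho_pos by (simp add: piece_outer_def)
  obtain p s where ps: "p \<in> frontier D" "dist p q \<le> 3 * r" "0 \<le> s" "s \<le> ?c i" "x = p + s *\<^sub>R \<nu> i"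
   using bad_subset_tube[OF oD \<epsilon> chart_cone[OF i(1)] K x q(1) qz q(2) r(1,2)] by blast
  have "p \<in> ball q \<l>" using ps(2) r by (simp add: dist_commute)
  then have "p \<in> ?O i" using i(2) ps(1) by blast
  then have "x \<in> ?T i" using ps by force
  then show "x \<in> (\<Union>i<N. ?T i)" using i(1) by blast
 qed
 then have "emeasure lborel (bad D K) \<le> emeasure lborel (\<Union>i<N. ?T i)"
  using Tb by (intro emeasure_mono) auto
 also have "\<dots> \<le> (\<Sum>i<N. emeasure lborel (?T i))"
  using Tb by (intro emeasure_subadditive_finite) auto
 also have "\<dots> \<le> (\<Sum>i<N. ennreal (?c i) * area (\<nu> i) (?O i))"
 proof (rule sum_mono)
  fix i assume "i \<in> {..<N}"
  then have i: "i < N" by simp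
  show "emeasure lborel (?T i) \<le> ennreal (?c i) * area (\<nu> i) (?O i)"
  proof (rule measure_le_area[OF chart_norm[OF i] Tb slab_outer_borel[OF i] _ _ c0[OF i]])
   show "inj_on (perp (\<nu> i)) (?O i)"
    by (rule inj_on_subset[OF inj_perp_frontier[OF oD \<epsilon> chart_cone[OF i]] outer_in_ball])
   fix x assume "x \<in> ?T i"
   then obtain p s where "p \<in> ?O i" "0 \<le> s" "s \<le> ?c i" "x = p + s *\<^sub>R \<nu> i" by auto
   then show "\<exists>p\<in>?O i. \<exists>s. 0 \<le> s \<and> s \<le> ?c i \<and> x = p + s *\<^sub>R \<nu> i" by blast
  qed
 qed
 finally show ?thesis .
qed

text \<open>The tubes over the inner approximations are disjoint, as these are separated by more than the size of the tubes.\<close>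
lemma bad_volume_lower:
 assumes sep: "\<And>i j x y. i < N ==> j < N ==> i \<noteq> j ==> x \<in> piece_inner D \<rho> z i n ==> y \<in> piece_inner D \<rho> z j n ==> \<sigma> \<le> dist x y"
  and K: "K \<subseteq> cball 0 r" "0 \<in> K" "countable K" and r: "0 < r" "r \<le> \<rho>/16" "2 * r \<le> \<sigma>"
 shows "(\<Sum>i<N. ennreal (max 0 (hgt K (\<nu> i) - 3 * \<epsilon> * r)) * area (\<nu> i) (piece_inner D \<rho> z i n)) \<le> emeasure lborel (bad D K)"
proof -
 let ?c = "\<lambda>i. max 0 (hgt K (\<nu> i) - 3 * \<epsilon> * r)"
 let ?C = "\<lambda>i. piece_inner D \<rho> z i n"
 let ?B = "\<lambda>i. bad D K \<inter> (\<Union>p\<in>?C i. ball p r)"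
 have Bb: "?B i \<in> sets borel" for i
  by (intro sets.Int bad_borel oD K borel_open open_UN) auto
 have "(\<Sum>i<N. ennreal (?c i) * area (\<nu> i) (?C i)) \<le> (\<Sum>i<N. emeasure lborel (?B i))"
 proof (rule sum_mono)
  fix i assume "i \<in> {..<N}"
  then have i: "i < N" by simp
  show "ennreal (?c i) * area (\<nu> i) (?C i) \<le> emeasure lborel (?B i)"
  proof (rule area_le_measure[OF chart_norm[OF i] Bb])
   show "slab (\<nu> i) (?C i) \<in> sets borel"
    using compact_slab[OF chart_norm[OF i] compact_piece_inner[OF bD]] by (simp add: borel_closed compact_imp_closed)
   fix p s assume p: "p \<in> ?C i" and s: "0 < s" "s < ?c i"
   then have s': "s < hgt K (\<nu> i) - 3 * \<epsilon> * r" by (simp add: max_def split: if_splits)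
   have "0 < 1 / real (Suc n)" by simp
   moreover have "dist (z i) p \<le> \<rho>/8 - 1 / real (Suc n)" using p unfolding piece_inner_def by blast
   ultimately have "dist (z i) p \<le> \<rho>/8" by linarith
   then have pz: "p \<in> ball (z i) (\<rho>/4)" using rho_pos by simp
   have pF: "p \<in> frontier D" using p by (simp add: piece_inner_def)
   have "p + s *\<^sub>R \<nu> i \<in> bad D K"
    by (rule tube_subset_bad[OF oD \<epsilon> chart_cone[OF i] K(1,2) pF pz r(1,2) s(1) s'])
   moreover have "p + s *\<^sub>R \<nu> i \<in> ball p r"
   proof -
    have "0 < \<epsilon> * r" using \<epsilon> r by simp
    then have "s < r" using s' hgt_bounds(2)[OF chart_norm[OF i] K(1,2)] by linarith
    then show ?thesis using s(1) chart_norm[OF i] by (simp add: dist_norm)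
   qed
   ultimately show "p + s *\<^sub>R \<nu> i \<in> ?B i" using p by blast
  qed simp
 qed
 also have "\<dots> = emeasure lborel (\<Union>i<N. ?B i)"
 proof (rule sum_emeasure)
  show "disjoint_family_on ?B {..<N}"
   unfolding disjoint_family_on_def
  proof (intro ballI impI)
   fix i j assume ij: "i \<in> {..<N}" "j \<in> {..<N}" "i \<noteq> j"
   show "?B i \<inter> ?B j = {}"
   proof (rule ccontr)
    assume "?B i \<inter> ?B j \<noteq> {}"
    then obtain x p q where "p \<in> ?C i" "x \<in> ball p r" "q \<in> ?C j" "x \<in> ball q r" by blast
    then have "\<sigma> \<le> dist p q" "dist p q < 2 * r" using sep[of i j p q] ij dist_triangle2[of p q x] by (auto simp: dist_commute)
    then show False using r by linarith
   qed
  qed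
 qed (use Bb in auto)
 also have "\<dots> \<le> emeasure lborel (bad D K)"
  by (intro emeasure_mono) (use bad_borel[OF oD K(3)] in auto)
 finally show ?thesis .
qed

end

section \<open>The volume of the boundary layer\<close>

lemma area_mono:
 assumes "S \<subseteq> S'" "slab \<nu> S' \<in> sets borel"
 shows "area \<nu> S \<le> area \<nu> S'"
 unfolding area_def using assms by (intro emeasure_mono slab_mono) auto

lemma finite_separation:
 fixes C :: "nat => 'a::heine_borel set"
 assumes "\<And>i. i < N ==> compact (C i)" "\<And>i j. i < N ==> j < N ==> i \<noteq> j ==> C i \<inter> C j = {}"
 obtains \<sigma> where "0 < \<sigma>" "\<And>i j x y. i < N ==> j < N ==> i \<noteq> j ==> x \<in> C i ==> y \<in> C j ==> \<sigma> \<le> dist x y"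
proof -
 have "\<exists>s>0. i < N \<longrightarrow> j < N \<longrightarrow> i \<noteq> j \<longrightarrow> (\<forall>x\<in>C i. \<forall>y\<in>C j. s \<le> dist x y)" for i j
 proof (cases "i < N \<and> j < N \<and> i \<noteq> j")
  case True
  then have "compact (C i)" "closed (C j)" "C i \<inter> C j = {}" using assms by (auto intro: compact_imp_closed)
  then obtain s where "0 < s" "\<forall>x\<in>C i. \<forall>y\<in>C j. s \<le> dist x y" using separate_compact_closed by blast
  then show ?thesis by blast
 qed (auto intro: exI[of _ 1])
 then obtain s where s: "\<And>i j. 0 < s i j"
   "\<And>i j. i < N ==> j < N ==> i \<noteq> j ==> (\<forall>x\<in>C i. \<forall>y\<in>C j. s i j \<le> dist x y)" by metis
 define S where "S = insert 1 ((\<lambda>(i, j). s i j) ` ({..<N} \<times> {..<N}))"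
 have fS: "finite S" "S \<noteq> {}" by (auto simp: S_def)
 show ?thesis
 proof (rule that)
  have "\<forall>x\<in>S. 0 < x" using s(1) by (auto simp: S_def)
  then show "0 < Min S" using fS by simp
  fix i j x y assume a: "i < N" "j < N" "i \<noteq> j" "x \<in> C i" "y \<in> C j"
  have "s i j \<in> S" using a by (force simp: S_def)
  then have "Min S \<le> s i j" using fS by simp
  also have "\<dots> \<le> dist x y" using s(2)[OF a(1-3)] a(4,5) by blast
  finally show "Min S \<le> dist x y" .
 qed
qed

text \<open>Choose \<open>\<epsilon>\<close> so small that projecting a piece changes its measure by a factor close to one, then inner and outer
approximations whose areas are close to those of the pieces, and finally \<open>r0\<close> below the separation of the former and the
thickness of the latter.\<close>
theorem boundary_layer_volume:
 fixes D :: "(real^'n) set"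
 assumes oD: "open D" and bD: "bounded D" and dim: "CARD('n) \<ge> 2" and flat: "flat_boundary D" and \<eta>: "0 < \<eta>"
 obtains N :: nat and \<nu> :: "nat => real^'n" and a a' :: "nat => real" and r0 :: real where
  "0 < r0" "\<And>i. i < N ==> norm (\<nu> i) = 1" "\<And>i. 0 \<le> a i" "\<And>i. 0 \<le> a' i"
  "perimeter D - \<eta> \<le> (\<Sum>i<N. a i)" "(\<Sum>i<N. a' i) \<le> perimeter D + \<eta>"
  "\<And>K r. K \<subseteq> cball 0 r ==> 0 \<in> K ==> countable K ==> 0 \<le> r ==> r < r0 ==>
    (\<Sum>i<N. a i * hgt K (\<nu> i)) - \<eta> * r \<le> measure lebesgue (bad D K)"
  "\<And>K r. K \<subseteq> cball 0 r ==> 0 \<in> K ==> countable K ==> 0 \<le> r ==> r < r0 ==>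
    measure lebesgue (bad D K) \<le> (\<Sum>i<N. a' i * hgt K (\<nu> i)) + \<eta> * r"
proof -
 let ?k = "CARD('n) - 1"
 define H where "H = perimeter D"
 have H0: "0 \<le> H" by (simp add: H_def perimeter_def)
 have "((\<lambda>\<epsilon>. sqrt (1 - \<epsilon>\<^sup>2) ^ ?k * H) \<longlongrightarrow> sqrt (1 - 0\<^sup>2) ^ ?k * H) (at_right 0)"
  by (intro tendsto_intros)
 then have lim: "((\<lambda>\<epsilon>. sqrt (1 - \<epsilon>\<^sup>2) ^ ?k * H) \<longlongrightarrow> H) (at_right 0)" by simp
 have ev1: "eventually (\<lambda>\<epsilon>. H - \<eta>/2 < sqrt (1 - \<epsilon>\<^sup>2) ^ ?k * H) (at_right 0)"
  by (rule order_tendstoD(1)[OF lim]) (use \<eta> in simp)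
 have "0 < min (1/4) (\<eta> / (3 * (H + \<eta>)))" using \<eta> H0 by simp
 then have ev2: "eventually (\<lambda>\<epsilon>. \<epsilon> \<in> {0<..<min (1/4) (\<eta> / (3 * (H + \<eta>)))}) (at_right 0)"
  by (rule eventually_at_right_real)
 have "\<exists>\<epsilon>. H - \<eta>/2 < sqrt (1 - \<epsilon>\<^sup>2) ^ ?k * H \<and> \<epsilon> \<in> {0<..<min (1/4) (\<eta> / (3 * (H + \<eta>)))}"
  using eventually_happens[OF eventually_conj[OF ev1 ev2]] by (simp add: trivial_limit_at_right_real)
 then obtain \<epsilon> where \<epsilon>: "H - \<eta>/2 < sqrt (1 - \<epsilon>\<^sup>2) ^ ?k * H" "0 < \<epsilon>" "\<epsilon> \<le> 1/4" "\<epsilon> < \<eta> / (3 * (H + \<eta>))"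
  by auto
 have eps3: "3 * \<epsilon> * (H + \<eta>) \<le> \<eta>" using \<epsilon>(4) H0 \<eta> by (simp add: field_simps)
 obtain \<rho> N z \<nu> where cc: "chart_cover D \<epsilon> \<rho> N z \<nu>"
  by (rule chart_cover_exists[OF bD flat \<epsilon>(2)])
 note facts = oD bD dim \<epsilon>(2,3) cc
 note nrm = chart_norm[OF facts] and rho = rho_pos[OF facts]
 let ?W = "piece D \<rho> z" and ?In = "\<lambda>n i. piece_inner D \<rho> z i n" and ?Out = "\<lambda>n i. frontier D \<inter> piece_outer \<rho> z i n"
 define E where "E i = enn2real (area (\<nu> i) (?W i))" for i
 have Efin: "area (\<nu> i) (?W i) = ennreal (E i)" if "i < N" for i
  using area_finite[OF nrm[OF that] bounded_piece[OF facts, of i]] by (simp add: E_def less_top)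
 have haus: "hausdorff_measure ?k (frontier D) = ennreal H"
  using hausdorff_frontier_finite[OF facts] by (simp add: H_def perimeter_def less_top)
 have E0: "0 \<le> E i" for i by (simp add: E_def)
 have sumE: "(\<Sum>i<N. area (\<nu> i) (?W i)) = ennreal (\<Sum>i<N. E i)"
  using Efin E0 by (subst sum_ennreal[symmetric]) auto
 have EH: "(\<Sum>i<N. E i) \<le> H"
  using pieces_le_hausdorff[OF facts] H0 unfolding haus sumE by simp
 have HE: "H - \<eta>/2 \<le> (\<Sum>i<N. E i)"
 proof -
  have e1: "\<epsilon>\<^sup>2 < 1" using \<epsilon> by (simp add: abs_square_less_1)
  have L0: "0 < sqrt (1 - \<epsilon>\<^sup>2) ^ ?k" using e1 by simp
  have "ennreal H \<le> ennreal ((1 / sqrt (1 - \<epsilon>\<^sup>2)) ^ ?k) * ennreal (\<Sum>i<N. E i)"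
   using hausdorff_le_pieces[OF facts] unfolding haus sumE .
  also have "\<dots> = ennreal ((1 / sqrt (1 - \<epsilon>\<^sup>2)) ^ ?k * (\<Sum>i<N. E i))"
   by (rule ennreal_mult''[symmetric]) (simp add: sum_nonneg E0)
  finally have "H \<le> (1 / sqrt (1 - \<epsilon>\<^sup>2)) ^ ?k * (\<Sum>i<N. E i)"
   using e1 by (subst (asm) ennreal_le_iff) (auto intro!: mult_nonneg_nonneg sum_nonneg E0)
  then have "sqrt (1 - \<epsilon>\<^sup>2) ^ ?k * H \<le> (\<Sum>i<N. E i)"
   using L0 by (simp add: power_divide field_simps)
  then show ?thesis using \<epsilon>(1) by linarith
 qed
 define \<eta>' where "\<eta>' = \<eta> / (2 * (real N + 1))"
 have \<eta>': "0 < \<eta>'" "real N * \<eta>' \<le> \<eta>/2"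
 proof -
  show "0 < \<eta>'" using \<eta> by (simp add: \<eta>'_def)
  have "(real N + 1) * \<eta>' = \<eta>/2" by (simp add: \<eta>'_def field_simps)
  then show "real N * \<eta>' \<le> \<eta>/2" using \<open>0 < \<eta>'\<close> by (simp add: distrib_right)
 qed
 have ev: "eventually (\<lambda>n. E i - \<eta>' < enn2real (area (\<nu> i) (?In n i)) \<and> enn2real (area (\<nu> i) (?Out n i)) < E i + \<eta>') sequentially"
  if i: "i < N" for i
 proof (rule eventually_conj)
  have "(\<lambda>n. enn2real (area (\<nu> i) (?In n i))) \<longlonglongrightarrow> E i"
   by (rule tendsto_enn2real[OF inner_tendsto[OF facts i, unfolded Efin[OF i]] E0])
  then show "eventually (\<lambda>n. E i - \<eta>' < enn2real (area (\<nu> i) (?In n i))) sequentially"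
   by (rule order_tendstoD) (use \<eta>' in simp)
  have "(\<lambda>n. enn2real (area (\<nu> i) (?Out n i))) \<longlonglongrightarrow> E i"
   by (rule tendsto_enn2real[OF outer_tendsto[OF facts i, unfolded Efin[OF i]] E0])
  then show "eventually (\<lambda>n. enn2real (area (\<nu> i) (?Out n i)) < E i + \<eta>') sequentially"
   by (rule order_tendstoD) (use \<eta>' in simp)
 qed
 have "eventually (\<lambda>n. \<forall>i\<in>{..<N}. E i - \<eta>' < enn2real (area (\<nu> i) (?In n i)) \<and> enn2real (area (\<nu> i) (?Out n i)) < E i + \<eta>') sequentially"
  by (rule eventually_ball_finite) (use ev in auto)
 then obtain n where n: "\<forall>i\<in>{..<N}. E i - \<eta>' < enn2real (area (\<nu> i) (?In n i)) \<and> enn2real (area (\<nu> i) (?Out n i)) < E i + \<eta>'"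
  using eventually_happens'[OF sequentially_bot] by blast
 define a where "a i = enn2real (area (\<nu> i) (?In n i))" for i
 define a' where "a' i = enn2real (area (\<nu> i) (?Out n i))" for i
 have inW: "?In n i \<subseteq> ?W i" for i unfolding piece_eq_UN by blast
 have WOut: "?W i \<subseteq> ?Out n i" for i unfolding piece_eq_INT by blast
 have afin: "area (\<nu> i) (?In n i) = ennreal (a i)" if "i < N" for i
  using area_finite[OF nrm[OF that] bounded_subset[OF bounded_piece[OF facts] inW]] by (simp add: a_def less_top)
 have a'fin: "area (\<nu> i) (?Out n i) = ennreal (a' i)" if "i < N" for i
  using area_finite[OF nrm[OF that] bounded_outer[OF facts]] by (simp add: a'_def less_top)
 have a0: "0 \<le> a i" "0 \<le> a' i" for i by (simp_all add: a_def a'_def)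
 have aE: "a i \<le> E i" if i: "i < N" for i
  using area_mono[OF inW slab_piece_borel[OF facts i]] E0 unfolding afin[OF i] Efin[OF i] by simp
 have suma_le: "(\<Sum>i<N. a i) \<le> H + \<eta>"
 proof -
  have "(\<Sum>i<N. a i) \<le> (\<Sum>i<N. E i)" by (rule sum_mono) (use aE in simp)
  then show ?thesis using EH \<eta> by linarith
 qed
 have suma_ge: "H - \<eta> \<le> (\<Sum>i<N. a i)"
 proof -
  have "(\<Sum>i<N. E i - \<eta>') \<le> (\<Sum>i<N. a i)" by (rule sum_mono) (use n in \<open>auto simp: a_def less_imp_le\<close>)
  then have "(\<Sum>i<N. E i) - real N * \<eta>' \<le> (\<Sum>i<N. a i)" by (simp add: sum_subtractf)
  then show ?thesis using HE \<eta>'(2) by linarith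
 qed
 have suma': "(\<Sum>i<N. a' i) \<le> H + \<eta>"
 proof -
  have "(\<Sum>i<N. a' i) \<le> (\<Sum>i<N. E i + \<eta>')" by (rule sum_mono) (use n in \<open>auto simp: a'_def less_imp_le\<close>)
  then have "(\<Sum>i<N. a' i) \<le> (\<Sum>i<N. E i) + real N * \<eta>'" by (simp add: sum.distrib)
  then show ?thesis using EH \<eta>'(2) \<eta> by linarith
 qed
 have cov: "frontier D \<subseteq> \<Union>((\<lambda>i. piece_outer \<rho> z i n) ` {..<N})"
  using frontier_eq_pieces[OF cc] WOut by blast
 obtain \<l> where \<l>: "0 < \<l>" "\<And>q. q \<in> frontier D ==> \<exists>T\<in>(\<lambda>i. piece_outer \<rho> z i n) ` {..<N}. ball q \<l> \<subseteq> T"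
 proof (rule Heine_Borel_lemma[OF compact_frontier_bounded[OF bD] cov])
  show "open T" if "T \<in> (\<lambda>i. piece_outer \<rho> z i n) ` {..<N}" for T using that open_piece_outer by blast
 qed blast
 have \<l>': "frontier D \<subseteq> (\<Union>i<N. {q. ball q \<l> \<subseteq> piece_outer \<rho> z i n})" using \<l>(2) by blast
 obtain \<sigma> where \<sigma>: "0 < \<sigma>" "\<And>i j x y. i < N ==> j < N ==> i \<noteq> j ==> x \<in> ?In n i ==> y \<in> ?In n j ==> \<sigma> \<le> dist x y"
 proof (rule finite_separation[of N "?In n"])
  show "compact (?In n i)" for i by (rule compact_piece_inner[OF bD])
  fix i j :: nat assume "i \<noteq> j"
  then have "?W i \<inter> ?W j = {}" using piece_disjoint[of i j D] piece_disjoint[of j i D] by (metis inf_commute nat_neq_iff)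
  then show "?In n i \<inter> ?In n j = {}" using inW[of i] inW[of j] by blast
 qed blast
 define r0 where "r0 = min (\<rho>/16) (min (\<l>/4) (\<sigma>/2))"
 have r0: "0 < r0" "r0 \<le> \<rho>/16" "r0 \<le> \<l>/4" "r0 \<le> \<sigma>/2" using rho \<l>(1) \<sigma>(1) by (simp_all add: r0_def)
 have vol: "(\<Sum>i<N. a i * hgt K (\<nu> i)) - \<eta> * r \<le> measure lebesgue (bad D K) \<and>
   measure lebesgue (bad D K) \<le> (\<Sum>i<N. a' i * hgt K (\<nu> i)) + \<eta> * r"
  if K: "K \<subseteq> cball 0 r" "0 \<in> K" "countable K" and r: "0 \<le> r" "r < r0" for K r
 proof (cases "r = 0")
  case True
  then have "K = {0}" using K by auto
  then have "bad D K = {}" "\<And>v. hgt K v = 0" by (auto simp: bad_def hgt_def)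
  then show ?thesis using True by simp
 next
  case False
  then have rp: "0 < r" and rr: "r \<le> \<rho>/16" "3 * r < \<l>" "2 * r \<le> \<sigma>" using r r0 by auto
  have bb: "bad D K \<in> sets borel" by (rule bad_borel[OF oD K(3)])
  have "bounded (bad D K)" using bD by (rule bounded_subset) (auto simp: bad_def)
  then have "emeasure lborel (bad D K) < \<infinity>" by (rule emeasure_bounded_finite)
  then have em: "emeasure lborel (bad D K) = ennreal (measure lebesgue (bad D K))"
   using bb by (simp add: emeasure_eq_ennreal_measure less_top[symmetric])
  have hg: "0 \<le> hgt K (\<nu> i)" if "i < N" for i using hgt_bounds(1)[OF nrm[OF that] K(1,2)] .
  have er: "3 * \<epsilon> * r * (H + \<eta>) \<le> \<eta> * r" using mult_right_mono[OF eps3 r(1)] by (simp add: mult_ac)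
  have er0: "0 \<le> 3 * \<epsilon> * r" using \<epsilon>(2) r(1) by simp
  have "(\<Sum>i<N. ennreal (max 0 (hgt K (\<nu> i) - 3 * \<epsilon> * r)) * area (\<nu> i) (?In n i)) \<le> emeasure lborel (bad D K)"
   by (rule bad_volume_lower[OF facts \<sigma>(2) K rp rr(1,3)])
  moreover have "(\<Sum>i<N. ennreal (max 0 (hgt K (\<nu> i) - 3 * \<epsilon> * r)) * area (\<nu> i) (?In n i))
    = ennreal (\<Sum>i<N. max 0 (hgt K (\<nu> i) - 3 * \<epsilon> * r) * a i)"
   using a0 afin by (subst sum_ennreal[symmetric]) (auto simp: ennreal_mult'' intro!: sum.cong)
  ultimately have "(\<Sum>i<N. max 0 (hgt K (\<nu> i) - 3 * \<epsilon> * r) * a i) \<le> measure lebesgue (bad D K)"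
   unfolding em by simp
  moreover have "(\<Sum>i<N. a i * hgt K (\<nu> i) - 3 * \<epsilon> * r * a i) \<le> (\<Sum>i<N. max 0 (hgt K (\<nu> i) - 3 * \<epsilon> * r) * a i)"
  proof (rule sum_mono)
   fix i
   have "(hgt K (\<nu> i) - 3 * \<epsilon> * r) * a i \<le> max 0 (hgt K (\<nu> i) - 3 * \<epsilon> * r) * a i"
    by (rule mult_right_mono) (use a0 in auto)
   then show "a i * hgt K (\<nu> i) - 3 * \<epsilon> * r * a i \<le> max 0 (hgt K (\<nu> i) - 3 * \<epsilon> * r) * a i"
    by (simp add: algebra_simps)
  qed
  moreover have "(\<Sum>i<N. a i * hgt K (\<nu> i) - 3 * \<epsilon> * r * a i) = (\<Sum>i<N. a i * hgt K (\<nu> i)) - 3 * \<epsilon> * r * (\<Sum>i<N. a i)"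
   by (simp add: sum_subtractf sum_distrib_left)
  moreover have "3 * \<epsilon> * r * (\<Sum>i<N. a i) \<le> \<eta> * r"
   using mult_left_mono[OF suma_le er0] er by linarith
  ultimately have lower: "(\<Sum>i<N. a i * hgt K (\<nu> i)) - \<eta> * r \<le> measure lebesgue (bad D K)" by linarith
  have "emeasure lborel (bad D K) \<le> (\<Sum>i<N. ennreal (hgt K (\<nu> i) + 3 * \<epsilon> * r) * area (\<nu> i) (?Out n i))"
   by (rule bad_volume_upper[OF facts \<l>' K(1,2) rp rr(1,2)])
  also have "\<dots> = (\<Sum>i<N. ennreal ((hgt K (\<nu> i) + 3 * \<epsilon> * r) * a' i))"
   using a0 a'fin by (intro sum.cong) (auto simp: ennreal_mult'')
  also have "\<dots> = ennreal (\<Sum>i<N. (hgt K (\<nu> i) + 3 * \<epsilon> * r) * a' i)"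
   using a0 hg er0 by (intro sum_ennreal) auto
  finally have "measure lebesgue (bad D K) \<le> (\<Sum>i<N. (hgt K (\<nu> i) + 3 * \<epsilon> * r) * a' i)"
   unfolding em using a0 hg er0 by (subst (asm) ennreal_le_iff) (auto intro!: sum_nonneg)
  also have "\<dots> = (\<Sum>i<N. a' i * hgt K (\<nu> i)) + 3 * \<epsilon> * r * (\<Sum>i<N. a' i)"
   by (simp add: sum.distrib sum_distrib_left algebra_simps)
  also have "3 * \<epsilon> * r * (\<Sum>i<N. a' i) \<le> \<eta> * r"
   using mult_left_mono[OF suma' er0] er by linarith
  finally show ?thesis using lower by simp
 qed
 show ?thesis
  by (rule that[of r0 N \<nu> a a']) (use r0 nrm a0 suma_ge suma' vol in \<open>auto simp: H_def\<close>)
qed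

section \<open>Dyadic times and eroded sets\<close>

text \<open>A countable dense set of times that contains both endpoints and is an increasing union of equidistant grids.\<close>
definition tgrid :: "real => real set" where
 "tgrid t = (\<lambda>(j, L). t * (real j / 2 ^ L)) ` {(j::nat, L::nat). j \<le> 2 ^ L}"

lemma countable_tgrid: "countable (tgrid t)"
 unfolding tgrid_def by (rule countable_image) (rule countable_subset[of _ UNIV], auto)

lemma tgrid_bounds: "0 \<le> t ==> u \<in> tgrid t ==> 0 \<le> u \<and> u \<le> t"
proof -
 assume t: "0 \<le> t" and u: "u \<in> tgrid t"
 then obtain j L where jL: "j \<le> 2 ^ L" "u = t * (real j / 2 ^ L)" by (auto simp: tgrid_def)
 have "real j \<le> real (2 ^ L)" using jL(1) by (simp only: of_nat_le_iff)
 then have "real j / 2 ^ L \<le> 1" by simp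
 then show "0 \<le> u \<and> u \<le> t" unfolding jL(2) using t mult_left_mono[of "real j / 2 ^ L" 1 t] by simp
qed

lemma tgrid_0: "0 \<in> tgrid t" and tgrid_end: "t \<in> tgrid t"
 unfolding tgrid_def by (force intro: image_eqI[where x="(0,0)"], force intro: image_eqI[where x="(1,0)"])

lemma tgrid_dense:
 assumes "0 \<le> s" "s < b" "b \<le> t"
 shows "\<exists>u\<in>tgrid t. s < u \<and> u < b"
proof -
 have t: "0 < t" using assms by linarith
 obtain L :: nat where L: "t / (b - s) < 2 ^ L" using real_arch_pow[of 2 "t / (b - s)"] by auto
 define j where "j = nat \<lfloor>s * 2 ^ L / t\<rfloor> + 1"
 have nn: "0 \<le> s * 2 ^ L / t" using assms t by simp
 have j1: "s * 2 ^ L / t < real j" and j2: "real j \<le> s * 2 ^ L / t + 1"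
  using nn unfolding j_def by (auto, linarith)
 have a: "s < t * (real j / 2 ^ L)" using j1 t by (simp add: field_simps)
 have "t * (real j / 2 ^ L) \<le> s + t / 2 ^ L" using j2 t by (simp add: field_simps)
 also have "t / 2 ^ L < b - s" using L assms by (simp add: field_simps)
 finally have b: "t * (real j / 2 ^ L) < b" by simp
 have "t * (real j / 2 ^ L) < t * 1" using b assms by linarith
 then have "real j / 2 ^ L < 1" using t by (simp only: mult_less_cancel_left_pos)
 then have "real j < real (2 ^ L)" by simp
 then have "j \<le> 2 ^ L" by (simp only: of_nat_less_iff less_imp_le)
 then have "t * (real j / 2 ^ L) \<in> tgrid t" unfolding tgrid_def by force
 then show ?thesis using a b by blast
qed

text \<open>Right continuity transports a closed condition from the grid to all times.\<close>
lemma cadlag_closed_tgrid: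
 assumes f: "cadlag f" and C: "closed C" and grid: "\<And>u. u \<in> tgrid t ==> f u \<in> C" and s: "0 \<le> s" "s \<le> t"
 shows "f s \<in> C"
proof (cases "s = t")
 case True
 then show ?thesis using grid tgrid_end by blast
next
 case False
 then have st: "s < t" using s by simp
 show ?thesis
 proof (rule ccontr)
  assume "f s \<notin> C"
  then have o: "open (- C)" "f s \<in> - C" using C by auto
  have "(f \<longlongrightarrow> f s) (at_right s)" using f s unfolding cadlag_def by blast
  then have "eventually (\<lambda>u. f u \<in> - C) (at_right s)" using o by (rule topological_tendstoD)
  then obtain b where b: "s < b" "\<And>u. s < u ==> u < b ==> f u \<in> - C"
   unfolding eventually_at_right_field by blast
  obtain u where "u \<in> tgrid t" "s < u" "u < min b t" using tgrid_dense[OF s(1), of "min b t" t] b(1) st by auto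
  then show False using b(2)[of u] grid[of u] by simp
 qed
qed

text \<open>The starting points that all displacements in \<open>K\<close> keep inside \<open>D\<close>.\<close>
definition erosion :: "'a::real_vector set => 'a set => 'a set" where
 "erosion D K = {x. \<forall>k\<in>K. x + k \<in> D}"

lemma erosion_borel:
 fixes D :: "'a::euclidean_space set"
 assumes "open D" "countable K" "K \<noteq> {}"
 shows "erosion D K \<in> sets borel"
proof -
 have "{x. x + k \<in> D} \<in> sets borel" for k
 proof -
  have "(\<lambda>x. x + k) -` D \<inter> space borel \<in> sets borel"
   by (rule measurable_sets[of _ borel borel]) (use assms in auto)
  then show ?thesis by (simp add: vimage_def)
 qed
 then have "(\<Inter>k\<in>K. {x. x + k \<in> D}) \<in> sets borel" using assms by (intro sets.countable_INT') auto
 moreover have "erosion D K = (\<Inter>k\<in>K. {x. x + k \<in> D})" by (auto simp: erosion_def)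
 ultimately show ?thesis by simp
qed

text \<open>The translates of the set by \<open>(c / Suc i) * v\<close> are pairwise disjoint and have the same measure, but they lie in a bounded set.\<close>
lemma porous_null:
 fixes E :: "'a::euclidean_space set" and v :: 'a
 assumes E: "E \<in> sets borel" "bounded E" and c: "0 < c"
 shows "{x\<in>E. \<forall>d. 0 < d \<and> d < c \<longrightarrow> x - d *\<^sub>R v \<notin> E} \<subseteq>
   {x\<in>E. \<forall>i j::nat. j < i \<longrightarrow> x - (c / real (Suc j) - c / real (Suc i)) *\<^sub>R v \<notin> E}" (is "?N \<subseteq> ?N'")
  and "{x\<in>E. \<forall>i j::nat. j < i \<longrightarrow> x - (c / real (Suc j) - c / real (Suc i)) *\<^sub>R v \<notin> E} \<in> null_sets lborel"
proof -
 define d where "d j i = c / real (Suc j) - c / real (Suc i)" for i j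
 have dpos: "0 < d j i" "d j i < c" if "j < i" for i j
 proof -
  have "c / real (Suc i) < c / real (Suc j)" using c that by (intro divide_strict_left_mono) auto
  then show "0 < d j i" by (simp add: d_def)
  have "c / real (Suc j) \<le> c" "0 < c / real (Suc i)" using c by (auto simp: field_simps)
  then show "d j i < c" by (simp add: d_def)
 qed
 show "?N \<subseteq> ?N'" using dpos unfolding d_def by blast
 let ?P = "{x\<in>E. \<forall>i j::nat. j < i \<longrightarrow> x - d j i *\<^sub>R v \<notin> E}"
 have tr: "{x. x - w \<in> S} \<in> sets borel" if "S \<in> sets borel" for w :: 'a and S
 proof -
  have "(\<lambda>x. x - w) -` S \<inter> space borel \<in> sets borel"
   by (rule measurable_sets[of _ borel borel]) (use that in auto)
  then show ?thesis by (simp add: vimage_def)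
 qed
 have Pb: "?P \<in> sets borel"
 proof -
  have "?P = E \<inter> (\<Inter>i. \<Inter>j\<in>{..<i}. - {x. x - d j i *\<^sub>R v \<in> E})" by auto
  also have "\<dots> \<in> sets borel"
   using tr[OF E(1)] E(1) by (intro sets.Int sets.countable_INT'' sets.countable_INT') (auto intro: borel_comp)
  finally show ?thesis .
 qed
 define A where "A j = {x. x - (c / real (Suc j)) *\<^sub>R v \<in> ?P}" for j :: nat
 have Ab: "A j \<in> sets borel" for j unfolding A_def by (rule tr[OF Pb])
 have Ae: "emeasure lborel (A j) = emeasure lborel ?P" for j
  using emeasure_lborel_translate[OF Pb, of "- ((c / real (Suc j)) *\<^sub>R v)"] unfolding A_def by simp
 have disj: "A i \<inter> A j = {}" if "j < i" for i j
 proof (rule ccontr)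
  assume "A i \<inter> A j \<noteq> {}"
  then obtain x where x: "x - (c / real (Suc i)) *\<^sub>R v \<in> ?P" "x - (c / real (Suc j)) *\<^sub>R v \<in> ?P" unfolding A_def by blast
  have eq: "x - (c / real (Suc j)) *\<^sub>R v = (x - (c / real (Suc i)) *\<^sub>R v) - d j i *\<^sub>R v"
   by (simp add: d_def scaleR_left_diff_distrib)
  moreover have "(x - (c / real (Suc i)) *\<^sub>R v) - d j i *\<^sub>R v \<notin> E" using x(1) that by blast
  ultimately show False using x(2) unfolding eq by blast
 qed
 obtain M where M: "\<And>x. x \<in> E ==> norm x \<le> M" using E(2) bounded_iff by blast
 have sub: "A j \<subseteq> cball 0 (M + c * norm v)" for j
 proof
  fix x assume "x \<in> A j"
  then have "norm (x - (c / real (Suc j)) *\<^sub>R v) \<le> M" using M unfolding A_def by blast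
  moreover have "norm ((c / real (Suc j)) *\<^sub>R v) \<le> c * norm v"
  proof -
   have "c / real (Suc j) \<le> c" using c by (simp add: field_simps)
   then have "c / real (Suc j) * norm v \<le> c * norm v" by (rule mult_right_mono) simp
   moreover have "norm ((c / real (Suc j)) *\<^sub>R v) = c / real (Suc j) * norm v" using c by (simp only: norm_scaleR) simp
   ultimately show ?thesis by (simp only:)
  qed
  ultimately have "norm x \<le> M + c * norm v"
   using norm_triangle_sub[of x "(c / real (Suc j)) *\<^sub>R v"] by linarith
  then show "x \<in> cball 0 (M + c * norm v)" by simp
 qed
 have fin: "emeasure lborel (cball (0::'a) (M + c * norm v)) < \<infinity>" by (rule emeasure_bounded_finite) simp
 have Pfin: "emeasure lborel ?P < \<infinity>"
  by (rule emeasure_bounded_finite) (rule bounded_subset[OF E(2)], auto)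
 have le: "real m * measure lborel ?P \<le> measure lborel (cball (0::'a) (M + c * norm v))" for m :: nat
 proof -
  have "(\<Sum>j<m. emeasure lborel (A j)) = emeasure lborel (\<Union>j<m. A j)"
  proof (rule sum_emeasure)
   show "disjoint_family_on A {..<m}" using disj unfolding disjoint_family_on_def
    by (metis inf_commute nat_neq_iff)
  qed (use Ab in auto)
  also have "\<dots> \<le> emeasure lborel (cball (0::'a) (M + c * norm v))"
   using sub by (intro emeasure_mono) auto
  finally have "of_nat m * emeasure lborel ?P \<le> emeasure lborel (cball (0::'a) (M + c * norm v))"
   unfolding Ae by simp
  then have "ennreal (real m * measure lborel ?P) \<le> ennreal (measure lborel (cball (0::'a) (M + c * norm v)))"
   using fin Pfin by (simp add: emeasure_eq_ennreal_measure less_top[symmetric] ennreal_mult' ennreal_of_nat_eq_real_of_nat)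
  then show ?thesis by (simp add: ennreal_le_iff)
 qed
 have "measure lborel ?P = 0"
 proof (rule ccontr)
  assume "measure lborel ?P \<noteq> 0"
  then have p: "0 < measure lborel ?P" by (simp add: zero_less_measure_iff)
  obtain m :: nat where "measure lborel (cball (0::'a) (M + c * norm v)) / measure lborel ?P < real m"
   using reals_Archimedean2 by blast
  then show False using le[of m] p by (simp add: field_simps)
 qed
 then have P0: "emeasure lborel ?P = 0" using Pfin by (simp add: emeasure_eq_ennreal_measure less_top[symmetric])
 have "?P \<in> null_sets lborel" by (rule null_setsI[OF P0]) (simp only: sets_lborel Pb)
 then show "?N' \<in> null_sets lborel" unfolding d_def .
qed

text \<open>A point of the exceptional set comes arbitrarily close to the complement without leaving \<open>D\<close>.  By the cone condition, moving it
slightly against a normal direction makes some displacement leave \<open>D\<close>; so the set is porous in one of finitely many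
directions.\<close>
lemma erosion_boundary_null:
 fixes D :: "'a::euclidean_space set"
 assumes oD: "open D" and bD: "bounded D" and flat: "flat_boundary D" and K: "countable K" "0 \<in> K"
 shows "\<exists>N\<in>null_sets lborel. {x\<in>erosion D K. \<not> (\<exists>m::nat. \<forall>k\<in>K. 1 / real (Suc m) \<le> infdist (x + k) (- D))} \<subseteq> N"
proof -
 let ?E = "erosion D K"
 have eps: "0 < (1/4::real)" "(1/4::real) \<le> 1/4" by simp_all
 obtain \<rho> n z \<nu> where cc: "chart_cover D (1/4) \<rho> n z \<nu>" by (rule chart_cover_exists[OF bD flat eps(1)])
 have rho: "0 < \<rho>" and cone: "\<And>i. i < n ==> cone_at D (1/4) \<rho> (z i) (\<nu> i)"
  and cov: "frontier D \<subseteq> (\<Union>i<n. ball (z i) (\<rho>/8))" using cc by (simp_all add: chart_cover_def)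
 have neD: "- D \<noteq> {}" using bD not_bounded_UNIV by (metis Compl_empty_eq double_complement)
 have clD: "closed (- D)" using oD by auto
 have Eb: "?E \<in> sets borel" by (rule erosion_borel[OF oD K(1)]) (use K(2) in blast)
 have ED: "?E \<subseteq> D" using K(2) unfolding erosion_def by force
 have bE: "bounded ?E" using bounded_subset[OF bD ED] .
 define N where "N i = {x\<in>?E. \<forall>a b::nat. b < a \<longrightarrow> x - ((\<rho>/2) / real (Suc b) - (\<rho>/2) / real (Suc a)) *\<^sub>R \<nu> i \<notin> ?E}" for i
 have r2: "0 < \<rho>/2" using rho by simp
 have Nn: "N i \<in> null_sets lborel" for i
  unfolding N_def by (rule porous_null(2)[OF Eb bE r2])
 have "(\<Union>i<n. N i) \<in> null_sets lborel" using Nn by (intro null_sets_UN') auto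
 moreover have "{x\<in>?E. \<not> (\<exists>m::nat. \<forall>k\<in>K. 1 / real (Suc m) \<le> infdist (x + k) (- D))} \<subseteq> (\<Union>i<n. N i)"
 proof
  fix x assume x: "x \<in> {x\<in>?E. \<not> (\<exists>m::nat. \<forall>k\<in>K. 1 / real (Suc m) \<le> infdist (x + k) (- D))}"
  then have xE: "x \<in> ?E" by blast
  have "\<forall>m::nat. \<exists>k\<in>K. infdist (x + k) (- D) < 1 / real (Suc m)" using x by (auto simp: not_le)
  then obtain k where k: "\<And>m. k m \<in> K" "\<And>m. infdist (x + k m) (- D) < 1 / real (Suc m)" by metis
  have inD: "x + k m \<in> D" for m using xE k(1) unfolding erosion_def by blast
  have cc: "compact (closure D)" using bD by (simp add: compact_closure)
  have ic: "\<forall>m. x + k m \<in> closure D" using inD closure_subset by blast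
  obtain y s where y: "y \<in> closure D" "strict_mono s" "((\<lambda>m. x + k m) \<circ> s) \<longlonglongrightarrow> y"
   using compact_def[THEN iffD1, OF cc, THEN spec, of "\<lambda>m. x + k m", THEN mp, OF ic] by blast
  have lim: "(\<lambda>m. x + k (s m)) \<longlonglongrightarrow> y" using y(3) by (simp add: o_def)
  have "(\<lambda>m. infdist (x + k (s m)) (- D)) \<longlonglongrightarrow> infdist y (- D)" by (intro tendsto_infdist lim)
  moreover have "(\<lambda>m. infdist (x + k (s m)) (- D)) \<longlonglongrightarrow> 0"
  proof (rule tendsto_sandwich[OF _ _ tendsto_const])
   have "(\<lambda>m. 1 / real (Suc m)) \<longlonglongrightarrow> 0" using LIMSEQ_inverse_real_of_nat by (simp add: inverse_eq_divide)
   then show "(\<lambda>m. 1 / real (Suc (s m))) \<longlonglongrightarrow> 0" using LIMSEQ_subseq_LIMSEQ[OF _ y(2)] by (force simp: o_def)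
   show "\<forall>\<^sub>F m in sequentially. 0 \<le> infdist (x + k (s m)) (- D)" by (simp add: infdist_nonneg)
   show "\<forall>\<^sub>F m in sequentially. infdist (x + k (s m)) (- D) \<le> 1 / real (Suc (s m))" using k(2) by (simp add: less_imp_le)
  qed
  ultimately have "infdist y (- D) = 0" by (rule LIMSEQ_unique)
  then have "y \<in> - D" using in_closed_iff_infdist_zero[OF clD neD] by blast
  then have yF: "y \<in> frontier D" using y(1) oD by (simp add: frontier_def interior_open)
  then obtain i where i: "i < n" "y \<in> ball (z i) (\<rho>/8)" using cov by blast
  have nn: "norm (\<nu> i) = 1" using cone[OF i(1)] by (simp add: cone_at_def)
  then have nn2: "\<nu> i \<bullet> \<nu> i = 1" by (simp add: norm_eq_1)
  have yb: "y \<in> ball (z i) \<rho>" using i(2) rho by simp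
  have "x - d *\<^sub>R \<nu> i \<notin> ?E" if d: "0 < d" "d < \<rho>/2" for d
  proof -
   let ?w = "\<lambda>m. x + k (s m) - d *\<^sub>R \<nu> i"
   have wl: "?w \<longlonglongrightarrow> y - d *\<^sub>R \<nu> i" by (intro tendsto_intros lim)
   have "y - d *\<^sub>R \<nu> i \<in> ball (z i) \<rho>"
   proof -
    have "dist (z i) (y - d *\<^sub>R \<nu> i) \<le> dist (z i) y + dist y (y - d *\<^sub>R \<nu> i)" by (rule dist_triangle)
    also have "dist y (y - d *\<^sub>R \<nu> i) = d" using d nn by (simp add: dist_norm)
    finally show ?thesis using i(2) d by simp
   qed
   then have ev1: "eventually (\<lambda>m. ?w m \<in> ball (z i) \<rho>) sequentially"
    using topological_tendstoD[OF wl open_ball] by blast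
   have "(\<lambda>m. (y - ?w m) \<bullet> \<nu> i - 1/4 * norm (?w m - y)) \<longlonglongrightarrow> (y - (y - d *\<^sub>R \<nu> i)) \<bullet> \<nu> i - 1/4 * norm (y - d *\<^sub>R \<nu> i - y)"
    by (intro tendsto_intros wl)
   moreover have "0 < (y - (y - d *\<^sub>R \<nu> i)) \<bullet> \<nu> i - 1/4 * norm (y - d *\<^sub>R \<nu> i - y)"
    using d nn nn2 by simp
   ultimately have ev2: "eventually (\<lambda>m. 0 < (y - ?w m) \<bullet> \<nu> i - 1/4 * norm (?w m - y)) sequentially"
    by (rule order_tendstoD)
   obtain m where m: "?w m \<in> ball (z i) \<rho>" "0 < (y - ?w m) \<bullet> \<nu> i - 1/4 * norm (?w m - y)"
    using eventually_happens'[OF sequentially_bot eventually_conj[OF ev1 ev2]] by blast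
   have "?w m \<notin> D"
    by (rule frontier_below[OF oD eps cone[OF i(1)] yF yb m(1)]) (use m(2) in linarith)
   moreover have "?w m = (x - d *\<^sub>R \<nu> i) + k (s m)" by (simp add: algebra_simps)
   ultimately have nD: "(x - d *\<^sub>R \<nu> i) + k (s m) \<notin> D" by (simp only: not_False_eq_True)
   show ?thesis
   proof
    assume "x - d *\<^sub>R \<nu> i \<in> ?E"
    then have all: "\<forall>k\<in>K. (x - d *\<^sub>R \<nu> i) + k \<in> D" by (simp only: erosion_def mem_Collect_eq)
    show False by (rule notE[OF nD bspec[OF all k(1)[of "s m"]]])
   qed
  qed
  then have "x \<in> {x\<in>?E. \<forall>d. 0 < d \<and> d < \<rho>/2 \<longrightarrow> x - d *\<^sub>R \<nu> i \<notin> ?E}" using xE by blast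
  then have "x \<in> N i" using porous_null(1)[OF Eb bE r2] unfolding N_def by blast
  then show "x \<in> (\<Union>i<n. N i)" using i(1) by blast
 qed
 ultimately show ?thesis by blast
qed

section \<open>The radial exponent and one-dimensional projections\<close>

lemma one_minus_cos_add: "1 - cos (x + y) \<le> 2 * (1 - cos x) + 2 * (1 - cos (y::real))"
proof -
 have h: "1 - cos u = 2 * (sin (u/2))\<^sup>2" for u :: real
  using cos_double_sin[of "u/2"] by simp
 have "\<bar>sin ((x + y)/2)\<bar> \<le> \<bar>sin (x/2)\<bar> + \<bar>sin (y/2)\<bar>"
 proof -
  have "\<bar>sin (x/2 + y/2)\<bar> \<le> \<bar>sin (x/2) * cos (y/2)\<bar> + \<bar>cos (x/2) * sin (y/2)\<bar>"
   unfolding sin_add by (rule abs_triangle_ineq)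
  also have "\<dots> \<le> \<bar>sin (x/2)\<bar> * 1 + 1 * \<bar>sin (y/2)\<bar>"
   unfolding abs_mult by (intro add_mono mult_left_mono mult_right_mono) auto
  finally show ?thesis by (simp add: add_divide_distrib)
 qed
 then have "\<bar>sin ((x + y)/2)\<bar>\<^sup>2 \<le> (\<bar>sin (x/2)\<bar> + \<bar>sin (y/2)\<bar>)\<^sup>2" by (intro power_mono) auto
 also have "\<dots> \<le> 2 * (sin (x/2))\<^sup>2 + 2 * (sin (y/2))\<^sup>2"
  using zero_le_power2[of "\<bar>sin (x/2)\<bar> - \<bar>sin (y/2)\<bar>"] by (simp add: power2_eq_square algebra_simps)
 finally show ?thesis unfolding h by simp
qed

text \<open>A single time leaves the exponent undetermined up to a period; all times together do not.\<close>
lemma exp_neg_mult_eq_imp_eq: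
 fixes a b :: complex
 assumes "\<And>t::real. 0 \<le> t ==> exp (- (complex_of_real t * a)) = exp (- (complex_of_real t * b))"
 shows "a = b"
proof (rule ccontr)
 assume ne: "a \<noteq> b"
 define c where "c = b - a"
 have c: "exp (complex_of_real t * c) = 1" if "0 \<le> t" for t
 proof -
  have "exp (complex_of_real t * c) = exp (- (complex_of_real t * a)) / exp (- (complex_of_real t * b))"
   by (simp add: exp_diff[symmetric] c_def algebra_simps)
  then show ?thesis using assms[OF that] by simp
 qed
 have nz: "c \<noteq> 0" using ne by (simp add: c_def)
 define t where "t = pi / norm c"
 have t: "0 < t" using nz by (simp add: t_def)
 have "Re (complex_of_real s * c) = 0 \<and> (\<exists>n. Im (complex_of_real s * c) = of_int (2 * n) * pi)" if "0 \<le> s" for s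
  using c[OF that] by (simp only: exp_eq_1)
 then have re: "Re c = 0" and im: "\<exists>n. t * Im c = of_int (2 * n) * pi"
  using t by (force dest: spec[of _ 1] simp: less_imp_le)+
 have "norm c = \<bar>Im c\<bar>" using re by (simp add: cmod_def)
 moreover have "Im c \<noteq> 0" using nz re by (auto simp: complex_eq_iff)
 ultimately have "\<bar>t * Im c\<bar> = pi" by (simp add: t_def abs_mult)
 moreover obtain n where "t * Im c = of_int (2 * n) * pi" using im by blast
 ultimately have "\<bar>real_of_int (2 * n) * pi\<bar> = pi" by (simp only:)
 then have "\<bar>real_of_int (2 * n)\<bar> * pi = 1 * pi" by (simp only: abs_mult abs_of_pos[OF pi_gt_zero] mult_1)
 then have "\<bar>real_of_int (2 * n)\<bar> = 1" by (simp only: mult_cancel_right pi_neq_zero simp_thms)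
 then have "real_of_int \<bar>2 * n\<bar> = real_of_int 1" by (simp only: of_int_abs of_int_1)
 then have "\<bar>2 * n\<bar> = 1" by (simp only: of_int_eq_iff)
 then show False by presburger
qed

context levy_process
begin

lemma iexp_inner_integrable:
 assumes "0 \<le> t"
 shows "integrable M (\<lambda>w. exp (\<i> * complex_of_real (\<xi> \<bullet> X t w)))"
proof (rule integrable_const_bound[where B=1])
 note [measurable] = measurable_X[OF assms]
 show "(\<lambda>w. exp (\<i> * complex_of_real (\<xi> \<bullet> X t w))) \<in> borel_measurable M" by measurable
qed simp

end

lemma char_exponentD: "char_exponent M X \<psi> ==> 0 \<le> t ==>
  integral\<^sup>L M (\<lambda>w. exp (\<i> * complex_of_real (\<xi> \<bullet> X t w))) = exp (- (complex_of_real t * \<psi> \<xi>))"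
 unfolding char_exponent_def by blast

lemma isotropic_marginal:
 fixes X :: "real => 'w => real^'n"
 assumes L: "levy_process M X" and iso: "isotropic M X" and Q: "rotation_matrix Q" and t: "0 \<le> t"
 shows "distr M borel (\<lambda>w. Q *v X t w) = distr M borel (X t)"
proof -
 interpret levy_process M X by fact
 have cont: "continuous_on UNIV ((*v) Q)" by (rule matrix_vector_mult_linear_continuous_on)
 have Qm: "(*v) Q \<in> borel_measurable borel" by (rule borel_measurable_continuous_onI[OF cont])
 have m1: "(\<lambda>w. \<lambda>t\<in>{0..}. X t w) \<in> M \<rightarrow>\<^sub>M (\<Pi>\<^sub>M t\<in>{0..}. borel)"
  by (rule measurable_restrict) (use measurable_X in auto)
 have m2: "(\<lambda>w. \<lambda>t\<in>{0..}. Q *v X t w) \<in> M \<rightarrow>\<^sub>M (\<Pi>\<^sub>M t\<in>{0..}. borel)"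
  by (rule measurable_restrict) (use measurable_compose[OF measurable_X Qm] in auto)
 have c: "(\<lambda>f. f t) \<in> (\<Pi>\<^sub>M t\<in>{0..}. borel) \<rightarrow>\<^sub>M (borel :: (real^'n) measure)"
  by (rule measurable_component_singleton) (use t in simp)
 have "distr M borel (\<lambda>w. Q *v X t w) = distr (process_law M (\<lambda>t w. Q *v X t w)) borel (\<lambda>f. f t)"
  unfolding process_law_def using t by (subst distr_distr[OF c m2]) (simp add: o_def)
 also have "\<dots> = distr (process_law M X) borel (\<lambda>f. f t)"
  using iso Q unfolding isotropic_def by simp
 also have "\<dots> = distr M borel (X t)"
  unfolding process_law_def using t by (subst distr_distr[OF c m1]) (simp add: o_def)
 finally show ?thesis .
qed

lemma isotropic_exponent_rotation:
 fixes X :: "real => 'w => real^'n"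
 assumes L: "levy_process M X" and iso: "isotropic M X" and ce: "char_exponent M X \<psi>" and Q: "rotation_matrix Q"
 shows "\<psi> (transpose Q *v \<xi>) = \<psi> \<xi>"
proof (rule exp_neg_mult_eq_imp_eq)
 interpret levy_process M X by fact
 fix t :: real assume t: "0 \<le> t"
 have cont: "continuous_on UNIV ((*v) Q)" by (rule matrix_vector_mult_linear_continuous_on)
 have Qm: "(*v) Q \<in> borel_measurable borel" by (rule borel_measurable_continuous_onI[OF cont])
 note [measurable] = measurable_X[OF t]
 let ?e = "\<lambda>x. exp (\<i> * complex_of_real (\<xi> \<bullet> x))"
 have em: "?e \<in> borel_measurable borel" by measurable
 have "exp (- (complex_of_real t * \<psi> (transpose Q *v \<xi>))) = integral\<^sup>L M (\<lambda>w. exp (\<i> * complex_of_real ((transpose Q *v \<xi>) \<bullet> X t w)))"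
  by (rule char_exponentD[OF ce t, symmetric])
 also have "\<dots> = integral\<^sup>L M (\<lambda>w. ?e (Q *v X t w))"
  by (simp add: transpose_matrix_vector dot_lmul_matrix)
 also have "\<dots> = integral\<^sup>L (distr M borel (\<lambda>w. Q *v X t w)) ?e"
  by (rule integral_distr[symmetric]) (use measurable_compose[OF measurable_X[OF t] Qm] em in auto)
 also have "\<dots> = integral\<^sup>L (distr M borel (X t)) ?e"
  by (simp only: isotropic_marginal[OF L iso Q t])
 also have "\<dots> = integral\<^sup>L M (\<lambda>w. ?e (X t w))"
  by (rule integral_distr) (use em in auto)
 also have "\<dots> = exp (- (complex_of_real t * \<psi> \<xi>))"
  by (rule char_exponentD[OF ce t])
 finally show "exp (- (complex_of_real t * \<psi> (transpose Q *v \<xi>))) = exp (- (complex_of_real t * \<psi> \<xi>))" .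
qed

text \<open>In dimension at least two the rotations act transitively on spheres.\<close>
lemma isotropic_exponent_radial:
 fixes X :: "real => 'w => real^'n"
 assumes L: "levy_process M X" and iso: "isotropic M X" and ce: "char_exponent M X \<psi>" and dim: "CARD('n) \<ge> 2"
  and n: "norm \<xi> = norm \<zeta>"
 shows "\<psi> \<xi> = \<psi> \<zeta>"
proof -
 obtain f :: "real^'n => real^'n" where f: "orthogonal_transformation f" "det (matrix f) = 1" "f \<zeta> = \<xi>"
  by (rule rotation_exists[OF dim n[symmetric]])
 have lin: "linear f" using f(1) orthogonal_transformation_linear by blast
 have "rotation_matrix (transpose (matrix f))"
  using f(1,2) unfolding rotation_matrix_def orthogonal_transformation_matrix by simp
 from isotropic_exponent_rotation[OF L iso ce this, of \<zeta>]
 show ?thesis using fun_cong[OF matrix_vector_mul(2)[OF lin], of \<zeta>] f(3) by simp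
qed

lemma exponent_minus:
 fixes X :: "real => 'w => 'a::euclidean_space"
 assumes ce: "char_exponent M X \<psi>"
 shows "\<psi> (- \<xi>) = cnj (\<psi> \<xi>)"
proof (rule exp_neg_mult_eq_imp_eq)
 fix t :: real assume t: "0 \<le> t"
 have "exp (- (complex_of_real t * \<psi> (- \<xi>))) = integral\<^sup>L M (\<lambda>w. exp (\<i> * complex_of_real ((- \<xi>) \<bullet> X t w)))"
  by (rule char_exponentD[OF ce t, symmetric])
 also have "\<dots> = integral\<^sup>L M (\<lambda>w. cnj (exp (\<i> * complex_of_real (\<xi> \<bullet> X t w))))"
  by (simp add: exp_cnj)
 also have "\<dots> = cnj (integral\<^sup>L M (\<lambda>w. exp (\<i> * complex_of_real (\<xi> \<bullet> X t w))))"
  by (rule Bochner_Integration.integral_cnj)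
 also have "\<dots> = cnj (exp (- (complex_of_real t * \<psi> \<xi>)))"
  by (simp only: char_exponentD[OF ce t])
 finally show "exp (- (complex_of_real t * \<psi> (- \<xi>))) = exp (- (complex_of_real t * cnj (\<psi> \<xi>)))"
  by (simp add: exp_cnj)
qed

text \<open>Reflecting \<open>\<xi>\<close> conjugates the exponent, and radiality makes this the same value; so it is real.\<close>
lemma isotropic_exponent_eq_profile:
 fixes X :: "real => 'w => real^'n"
 assumes L: "levy_process M X" and iso: "isotropic M X" and ce: "char_exponent M X \<psi>" and dim: "CARD('n) \<ge> 2"
 shows "\<psi> \<xi> = complex_of_real (radial_profile \<psi> (norm \<xi>))"
proof -
 have "\<psi> (- \<xi>) = \<psi> \<xi>" by (rule isotropic_exponent_radial[OF L iso ce dim]) simp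
 then have "cnj (\<psi> \<xi>) = \<psi> \<xi>" using exponent_minus[OF ce] by metis
 then have r: "\<psi> \<xi> = complex_of_real (Re (\<psi> \<xi>))" by (simp add: complex_eq_iff)
 have "norm (SOME \<zeta>::real^'n. norm \<zeta> = norm \<xi>) = norm \<xi>" by (rule someI[where P="\<lambda>\<zeta>. norm \<zeta> = norm \<xi>"]) simp
 then have "\<psi> (SOME \<zeta>. norm \<zeta> = norm \<xi>) = \<psi> \<xi>" by (rule isotropic_exponent_radial[OF L iso ce dim])
 then show ?thesis using r by (simp add: radial_profile_def)
qed

text \<open>One-dimensional projections of an isotropic process: all of them have the same real exponent \<open>f\<close>.\<close>
locale symmetric_levy = levy_process M Z for M :: "'w measure" and Z :: "real => 'w => real" +
 fixes f :: "real => real"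
 assumes char_Z: "\<And>t b. 0 \<le> t ==> char (distr M borel (Z t)) b = complex_of_real (exp (- (t * f \<bar>b\<bar>)))"
begin

lemma real_distribution_Z: "0 \<le> t ==> real_distribution (distr M borel (Z t))"
 using measurable_X by (intro real_distribution_distr) simp

lemma f_nonneg: "0 \<le> b ==> 0 \<le> f b"
proof -
 assume b: "0 \<le> b"
 interpret R: real_distribution "distr M borel (Z 1)" by (rule real_distribution_Z) simp
 have "norm (char (distr M borel (Z 1)) b) \<le> 1" by (rule R.cmod_char_le_1)
 then show ?thesis using char_Z[of 1 b] b by simp
qed

lemma f_0: "f 0 = 0"
proof -
 interpret R: real_distribution "distr M borel (Z 1)" by (rule real_distribution_Z) simp
 have "char (distr M borel (Z 1)) 0 = 1" by (rule R.char_zero)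
 then have "complex_of_real (exp (- f 0)) = complex_of_real 1" using char_Z[of 1 0] by simp
 then show ?thesis by (simp only: of_real_eq_iff) simp
qed

lemma f_continuous: "isCont (\<lambda>b. f \<bar>b\<bar>) b"
proof -
 interpret R: real_distribution "distr M borel (Z 1)" by (rule real_distribution_Z) simp
 have "isCont (\<lambda>b. Re (char (distr M borel (Z 1)) b)) b"
  by (intro isCont_Re R.isCont_char)
 moreover have "Re (char (distr M borel (Z 1)) b) \<noteq> 0" by (simp add: char_Z)
 ultimately have "isCont (\<lambda>b. - ln (Re (char (distr M borel (Z 1)) b))) b"
  by (intro isCont_minus isCont_ln')
 then show ?thesis by (simp add: char_Z)
qed

end

lemma levy_projection:
 fixes X :: "real => 'w => 'a::euclidean_space"
 assumes L: "levy_process M X"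
 shows "levy_process M (\<lambda>t w. X t w \<bullet> \<nu>)"
proof -
 interpret levy_process M X by fact
 have im: "(\<lambda>x. x \<bullet> \<nu>) \<in> borel_measurable borel" by measurable
 show ?thesis
 proof (intro levy_process.intro levy_process_axioms.intro prob_space_axioms)
  show "(\<lambda>w. X t w \<bullet> \<nu>) \<in> borel_measurable M" if "0 \<le> t" for t
   using measurable_X[OF that] by measurable
  show "AE w in M. X 0 w \<bullet> \<nu> = 0" using start_0 by eventually_elim simp
  show "cadlag (\<lambda>t. X t w \<bullet> \<nu>)" if "w \<in> space M" for w
   unfolding cadlag_def
  proof (intro conjI allI impI)
   note c = cadlag_paths[OF that, unfolded cadlag_def]
   show "((\<lambda>t. X t w \<bullet> \<nu>) \<longlongrightarrow> X t w \<bullet> \<nu>) (at_right t)" if "0 \<le> t" for t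
    using c that by (intro tendsto_inner tendsto_const) blast
   show "\<exists>l. ((\<lambda>t. X t w \<bullet> \<nu>) \<longlongrightarrow> l) (at_left t)" if t: "0 < t" for t
   proof -
    obtain l where "((\<lambda>t. X t w) \<longlongrightarrow> l) (at_left t)" using c t by blast
    then have "((\<lambda>t. X t w \<bullet> \<nu>) \<longlongrightarrow> l \<bullet> \<nu>) (at_left t)" by (intro tendsto_inner tendsto_const)
    then show ?thesis by blast
   qed
  qed
  show "indep_vars (\<lambda>_. borel) (\<lambda>i w. X (t (Suc i)) w \<bullet> \<nu> - X (t i) w \<bullet> \<nu>) {..<n}"
   if "0 \<le> t 0" "\<And>i. i < n ==> t i \<le> t (Suc i)" for t :: "nat => real" and n
  proof -
   have "indep_vars (\<lambda>_. borel) (\<lambda>i w. (X (t (Suc i)) w - X (t i) w) \<bullet> \<nu>) {..<n}"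
    by (rule indep_vars_compose2[OF indep_increments[OF that]]) (use im in auto)
   then show ?thesis by (simp add: inner_diff_left)
  qed
  show "distr M borel (\<lambda>w. X t w \<bullet> \<nu> - X s w \<bullet> \<nu>) = distr M borel (\<lambda>w. X (t - s) w \<bullet> \<nu>)"
   if st: "0 \<le> s" "s \<le> t" for s t
  proof -
   have m: "(\<lambda>w. X t w - X s w) \<in> borel_measurable M" "X (t - s) \<in> borel_measurable M"
    using measurable_X st by (auto intro!: borel_measurable_diff)
   have "distr M borel (\<lambda>w. X t w \<bullet> \<nu> - X s w \<bullet> \<nu>) = distr (distr M borel (\<lambda>w. X t w - X s w)) borel (\<lambda>x. x \<bullet> \<nu>)"
    by (subst distr_distr[OF im m(1)]) (simp add: o_def inner_diff_left)
   also have "\<dots> = distr (distr M borel (X (t - s))) borel (\<lambda>x. x \<bullet> \<nu>)"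
    using stationary_increments[OF st] by simp
   also have "\<dots> = distr M borel (\<lambda>w. X (t - s) w \<bullet> \<nu>)"
    by (subst distr_distr[OF im m(2)]) (simp add: o_def)
   finally show ?thesis .
  qed
 qed
qed

lemma char_projection:
 fixes X :: "real => 'w => 'a::euclidean_space"
 assumes L: "levy_process M X" and t: "0 \<le> t"
 shows "char (distr M borel (\<lambda>w. X t w \<bullet> \<nu>)) b = integral\<^sup>L M (\<lambda>w. exp (\<i> * complex_of_real ((b *\<^sub>R \<nu>) \<bullet> X t w)))"
proof -
 interpret levy_process M X by fact
 note [measurable] = measurable_X[OF t]
 show ?thesis
  unfolding char_def by (subst integral_distr) (auto simp: inner_commute mult.commute)
qed

lemma isotropic_projection:
 fixes X :: "real => 'w => real^'n"
 assumes L: "levy_process M X" and iso: "isotropic M X" and ce: "char_exponent M X \<psi>" and dim: "CARD('n) \<ge> 2"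
  and n: "norm \<nu> = 1"
 shows "symmetric_levy M (\<lambda>t w. X t w \<bullet> \<nu>) (radial_profile \<psi>)"
proof (intro symmetric_levy.intro symmetric_levy_axioms.intro levy_projection L)
 fix t b :: real assume t: "0 \<le> t"
 have "char (distr M borel (\<lambda>w. X t w \<bullet> \<nu>)) b = exp (- (complex_of_real t * \<psi> (b *\<^sub>R \<nu>)))"
  unfolding char_projection[OF L t] by (rule char_exponentD[OF ce t])
 also have "\<psi> (b *\<^sub>R \<nu>) = complex_of_real (radial_profile \<psi> \<bar>b\<bar>)"
  using isotropic_exponent_eq_profile[OF L iso ce dim, of "b *\<^sub>R \<nu>"] n by simp
 finally show "char (distr M borel (\<lambda>w. X t w \<bullet> \<nu>)) b = complex_of_real (exp (- (t * radial_profile \<psi> \<bar>b\<bar>)))"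
  by (simp flip: of_real_mult of_real_minus exp_of_real)
qed

text \<open>A vector of length \<open>b \<le> 2 * a\<close> is the sum of two vectors of length \<open>a\<close>.  The inequality for \<open>1 - cos\<close> of a sum, applied under the
expectation and divided by \<open>t \<rightarrow> 0\<close>, gives the claim.  It replaces monotonicity, which \<open>f\<close> may lack.\<close>
lemma profile_doubling:
 fixes X :: "real => 'w => real^'n"
 assumes L: "levy_process M X" and iso: "isotropic M X" and ce: "char_exponent M X \<psi>" and dim: "CARD('n) \<ge> 2"
  and ab: "0 \<le> b" "b \<le> 2 * a"
 shows "radial_profile \<psi> b \<le> 4 * radial_profile \<psi> a"
proof -
 interpret levy_process M X by fact
 let ?f = "radial_profile \<psi>"
 obtain i j :: 'n where ij: "i \<noteq> j"
 proof -
  have "\<not> (\<forall>i j :: 'n. i = j)"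
  proof
   assume *: "\<forall>i j :: 'n. i = j"
   have "CARD('n) \<le> Suc 0" by (rule iffD2[OF card_le_Suc0_iff_eq[OF finite]]) (use * in blast)
   then show False using dim by simp
  qed
  then show ?thesis using that by blast
 qed
 define s where "s = sqrt (a\<^sup>2 - (b/2)\<^sup>2)"
 have "(b/2)\<^sup>2 \<le> a\<^sup>2" using ab by (intro power_mono) auto
 then have s2: "s\<^sup>2 = a\<^sup>2 - (b/2)\<^sup>2" by (simp add: s_def)
 have a0: "0 \<le> a" using ab by linarith
 define \<xi> where "\<xi> = axis i (b/2) + axis j s"
 define \<zeta> where "\<zeta> = axis i (b/2) - (axis j s :: real^'n)"
 have o: "axis i u \<bullet> (axis j v :: real^'n) = 0" "axis j v \<bullet> (axis i u :: real^'n) = 0" for u v :: real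
  using ij by (simp_all add: inner_axis_axis)
 have "(norm \<xi>)\<^sup>2 = a\<^sup>2" "(norm \<zeta>)\<^sup>2 = a\<^sup>2"
  unfolding power2_norm_eq_inner \<xi>_def \<zeta>_def using s2 ij ij[symmetric]
  by (simp_all add: inner_add_left inner_add_right inner_diff_left inner_diff_right o inner_axis_axis power2_eq_square)
 then have n: "norm \<xi> = a" "norm \<zeta> = a" using a0 by (simp_all add: power2_eq_iff_nonneg)
 have "\<xi> + \<zeta> = axis i b" by (simp add: \<xi>_def \<zeta>_def vec_eq_iff axis_def)
 moreover have "norm (axis i b :: real^'n) = b"
  using ab by (simp add: norm_eq_sqrt_inner inner_axis_axis)
 ultimately have nb: "norm (\<xi> + \<zeta>) = b" by (simp only:)
 have c: "integrable M (\<lambda>w. cos (v \<bullet> X t w))"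
   "integral\<^sup>L M (\<lambda>w. cos (v \<bullet> X t w)) = exp (- (t * ?f (norm v)))" if t: "0 \<le> t" for t v
 proof -
  have eq: "Re (exp (\<i> * complex_of_real (v \<bullet> X t w))) = cos (v \<bullet> X t w)" for w by (simp add: Re_exp)
  have int: "integrable M (\<lambda>w. exp (\<i> * complex_of_real (v \<bullet> X t w)))" by (rule iexp_inner_integrable[OF t])
  show "integrable M (\<lambda>w. cos (v \<bullet> X t w))" using integrable_Re[OF int] by (simp only: eq)
  have "integral\<^sup>L M (\<lambda>w. cos (v \<bullet> X t w)) = Re (integral\<^sup>L M (\<lambda>w. exp (\<i> * complex_of_real (v \<bullet> X t w))))"
   using integral_Re[OF int] by (simp only: eq)
  also have "\<dots> = Re (exp (- (complex_of_real t * \<psi> v)))" by (simp only: char_exponentD[OF ce t])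
  also have "\<dots> = Re (complex_of_real (exp (- (t * ?f (norm v)))))"
   by (subst isotropic_exponent_eq_profile[OF L iso ce dim]) (simp flip: of_real_mult of_real_minus exp_of_real del: Re_complex_of_real)
  finally show "integral\<^sup>L M (\<lambda>w. cos (v \<bullet> X t w)) = exp (- (t * ?f (norm v)))" by simp
 qed
 have ineq: "(1 - exp (- (t * ?f b))) / t \<le> 4 * ?f a" if t: "0 < t" for t
 proof -
  have t0: "0 \<le> t" using t by simp
  note ci = c(1)[OF t0]
  have "1 - exp (- (t * ?f b)) = integral\<^sup>L M (\<lambda>w. 1 - cos ((\<xi> + \<zeta>) \<bullet> X t w))"
   using c(2)[OF t0, of "\<xi> + \<zeta>"] nb by (subst Bochner_Integration.integral_diff) (auto intro: ci simp: prob_space)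
  also have "\<dots> \<le> integral\<^sup>L M (\<lambda>w. 2 * (1 - cos (\<xi> \<bullet> X t w)) + 2 * (1 - cos (\<zeta> \<bullet> X t w)))"
  proof (rule integral_mono)
   show "integrable M (\<lambda>w. 1 - cos ((\<xi> + \<zeta>) \<bullet> X t w))"
    by (intro Bochner_Integration.integrable_diff integrable_const ci)
   show "integrable M (\<lambda>w. 2 * (1 - cos (\<xi> \<bullet> X t w)) + 2 * (1 - cos (\<zeta> \<bullet> X t w)))"
    by (intro Bochner_Integration.integrable_add Bochner_Integration.integrable_diff integrable_mult_right integrable_const ci)
   show "1 - cos ((\<xi> + \<zeta>) \<bullet> X t w) \<le> 2 * (1 - cos (\<xi> \<bullet> X t w)) + 2 * (1 - cos (\<zeta> \<bullet> X t w))" for w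
    unfolding inner_add_left by (rule one_minus_cos_add)
  qed
  also have "\<dots> = 2 * (1 - exp (- (t * ?f a))) + 2 * (1 - exp (- (t * ?f a)))"
   using c(2)[OF t0, of \<xi>] c(2)[OF t0, of \<zeta>] n ci[of \<xi>] ci[of \<zeta>] by (simp add: prob_space)
  also have "\<dots> \<le> 4 * (t * ?f a)"
  proof -
   define y where "y = t * ?f a"
   have "1 + - y \<le> exp (- y)" by (rule exp_ge_add_one_self)
   then have "1 - exp (- y) \<le> y" by simp
   then show ?thesis unfolding y_def[symmetric] by simp
  qed
  finally show ?thesis using t by (simp add: field_simps)
 qed
 have "((\<lambda>t. exp (- (t * ?f b))) has_real_derivative - ?f b * exp (- (0 * ?f b))) (at 0)"
  by (auto intro!: derivative_eq_intros)
 then have "((\<lambda>t. (exp (- (t * ?f b)) - 1) / t) \<longlongrightarrow> - ?f b) (at 0)" by (simp add: DERIV_def)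
 then have "((\<lambda>t. - ((exp (- (t * ?f b)) - 1) / t)) \<longlongrightarrow> - (- ?f b)) (at 0)" by (rule tendsto_minus)
 then have "((\<lambda>t. - ((exp (- (t * ?f b)) - 1) / t)) \<longlongrightarrow> - (- ?f b)) (at_right 0)"
  by (rule tendsto_mono[OF at_le[OF subset_UNIV]])
 then have "((\<lambda>t. - ((exp (- (t * ?f b)) - 1) / t)) \<longlongrightarrow> ?f b) (at_right 0)"
  by (simp only: minus_minus)
 then have lim: "((\<lambda>t. (1 - exp (- (t * ?f b))) / t) \<longlongrightarrow> ?f b) (at_right 0)"
  by (rule Lim_transform_eventually) (rule always_eventually, simp only: minus_divide_left minus_diff_eq simp_thms)
 show ?thesis
 proof (rule tendsto_upperbound[OF lim])
  show "\<forall>\<^sub>F t in at_right 0. (1 - exp (- (t * ?f b))) / t \<le> 4 * ?f a"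
   using eventually_at_right_less[of "0::real"] by eventually_elim (rule ineq)
 qed simp
qed

section \<open>First passage and truncation inequalities\<close>

definition psum :: "(nat => 'w => real) => nat => nat => 'w => real" where
 "psum D j k w = (\<Sum>i\<in>{j..<k}. D i w)"

lemma psum_split: "j \<le> k ==> psum D 0 k w = psum D 0 j w + psum D j k w"
 unfolding psum_def by (simp add: sum.atLeastLessThan_concat)

context prob_space
begin

lemma indep_vars_split_prob:
 fixes D :: "nat => 'a => real"
 assumes ind: "indep_vars (\<lambda>_. borel) D {..<n}" and k: "k \<le> n"
  and P: "Measurable.pred (Pi\<^sub>M {..<k} (\<lambda>_. borel)) P" and Q: "Measurable.pred (Pi\<^sub>M {k..<n} (\<lambda>_. borel)) Q"
 shows "prob {w\<in>space M. P (restrict (\<lambda>i. D i w) {..<k}) \<and> Q (restrict (\<lambda>i. D i w) {k..<n})}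
   = prob {w\<in>space M. P (restrict (\<lambda>i. D i w) {..<k})} * prob {w\<in>space M. Q (restrict (\<lambda>i. D i w) {k..<n})}"
proof -
 let ?X = "\<lambda>w. restrict (\<lambda>i. D i w) {..<k}" and ?Y = "\<lambda>w. restrict (\<lambda>i. D i w) {k..<n}"
 let ?A = "{x\<in>space (Pi\<^sub>M {..<k} (\<lambda>_. borel)). P x}" and ?B = "{x\<in>space (Pi\<^sub>M {k..<n} (\<lambda>_. borel)). Q x}"
 have iv: "indep_var (Pi\<^sub>M {..<k} (\<lambda>_. borel)) ?X (Pi\<^sub>M {k..<n} (\<lambda>_. borel)) ?Y"
  by (rule indep_var_restrict[OF ind]) (use k in auto)
 have X: "?X \<in> M \<rightarrow>\<^sub>M Pi\<^sub>M {..<k} (\<lambda>_. borel)" and Y: "?Y \<in> M \<rightarrow>\<^sub>M Pi\<^sub>M {k..<n} (\<lambda>_. borel)"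
  using indep_var_rv1[OF iv] indep_var_rv2[OF iv] by auto
 have A: "?A \<in> sets (Pi\<^sub>M {..<k} (\<lambda>_. borel))" using P by simp
 have B: "?B \<in> sets (Pi\<^sub>M {k..<n} (\<lambda>_. borel))" using Q by simp
 have "(\<lambda>w. (?X w, ?Y w)) -` (?A \<times> ?B) \<inter> space M = {w\<in>space M. P (?X w) \<and> Q (?Y w)}"
  using measurable_space[OF X] measurable_space[OF Y] by auto
 moreover have "?X -` ?A \<inter> space M = {w\<in>space M. P (?X w)}" using measurable_space[OF X] by auto
 moreover have "?Y -` ?B \<inter> space M = {w\<in>space M. Q (?Y w)}" using measurable_space[OF Y] by auto
 ultimately show ?thesis using indep_varD[OF iv A B] by simp
qed

text \<open>Decompose at the first index where the partial sums exceed \<open>x\<close>.  The further increment up to \<open>\<sigma> k\<close> is independent of this event and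
is at least \<open>- \<epsilon>\<close> with probability \<open>1 - q\<close>.  With \<open>\<sigma> k = n\<close> and \<open>\<epsilon> = 0\<close> this is Levy's maximal inequality; with \<open>\<sigma> k\<close> the next point
of a coarser grid it compares two grids.\<close>
lemma first_passage:
 fixes D :: "nat => 'a => real"
 assumes ind: "indep_vars (\<lambda>_. borel) D {..<n}"
  and \<sigma>: "\<And>k. k \<le> n ==> k \<le> \<sigma> k \<and> \<sigma> k \<le> n"
  and q: "\<And>k. k \<le> n ==> prob {w\<in>space M. psum D k (\<sigma> k) w < - \<epsilon>} \<le> q"
 shows "(1 - q) * prob {w\<in>space M. \<exists>k\<le>n. psum D 0 k w > x}
  \<le> prob {w\<in>space M. \<exists>k\<le>n. psum D 0 (\<sigma> k) w > x - \<epsilon>}"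
proof -
 have rv: "D i \<in> borel_measurable M" if "i < n" for i
  using ind that unfolding indep_vars_def by auto
 have pm: "psum D j k \<in> borel_measurable M" if "k \<le> n" for j k
  unfolding psum_def by (intro borel_measurable_sum) (use that rv in auto)
 let ?A = "\<lambda>k. {w\<in>space M. (\<forall>j\<in>{..<k}. psum D 0 j w \<le> x) \<and> psum D 0 k w > x}"
 let ?AB = "\<lambda>k. {w\<in>space M. ((\<forall>j\<in>{..<k}. psum D 0 j w \<le> x) \<and> psum D 0 k w > x) \<and> - \<epsilon> \<le> psum D k (\<sigma> k) w}"
 have pj: "Measurable.pred M (\<lambda>w. \<forall>j\<in>{..<k}. psum D 0 j w \<le> x)" if "k \<le> n" for k
  by (rule pred_intros_finite) (use that pm in auto)
 have Am: "?A k \<in> events" if k: "k \<le> n" for k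
 proof -
  note [measurable] = pj[OF k] pm[OF k]
  show ?thesis by measurable
 qed
 have ABm: "?AB k \<in> events" if k: "k \<le> n" for k
 proof -
  have [measurable]: "psum D k (\<sigma> k) \<in> borel_measurable M" by (rule pm) (use \<sigma>[OF k] in simp)
  note [measurable] = pj[OF k] pm[OF k]
  show ?thesis by measurable
 qed
 have AB: "(1 - q) * prob (?A k) \<le> prob (?AB k)" if k: "k \<le> n" for k
 proof -
  let ?P = "\<lambda>f :: nat => real. (\<forall>j\<in>{..<k}. (\<Sum>i\<in>{0..<j}. f i) \<le> x) \<and> (\<Sum>i\<in>{0..<k}. f i) > x"
  let ?Q = "\<lambda>f :: nat => real. - \<epsilon> \<le> (\<Sum>i\<in>{k..<\<sigma> k}. f i)"
  have s1: "(\<lambda>f. \<Sum>i\<in>{0..<j}. f i) \<in> borel_measurable (Pi\<^sub>M {..<k} (\<lambda>_. borel :: real measure))" if "j \<le> k" for j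
   by (intro borel_measurable_sum measurable_component_singleton) (use that in auto)
  have s2: "(\<lambda>f. \<Sum>i\<in>{k..<\<sigma> k}. f i) \<in> borel_measurable (Pi\<^sub>M {k..<n} (\<lambda>_. borel :: real measure))"
   by (intro borel_measurable_sum measurable_component_singleton) (use \<sigma>[OF k] in auto)
  have P1: "Measurable.pred (Pi\<^sub>M {..<k} (\<lambda>_. borel)) (\<lambda>f. \<forall>j\<in>{..<k}. (\<Sum>i\<in>{0..<j}. f i) \<le> x)"
   by (rule pred_intros_finite) (use s1 in auto)
  have P: "Measurable.pred (Pi\<^sub>M {..<k} (\<lambda>_. borel)) ?P" using P1 s1[of k] by measurable
  have Q: "Measurable.pred (Pi\<^sub>M {k..<n} (\<lambda>_. borel)) ?Q" using s2 by measurable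
  have eP: "?P (restrict (\<lambda>i. D i w) {..<k}) \<longleftrightarrow> (\<forall>j\<in>{..<k}. psum D 0 j w \<le> x) \<and> psum D 0 k w > x" for w
  proof -
   have "(\<Sum>i\<in>{0..<j}. restrict (\<lambda>i. D i w) {..<k} i) = psum D 0 j w" if "j \<le> k" for j
    unfolding psum_def by (rule sum.cong) (use that in auto)
   then show ?thesis by simp
  qed
  have eQ: "?Q (restrict (\<lambda>i. D i w) {k..<n}) \<longleftrightarrow> - \<epsilon> \<le> psum D k (\<sigma> k) w" for w
  proof -
   have "(\<Sum>i\<in>{k..<\<sigma> k}. restrict (\<lambda>i. D i w) {k..<n} i) = psum D k (\<sigma> k) w"
    unfolding psum_def by (rule sum.cong) (use \<sigma>[OF k] in auto)
   then show ?thesis by simp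
  qed
  have "prob (?AB k) = prob (?A k) * prob {w\<in>space M. - \<epsilon> \<le> psum D k (\<sigma> k) w}"
   using indep_vars_split_prob[OF ind k P Q] unfolding eP eQ .
  moreover have "prob {w\<in>space M. - \<epsilon> \<le> psum D k (\<sigma> k) w} = 1 - prob {w\<in>space M. psum D k (\<sigma> k) w < - \<epsilon>}"
  proof -
   have "{w\<in>space M. psum D k (\<sigma> k) w < - \<epsilon>} \<in> events"
   proof -
    have [measurable]: "psum D k (\<sigma> k) \<in> borel_measurable M" by (rule pm) (use \<sigma>[OF k] in simp)
    show ?thesis by measurable
   qed
   moreover have "{w\<in>space M. - \<epsilon> \<le> psum D k (\<sigma> k) w} = space M - {w\<in>space M. psum D k (\<sigma> k) w < - \<epsilon>}" by auto
   ultimately show ?thesis using prob_compl by simp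
  qed
  moreover have "1 - q \<le> 1 - prob {w\<in>space M. psum D k (\<sigma> k) w < - \<epsilon>}" using q[OF k] by simp
  ultimately have e: "prob (?AB k) = prob (?A k) * prob {w\<in>space M. - \<epsilon> \<le> psum D k (\<sigma> k) w}"
   and le: "1 - q \<le> prob {w\<in>space M. - \<epsilon> \<le> psum D k (\<sigma> k) w}" by (simp_all only:)
  show ?thesis unfolding e mult.commute[of "prob (?A k)"] by (rule mult_right_mono[OF le measure_nonneg])
 qed
 have disj: "disjoint_family_on ?A {..n}" "disjoint_family_on ?AB {..n}"
 proof -
  have *: "j = k" if "\<forall>i\<in>{..<k}. psum D 0 i w \<le> x" "psum D 0 k w > x" "\<forall>i\<in>{..<j}. psum D 0 i w \<le> x" "psum D 0 j w > x" for j k w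
   using that by (metis lessThan_iff linorder_neqE_nat not_le)
  show "disjoint_family_on ?A {..n}" "disjoint_family_on ?AB {..n}"
   unfolding disjoint_family_on_def using * by blast+
 qed
 have un: "{w\<in>space M. \<exists>k\<le>n. psum D 0 k w > x} = (\<Union>k\<in>{..n}. ?A k)"
 proof (intro equalityI subsetI)
  fix w assume w: "w \<in> {w\<in>space M. \<exists>k\<le>n. psum D 0 k w > x}"
  then have ex: "\<exists>k. k \<le> n \<and> psum D 0 k w > x" by blast
  define k where "k = (LEAST k. k \<le> n \<and> psum D 0 k w > x)"
  have k: "k \<le> n" "psum D 0 k w > x" using LeastI_ex[OF ex] unfolding k_def by auto
  have "psum D 0 j w \<le> x" if "j < k" for j
   using not_less_Least[of j "\<lambda>k. k \<le> n \<and> psum D 0 k w > x"] that k(1) unfolding k_def by (meson le_trans less_imp_le not_le)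
  then show "w \<in> (\<Union>k\<in>{..n}. ?A k)" using k w by auto
 qed auto
 have "(1 - q) * prob {w\<in>space M. \<exists>k\<le>n. psum D 0 k w > x} = (1 - q) * (\<Sum>k\<in>{..n}. prob (?A k))"
  unfolding un by (subst finite_measure_finite_Union) (use Am disj in auto)
 also have "\<dots> = (\<Sum>k\<in>{..n}. (1 - q) * prob (?A k))" by (rule sum_distrib_left)
 also have "\<dots> \<le> (\<Sum>k\<in>{..n}. prob (?AB k))" by (rule sum_mono) (use AB in auto)
 also have "\<dots> = prob (\<Union>k\<in>{..n}. ?AB k)"
  by (subst finite_measure_finite_Union) (use ABm disj in auto)
 also have "\<dots> \<le> prob {w\<in>space M. \<exists>k\<le>n. psum D 0 (\<sigma> k) w > x - \<epsilon>}"
 proof (rule finite_measure_mono)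
  show "(\<Union>k\<in>{..n}. ?AB k) \<subseteq> {w\<in>space M. \<exists>k\<le>n. psum D 0 (\<sigma> k) w > x - \<epsilon>}"
  proof
   fix w assume "w \<in> (\<Union>k\<in>{..n}. ?AB k)"
   then obtain k where k: "k \<le> n" "w \<in> space M" "psum D 0 k w > x" "- \<epsilon> \<le> psum D k (\<sigma> k) w" by auto
   then have "psum D 0 (\<sigma> k) w > x - \<epsilon>" using psum_split[of k "\<sigma> k" D w] \<sigma>[OF k(1)] by simp
   then show "w \<in> {w\<in>space M. \<exists>k\<le>n. psum D 0 (\<sigma> k) w > x - \<epsilon>}" using k by blast
  qed
  have "{w\<in>space M. \<exists>k\<in>{..n}. psum D 0 (\<sigma> k) w > x - \<epsilon>} \<in> events"
  proof (rule sets.sets_Collect_finite_Ex)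
   fix k assume "k \<in> {..n}"
   then have [measurable]: "psum D 0 (\<sigma> k) \<in> borel_measurable M" using pm \<sigma> by simp
   show "{w\<in>space M. psum D 0 (\<sigma> k) w > x - \<epsilon>} \<in> events" by measurable
  qed simp
  then show "{w\<in>space M. \<exists>k\<le>n. psum D 0 (\<sigma> k) w > x - \<epsilon>} \<in> events"
   by (simp only: Bex_def atMost_iff)
 qed
 finally show ?thesis .
qed

text \<open>Average \<open>1 - cos (v * Z)\<close> over \<open>\<bar>v\<bar> \<le> u\<close>: on the event in question the average is at least one half.\<close>
lemma prob_abs_ge_le_char:
 fixes Z :: "'a => real"
 assumes Z[measurable]: "Z \<in> borel_measurable M" and u: "0 < u" and S: "0 \<le> S"
  and ch: "\<And>v. \<bar>v\<bar> \<le> u ==> 1 - Re (char (distr M borel Z) v) \<le> S"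
 shows "prob {w\<in>space M. 2 / u \<le> \<bar>Z w\<bar>} \<le> 2 * S"
proof -
 interpret P: pair_sigma_finite M lborel ..
 let ?E = "{w\<in>space M. 2 / u \<le> \<bar>Z w\<bar>}"
 have E: "?E \<in> events" by measurable
 have low: "ennreal u * indicator ?E w \<le> (\<integral>\<^sup>+v. ennreal (1 - cos (v * Z w)) * indicator {-u..u} v \<partial>lborel)" for w
 proof (cases "w \<in> ?E")
  case True
  define x where "x = Z w"
  have xu: "2 / u \<le> \<bar>x\<bar>" using True by (simp add: x_def)
  have "0 < 2 / u" using u by simp
  then have x0: "x \<noteq> 0" using xu by force
  have "(\<integral>\<^sup>+v. ennreal (1 - cos (v * x)) * indicator {-u..u} v \<partial>lborel) = ennreal ((u - sin (u * x) / x) - (- u - sin (- u * x) / x))"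
  proof (rule nn_integral_FTC_Icc[where F="\<lambda>v. v - sin (v * x) / x"])
   show "((\<lambda>v. v - sin (v * x) / x) has_real_derivative 1 - cos (v * x)) (at v)" for v
    using x0 by (auto intro!: derivative_eq_intros)
   show "- u \<le> u" using u by simp
  qed auto
  moreover have "u \<le> (u - sin (u * x) / x) - (- u - sin (- u * x) / x)"
  proof -
   have "\<bar>sin (u * x) / x\<bar> \<le> 1 / \<bar>x\<bar>" by (simp add: divide_right_mono)
   also have "\<dots> \<le> u / 2" using xu u x0 by (simp add: field_simps)
   finally have "sin (u * x) / x \<le> u / 2" by linarith
   then have "u / 2 \<le> u - sin (u * x) / x" by linarith
   moreover have "- u - sin (- u * x) / x = - (u - sin (u * x) / x)" by simp
   ultimately show ?thesis by linarith
  qed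
  ultimately show ?thesis using True by (simp add: x_def ennreal_leI)
 qed simp
 have cosint: "integrable M (\<lambda>w. cos (v * Z w))" for v
  by (rule integrable_const_bound[where B=1]) auto
 have ex: "(\<integral>\<^sup>+w. ennreal (1 - cos (v * Z w)) \<partial>M) = ennreal (1 - Re (char (distr M borel Z) v))" for v
 proof -
  have "(\<integral>\<^sup>+w. ennreal (1 - cos (v * Z w)) \<partial>M) = ennreal (integral\<^sup>L M (\<lambda>w. 1 - cos (v * Z w)))"
   by (rule nn_integral_eq_integral) (auto intro!: cosint)
  also have "integral\<^sup>L M (\<lambda>w. 1 - cos (v * Z w)) = 1 - integral\<^sup>L M (\<lambda>w. cos (v * Z w))"
   by (subst Bochner_Integration.integral_diff) (auto intro: cosint simp: prob_space)
  also have "integral\<^sup>L M (\<lambda>w. cos (v * Z w)) = Re (char (distr M borel Z) v)"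
  proof -
   have int: "integrable M (\<lambda>w. iexp (v * Z w))"
    by (rule integrable_const_bound[where B=1]) auto
   have "char (distr M borel Z) v = integral\<^sup>L M (\<lambda>w. iexp (v * Z w))"
    unfolding char_def by (subst integral_distr) auto
   then have "Re (char (distr M borel Z) v) = integral\<^sup>L M (\<lambda>w. Re (iexp (v * Z w)))"
    using integral_Re[OF int] by simp
   then show ?thesis by (simp add: Re_exp)
  qed
  finally show ?thesis .
 qed
 have "ennreal u * emeasure M ?E = (\<integral>\<^sup>+w. ennreal u * indicator ?E w \<partial>M)"
  using E by (subst nn_integral_cmult_indicator) auto
 also have "\<dots> \<le> (\<integral>\<^sup>+w. (\<integral>\<^sup>+v. ennreal (1 - cos (v * Z w)) * indicator {-u..u} v \<partial>lborel) \<partial>M)"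
  by (rule nn_integral_mono) (rule low)
 also have "\<dots> = (\<integral>\<^sup>+v. (\<integral>\<^sup>+w. ennreal (1 - cos (v * Z w)) * indicator {-u..u} v \<partial>M) \<partial>lborel)"
  by (rule P.Fubini'[symmetric]) measurable
 also have "\<dots> = (\<integral>\<^sup>+v. ennreal (1 - Re (char (distr M borel Z) v)) * indicator {-u..u} v \<partial>lborel)"
  by (intro nn_integral_cong) (subst nn_integral_multc, auto simp: ex)
 also have "\<dots> \<le> (\<integral>\<^sup>+v. ennreal S * indicator {-u..u} v \<partial>lborel)"
  by (intro nn_integral_mono) (auto simp: indicator_def intro!: ennreal_leI ch)
 also have "\<dots> = ennreal S * ennreal (2 * u)"
  using u by (subst nn_integral_cmult_indicator) auto
 finally have "ennreal u * ennreal (prob ?E) \<le> ennreal S * ennreal (2 * u)"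
  by (simp add: emeasure_eq_measure)
 then have "u * prob ?E \<le> S * (2 * u)"
  using u S by (simp add: ennreal_mult'[symmetric])
 then show ?thesis using u by simp
qed

end

section \<open>The heat content as an expected volume\<close>

definition path_range :: "(real => 'w => 'a) => real => 'w => 'a set" where
 "path_range X t w = (\<lambda>u. X u w) ` tgrid t"

lemma countable_path_range: "countable (path_range X t w)"
 unfolding path_range_def by (intro countable_image countable_tgrid)

text \<open>The positive distance from the complement survives the passage from grid times to all times, and by right continuity the path stays in \<open>D\<close> a little longer than \<open>t\<close>.\<close>
lemma exit_time_gt_if:
 fixes D :: "'a::euclidean_space set"
 assumes oD: "open D" and ne: "- D \<noteq> {}" and f: "cadlag f" and t: "0 < t" and \<delta>: "0 < \<delta>"
  and grid: "\<And>u. u \<in> tgrid t ==> \<delta> \<le> infdist (x + f u) (- D)"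
 shows "ereal t < exit_time D (\<lambda>s. x + f s)"
proof -
 have clD: "closed (- D)" using oD by auto
 have inD: "x + f s \<in> D" if s: "0 \<le> s" "s \<le> t" for s
 proof -
  have "closed {y. \<delta> \<le> infdist (x + y) (- D)}" by (intro closed_Collect_le continuous_intros)
  then have "f s \<in> {y. \<delta> \<le> infdist (x + y) (- D)}"
   by (rule cadlag_closed_tgrid[OF f _ _ s]) (use grid in blast)
  then have "infdist (x + f s) (- D) \<noteq> 0" using \<delta> by simp
  then show ?thesis using in_closed_iff_infdist_zero[OF clD ne] by blast
 qed
 have "(f \<longlongrightarrow> f t) (at_right t)" using f t unfolding cadlag_def by simp
 then have "((\<lambda>s. x + f s) \<longlongrightarrow> x + f t) (at_right t)" by (intro tendsto_intros)
 then have "eventually (\<lambda>s. x + f s \<in> D) (at_right t)"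
  using topological_tendstoD[OF _ oD] inD[of t] t by simp
 then obtain b where b: "t < b" "\<And>s. t < s ==> s < b ==> x + f s \<in> D"
  unfolding eventually_at_right_field by blast
 have "ereal b \<le> exit_time D (\<lambda>s. x + f s)"
  unfolding exit_time_def
 proof (rule Inf_greatest)
  fix y assume "y \<in> {ereal t |t. 0 < t \<and> x + f t \<notin> D}"
  then obtain s where s: "y = ereal s" "0 < s" "x + f s \<notin> D" by blast
  then have "b \<le> s" using inD[of s] b(2)[of s] by force
  then show "ereal b \<le> y" using s by simp
 qed
 moreover have "ereal t < ereal b" using b(1) by simp
 ultimately show ?thesis by (rule less_le_trans[rotated])
qed

lemma exit_time_gtD:
 assumes "ereal t < exit_time D f" "0 < s" "s \<le> t"
 shows "f s \<in> D"
proof (rule ccontr)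
 assume "f s \<notin> D"
 then have "exit_time D f \<le> ereal s" unfolding exit_time_def using assms(2) by (intro Inf_lower) blast
 then show False using assms(1,3) by (metis ereal_less_eq(3) le_less_trans less_le_trans less_irrefl)
qed

lemma pred_Ball_countable:
 assumes "countable I" "\<And>i. i \<in> I ==> Measurable.pred M (P i)"
 shows "Measurable.pred M (\<lambda>x. \<forall>i\<in>I. P i x)"
proof (cases "I = {}")
 case False
 have "{x\<in>space M. \<forall>i\<in>I. P i x} = (\<Inter>i\<in>I. {x\<in>space M. P i x})" using False by auto
 also have "\<dots> \<in> sets M" using assms False by (intro sets.countable_INT') auto
 finally show ?thesis by simp
qed simp

lemma (in complete_measure) borel_measurable_AE_eq:
 fixes f g :: "'a => 'b::topological_space"
 assumes g: "g \<in> borel_measurable M" and ae: "AE x in M. g x = f x"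
 shows "f \<in> borel_measurable M"
proof (rule measurableI)
 fix S :: "'b set" assume S: "S \<in> sets borel"
 show "f -` S \<inter> space M \<in> sets M"
 proof (rule in_sets_AE)
  show "AE x in M. x \<in> g -` S \<inter> space M \<longleftrightarrow> x \<in> f -` S \<inter> space M" using ae by eventually_elim auto
  show "g -` S \<inter> space M \<in> sets M" using g S by (rule measurable_sets)
 qed simp
qed simp

context levy_process
begin

text \<open>Staying in \<open>D\<close> at all grid times is necessary for a late exit, and staying at a positive distance from the complement is sufficient.
For almost every path these two conditions differ by a null set of starting points, so Fubini's theorem applies to the measurable
condition on grid times.\<close>
lemma heat_content_deficit:
 fixes D :: "'a set"
 assumes oD: "open D" and bD: "bounded D" and flat: "flat_boundary D" and t: "0 < t"
 shows "(\<lambda>w. measure lebesgue (bad D (path_range X t w))) \<in> borel_measurable M"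
  and "measure lebesgue D - spectral_heat_content M X D t = (\<integral>w. measure lebesgue (bad D (path_range X t w)) \<partial>M)"
proof -
 interpret P: pair_sigma_finite "lborel :: 'a measure" M ..
 have mX[measurable]: "X u \<in> borel_measurable M" if "u \<in> tgrid t" for u
  using measurable_X tgrid_bounds[of t u] t that by simp
 have cD: "countable (tgrid t)" by (rule countable_tgrid)
 have ne: "- D \<noteq> {}" using bD not_bounded_UNIV by (metis Compl_empty_eq double_complement)
 have [measurable]: "D \<in> sets borel" using oD by simp
 let ?K = "path_range X t"
 let ?F = "\<lambda>(x, w). \<forall>u\<in>tgrid t. x + X u w \<in> D"
 let ?G = "\<lambda>(x, w). \<exists>m::nat. \<forall>u\<in>tgrid t. 1 / real (Suc m) \<le> infdist (x + X u w) (- D)"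
 have mp: "(\<lambda>z. fst z + X u (snd z)) \<in> borel_measurable (lborel \<Otimes>\<^sub>M M)" if "u \<in> tgrid t" for u
  using mX[OF that] by measurable
 have infm: "(\<lambda>y. infdist y (- D)) \<in> borel_measurable borel"
  by (intro borel_measurable_continuous_onI continuous_intros)
 have Fm[measurable]: "Measurable.pred (lborel \<Otimes>\<^sub>M M) ?F"
  unfolding case_prod_beta by (rule pred_Ball_countable[OF cD]) (use mp in measurable)
 have Gm[measurable]: "Measurable.pred (lborel \<Otimes>\<^sub>M M) ?G"
  unfolding case_prod_beta
 proof (rule pred_intros_countable, rule pred_Ball_countable[OF cD])
  fix m u assume "u \<in> tgrid t"
  from measurable_compose[OF mp[OF this] infm]
  show "Measurable.pred (lborel \<Otimes>\<^sub>M M) (\<lambda>z. 1 / real (Suc m) \<le> infdist (fst z + X u (snd z)) (- D))"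
   by measurable
 qed
 have GF: "?F (x, w)" if G: "?G (x, w)" for x w
 proof -
  obtain m :: nat where m: "\<And>u. u \<in> tgrid t ==> 1 / real (Suc m) \<le> infdist (x + X u w) (- D)" using G by auto
  have "0 < 1 / real (Suc m)" by simp
  then have "infdist (x + X u w) (- D) \<noteq> 0" if "u \<in> tgrid t" for u using m[OF that] by linarith
  moreover have "closed (- D)" using oD by auto
  ultimately show ?thesis using in_closed_iff_infdist_zero[OF _ ne] by force
 qed
 have rng: "(\<forall>k\<in>?K w. Q k) \<longleftrightarrow> (\<forall>u\<in>tgrid t. Q (X u w))" for w and Q :: "'a => bool"
  unfolding path_range_def by blast
 \<comment> \<open>The starting points and outcomes for which the necessary and the sufficient condition differ.\<close>
 define N2 where "N2 = {z\<in>space (lborel \<Otimes>\<^sub>M M). ?F z \<and> \<not> ?G z}"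
 have N2m: "N2 \<in> sets (lborel \<Otimes>\<^sub>M M)" unfolding N2_def by measurable
 have AE0: "AE w in M. X 0 w = 0" by (rule start_0)
 have "AE w in M. emeasure lborel ((\<lambda>x. (x, w)) -` N2) = 0"
  using AE0
 proof (eventually_elim)
  case (elim w)
  have z: "0 \<in> ?K w" using elim tgrid_0[of t] unfolding path_range_def by force
  obtain N where N: "N \<in> null_sets lborel"
    "{x\<in>erosion D (?K w). \<not> (\<exists>m::nat. \<forall>k\<in>?K w. 1 / real (Suc m) \<le> infdist (x + k) (- D))} \<subseteq> N"
   using erosion_boundary_null[OF oD bD flat countable_path_range z] by blast
  have "(\<lambda>x. (x, w)) -` N2 \<subseteq> N"
  proof
   fix x assume "x \<in> (\<lambda>x. (x, w)) -` N2"
   then have "?F (x, w)" "\<not> ?G (x, w)" unfolding N2_def by auto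
   then have "x \<in> {x\<in>erosion D (?K w). \<not> (\<exists>m::nat. \<forall>k\<in>?K w. 1 / real (Suc m) \<le> infdist (x + k) (- D))}"
    unfolding erosion_def mem_Collect_eq rng by simp
   then show "x \<in> N" using N(2) by blast
  qed
  moreover have "emeasure lborel N = 0" using N(1) by auto
  ultimately show ?case using emeasure_mono[of "(\<lambda>x. (x, w)) -` N2" N lborel] N(1) by (auto simp: null_sets_def)
 qed
 then have "emeasure (lborel \<Otimes>\<^sub>M M) N2 = 0"
  unfolding P.emeasure_pair_measure_alt2[OF N2m]
  using nn_integral_0_iff_AE[OF P.measurable_emeasure_Pair2[OF N2m]] by (rule iffD2[rotated])
 then have "(\<integral>\<^sup>+x. emeasure M (Pair x -` N2) \<partial>lborel) = 0"
  by (simp add: emeasure_pair_measure_alt[OF N2m])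
 then have AEx: "AE x in lborel. emeasure M (Pair x -` N2) = 0"
  using nn_integral_0_iff_AE[OF measurable_emeasure_Pair[OF N2m]] by (rule iffD1[rotated])
 define p where "p x = measure (completion M) {w \<in> space M. exit_time D (\<lambda>s. x + X s w) > ereal t}" for x
 define q where "q x = measure M {w\<in>space M. ?F (x, w)}" for x
 have Fx: "{w\<in>space M. ?F (x, w)} \<in> events" for x
 proof -
  have "Measurable.pred M (\<lambda>w. \<forall>u\<in>tgrid t. x + X u w \<in> D)"
   by (rule pred_Ball_countable[OF cD]) measurable
  then show ?thesis by simp
 qed
 have pq: "AE x in lborel. x \<in> D \<longrightarrow> p x = q x"
  using AEx
 proof (eventually_elim)
  case (elim x)
  let ?S = "{w \<in> space M. exit_time D (\<lambda>s. x + X s w) > ereal t}"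
  let ?Fx = "{w\<in>space M. ?F (x, w)}"
  have N2x: "Pair x -` N2 \<in> null_sets M"
   using elim sets_Pair1[OF N2m] by (intro null_setsI) auto
  have "AE w in M. w \<notin> Pair x -` N2" by (rule AE_not_in[OF N2x])
  then have "AE w in M. x \<in> D \<longrightarrow> (w \<in> ?Fx \<longleftrightarrow> w \<in> ?S)"
   using AE0 AE_space
  proof (eventually_elim)
   case (elim w)
   show ?case
   proof (intro impI iffI)
    assume "w \<in> ?Fx"
    then have "?G (x, w)" using elim unfolding N2_def by (auto simp: space_pair_measure)
    then obtain m :: nat where m: "\<And>u. u \<in> tgrid t ==> 1 / real (Suc m) \<le> infdist (x + X u w) (- D)" by auto
    have "ereal t < exit_time D (\<lambda>s. x + X s w)"
     by (rule exit_time_gt_if[OF oD ne cadlag_paths[OF elim(3)] t _ m]) simp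
    then show "w \<in> ?S" using elim(3) by simp
   next
    assume xD: "x \<in> D" and S: "w \<in> ?S"
    have "x + X u w \<in> D" if u: "u \<in> tgrid t" for u
    proof (cases "u = 0")
     case True
     then show ?thesis using xD elim(2) by simp
    next
     case False
     then have "0 < u" "u \<le> t" using tgrid_bounds[of t u] t u by auto
     then show ?thesis using exit_time_gtD[of t D "\<lambda>s. x + X s w" u] S by simp
    qed
    then show "w \<in> ?Fx" using elim(3) by simp
   qed
  qed
  then show ?case
  proof (intro impI)
   assume xD: "x \<in> D" and ae: "AE w in M. x \<in> D \<longrightarrow> (w \<in> ?Fx \<longleftrightarrow> w \<in> ?S)"
   have ae': "AE w in completion M. w \<in> ?Fx \<longleftrightarrow> w \<in> ?S"
    by (rule AE_completion) (use ae xD in simp)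
   have Fc: "?Fx \<in> sets (completion M)" using Fx by simp
   interpret C: complete_measure "completion M" ..
   have Sc: "?S \<in> sets (completion M)"
    by (rule completion.in_sets_AE[OF ae' Fc]) auto
   have "measure (completion M) ?Fx = measure (completion M) ?S" by (rule measure_eq_AE[OF ae' Fc Sc])
   then show "p x = q x" using Fx by (simp add: p_def q_def)
  qed
 qed
 have qm[measurable]: "q \<in> borel_measurable borel"
 proof -
  have "{z\<in>space (lborel \<Otimes>\<^sub>M M). ?F z} \<in> sets (lborel \<Otimes>\<^sub>M M)" by measurable
  from measurable_emeasure_Pair[OF this]
  have "(\<lambda>x. emeasure M (Pair x -` {z\<in>space (lborel \<Otimes>\<^sub>M M). ?F z})) \<in> borel_measurable lborel" .
  moreover have "Pair x -` {z\<in>space (lborel \<Otimes>\<^sub>M M). ?F z} = {w\<in>space M. ?F (x, w)}" for x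
   by (auto simp: space_pair_measure)
  ultimately have "(\<lambda>x. emeasure M {w\<in>space M. ?F (x, w)}) \<in> borel_measurable borel" by simp
  then show ?thesis unfolding q_def measure_def by measurable
 qed
 have q01: "0 \<le> q x" "q x \<le> 1" for x by (simp_all add: q_def)
 have fD: "emeasure lborel D < \<infinity>" by (rule emeasure_bounded_finite[OF bD])
 have iD: "integrable lborel (\<lambda>x. indicator D x :: real)" using fD by simp
 have iq: "integrable lborel (\<lambda>x. indicator D x * q x)"
  by (rule Bochner_Integration.integrable_bound[OF iD]) (auto simp: indicator_def q01)
 have shc: "spectral_heat_content M X D t = (\<integral>x. indicator D x * q x \<partial>lborel)"
 proof -
  have "spectral_heat_content M X D t = (\<integral>x. indicator D x * p x \<partial>lebesgue)"
   unfolding spectral_heat_content_def set_lebesgue_integral_def p_def by simp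
  also have "\<dots> = (\<integral>x. indicator D x * q x \<partial>lebesgue)"
  proof (rule integral_cong_AE)
   have qc: "(\<lambda>x. indicator D x * q x) \<in> borel_measurable lebesgue"
    by (rule measurable_completion) measurable
   have ae: "AE x in lebesgue. indicator D x * q x = indicator D x * p x"
    by (rule AE_completion) (use pq in eventually_elim, auto simp: indicator_def)
   show "(\<lambda>x. indicator D x * q x) \<in> borel_measurable lebesgue" by (rule qc)
   show "(\<lambda>x. indicator D x * p x) \<in> borel_measurable lebesgue"
    by (rule complete_measure.borel_measurable_AE_eq[OF _ qc ae]) (rule completion.complete_measure_axioms)
   show "AE x in lebesgue. indicator D x * p x = indicator D x * q x" using ae by eventually_elim (rule sym)
  qed
  also have "\<dots> = (\<integral>x. indicator D x * q x \<partial>lborel)"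
   by (rule integral_completion) measurable
  finally show ?thesis .
 qed
 have mD: "measure lebesgue D = (\<integral>x. indicator D x \<partial>lborel)" by simp
 have diff: "measure lebesgue D - spectral_heat_content M X D t = (\<integral>x. indicator D x * (1 - q x) \<partial>lborel)"
  unfolding shc mD using iD iq by (subst Bochner_Integration.integral_diff[symmetric]) (auto simp: algebra_simps)
 have nn: "ennreal (\<integral>x. indicator D x * (1 - q x) \<partial>lborel) = (\<integral>\<^sup>+x. ennreal (indicator D x * (1 - q x)) \<partial>lborel)"
 proof (rule nn_integral_eq_integral[symmetric])
  show "integrable lborel (\<lambda>x. indicator D x * (1 - q x))"
   using Bochner_Integration.integrable_diff[OF iD iq] by (simp add: algebra_simps)
 qed (auto simp: indicator_def q01)
 let ?B = "{z\<in>space (lborel \<Otimes>\<^sub>M M). fst z \<in> D \<and> \<not> ?F z}"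
 have Bm: "?B \<in> sets (lborel \<Otimes>\<^sub>M M)" by measurable
 have Bx: "emeasure M (Pair x -` ?B) = ennreal (indicator D x * (1 - q x))" for x
 proof (cases "x \<in> D")
  case True
  then have "Pair x -` ?B = space M - {w\<in>space M. ?F (x, w)}" by (auto simp: space_pair_measure)
  then show ?thesis using prob_compl[OF Fx[of x]] True by (simp add: q_def emeasure_eq_measure)
 next
  case False
  then have "Pair x -` ?B = {}" by auto
  then show ?thesis using False by simp
 qed
 have Bw: "(\<lambda>x. (x, w)) -` ?B = bad D (?K w)" if "w \<in> space M" for w
  using that unfolding bad_def path_range_def by (auto simp: space_pair_measure)
 have bfin: "emeasure lborel (bad D K) = ennreal (measure lebesgue (bad D K)) \<and> measure lebesgue (bad D K) \<le> measure lebesgue D"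
  if "countable K" for K
 proof
  have bb: "bad D K \<in> sets borel" by (rule bad_borel[OF oD that])
  have sub: "bad D K \<subseteq> D" by (auto simp: bad_def)
  have "emeasure lborel (bad D K) < \<infinity>" by (rule emeasure_bounded_finite[OF bounded_subset[OF bD sub]])
  then show "emeasure lborel (bad D K) = ennreal (measure lebesgue (bad D K))"
   using bb by (simp add: emeasure_eq_ennreal_measure less_top[symmetric])
  show "measure lebesgue (bad D K) \<le> measure lebesgue D"
   by (rule measure_mono_fmeasurable[OF sub]) (use bb oD bD lmeasurable_open in auto)
 qed
 have eM: "(\<lambda>w. emeasure lborel ((\<lambda>x. (x, w)) -` ?B)) \<in> borel_measurable M"
  by (rule P.measurable_emeasure_Pair2[OF Bm])
 have em2: "(\<lambda>w. emeasure lborel (bad D (?K w))) \<in> borel_measurable M"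
 proof -
  have "((\<lambda>w. emeasure lborel ((\<lambda>x. (x, w)) -` ?B)) \<in> borel_measurable M) = ((\<lambda>w. emeasure lborel (bad D (?K w))) \<in> borel_measurable M)"
   by (rule measurable_cong) (simp only: Bw)
  then show ?thesis using eM by (simp only:)
 qed
 then have "(\<lambda>w. enn2real (emeasure lborel (bad D (?K w)))) \<in> borel_measurable M" by measurable
 moreover have "enn2real (emeasure lborel (bad D (?K w))) = measure lebesgue (bad D (?K w))" for w
  by (simp only: bfin[OF countable_path_range] enn2real_ennreal measure_nonneg)
 ultimately show meas: "(\<lambda>w. measure lebesgue (bad D (?K w))) \<in> borel_measurable M" by simp
 have "ennreal (measure lebesgue D - spectral_heat_content M X D t) = (\<integral>\<^sup>+x. emeasure M (Pair x -` ?B) \<partial>lborel)"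
  unfolding diff nn Bx ..
 also have "\<dots> = emeasure (lborel \<Otimes>\<^sub>M M) ?B" by (rule emeasure_pair_measure_alt[OF Bm, symmetric])
 also have "\<dots> = (\<integral>\<^sup>+w. emeasure lborel ((\<lambda>x. (x, w)) -` ?B) \<partial>M)" by (rule P.emeasure_pair_measure_alt2[OF Bm])
 also have "\<dots> = (\<integral>\<^sup>+w. ennreal (measure lebesgue (bad D (?K w))) \<partial>M)"
  by (rule nn_integral_cong) (simp only: Bw bfin[OF countable_path_range])
 also have "\<dots> = ennreal (\<integral>w. measure lebesgue (bad D (?K w)) \<partial>M)"
 proof (rule nn_integral_eq_integral[OF integrable_const_bound[where B="measure lebesgue D"]])
  show "AE w in M. norm (measure lebesgue (bad D (?K w))) \<le> measure lebesgue D"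
  proof (rule AE_I2)
   fix w
   have "measure lebesgue (bad D (?K w)) \<le> measure lebesgue D" by (rule conjunct2[OF bfin[OF countable_path_range]])
   then show "norm (measure lebesgue (bad D (?K w))) \<le> measure lebesgue D"
    by (simp only: real_norm_def abs_of_nonneg measure_nonneg)
  qed
 qed (rule meas, simp)
 finally have "ennreal (measure lebesgue D - spectral_heat_content M X D t) = ennreal (\<integral>w. measure lebesgue (bad D (?K w)) \<partial>M)" .
 moreover have "0 \<le> measure lebesgue D - spectral_heat_content M X D t"
  unfolding diff by (rule integral_nonneg_AE) (auto simp: indicator_def q01)
 moreover have "0 \<le> (\<integral>w. measure lebesgue (bad D (?K w)) \<partial>M)" by simp
 ultimately show "measure lebesgue D - spectral_heat_content M X D t = (\<integral>w. measure lebesgue (bad D (?K w)) \<partial>M)"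
  by (simp only: ennreal_inj)
qed

end

section \<open>Tail integrals and the law of a discrete maximum\<close>

context prob_space
begin

lemma layer_cake:
 fixes W :: "'a => real"
 assumes W[measurable]: "W \<in> borel_measurable M"
 shows "(\<integral>\<^sup>+w. ennreal (W w - a) \<partial>M) = (\<integral>\<^sup>+x. indicator {a..} x * ennreal (prob {w\<in>space M. x < W w}) \<partial>lborel)"
proof -
 interpret P: pair_sigma_finite M "lborel :: real measure" ..
 have "(\<integral>\<^sup>+w. ennreal (W w - a) \<partial>M) = (\<integral>\<^sup>+w. (\<integral>\<^sup>+x. indicator {a..<W w} x \<partial>lborel) \<partial>M)"
 proof (rule nn_integral_cong)
  fix w show "ennreal (W w - a) = (\<integral>\<^sup>+x. indicator {a..<W w} x \<partial>lborel)"
   by (cases "a \<le> W w") (auto simp: ennreal_neg)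
 qed
 also have "\<dots> = (\<integral>\<^sup>+w. (\<integral>\<^sup>+x. indicator {a..} x * (if x < W w then 1 else 0) \<partial>lborel) \<partial>M)"
  by (intro nn_integral_cong) (auto simp: indicator_def)
 also have "\<dots> = (\<integral>\<^sup>+x. (\<integral>\<^sup>+w. indicator {a..} x * (if x < W w then 1 else 0) \<partial>M) \<partial>lborel)"
  by (rule P.Fubini'[symmetric]) measurable
 also have "\<dots> = (\<integral>\<^sup>+x. indicator {a..} x * ennreal (prob {w\<in>space M. x < W w}) \<partial>lborel)"
 proof (rule nn_integral_cong)
  fix x :: real
  have "(\<integral>\<^sup>+w. indicator {a..} x * (if x < W w then 1 else 0) \<partial>M) = (\<integral>\<^sup>+w. indicator {a..} x * indicator {w\<in>space M. x < W w} w \<partial>M)"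
   by (intro nn_integral_cong) (auto simp: indicator_def)
  also have "\<dots> = indicator {a..} x * ennreal (prob {w\<in>space M. x < W w})"
   by (subst nn_integral_cmult_indicator) (auto simp: emeasure_eq_measure)
  finally show "(\<integral>\<^sup>+w. indicator {a..} x * (if x < W w then 1 else 0) \<partial>M) = indicator {a..} x * ennreal (prob {w\<in>space M. x < W w})" .
 qed
 finally show ?thesis .
qed

lemma expectation_min_nn:
 fixes H :: "'a => real"
 assumes [measurable]: "H \<in> borel_measurable M" and H: "\<And>w. w \<in> space M ==> 0 \<le> H w" and A: "0 \<le> A"
 shows "integrable M (\<lambda>w. min (H w) A)" "ennreal (expectation (\<lambda>w. min (H w) A)) = (\<integral>\<^sup>+w. ennreal (min (H w) A - 0) \<partial>M)"
proof -
 show i: "integrable M (\<lambda>w. min (H w) A)"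
  by (rule integrable_const_bound[where B=A]) (use H A in \<open>auto intro!: AE_I2\<close>)
 show "ennreal (expectation (\<lambda>w. min (H w) A)) = (\<integral>\<^sup>+w. ennreal (min (H w) A - 0) \<partial>M)"
  using nn_integral_eq_integral[OF i] H A by (simp add: AE_I2)
qed

text \<open>By the layer cake formula, truncated expectations inherit inequalities between tail probabilities.\<close>
lemma expectation_min_compare:
 fixes H H' :: "'a => real"
 assumes m[measurable]: "H \<in> borel_measurable M" "H' \<in> borel_measurable M"
  and H: "\<And>w. w \<in> space M ==> 0 \<le> H w" "\<And>w. w \<in> space M ==> 0 \<le> H' w" and A: "0 \<le> A" and l: "0 \<le> l"
  and le: "\<And>x. 0 \<le> x ==> l * prob {w\<in>space M. x < H w} \<le> prob {w\<in>space M. x < H' w}"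
 shows "l * expectation (\<lambda>w. min (H w) A) \<le> expectation (\<lambda>w. min (H' w) A)"
proof -
 have E0: "0 \<le> expectation (\<lambda>w. min (H w) A)" "0 \<le> expectation (\<lambda>w. min (H' w) A)"
  using H A by (auto intro!: integral_nonneg_AE AE_I2)
 have mm: "(\<lambda>w. min (H w) A) \<in> borel_measurable M" "(\<lambda>w. min (H' w) A) \<in> borel_measurable M" by measurable
 have E1: "ennreal (expectation (\<lambda>w. min (H w) A)) = (\<integral>\<^sup>+x. indicator {0..} x * ennreal (prob {w\<in>space M. x < min (H w) A}) \<partial>lborel)"
  by (rule trans[OF expectation_min_nn(2)[OF m(1) H(1) A] layer_cake[OF mm(1)]])
 have E2: "ennreal (expectation (\<lambda>w. min (H' w) A)) = (\<integral>\<^sup>+x. indicator {0..} x * ennreal (prob {w\<in>space M. x < min (H' w) A}) \<partial>lborel)"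
  by (rule trans[OF expectation_min_nn(2)[OF m(2) H(2) A] layer_cake[OF mm(2)]])
 have "ennreal (l * expectation (\<lambda>w. min (H w) A)) = ennreal l * (\<integral>\<^sup>+x. indicator {0..} x * ennreal (prob {w\<in>space M. x < min (H w) A}) \<partial>lborel)"
  by (simp only: ennreal_mult'[OF l] E1)
 also have "\<dots> = (\<integral>\<^sup>+x. ennreal l * (indicator {0..} x * ennreal (prob {w\<in>space M. x < min (H w) A})) \<partial>lborel)"
  by (rule nn_integral_cmult[symmetric]) measurable
 also have "\<dots> \<le> (\<integral>\<^sup>+x. indicator {0..} x * ennreal (prob {w\<in>space M. x < min (H' w) A}) \<partial>lborel)"
 proof (rule nn_integral_mono)
  fix x :: real
  show "ennreal l * (indicator {0..} x * ennreal (prob {w\<in>space M. x < min (H w) A})) \<le> indicator {0..} x * ennreal (prob {w\<in>space M. x < min (H' w) A})"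
  proof (cases "0 \<le> x \<and> x < A")
   case True
   then show ?thesis using le[of x] l by (simp add: ennreal_mult'[symmetric] ennreal_leI)
  next
   case False
   then have "indicator {0..} x * ennreal (prob {w\<in>space M. x < min (H w) A}) = (0::ennreal)" by (auto simp: indicator_def)
   then show ?thesis by (simp only: mult_zero_right zero_le)
  qed
 qed
 also have "\<dots> = ennreal (expectation (\<lambda>w. min (H' w) A))"
  by (rule E2[symmetric])
 finally show ?thesis using E0 by simp
qed

lemma expectation_tail_le:
 fixes W :: "'a => real"
 assumes W[measurable]: "W \<in> borel_measurable M" and b: "1 < \<beta>" and C: "0 \<le> C" and a: "0 < a"
  and tail: "\<And>x. a \<le> x ==> prob {w\<in>space M. x < W w} \<le> C * x powr (- \<beta>)"
 shows "(\<integral>\<^sup>+w. ennreal (W w - a) \<partial>M) \<le> ennreal (C / (\<beta> - 1) * a powr (1 - \<beta>))"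
proof -
 have "(\<integral>\<^sup>+w. ennreal (W w - a) \<partial>M) = (\<integral>\<^sup>+x. indicator {a..} x * ennreal (prob {w\<in>space M. x < W w}) \<partial>lborel)"
  by (rule layer_cake[OF W])
 also have "\<dots> \<le> (\<integral>\<^sup>+x. ennreal (C * x powr (- \<beta>)) * indicator {a..} x \<partial>lborel)"
  by (intro nn_integral_mono) (auto simp: indicator_def intro!: ennreal_leI tail)
 also have "\<dots> = ennreal (0 - (- (C / (\<beta> - 1) * a powr (1 - \<beta>))))"
 proof (rule nn_integral_FTC_atLeast[where F="\<lambda>x. - (C / (\<beta> - 1) * x powr (1 - \<beta>))"])
  show "(\<lambda>x. C * x powr (- \<beta>)) \<in> borel_measurable borel" by measurable
  show "((\<lambda>x. - (C / (\<beta> - 1) * x powr (1 - \<beta>))) has_real_derivative C * x powr (- \<beta>)) (at x)" if "a \<le> x" for x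
  proof -
   have x: "0 < x" using that a by simp
   have "((\<lambda>x. - (C / (\<beta> - 1) * x powr (1 - \<beta>))) has_real_derivative - (C / (\<beta> - 1) * ((1 - \<beta>) * x powr (1 - \<beta> - 1)))) (at x)"
    using x b by (auto intro!: derivative_eq_intros)
   moreover have "- (C / (\<beta> - 1) * ((1 - \<beta>) * x powr (1 - \<beta> - 1))) = C * x powr (- \<beta>)"
   proof -
    have "- (c * ((1 - \<beta>) * y)) = (c * (\<beta> - 1)) * y" for c y :: real by (simp add: algebra_simps)
    from this[of "C / (\<beta> - 1)" "x powr (1 - \<beta> - 1)"]
    show ?thesis using b by simp
   qed
   ultimately show ?thesis by simp
  qed
  show "0 \<le> C * x powr (- \<beta>)" for x using C by simp
  have "((\<lambda>x. - (C / (\<beta> - 1) * x powr (1 - \<beta>))) \<longlongrightarrow> - (C / (\<beta> - 1) * 0)) at_top"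
   by (intro tendsto_intros tendsto_neg_powr filterlim_ident) (use b in simp)
  then show "((\<lambda>x. - (C / (\<beta> - 1) * x powr (1 - \<beta>))) \<longlongrightarrow> 0) at_top" by simp
 qed
 finally show ?thesis by simp
qed

end

text \<open>The maximum of the partial sums \<open>0, d a, d a + d (a + 1), ...\<close> with \<open>j\<close> steps, in the backward recursion that keeps the first summand independent of the rest.\<close>
primrec rmax :: "(nat => real) => nat => nat => real" where
 "rmax d 0 a = 0"
| "rmax d (Suc j) a = max 0 (d a + rmax d j (Suc a))"

text \<open>The law of \<open>rmax\<close> when the summands are independent with law \<open>\<mu>\<close>.\<close>
primrec maxlaw :: "real measure => nat => real measure" where
 "maxlaw \<mu> 0 = return borel 0"
| "maxlaw \<mu> (Suc j) = distr (distr (\<mu> \<Otimes>\<^sub>M maxlaw \<mu> j) borel (\<lambda>(x, y). x + y)) borel (max 0)"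

lemma rmax_nonneg: "0 \<le> rmax d j a"
 by (cases j) auto

lemma rmax_greater_iff: "y < rmax d j a \<longleftrightarrow> (\<exists>k\<le>j. y < (\<Sum>i\<in>{a..<a + k}. d i))"
proof (induction j arbitrary: a y)
 case (Suc j)
 have s: "(\<Sum>i\<in>{a..<a + Suc k}. d i) = d a + (\<Sum>i\<in>{Suc a..<Suc a + k}. d i)" for k
  using sum.atLeast_Suc_lessThan[of a "a + Suc k" d] by simp
 have "y < rmax d (Suc j) a \<longleftrightarrow> y < 0 \<or> y - d a < rmax d j (Suc a)" by (auto simp: less_max_iff_disj)
 also have "\<dots> \<longleftrightarrow> y < 0 \<or> (\<exists>k\<le>j. y < (\<Sum>i\<in>{a..<a + Suc k}. d i))"
  unfolding Suc.IH s by (auto simp: algebra_simps)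
 also have "\<dots> \<longleftrightarrow> (\<exists>k\<le>Suc j. y < (\<Sum>i\<in>{a..<a + k}. d i))"
 proof
  assume "y < 0 \<or> (\<exists>k\<le>j. y < (\<Sum>i\<in>{a..<a + Suc k}. d i))"
  then show "\<exists>k\<le>Suc j. y < (\<Sum>i\<in>{a..<a + k}. d i)"
  proof
   assume "y < 0"
   then show ?thesis by (intro exI[of _ 0]) simp
  qed (use Suc_le_mono in blast)
 next
  assume "\<exists>k\<le>Suc j. y < (\<Sum>i\<in>{a..<a + k}. d i)"
  then obtain k where k: "k \<le> Suc j" "y < (\<Sum>i\<in>{a..<a + k}. d i)" by blast
  show "y < 0 \<or> (\<exists>k\<le>j. y < (\<Sum>i\<in>{a..<a + Suc k}. d i))"
  proof (cases k)
   case 0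
   then show ?thesis using k by simp
  next
   case (Suc k')
   then show ?thesis using k by blast
  qed
 qed
 finally show ?case .
qed simp

lemma rmax_cong: "(\<And>i. a \<le> i ==> i < a + j ==> d i = e i) ==> rmax d j a = rmax e j a"
 by (induction j arbitrary: a) auto

lemma rmax_measurable:
 "{a..<a + j} \<subseteq> I ==> (\<lambda>d. rmax d j a) \<in> borel_measurable (Pi\<^sub>M I (\<lambda>_. borel))"
proof (induction j arbitrary: a)
 case (Suc j)
 have "(\<lambda>d. rmax d j (Suc a)) \<in> borel_measurable (Pi\<^sub>M I (\<lambda>_. borel))" by (rule Suc.IH) (use Suc.prems in auto)
 moreover have "(\<lambda>d. d a) \<in> borel_measurable (Pi\<^sub>M I (\<lambda>_. borel))"
  by (rule measurable_component_singleton) (use Suc.prems in auto)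
 ultimately show ?case unfolding rmax.simps by (intro borel_measurable_max borel_measurable_add) auto
qed simp

lemma real_distribution_maxlaw:
 assumes \<mu>: "real_distribution \<mu>"
 shows "real_distribution (maxlaw \<mu> j)" "real_distribution (distr (\<mu> \<Otimes>\<^sub>M maxlaw \<mu> j) borel (\<lambda>(x, y). x + y))"
proof -
 interpret \<mu>: real_distribution \<mu> by fact
 have sum: "real_distribution (distr (\<mu> \<Otimes>\<^sub>M N) borel (\<lambda>(x, y). x + y))" if "real_distribution N" for N
 proof -
  interpret N: real_distribution N by fact
  interpret P: pair_prob_space \<mu> N ..
  note [measurable_cong] = \<mu>.events_eq_borel N.events_eq_borel
  show ?thesis by (rule P.real_distribution_distr) measurable
 qed
 show r: "real_distribution (maxlaw \<mu> j)"
 proof (induction j)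
  case 0
  have "prob_space (return borel (0::real))" by (rule prob_space_return) simp
  then show ?case by (simp add: real_distribution_def real_distribution_axioms_def)
 next
  case (Suc j)
  interpret S: real_distribution "distr (\<mu> \<Otimes>\<^sub>M maxlaw \<mu> j) borel (\<lambda>(x, y). x + y)" by (rule sum[OF Suc])
  show ?case unfolding maxlaw.simps by (rule S.real_distribution_distr) simp
 qed
 show "real_distribution (distr (\<mu> \<Otimes>\<^sub>M maxlaw \<mu> j) borel (\<lambda>(x, y). x + y))" by (rule sum[OF r])
qed

lemma char_sum_pair:
 assumes "real_distribution \<mu>" "real_distribution N"
 shows "char (distr (\<mu> \<Otimes>\<^sub>M N) borel (\<lambda>(x, y). x + y)) t = char \<mu> t * char N t"
proof -
 interpret \<mu>: real_distribution \<mu> by fact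
 interpret N: real_distribution N by fact
 interpret P: pair_prob_space \<mu> N ..
 note [measurable_cong] = \<mu>.events_eq_borel N.events_eq_borel
 have int: "integrable (\<mu> \<Otimes>\<^sub>M N) (\<lambda>(x, y). iexp (t * (x + y)))"
  by (rule P.integrable_const_bound[where B=1]) auto
 have "char (distr (\<mu> \<Otimes>\<^sub>M N) borel (\<lambda>(x, y). x + y)) t = integral\<^sup>L (\<mu> \<Otimes>\<^sub>M N) (\<lambda>(x, y). iexp (t * (x + y)))"
  unfolding char_def by (subst integral_distr) (auto simp: case_prod_unfold)
 also have "\<dots> = (\<integral>x. (\<integral>y. iexp (t * (x + y)) \<partial>N) \<partial>\<mu>)"
  using P.integral_fst'[OF int] by (simp only: case_prod_beta fst_conv snd_conv)
 also have "\<dots> = (\<integral>x. iexp (t * x) * char N t \<partial>\<mu>)"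
  unfolding char_def by (simp add: distrib_left exp_add)
 also have "\<dots> = char \<mu> t * char N t" unfolding char_def by simp
 finally show ?thesis .
qed

text \<open>Each step of the recursion adds an independent summand, which multiplies characteristic functions, and applies the continuous map \<open>max 0\<close>.  Levy continuity translates between the two.\<close>
lemma weak_conv_maxlaw:
 assumes \<mu>n: "\<And>n. real_distribution (\<mu>n n)" and \<mu>: "real_distribution \<mu>"
  and ch: "\<And>t. (\<lambda>n. char (\<mu>n n) t) \<longlonglongrightarrow> char \<mu> t"
 shows "weak_conv_m (\<lambda>n. maxlaw (\<mu>n n) j) (maxlaw \<mu> j)"
proof (induction j)
 case 0
 show ?case by (simp add: weak_conv_m_def weak_conv_def)
next
 case (Suc j)
 let ?S = "\<lambda>n. distr (\<mu>n n \<Otimes>\<^sub>M maxlaw (\<mu>n n) j) borel (\<lambda>(x, y). x + y)" and ?T = "distr (\<mu> \<Otimes>\<^sub>M maxlaw \<mu> j) borel (\<lambda>(x, y). x + y)"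
 note rd = real_distribution_maxlaw[OF \<mu>n] real_distribution_maxlaw[OF \<mu>]
 have "(\<lambda>n. char (maxlaw (\<mu>n n) j) t) \<longlonglongrightarrow> char (maxlaw \<mu> j) t" for t
  by (rule levy_continuity1[OF rd(1) rd(3) Suc])
 then have "(\<lambda>n. char (?S n) t) \<longlonglongrightarrow> char ?T t" for t
  unfolding char_sum_pair[OF \<mu>n rd(1)] char_sum_pair[OF \<mu> rd(3)] by (intro tendsto_mult ch)
 then have wc: "weak_conv_m ?S ?T" by (rule levy_continuity[OF rd(2) rd(4)])
 show ?case
 proof (rule integral_bdd_continuous_conv_imp_weak_conv)
  fix f :: "real => real" assume f: "\<And>x. isCont f x" "\<And>x. \<bar>f x\<bar> \<le> 1"
  have fm: "f \<in> borel_measurable borel" using f(1) by (intro borel_measurable_continuous_onI continuous_at_imp_continuous_on) auto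
  have c: "isCont (\<lambda>x. f (max 0 x)) x" for x
   by (rule isCont_o2[OF _ f(1)]) (intro continuous_intros)
  have e: "integral\<^sup>L (distr S borel (max 0)) f = integral\<^sup>L S (\<lambda>x. f (max 0 x))" if "real_distribution S" for S
  proof -
   interpret real_distribution S by fact
   show ?thesis using fm by (subst integral_distr) auto
  qed
  have "(\<lambda>n. integral\<^sup>L (?S n) (\<lambda>x. f (max 0 x))) \<longlonglongrightarrow> integral\<^sup>L ?T (\<lambda>x. f (max 0 x))"
   by (rule weak_conv_imp_integral_bdd_continuous_conv[OF rd(2) rd(4) wc c, of 1]) (use f(2) in simp)
  then show "(\<lambda>n. integral\<^sup>L (maxlaw (\<mu>n n) (Suc j)) f) \<longlonglongrightarrow> integral\<^sup>L (maxlaw \<mu> (Suc j)) f"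
   unfolding maxlaw.simps e[OF rd(2)] e[OF rd(4)] .
 qed (rule real_distribution_maxlaw(1)[OF \<mu>n], rule real_distribution_maxlaw(1)[OF \<mu>])
qed

lemma (in prob_space) distr_rmax:
 assumes ind: "indep_vars (\<lambda>_. borel) D {..<n}" and law: "\<And>i. i < n ==> distr M borel (D i) = \<mu>"
  and an: "a + j \<le> n"
 shows "distr M borel (\<lambda>w. rmax (\<lambda>i. D i w) j a) = maxlaw \<mu> j"
 using an
proof (induction j arbitrary: a)
 case 0
 show ?case by (simp add: distr_const[of 0 borel])
next
 case (Suc j)
 have rv: "D i \<in> borel_measurable M" if "i < n" for i
  using ind that unfolding indep_vars_def by auto
 let ?R = "\<lambda>w. rmax (\<lambda>i. D i w) j (Suc a)"
 have iv: "indep_var (Pi\<^sub>M {a} (\<lambda>_. borel)) (\<lambda>w. restrict (\<lambda>i. D i w) {a}) (Pi\<^sub>M {Suc a..<Suc a + j} (\<lambda>_. borel)) (\<lambda>w. restrict (\<lambda>i. D i w) {Suc a..<Suc a + j})"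
  by (rule indep_var_restrict[OF ind]) (use Suc.prems in auto)
 have iv2: "indep_var borel ((\<lambda>d. d a) \<circ> (\<lambda>w. restrict (\<lambda>i. D i w) {a})) borel ((\<lambda>d. rmax d j (Suc a)) \<circ> (\<lambda>w. restrict (\<lambda>i. D i w) {Suc a..<Suc a + j}))"
  by (rule indep_var_compose[OF iv]) (auto intro!: measurable_component_singleton rmax_measurable)
 have "(\<lambda>d. d a) \<circ> (\<lambda>w. restrict (\<lambda>i. D i w) {a}) = D a" by (auto simp: fun_eq_iff)
 moreover have "(\<lambda>d. rmax d j (Suc a)) \<circ> (\<lambda>w. restrict (\<lambda>i. D i w) {Suc a..<Suc a + j}) = ?R"
  by (auto simp: fun_eq_iff intro!: rmax_cong)
 ultimately have iv3: "indep_var borel (D a) borel ?R" using iv2 by simp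
 then have rvs: "D a \<in> borel_measurable M" "?R \<in> borel_measurable M" and
  jt: "distr M borel (D a) \<Otimes>\<^sub>M distr M borel ?R = distr M (borel \<Otimes>\<^sub>M borel) (\<lambda>w. (D a w, ?R w))"
  unfolding indep_var_distribution_eq by blast+
 have "distr M borel ?R = maxlaw \<mu> j" by (rule Suc.IH) (use Suc.prems in simp)
 moreover have "distr M borel (D a) = \<mu>" by (rule law) (use Suc.prems in simp)
 ultimately have jt': "\<mu> \<Otimes>\<^sub>M maxlaw \<mu> j = distr M (borel \<Otimes>\<^sub>M borel) (\<lambda>w. (D a w, ?R w))" using jt by simp
 have pm: "(\<lambda>w. (D a w, ?R w)) \<in> M \<rightarrow>\<^sub>M borel \<Otimes>\<^sub>M borel" using rvs by measurable
 have am: "(\<lambda>(x::real, y). x + y) \<in> borel_measurable (borel \<Otimes>\<^sub>M borel)" by measurable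
 have "maxlaw \<mu> (Suc j) = distr (distr M borel (\<lambda>w. D a w + ?R w)) borel (max 0)"
  unfolding maxlaw.simps jt' by (subst distr_distr[OF am pm]) (simp add: o_def)
 also have "\<dots> = distr M borel (\<lambda>w. max 0 (D a w + ?R w))"
  using rvs by (subst distr_distr) (auto simp: o_def)
 finally show ?case by simp
qed

section \<open>Maximal inequalities for symmetric processes\<close>

lemma (in symmetric_levy) symmetric_levy_uminus: "symmetric_levy M (\<lambda>t w. - Z t w) f"
proof (intro symmetric_levy.intro symmetric_levy_axioms.intro)
 show "levy_process M (\<lambda>t w. - Z t w)"
  using levy_projection[OF levy_process_axioms, of "-1"] by simp
 fix t b :: real assume t: "0 \<le> t"
 note [measurable] = measurable_X[OF t]
 have "char (distr M borel (\<lambda>w. - Z t w)) b = char (distr M borel (Z t)) (- b)"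
  unfolding char_def by (subst (1 2) integral_distr) auto
 then show "char (distr M borel (\<lambda>w. - Z t w)) b = complex_of_real (exp (- (t * f \<bar>b\<bar>)))"
  using char_Z[OF t, of "- b"] by simp
qed

context symmetric_levy
begin

lemma prob_less_0:
 assumes t: "0 \<le> t"
 shows "prob {w\<in>space M. Z t w < 0} \<le> 1 / 2"
proof -
 interpret m: symmetric_levy M "\<lambda>t w. - Z t w" f by (rule symmetric_levy_uminus)
 note [measurable] = measurable_X[OF t]
 have eq: "distr M borel (Z t) = distr M borel (\<lambda>w. - Z t w)"
  by (rule Levy_uniqueness[OF real_distribution_Z[OF t] m.real_distribution_Z[OF t]])
   (simp add: fun_eq_iff char_Z[OF t] m.char_Z[OF t])
 have "prob {w\<in>space M. Z t w < 0} = measure (distr M borel (Z t)) {..<0}"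
  by (subst measure_distr) (auto intro!: arg_cong[where f=prob])
 also have "\<dots> = prob {w\<in>space M. 0 < Z t w}"
  unfolding eq by (subst measure_distr) (auto intro!: arg_cong[where f=prob])
 finally have "2 * prob {w\<in>space M. Z t w < 0} = prob {w\<in>space M. Z t w < 0} + prob {w\<in>space M. 0 < Z t w}" by simp
 also have "\<dots> = prob ({w\<in>space M. Z t w < 0} \<union> {w\<in>space M. 0 < Z t w})"
  by (rule finite_measure_Union[symmetric]) auto
 also have "\<dots> \<le> 1" by (rule prob_le_1)
 finally show ?thesis by simp
qed

text \<open>The increments over a grid of mesh \<open>s\<close>.\<close>
definition incr :: "real => nat => 'w => real" where
 "incr s i w = Z (s * real (Suc i)) w - Z (s * real i) w"

lemma indep_incr: "0 \<le> s ==> indep_vars (\<lambda>_. borel) (incr s) {..<n}"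
 unfolding incr_def by (rule indep_increments[of "\<lambda>i. s * real i"]) (auto simp: mult_left_mono)

lemma distr_incr: "0 \<le> s ==> distr M borel (incr s i) = distr M borel (Z s)"
 unfolding incr_def using stationary_increments[of "s * real i" "s * real (Suc i)"]
 by (simp add: mult_left_mono algebra_simps)

lemma sum_incr: "j \<le> k ==> (\<Sum>i\<in>{j..<k}. incr s i w) = Z (s * real k) w - Z (s * real j) w"
 unfolding incr_def by (rule sum_Suc_diff')

lemma psum_incr: "j \<le> k ==> psum (incr s) j k w = Z (s * real k) w - Z (s * real j) w"
 unfolding psum_def by (rule sum_incr)

lemma prob_psum_incr:
 assumes s: "0 \<le> s" and jk: "j \<le> k"
 shows "prob {w\<in>space M. psum (incr s) j k w < y} = prob {w\<in>space M. Z (s * real (k - j)) w < y}"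
proof -
 have m: "Z (s * real i) \<in> borel_measurable M" for i by (rule measurable_X) (use s in simp)
 note [measurable] = m
 have "prob {w\<in>space M. psum (incr s) j k w < y} = measure (distr M borel (\<lambda>w. Z (s * real k) w - Z (s * real j) w)) {..<y}"
  unfolding psum_incr[OF jk] by (subst measure_distr) (auto intro!: arg_cong[where f=prob])
 also have "distr M borel (\<lambda>w. Z (s * real k) w - Z (s * real j) w) = distr M borel (Z (s * real (k - j)))"
  using stationary_increments[of "s * real j" "s * real k"] s jk
  by (simp add: mult_left_mono of_nat_diff algebra_simps)
 also have "measure (distr M borel (Z (s * real (k - j)))) {..<y} = prob {w\<in>space M. Z (s * real (k - j)) w < y}"
  by (subst measure_distr) (auto intro!: arg_cong[where f=prob])
 finally show ?thesis .
qed

lemma grid_levy_inequality: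
 assumes s: "0 \<le> s"
 shows "prob {w\<in>space M. \<exists>k\<le>n. x < Z (s * real k) w - Z 0 w} \<le> 2 * prob {w\<in>space M. x < Z (s * real n) w - Z 0 w}"
proof -
 have "(1 - 1/2) * prob {w\<in>space M. \<exists>k\<le>n. psum (incr s) 0 k w > x} \<le> prob {w\<in>space M. \<exists>k\<le>n. psum (incr s) 0 n w > x - 0}"
 proof (rule first_passage[OF indep_incr[OF s], where \<sigma>="\<lambda>_. n" and \<epsilon>=0])
  show "prob {w\<in>space M. psum (incr s) k n w < - 0} \<le> 1 / 2" if "k \<le> n" for k
   using prob_psum_incr[OF s that, of 0] prob_less_0[of "s * real (n - k)"] s by simp
 qed simp
 moreover have "{w\<in>space M. \<exists>k\<le>n. psum (incr s) 0 n w > x - 0} = {w\<in>space M. x < Z (s * real n) w - Z 0 w}"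
  by (auto simp: psum_incr)
 ultimately show ?thesis by (simp add: psum_incr)
qed

lemma grid_event_measurable:
 assumes s: "0 \<le> s" and c[measurable]: "c \<in> borel_measurable M"
 shows "{w\<in>space M. \<exists>k\<le>n. x < Z (s * real k) w - c w} \<in> events"
proof -
 have "{w\<in>space M. \<exists>k\<in>{..n}. x < Z (s * real k) w - c w} \<in> events"
 proof (rule sets.sets_Collect_finite_Ex)
  fix k
  have [measurable]: "Z (s * real k) \<in> borel_measurable M" using s by (intro measurable_X) simp
  show "{w\<in>space M. x < Z (s * real k) w - c w} \<in> events" by measurable
 qed simp
 then show ?thesis by (simp only: Bex_def atMost_iff)
qed

lemma tgrid_event:
 "{w\<in>space M. \<exists>u\<in>tgrid t. P u w} = (\<Union>L. {w\<in>space M. \<exists>k\<le>2 ^ L. P (t / 2 ^ L * real k) w})"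
 unfolding tgrid_def by (auto simp: mult.commute)

lemma grid_refine:
 assumes "k \<le> 2 ^ m" "m \<le> L"
 shows "\<exists>j\<le>2 ^ L. t / 2 ^ m * real k = t / 2 ^ L * real (j::nat)"
proof (intro exI[of _ "k * 2 ^ (L - m)"] conjI)
 have "(2::nat) ^ L = 2 ^ m * 2 ^ (L - m)" using assms(2) by (simp flip: power_add)
 then show "k * 2 ^ (L - m) \<le> 2 ^ L" using assms(1) by simp
 have "(2::real) ^ L = 2 ^ m * 2 ^ (L - m)" using assms(2) by (simp flip: power_add)
 then show "t / 2 ^ m * real k = t / 2 ^ L * real (k * 2 ^ (L - m))" by simp
qed

text \<open>The finite grids increase to the whole grid, so a bound for each of them passes to the limit.\<close>
lemma tgrid_prob_le:
 assumes t: "0 \<le> t" and l: "\<And>L. m \<le> L ==> l * prob {w\<in>space M. \<exists>k\<le>2 ^ L. x < Z (t / 2 ^ L * real k) w - Z 0 w} \<le> c"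
 shows "l * prob {w\<in>space M. \<exists>u\<in>tgrid t. x < Z u w} \<le> c" "{w\<in>space M. \<exists>u\<in>tgrid t. x < Z u w} \<in> events"
proof -
 let ?E = "\<lambda>L. {w\<in>space M. \<exists>k\<le>2 ^ L. x < Z (t / 2 ^ L * real k) w - Z 0 w}"
 let ?G = "\<lambda>L. {w\<in>space M. \<exists>k\<le>2 ^ L. x < Z (t / 2 ^ L * real k) w}"
 have m: "Z (t / 2 ^ L * real k) \<in> borel_measurable M" "Z 0 \<in> borel_measurable M" for L :: nat and k :: nat
  using t by (auto intro!: measurable_X)
 have E: "?E L \<in> events" "?G L \<in> events" for L
 proof -
  note [measurable] = m
  show "?E L \<in> events" by (rule grid_event_measurable[of "t / 2 ^ L" "Z 0"]) (use t m in simp_all)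
  show "?G L \<in> events"
  proof -
   have "0 \<le> t / 2 ^ L" using t by simp
   from grid_event_measurable[OF this borel_measurable_const, of "2 ^ L" x 0]
   show ?thesis by (simp only: diff_0_right)
  qed
 qed
 have inc: "incseq ?E"
 proof (rule incseq_SucI, rule subsetI)
  fix L w assume "w \<in> ?E L"
  then obtain k where k: "w \<in> space M" "k \<le> 2 ^ L" "x < Z (t / 2 ^ L * real k) w - Z 0 w" by blast
  obtain j where "j \<le> 2 ^ Suc L" "t / 2 ^ L * real k = t / 2 ^ Suc L * real j"
   using grid_refine[OF k(2), of "Suc L" t] by auto
  then show "w \<in> ?E (Suc L)" using k by (auto simp del: power_Suc)
 qed
 show ev: "{w\<in>space M. \<exists>u\<in>tgrid t. x < Z u w} \<in> events"
  unfolding tgrid_event by (rule sets.countable_nat_UN, rule image_subsetI, rule E)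
 have "prob {w\<in>space M. \<exists>u\<in>tgrid t. x < Z u w} = prob (\<Union>L. ?E L)"
 proof (rule measure_eq_AE)
  show "AE w in M. (w \<in> {w\<in>space M. \<exists>u\<in>tgrid t. x < Z u w}) = (w \<in> (\<Union>L. ?E L))"
   unfolding tgrid_event using start_0 by eventually_elim (simp only: UN_iff mem_Collect_eq diff_0_right)
 qed (rule ev, rule sets.countable_nat_UN, rule image_subsetI, rule E)
 moreover have "(\<lambda>L. prob (?E L)) \<longlonglongrightarrow> prob (\<Union>L. ?E L)"
  by (rule finite_Lim_measure_incseq[OF _ inc], rule image_subsetI, rule E)
 ultimately have "(\<lambda>L. prob (?E L)) \<longlonglongrightarrow> prob {w\<in>space M. \<exists>u\<in>tgrid t. x < Z u w}" by simp
 then have "(\<lambda>L. l * prob (?E L)) \<longlonglongrightarrow> l * prob {w\<in>space M. \<exists>u\<in>tgrid t. x < Z u w}" by (rule tendsto_mult_left)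
 then show "l * prob {w\<in>space M. \<exists>u\<in>tgrid t. x < Z u w} \<le> c"
  by (rule LIMSEQ_le_const2) (use l in auto)
qed

lemma tgrid_event_measurable: "0 \<le> t ==> {w\<in>space M. \<exists>u\<in>tgrid t. x < Z u w} \<in> events"
 by (rule tgrid_prob_le(2)[where l=0 and c=0]) auto

end

locale doubling_levy = symmetric_levy +
 assumes doubling: "\<And>a b. 0 \<le> b ==> b \<le> 2 * a ==> f b \<le> 4 * f a"
begin

lemma prob_abs_ge:
 assumes t: "0 \<le> t" and x: "0 < x"
 shows "prob {w\<in>space M. x \<le> \<bar>Z t w\<bar>} \<le> 8 * t * f (2 / x)"
proof -
 have u: "0 < 2 / x" using x by simp
 have "prob {w\<in>space M. 2 / (2 / x) \<le> \<bar>Z t w\<bar>} \<le> 2 * (4 * t * f (2 / x))"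
 proof (rule prob_abs_ge_le_char[OF measurable_X[OF t] u])
  show "0 \<le> 4 * t * f (2 / x)" using f_nonneg[of "2 / x"] t u by simp
  fix v :: real assume v: "\<bar>v\<bar> \<le> 2 / x"
  have "1 + - (t * f \<bar>v\<bar>) \<le> exp (- (t * f \<bar>v\<bar>))" by (rule exp_ge_add_one_self)
  moreover have "t * f \<bar>v\<bar> \<le> t * (4 * f (2 / x))"
   by (rule mult_left_mono[OF doubling t]) (use v u in \<open>auto intro: order_trans\<close>)
  ultimately show "1 - Re (char (distr M borel (Z t)) v) \<le> 4 * t * f (2 / x)"
   unfolding char_Z[OF t] by simp
 qed
 then show ?thesis using x by simp
qed

text \<open>Levy's inequality reduces the running maximum to the terminal value.\<close>
lemma prob_sup_greater:
 assumes t: "0 \<le> t" and x: "0 < x"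
 shows "prob {w\<in>space M. \<exists>u\<in>tgrid t. x < Z u w} \<le> 16 * t * f (2 / x)"
proof -
 have "1 * prob {w\<in>space M. \<exists>u\<in>tgrid t. x < Z u w} \<le> 16 * t * f (2 / x)"
 proof (rule tgrid_prob_le(1)[OF t, of 0])
  fix L :: nat
  note [measurable] = measurable_X[OF t] measurable_X[OF order_refl]
  have "prob {w\<in>space M. \<exists>k\<le>2 ^ L. x < Z (t / 2 ^ L * real k) w - Z 0 w} \<le> 2 * prob {w\<in>space M. x < Z (t / 2 ^ L * real (2 ^ L)) w - Z 0 w}"
   by (rule grid_levy_inequality) (use t in simp)
  also have "prob {w\<in>space M. x < Z (t / 2 ^ L * real (2 ^ L)) w - Z 0 w} = prob {w\<in>space M. x < Z t w - Z 0 w}" by simp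
  also have "\<dots> = prob {w\<in>space M. x < Z t w}"
  proof (rule measure_eq_AE)
   show "AE w in M. (w \<in> {w\<in>space M. x < Z t w - Z 0 w}) = (w \<in> {w\<in>space M. x < Z t w})"
    using start_0 by eventually_elim simp
  qed measurable
  also have "\<dots> \<le> prob {w\<in>space M. x \<le> \<bar>Z t w\<bar>}" by (rule finite_measure_mono) (auto, measurable)
  also have "\<dots> \<le> 8 * t * f (2 / x)" by (rule prob_abs_ge[OF t x])
  finally show "1 * prob {w\<in>space M. \<exists>k\<le>2 ^ L. x < Z (t / 2 ^ L * real k) w - Z 0 w} \<le> 16 * t * f (2 / x)" by simp
 qed
 then show ?thesis by simp
qed

text \<open>From the first passage on the fine grid until the next point of the coarse grid the process rarely drops by more than \<open>\<epsilon>\<close>, since only a time \<open>t / 2\<^sup>m\<close> passes.\<close>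
lemma coarse_grid_comparison:
 assumes t: "0 \<le> t" and e: "0 < \<epsilon>"
 shows "(1 - 8 * (t / 2 ^ m) * f (2 / \<epsilon>)) * prob {w\<in>space M. \<exists>u\<in>tgrid t. x < Z u w}
  \<le> prob {w\<in>space M. \<exists>k\<le>2 ^ m. x - \<epsilon> < Z (t / 2 ^ m * real k) w - Z 0 w}"
proof (rule tgrid_prob_le(1)[OF t, of m])
 fix L assume L: "m \<le> L"
 define g :: nat where "g = 2 ^ (L - m)"
 define s where "s = t / 2 ^ L"
 \<comment> \<open>The index \<open>k\<close> rounded up to the coarse grid, whose mesh is \<open>g\<close> fine steps.\<close>
 define \<sigma> where "\<sigma> k = (k + g - 1) div g * g" for k
 have s: "0 \<le> s" using t by (simp add: s_def)
 have g: "0 < g" "2 ^ L = 2 ^ m * g" using L by (simp_all add: g_def flip: power_add)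
 have gr: "(2::real) ^ L = 2 ^ m * real g" using L by (simp add: g_def flip: power_add)
 have sg: "s * real g = t / 2 ^ m" using g(1) by (simp add: s_def gr)
 have \<sigma>1: "k \<le> \<sigma> k" "\<sigma> k - k \<le> g" for k
 proof -
  have "k + g - 1 = \<sigma> k + (k + g - 1) mod g" unfolding \<sigma>_def by simp
  moreover have "(k + g - 1) mod g < g" using g by simp
  ultimately show "k \<le> \<sigma> k" "\<sigma> k - k \<le> g" by linarith+
 qed
 have \<sigma>2: "(k + g - 1) div g \<le> 2 ^ m" if "k \<le> 2 ^ L" for k
 proof -
  have "k + g - 1 < (2 ^ m + 1) * g" using that g by simp
  then have "(k + g - 1) div g < 2 ^ m + 1" by (simp only: div_less_iff_less_mult[OF g(1)])
  then show ?thesis by simp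
 qed
 have f0: "0 \<le> f (2 / \<epsilon>)" using e by (intro f_nonneg) simp
 have "(1 - 8 * (t / 2 ^ m) * f (2 / \<epsilon>)) * prob {w\<in>space M. \<exists>k\<le>2 ^ L. psum (incr s) 0 k w > x}
  \<le> prob {w\<in>space M. \<exists>k\<le>2 ^ L. psum (incr s) 0 (\<sigma> k) w > x - \<epsilon>}"
 proof (rule first_passage[OF indep_incr[OF s]])
  fix k :: nat assume k: "k \<le> 2 ^ L"
  have "\<sigma> k \<le> 2 ^ L" unfolding g(2) \<sigma>_def by (rule mult_right_mono[OF \<sigma>2[OF k]]) simp
  then show "k \<le> \<sigma> k \<and> \<sigma> k \<le> 2 ^ L" using \<sigma>1 by simp
  let ?r = "s * real (\<sigma> k - k)"
  have r: "0 \<le> ?r" using s by simp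
  have rt: "?r \<le> t / 2 ^ m" unfolding sg[symmetric] using \<sigma>1(2)[of k] s by (simp add: mult_left_mono)
  note [measurable] = measurable_X[OF r]
  have "prob {w\<in>space M. psum (incr s) k (\<sigma> k) w < - \<epsilon>} = prob {w\<in>space M. Z ?r w < - \<epsilon>}"
   by (rule prob_psum_incr[OF s \<sigma>1(1)])
  also have "\<dots> \<le> prob {w\<in>space M. \<epsilon> \<le> \<bar>Z ?r w\<bar>}" by (rule finite_measure_mono) (auto, measurable)
  also have "\<dots> \<le> 8 * ?r * f (2 / \<epsilon>)" by (rule prob_abs_ge[OF r e])
  also have "\<dots> \<le> 8 * (t / 2 ^ m) * f (2 / \<epsilon>)" by (rule mult_right_mono[OF _ f0]) (use rt in simp)
  finally show "prob {w\<in>space M. psum (incr s) k (\<sigma> k) w < - \<epsilon>} \<le> 8 * (t / 2 ^ m) * f (2 / \<epsilon>)" .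
 qed
 also have "\<dots> \<le> prob {w\<in>space M. \<exists>k\<le>2 ^ m. x - \<epsilon> < Z (t / 2 ^ m * real k) w - Z 0 w}"
 proof (rule finite_measure_mono)
  show "{w\<in>space M. \<exists>k\<le>2 ^ L. psum (incr s) 0 (\<sigma> k) w > x - \<epsilon>} \<subseteq> {w\<in>space M. \<exists>k\<le>2 ^ m. x - \<epsilon> < Z (t / 2 ^ m * real k) w - Z 0 w}"
  proof
   fix w assume "w \<in> {w\<in>space M. \<exists>k\<le>2 ^ L. psum (incr s) 0 (\<sigma> k) w > x - \<epsilon>}"
   then obtain k where k: "w \<in> space M" "k \<le> 2 ^ L" "psum (incr s) 0 (\<sigma> k) w > x - \<epsilon>" by blast
   let ?j = "(k + g - 1) div g"
   have "s * real (\<sigma> k) = t / 2 ^ m * real ?j" unfolding \<sigma>_def sg[symmetric] by simp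
   then have "x - \<epsilon> < Z (t / 2 ^ m * real ?j) w - Z 0 w" using k(3) by (simp only: psum_incr[OF le0] of_nat_0 mult_zero_right)
   then show "w \<in> {w\<in>space M. \<exists>k\<le>2 ^ m. x - \<epsilon> < Z (t / 2 ^ m * real k) w - Z 0 w}" using k(1) \<sigma>2[OF k(2)] by blast
  qed
  show "{w\<in>space M. \<exists>k\<le>2 ^ m. x - \<epsilon> < Z (t / 2 ^ m * real k) w - Z 0 w} \<in> events"
   by (rule grid_event_measurable[of "t / 2 ^ m" "Z 0"]) (use t measurable_X[OF order_refl] in simp_all)
 qed
 finally show "(1 - 8 * (t / 2 ^ m) * f (2 / \<epsilon>)) * prob {w\<in>space M. \<exists>k\<le>2 ^ L. x < Z (t / 2 ^ L * real k) w - Z 0 w}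
  \<le> prob {w\<in>space M. \<exists>k\<le>2 ^ m. x - \<epsilon> < Z (t / 2 ^ m * real k) w - Z 0 w}"
  by (simp add: psum_incr s_def)
qed

end

section \<open>Regular variation\<close>

text \<open>Continuity makes the infimum a point where the level is attained.\<close>
lemma gen_inverse_properties:
 fixes f :: "real => real"
 assumes cont: "\<And>b. isCont (\<lambda>b. f \<bar>b\<bar>) b" and f0: "f 0 = 0" and top: "filterlim f at_top at_top" and s: "0 < s"
 shows "0 < gen_inverse f s" "f (gen_inverse f s) = s" "\<And>b. 0 \<le> b ==> b < gen_inverse f s ==> f b \<le> s"
proof -
 let ?B = "{b. 0 \<le> b \<and> f b > s}"
 let ?b = "gen_inverse f s"
 have ne: "?B \<noteq> {}"
 proof -
  have "\<forall>\<^sub>F b in at_top. s + 1 \<le> f b \<and> 0 \<le> b"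
   using top eventually_ge_at_top[of 0] unfolding filterlim_at_top by (auto intro: eventually_conj)
  then obtain b where "s + 1 \<le> f b" "0 \<le> b" by (auto simp: eventually_at_top_linorder)
  then show ?thesis by (auto intro!: exI[of _ b])
 qed
 have bb: "bdd_below ?B" by (rule bdd_belowI[of _ 0]) simp
 have b0: "0 \<le> ?b" unfolding gen_inverse_def by (rule cInf_greatest[OF ne]) simp
 show lt: "f b \<le> s" if "0 \<le> b" "b < ?b" for b
 proof (rule ccontr)
  assume "\<not> f b \<le> s"
  then have "b \<in> ?B" using that by simp
  from cInf_lower[OF this bb] show False using that(2) unfolding gen_inverse_def by simp
 qed
 have tr: "((\<lambda>b. f \<bar>b\<bar>) \<longlongrightarrow> f \<bar>?b\<bar>) (at ?b)" using cont[of ?b] by (simp add: isCont_def)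
 have up: "f ?b \<le> s"
 proof (cases "?b = 0")
  case False
  then have p: "0 < ?b" using b0 by simp
  have "((\<lambda>b. f \<bar>b\<bar>) \<longlongrightarrow> f \<bar>?b\<bar>) (at_left ?b)" by (rule tendsto_mono[OF at_le[OF subset_UNIV] tr])
  moreover have "\<forall>\<^sub>F b in at_left ?b. f \<bar>b\<bar> \<le> s"
   by (rule eventually_mono[OF eventually_at_leftI[of 0 _ "\<lambda>b. 0 < b \<and> b < ?b"]]) (use p lt in auto)
  ultimately have "f \<bar>?b\<bar> \<le> s" by (rule tendsto_upperbound) simp
  then show ?thesis using p by simp
 qed (use f0 s in simp)
 moreover have "s \<le> f ?b"
 proof (rule ccontr)
  assume "\<not> s \<le> f ?b"
  then have ls: "f \<bar>?b\<bar> < s" using b0 by simp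
  from order_tendstoD(2)[OF tr this] obtain d where d: "0 < d" "\<And>b. b \<noteq> ?b ==> dist b ?b < d ==> f \<bar>b\<bar> < s"
   unfolding eventually_at by auto
  obtain b where b: "b \<in> ?B" "b < ?b + d"
   using cInf_lessD[OF ne, of "?b + d"] d(1) unfolding gen_inverse_def by auto
  have "?b \<le> b" unfolding gen_inverse_def by (rule cInf_lower[OF b(1) bb])
  then have "f \<bar>b\<bar> < s" using b d(2)[of b] ls by (cases "b = ?b") (auto simp: dist_real_def)
  then show False using b(1) by simp
 qed
 ultimately show eq: "f ?b = s" by simp
 then show "0 < ?b" using b0 f0 s by (cases "?b = 0") auto
qed

text \<open>Only the ratio at scale two is used: it controls the growth along dyadic points, and the doubling property fills the gaps.\<close>
lemma regularly_varying_at_top: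
 fixes f :: "real => real"
 assumes rv: "regularly_varying \<alpha> f" and nn: "\<And>b. 0 \<le> b ==> 0 \<le> f b" and \<beta>: "0 \<le> \<beta>" "\<beta> < \<alpha>"
 obtains y0 where "1 \<le> y0" "\<And>y. y0 \<le> y ==> 0 < f y" "\<And>y. y0 \<le> y ==> 2 powr \<beta> * f y \<le> f (2 * y)"
proof -
 have "((\<lambda>y. f (2 * y) / f y) \<longlongrightarrow> 2 powr \<alpha>) at_top" using rv unfolding regularly_varying_def by simp
 moreover have "2 powr \<beta> < (2::real) powr \<alpha>" using \<beta> by simp
 ultimately have "\<forall>\<^sub>F y in at_top. 2 powr \<beta> < f (2 * y) / f y" by (rule order_tendstoD(1))
 then obtain y0 where y0: "\<And>y. y0 \<le> y ==> 2 powr \<beta> < f (2 * y) / f y" by (auto simp: eventually_at_top_linorder)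
 have pos: "0 < f y" if "max 1 y0 \<le> y" for y
 proof -
  have "f y \<noteq> 0"
  proof
   assume "f y = 0"
   then have "2 powr \<beta> < (0::real)" using y0[of y] that by simp
   then show False by simp
  qed
  then show ?thesis using nn[of y] that by simp
 qed
 show thesis
 proof (rule that[of "max 1 y0"])
  show "2 powr \<beta> * f y \<le> f (2 * y)" if "max 1 y0 \<le> y" for y
   using y0[of y] pos[OF that] that by (simp add: field_simps)
 qed (use pos in auto)
qed

text \<open>Halve \<open>b\<close> as often as \<open>x\<close> can be halved; each step loses a factor \<open>2 powr \<beta>\<close>.\<close>
lemma powr_lower_bound:
 fixes f :: "real => real"
 assumes dbl: "\<And>a b. 0 \<le> b ==> b \<le> 2 * a ==> f b \<le> 4 * f a" and nn: "\<And>b. 0 \<le> b ==> 0 \<le> f b" and \<beta>: "0 \<le> \<beta>"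
  and y0: "1 \<le> y0" "\<And>y. y0 \<le> y ==> 2 powr \<beta> * f y \<le> f (2 * y)"
  and x: "1 \<le> x" "y0 * x \<le> b"
 shows "f (b / x) \<le> 4 * 2 powr \<beta> * x powr (- \<beta>) * f b"
proof -
 define k where "k = nat \<lfloor>log 2 x\<rfloor>"
 have l0: "0 \<le> log 2 x" using x by simp
 have k: "real k \<le> log 2 x" "log 2 x < real k + 1" using l0 unfolding k_def by linarith+
 have k1: "2 ^ k \<le> x" using k(1) x by (simp add: le_log_iff powr_realpow)
 have "x < 2 powr (real k + 1)" using k(2) x by (simp add: log_less_iff)
 then have k2: "x < 2 * 2 ^ k" by (simp add: powr_add powr_realpow)
 have b0: "0 < b" using x y0 by (smt (verit) mult_pos_pos)
 have it: "(2 powr \<beta>) ^ j * f (b / 2 ^ j) \<le> f b" if "j \<le> k" for j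
  using that
 proof (induction j)
  case (Suc j)
  have "(2::real) ^ Suc j \<le> 2 ^ k" using Suc.prems by (intro power_increasing) auto
  then have "y0 * 2 ^ Suc j \<le> y0 * x" using k1 y0 by (intro mult_left_mono) auto
  then have "y0 \<le> b / 2 ^ Suc j" using x(2) by (simp add: pos_le_divide_eq)
  then have "2 powr \<beta> * f (b / 2 ^ Suc j) \<le> f (2 * (b / 2 ^ Suc j))" by (rule y0(2))
  then have "2 powr \<beta> * f (b / 2 ^ Suc j) \<le> f (b / 2 ^ j)" by simp
  then have "(2 powr \<beta>) ^ j * (2 powr \<beta> * f (b / 2 ^ Suc j)) \<le> (2 powr \<beta>) ^ j * f (b / 2 ^ j)" by (rule mult_left_mono) simp
  also have "\<dots> \<le> f b" using Suc by simp
  finally show ?case by (simp add: mult_ac)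
 qed simp
 have "b / x \<le> b / 2 ^ k" using k1 b0 x by (intro divide_left_mono) auto
 also have "\<dots> \<le> 2 * (b / 2 ^ k)" using b0 by (simp add: field_simps)
 finally have "f (b / x) \<le> 4 * f (b / 2 ^ k)" using b0 x by (intro dbl) auto
 moreover have "x powr \<beta> \<le> (2 * 2 ^ k) powr \<beta>" using k2 x \<beta> by (intro powr_mono2) auto
 moreover have "(2 * 2 ^ k) powr \<beta> = 2 powr \<beta> * (2 powr \<beta>) ^ k"
  by (simp add: powr_mult powr_power mult.commute flip: powr_realpow) (simp add: powr_powr mult.commute)
 ultimately have "f (b / x) \<le> 4 * f (b / 2 ^ k)" and p: "x powr \<beta> \<le> 2 powr \<beta> * (2 powr \<beta>) ^ k" by simp_all
 have nb: "0 \<le> f (b / 2 ^ k)" using b0 by (intro nn) simp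
 have "x powr \<beta> * f (b / x) \<le> x powr \<beta> * (4 * f (b / 2 ^ k))" by (rule mult_left_mono) (fact, simp)
 also have "\<dots> \<le> (2 powr \<beta> * (2 powr \<beta>) ^ k) * (4 * f (b / 2 ^ k))" by (rule mult_right_mono[OF p]) (use nb in simp)
 also have "\<dots> = 4 * 2 powr \<beta> * ((2 powr \<beta>) ^ k * f (b / 2 ^ k))" by simp
 also have "\<dots> \<le> 4 * 2 powr \<beta> * f b" using it[OF order_refl] by (intro mult_left_mono) auto
 finally show ?thesis using x by (simp add: powr_minus field_simps)
qed

text \<open>Arguments \<open>b / x\<close> below the threshold \<open>y0\<close> are compared with \<open>y0\<close> itself, where the bound for large arguments applies.\<close>
lemma potter_bound:
 fixes f :: "real => real"
 assumes dbl: "\<And>a b. 0 \<le> b ==> b \<le> 2 * a ==> f b \<le> 4 * f a" and nn: "\<And>b. 0 \<le> b ==> 0 \<le> f b"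
  and rv: "regularly_varying \<alpha> f" and \<beta>: "0 \<le> \<beta>" "\<beta> < \<alpha>"
 obtains C y0 where "0 \<le> C" "1 \<le> y0" "\<And>b x. y0 \<le> b ==> 1 \<le> x ==> x \<le> b ==> f (b / x) \<le> C * x powr (- \<beta>) * f b"
proof -
 obtain y0 where y0: "1 \<le> y0" "\<And>y. y0 \<le> y ==> 0 < f y" "\<And>y. y0 \<le> y ==> 2 powr \<beta> * f y \<le> f (2 * y)"
  using regularly_varying_at_top[OF rv nn \<beta>] by blast
 have plb: "f (b / x) \<le> 4 * 2 powr \<beta> * x powr (- \<beta>) * f b" if "1 \<le> x" "y0 * x \<le> b" for b x
  by (rule powr_lower_bound[of f \<beta> y0]) (use dbl nn \<beta>(1) y0(1) y0(3) that in auto)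
 define C where "C = 4 * (4 * 2 powr \<beta>) * y0 powr \<beta>"
 have p1: "1 \<le> y0 powr \<beta>" using y0(1) \<beta>(1) by (rule ge_one_powr_ge_zero)
 show thesis
 proof (rule that[of C y0])
  show "0 \<le> C" "1 \<le> y0" using y0 by (simp_all add: C_def)
  fix b x :: real assume b: "y0 \<le> b" and x: "1 \<le> x" "x \<le> b"
  have fb: "0 \<le> f b" using y0(1) b by (intro nn) simp
  show "f (b / x) \<le> C * x powr (- \<beta>) * f b"
  proof (cases "y0 * x \<le> b")
   case True
   have "f (b / x) \<le> 4 * 2 powr \<beta> * x powr (- \<beta>) * f b" by (rule plb[OF x(1) True])
   also have "\<dots> \<le> C * x powr (- \<beta>) * f b"
   proof (intro mult_right_mono fb)
    have "4 * 2 powr \<beta> * 1 \<le> 4 * 2 powr \<beta> * (4 * y0 powr \<beta>)" using p1 by (intro mult_left_mono) auto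
    then show "4 * 2 powr \<beta> \<le> C" by (simp add: C_def)
   qed simp
   finally show ?thesis .
  next
   case False
   have bp: "0 < b" using y0(1) b by simp
   have bx: "b / x \<le> 2 * y0" using False x y0(1) by (simp add: field_simps)
   have "f (b / x) \<le> 4 * f y0" using bx bp x by (intro dbl) auto
   also have "f y0 = f (b / (b / y0))" using y0(1) bp by simp
   also have "\<dots> \<le> 4 * 2 powr \<beta> * (b / y0) powr (- \<beta>) * f b"
    by (rule plb) (use b y0(1) in \<open>auto simp: field_simps\<close>)
   also have "(b / y0) powr (- \<beta>) \<le> y0 powr \<beta> * x powr (- \<beta>)"
   proof -
    have "(b / y0) powr (- \<beta>) = y0 powr \<beta> * b powr (- \<beta>)" using bp y0(1) by (simp add: powr_divide powr_minus field_simps)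
    moreover have "b powr (- \<beta>) \<le> x powr (- \<beta>)" using x \<beta>(1) by (intro powr_mono2') auto
    ultimately show ?thesis by (simp add: mult_left_mono)
   qed
   finally have "f (b / x) \<le> 4 * (4 * 2 powr \<beta> * (y0 powr \<beta> * x powr (- \<beta>)) * f b)"
    using fb by (simp add: mult_left_mono mult_right_mono)
   then show ?thesis by (simp add: C_def mult_ac)
  qed
 qed
qed

section \<open>Convergence of truncated running maxima\<close>

text \<open>One-sided limits make the path bounded near each time; a compact interval needs finitely many such neighbourhoods.\<close>
lemma cadlag_bounded:
 fixes f :: "real => 'a::real_normed_vector"
 assumes f: "cadlag f" and t: "0 \<le> t"
 shows "bounded (f ` {0..t})"
proof -
 have "bounded (f ` ({0..t} \<inter> {0..}))"
 proof (rule Bolzano[where P="\<lambda>a b. bounded (f ` ({a..b} \<inter> {0..}))", OF t])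
  fix a b c :: real assume *: "bounded (f ` ({a..b} \<inter> {0..}))" "bounded (f ` ({b..c} \<inter> {0..}))" "a \<le> b" "b \<le> c"
  have "{a..c} \<inter> {0..} \<subseteq> ({a..b} \<inter> {0..}) \<union> ({b..c} \<inter> {0..})" by auto
  then have sub: "f ` ({a..c} \<inter> {0..}) \<subseteq> f ` ({a..b} \<inter> {0..}) \<union> f ` ({b..c} \<inter> {0..})" unfolding image_Un[symmetric] by (rule image_mono)
  show "bounded (f ` ({a..c} \<inter> {0..}))"
   by (rule bounded_subset[OF _ sub]) (simp only: bounded_Un *(1,2) simp_thms)
 next
  fix x :: real assume x: "0 \<le> x" "x \<le> t"
  have lim: "\<exists>C d. 0 < d \<and> (\<forall>y. P y \<longrightarrow> dist y x < d \<longrightarrow> norm (f y) \<le> C)"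
   if "(f \<longlongrightarrow> l) (at x within S)" "\<And>y. P y ==> y \<in> S \<and> y \<noteq> x" for l S P
  proof -
   have "\<forall>\<^sub>F y in at x within S. dist (f y) l < 1" using tendstoD[OF that(1), of 1] by simp
   then obtain d where "0 < d" "\<And>y. y \<in> S ==> y \<noteq> x ==> dist y x < d ==> dist (f y) l < 1" unfolding eventually_at by blast
   moreover have "norm (f y) \<le> norm l + 1" if "dist (f y) l < 1" for y
    using that norm_triangle_sub[of "f y" l] by (simp add: dist_norm)
   ultimately show ?thesis using that(2) by blast
  qed
  have "(f \<longlongrightarrow> f x) (at_right x)" using f x unfolding cadlag_def by blast
  from lim[OF this, of "\<lambda>y. x < y"] obtain C1 d1 where d1: "0 < d1" "\<And>y. x < y ==> dist y x < d1 ==> norm (f y) \<le> C1" by auto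
  have "\<exists>C d. 0 < d \<and> (\<forall>y. 0 \<le> y \<and> y < x \<longrightarrow> dist y x < d \<longrightarrow> norm (f y) \<le> C)"
  proof (cases "x = 0")
   case True
   then show ?thesis by (intro exI[of _ 0] exI[of _ 1]) auto
  next
   case False
   then obtain l where "(f \<longlongrightarrow> l) (at_left x)" using f x unfolding cadlag_def by (metis order_le_less)
   from lim[OF this, of "\<lambda>y. 0 \<le> y \<and> y < x"] show ?thesis by auto
  qed
  then obtain C2 d2 where d2: "0 < d2" "\<And>y. 0 \<le> y ==> y < x ==> dist y x < d2 ==> norm (f y) \<le> C2" by blast
  show "\<exists>d>0. \<forall>a b. a \<le> x \<and> x \<le> b \<and> b - a < d \<longrightarrow> bounded (f ` ({a..b} \<inter> {0..}))"
  proof (intro exI[of _ "min d1 d2"] conjI allI impI)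
   show "0 < min d1 d2" using d1 d2 by simp
   fix a b assume ab: "a \<le> x \<and> x \<le> b \<and> b - a < min d1 d2"
   have "norm (f y) \<le> max (norm (f x)) (max C1 C2)" if "y \<in> {a..b} \<inter> {0..}" for y
   proof -
    have y: "a \<le> y" "y \<le> b" "0 \<le> y" using that by auto
    consider "y < x" | "y = x" | "x < y" by linarith
    then show ?thesis
    proof cases
     case 1
     then have "dist y x < d2" using y ab unfolding dist_real_def by linarith
     then have "norm (f y) \<le> C2" using 1 y by (intro d2(2))
     then show ?thesis by (simp only: le_max_iff_disj simp_thms)
    next
     case 2
     show ?thesis unfolding 2 by (rule max.cobounded1)
    next
     case 3
     then have "dist y x < d1" using y ab unfolding dist_real_def by linarith
     then have "norm (f y) \<le> C1" using 3 by (intro d1(2))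
     then show ?thesis by (simp only: le_max_iff_disj simp_thms)
    qed
   qed
   then show "bounded (f ` ({a..b} \<inter> {0..}))" unfolding bounded_iff by blast
  qed
 qed
 then show ?thesis by (simp add: Int_absorb2)
qed

text \<open>The maximum with zero only matters on the null set where the process does not start at zero.\<close>
definition gsup :: "(real => 'w => real) => real => 'w => real" where
 "gsup Z t w = max 0 (SUP u\<in>tgrid t. Z u w)"

lemma gsup_nonneg: "0 \<le> gsup Z t w"
 by (simp add: gsup_def)

context symmetric_levy
begin

lemma bdd_above_tgrid: "w \<in> space M ==> 0 \<le> t ==> bdd_above ((\<lambda>u. Z u w) ` tgrid t)"
proof -
 assume w: "w \<in> space M" and t: "0 \<le> t"
 have bdd: "bdd_above ((\<lambda>s. Z s w) ` {0..t})"
  by (rule bounded_imp_bdd_above[OF cadlag_bounded[OF cadlag_paths[OF w] t]])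
 have sub: "tgrid t \<subseteq> {0..t}" using tgrid_bounds[OF t] by auto
 show ?thesis by (rule bdd_above_mono[OF bdd image_mono[OF sub]])
qed

lemma gsup_greater_iff:
 assumes "w \<in> space M" "0 \<le> t" "0 \<le> x"
 shows "x < gsup Z t w \<longleftrightarrow> (\<exists>u\<in>tgrid t. x < Z u w)"
proof -
 have ne: "tgrid t \<noteq> {}" using tgrid_0 by blast
 show ?thesis using assms(3) unfolding gsup_def less_max_iff_disj less_cSUP_iff[OF ne bdd_above_tgrid[OF assms(1,2)]] by auto
qed

lemma gsup_event: "0 \<le> t ==> 0 \<le> x ==> {w\<in>space M. x < gsup Z t w} = {w\<in>space M. \<exists>u\<in>tgrid t. x < Z u w}"
 using gsup_greater_iff by blast

lemma gsup_measurable: "0 \<le> t ==> gsup Z t \<in> borel_measurable M"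
proof (rule borel_measurableI_greater)
 fix x assume t: "0 \<le> t"
 show "{w\<in>space M. x < gsup Z t w} \<in> events"
 proof (cases "0 \<le> x")
  case True
  then show ?thesis using tgrid_event_measurable[OF t] by (simp only: gsup_event[OF t])
 next
  case False
  then have "{w\<in>space M. x < gsup Z t w} = space M" by (auto intro!: less_le_trans[of x 0 "gsup Z t _"] gsup_nonneg)
  then show ?thesis by simp
 qed
qed

end

definition coarse_expectation :: "real measure => nat => real => real" where
 "coarse_expectation \<mu> m A = (\<integral>x. min (max x 0) A \<partial>maxlaw \<mu> (2 ^ m))"

text \<open>The coarse maximum is below the running maximum, and the comparison of grids bounds it from the other side up to the event of a large drop, whose probability is multiplied by the truncation level.\<close>
lemma (in doubling_levy) gsup_coarse:
 assumes t: "0 \<le> t" and b: "0 < b" and A: "0 \<le> A" and d: "0 < \<delta>"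
 shows "\<bar>expectation (\<lambda>w. min (b * gsup Z t w) A) - coarse_expectation (distr M borel (\<lambda>w. b * Z (t / 2 ^ m) w)) m A\<bar>
  \<le> \<delta> + 8 * (t / 2 ^ m) * f (2 * b / \<delta>) * A"
proof -
 define s where "s = t / 2 ^ m"
 have s: "0 \<le> s" using t by (simp add: s_def)
 note [measurable] = gsup_measurable[OF t] measurable_X[OF s]
 let ?D = "\<lambda>i w. b * incr s i w" and ?\<mu> = "distr M borel (\<lambda>w. b * Z s w)"
 let ?R = "\<lambda>w. rmax (\<lambda>i. ?D i w) (2 ^ m) 0" and ?H = "\<lambda>w. b * gsup Z t w"
 have incm: "incr s i \<in> borel_measurable M" for i
  using indep_incr[OF s, of "Suc i"] unfolding indep_vars_def by auto
 have ind: "indep_vars (\<lambda>_. borel) ?D {..<2 ^ m}"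
  by (rule indep_vars_compose2[OF indep_incr[OF s], where Y="\<lambda>_ x. b * x"]) simp
 have law: "distr M borel (?D i) = ?\<mu>" for i
 proof -
  have "distr M borel (?D i) = distr (distr M borel (incr s i)) borel (\<lambda>x. b * x)"
   by (subst distr_distr) (auto simp: o_def incm)
  also have "\<dots> = ?\<mu>" unfolding distr_incr[OF s] by (subst distr_distr) (auto simp: o_def)
  finally show ?thesis .
 qed
 have lawR: "distr M borel ?R = maxlaw ?\<mu> (2 ^ m)" by (rule distr_rmax[OF ind law]) simp_all
 have Rm[measurable]: "?R \<in> borel_measurable M"
 proof -
  have "(\<lambda>w. rmax (restrict (\<lambda>i. ?D i w) {..<2 ^ m}) (2 ^ m) 0) \<in> borel_measurable M"
   by (rule measurable_compose[OF _ rmax_measurable[of 0 "2 ^ m" "{..<2 ^ m}"]])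
    (auto intro!: measurable_restrict borel_measurable_times incm)
  also have "(\<lambda>w. rmax (restrict (\<lambda>i. ?D i w) {..<2 ^ m}) (2 ^ m) 0) = ?R"
   by (rule ext, rule rmax_cong) simp
  finally show ?thesis .
 qed
 have coarse: "coarse_expectation ?\<mu> m A = expectation (\<lambda>w. min (?R w) A)"
  unfolding coarse_expectation_def lawR[symmetric]
  by (subst integral_distr) (auto simp: rmax_nonneg max_absorb1)
 have Rev: "x < ?R w \<longleftrightarrow> (\<exists>k\<le>2 ^ m. x / b < Z (s * real k) w - Z 0 w)" for x w
 proof -
  have "(\<Sum>i\<in>{0..<0 + k}. b * incr s i w) = b * (Z (s * real k) w - Z 0 w)" for k
   by (simp add: sum_incr flip: sum_distrib_left)
  then show ?thesis unfolding rmax_greater_iff using b by (simp add: pos_divide_less_eq mult.commute)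
 qed
 have Hev: "{w\<in>space M. x < ?H w} = {w\<in>space M. \<exists>u\<in>tgrid t. x / b < Z u w}" if x: "0 \<le> x" for x
 proof -
  have "{w\<in>space M. x < ?H w} = {w\<in>space M. x / b < gsup Z t w}" using b by (simp add: pos_divide_less_eq mult.commute)
  then show ?thesis using gsup_event[OF t, of "x / b"] x b by simp
 qed
 have H0: "0 \<le> ?H w" for w using b gsup_nonneg[of Z t w] by simp
 have R0: "0 \<le> ?R w" for w by (rule rmax_nonneg)
 let ?q = "8 * s * f (2 * b / \<delta>)"
 have q: "0 \<le> ?q" using s f_nonneg[of "2 * b / \<delta>"] b d by simp
 have lo: "expectation (\<lambda>w. min (?R w) A) \<le> expectation (\<lambda>w. min (?H w) A)"
 proof (rule integral_mono_AE)
  show "integrable M (\<lambda>w. min (?R w) A)" "integrable M (\<lambda>w. min (?H w) A)"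
   by (auto intro!: expectation_min_nn(1) A H0 R0)
  show "AE w in M. min (?R w) A \<le> min (?H w) A"
   using start_0 AE_space
  proof eventually_elim
   case (elim w)
   have "\<not> ?H w < ?R w"
   proof
    assume "?H w < ?R w"
    then obtain k where k: "k \<le> 2 ^ m" "?H w / b < Z (s * real k) w - Z 0 w" unfolding Rev by blast
    have mem: "s * real k \<in> tgrid t" unfolding tgrid_def s_def using k(1) by (intro image_eqI[of _ _ "(k, m)"]) auto
    have gl: "gsup Z t w < Z (s * real k) w" using k(2) b elim by simp
    have "gsup Z t w < gsup Z t w"
     by (rule iffD2[OF gsup_greater_iff[OF elim(2) t gsup_nonneg]], rule bexI[of _ "s * real k"], rule gl, rule mem)
    then show False by simp
   qed
   then show ?case by simp
  qed
 qed
 have up: "expectation (\<lambda>w. min (?H w) A) \<le> expectation (\<lambda>w. min (?R w) A) + \<delta> + ?q * A"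
 proof (cases "?q \<le> 1")
  case True
  have iR: "integrable M (\<lambda>w. min (?R w) A)" by (auto intro!: expectation_min_nn(1) A R0)
  have "(1 - ?q) * expectation (\<lambda>w. min (?H w) A) \<le> expectation (\<lambda>w. min (?R w + \<delta>) A)"
  proof (rule expectation_min_compare)
   show "0 \<le> 1 - ?q" using True by simp
   show "0 \<le> ?R w + \<delta>" for w using R0[of w] d by simp
   fix x :: real assume x: "0 \<le> x"
   have e: "0 < \<delta> / b" using d b by simp
   have f2: "2 / (\<delta> / b) = 2 * b / \<delta>" by simp
   have "{w\<in>space M. x < ?R w + \<delta>} = {w\<in>space M. x - \<delta> < ?R w}" by (simp only: diff_less_eq)
   also have "\<dots> = {w\<in>space M. \<exists>k\<le>2 ^ m. x / b - \<delta> / b < Z (t / 2 ^ m * real k) w - Z 0 w}"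
    unfolding Rev diff_divide_distrib unfolding s_def ..
   finally show "(1 - ?q) * prob {w\<in>space M. x < ?H w} \<le> prob {w\<in>space M. x < ?R w + \<delta>}"
    using coarse_grid_comparison[OF t e, of m "x / b"] unfolding f2 Hev[OF x] s_def by (simp only:)
  qed (use H0 A in auto)
  also have "\<dots> \<le> expectation (\<lambda>w. min (?R w) A + \<delta>)"
  proof (rule integral_mono)
   have "0 \<le> ?R w + \<delta>" for w using R0[of w] d by simp
   then show "integrable M (\<lambda>w. min (?R w + \<delta>) A)" by (intro expectation_min_nn(1) A) auto
  qed (use d iR in auto)
  also have "\<dots> = expectation (\<lambda>w. min (?R w) A) + \<delta>"
   using iR by (simp add: prob_space)
  finally have 1: "(1 - ?q) * expectation (\<lambda>w. min (?H w) A) \<le> expectation (\<lambda>w. min (?R w) A) + \<delta>" .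
  have "expectation (\<lambda>w. min (?H w) A) \<le> expectation (\<lambda>_. A)"
   by (rule integral_mono) (auto intro!: expectation_min_nn(1) A H0)
  then have "expectation (\<lambda>w. min (?H w) A) \<le> A" by (simp add: prob_space)
  from mult_left_mono[OF this q] 1 show ?thesis by (simp add: algebra_simps)
 next
  case False
  have "expectation (\<lambda>w. min (?H w) A) \<le> expectation (\<lambda>_. A)"
   by (rule integral_mono) (auto intro!: expectation_min_nn(1) A H0)
  then have "expectation (\<lambda>w. min (?H w) A) \<le> A" by (simp add: prob_space)
  also have "A \<le> ?q * A" using mult_right_mono[of 1 ?q A] False A by simp
  finally have "expectation (\<lambda>w. min (?H w) A) \<le> ?q * A" .
  moreover have "0 \<le> expectation (\<lambda>w. min (?R w) A)" using R0 A by (auto intro!: integral_nonneg_AE AE_I2)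
  ultimately show ?thesis using d by linarith
 qed
 have "0 \<le> ?q * A" using q A by (rule mult_nonneg_nonneg)
 then show ?thesis using lo up d unfolding s_def[symmetric] coarse by linarith
qed

lemma coarse_expectation_tendsto:
 assumes \<mu>n: "\<And>n. real_distribution (\<mu>n n)" and \<mu>: "real_distribution \<mu>" and A: "0 \<le> A"
  and ch: "\<And>t. (\<lambda>n. char (\<mu>n n) t) \<longlonglongrightarrow> char \<mu> t"
 shows "(\<lambda>n. coarse_expectation (\<mu>n n) m A) \<longlonglongrightarrow> coarse_expectation \<mu> m A"
 unfolding coarse_expectation_def
proof (rule weak_conv_imp_integral_bdd_continuous_conv[where B=A])
 show "real_distribution (maxlaw (\<mu>n n) (2 ^ m))" for n by (rule real_distribution_maxlaw(1)[OF \<mu>n])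
 show "real_distribution (maxlaw \<mu> (2 ^ m))" by (rule real_distribution_maxlaw(1)[OF \<mu>])
 show "weak_conv_m (\<lambda>n. maxlaw (\<mu>n n) (2 ^ m)) (maxlaw \<mu> (2 ^ m))" by (rule weak_conv_maxlaw[OF \<mu>n \<mu> ch])
 show "isCont (\<lambda>x. min (max x 0) A) x" for x by (intro continuous_intros)
 show "norm (min (max x 0) A) \<le> A" for x using A by auto
qed

lemma (in symmetric_levy) char_scaled:
 assumes t: "0 \<le> t" and b: "0 \<le> b"
 shows "real_distribution (distr M borel (\<lambda>w. b * Z t w))"
  "char (distr M borel (\<lambda>w. b * Z t w)) v = complex_of_real (exp (- (t * f (b * \<bar>v\<bar>))))"
proof -
 note [measurable] = measurable_X[OF t]
 show "real_distribution (distr M borel (\<lambda>w. b * Z t w))" by (rule real_distribution_distr) measurable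
 have "char (distr M borel (\<lambda>w. b * Z t w)) v = char (distr M borel (Z t)) (b * v)"
  unfolding char_def by (subst (1 2) integral_distr) (auto simp: mult_ac)
 then show "char (distr M borel (\<lambda>w. b * Z t w)) v = complex_of_real (exp (- (t * f (b * \<bar>v\<bar>))))"
  using char_Z[OF t, of "b * v"] b by (simp add: abs_mult)
qed

text \<open>Both processes are close to their maxima over a grid with \<open>2\<^sup>m\<close> steps, uniformly in \<open>n\<close>, and for fixed \<open>m\<close> the laws of these maxima converge
because the characteristic functions of the increments do.\<close>
lemma truncated_sup_limit:
 fixes tn b :: "nat => real"
 assumes Z: "doubling_levy M Z f" and Y: "doubling_levy N Y (\<lambda>x. x powr \<alpha>)"
  and tn: "\<And>n. 0 \<le> tn n" and b: "\<And>n. 0 < b n" and A: "0 \<le> A"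
  and lim: "\<And>x. 0 < x ==> (\<lambda>n. tn n * f (b n * x)) \<longlonglongrightarrow> x powr \<alpha>"
 shows "(\<lambda>n. integral\<^sup>L M (\<lambda>w. min (b n * gsup Z (tn n) w) A)) \<longlonglongrightarrow> integral\<^sup>L N (\<lambda>w. min (gsup Y 1 w) A)"
proof (rule LIMSEQ_I)
 interpret Z: doubling_levy M Z f by fact
 interpret Y: doubling_levy N Y "\<lambda>x. x powr \<alpha>" by fact
 let ?Zn = "\<lambda>n. integral\<^sup>L M (\<lambda>w. min (b n * gsup Z (tn n) w) A)" and ?Y = "integral\<^sup>L N (\<lambda>w. min (gsup Y 1 w) A)"
 fix e :: real assume e: "0 < e"
 define \<delta> where "\<delta> = e / 8"
 have d: "0 < \<delta>" using e by (simp add: \<delta>_def)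
 define q where "q = (2 / \<delta>) powr \<alpha> + 1"
 have q: "0 < q" by (simp add: q_def add_nonneg_pos)
 obtain m :: nat where m: "8 * q * A / \<delta> < 2 ^ m" using real_arch_pow[of 2] by auto
 have m': "8 * (1 / 2 ^ m) * q * A \<le> \<delta>" using m d by (simp add: field_simps)
 let ?\<mu>n = "\<lambda>n. distr M borel (\<lambda>w. b n * Z (tn n / 2 ^ m) w)" and ?\<mu> = "distr N borel (\<lambda>w. 1 * Y (1 / 2 ^ m) w)"
 have "(\<lambda>n. coarse_expectation (?\<mu>n n) m A) \<longlonglongrightarrow> coarse_expectation ?\<mu> m A"
 proof (rule coarse_expectation_tendsto[OF _ _ A])
  show "real_distribution (?\<mu>n n)" for n by (rule Z.char_scaled(1)) (use tn b in \<open>auto intro: less_imp_le\<close>)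
  show "real_distribution ?\<mu>" by (rule Y.char_scaled(1)) auto
  fix v :: real
  have c1: "char (?\<mu>n n) v = complex_of_real (exp (- (tn n / 2 ^ m * f (b n * \<bar>v\<bar>))))" for n
   by (rule Z.char_scaled(2)) (use tn b in \<open>auto intro: less_imp_le\<close>)
  have c2: "char ?\<mu> v = complex_of_real (exp (- (1 / 2 ^ m * (1 * \<bar>v\<bar>) powr \<alpha>)))"
   by (rule Y.char_scaled(2)) auto
  have l: "(\<lambda>n. tn n * f (b n * \<bar>v\<bar>)) \<longlonglongrightarrow> \<bar>v\<bar> powr \<alpha>"
  proof (cases "v = 0")
   case True
   then show ?thesis using Z.f_0 by simp
  qed (use lim in simp)
  have "(\<lambda>n. exp (- (1 / 2 ^ m * (tn n * f (b n * \<bar>v\<bar>))))) \<longlonglongrightarrow> exp (- (1 / 2 ^ m * \<bar>v\<bar> powr \<alpha>))"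
   by (intro tendsto_intros l)
  then show "(\<lambda>n. char (?\<mu>n n) v) \<longlonglongrightarrow> char ?\<mu> v" unfolding c1 c2 by (intro tendsto_of_real) simp
 qed
 then have ev1: "\<forall>\<^sub>F n in sequentially. dist (coarse_expectation (?\<mu>n n) m A) (coarse_expectation ?\<mu> m A) < \<delta>"
  by (rule tendstoD[OF _ d])
 have "(\<lambda>n. tn n * f (b n * (2 / \<delta>))) \<longlonglongrightarrow> (2 / \<delta>) powr \<alpha>" by (rule lim) (use d in simp)
 then have ev2: "\<forall>\<^sub>F n in sequentially. tn n * f (b n * (2 / \<delta>)) < q" by (rule order_tendstoD(2)) (simp add: q_def)
 have Yb: "\<bar>?Y - coarse_expectation ?\<mu> m A\<bar> \<le> 2 * \<delta>"
 proof -
  have "\<bar>integral\<^sup>L N (\<lambda>w. min (1 * gsup Y 1 w) A) - coarse_expectation ?\<mu> m A\<bar> \<le> \<delta> + 8 * (1 / 2 ^ m) * (2 * 1 / \<delta>) powr \<alpha> * A"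
   by (rule Y.gsup_coarse) (use A d in auto)
  also have "8 * (1 / 2 ^ m) * (2 * 1 / \<delta>) powr \<alpha> * A \<le> 8 * (1 / 2 ^ m) * q * A"
   by (intro mult_right_mono mult_left_mono) (auto simp: q_def A)
  finally show ?thesis using m' by simp
 qed
 have "\<forall>\<^sub>F n in sequentially. norm (?Zn n - ?Y) < e"
  using ev1 ev2
 proof eventually_elim
  case (elim n)
  have "\<bar>?Zn n - coarse_expectation (?\<mu>n n) m A\<bar> \<le> \<delta> + 8 * (tn n / 2 ^ m) * f (2 * b n / \<delta>) * A"
   by (rule Z.gsup_coarse[OF tn b A d])
  also have "8 * (tn n / 2 ^ m) * f (2 * b n / \<delta>) * A = 8 * (1 / 2 ^ m) * (tn n * f (b n * (2 / \<delta>))) * A"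
   by (simp add: mult_ac)
  also have "\<dots> \<le> 8 * (1 / 2 ^ m) * q * A"
   by (intro mult_right_mono mult_left_mono) (use elim A in auto)
  finally have "\<bar>?Zn n - coarse_expectation (?\<mu>n n) m A\<bar> \<le> 2 * \<delta>" using m' by simp
  then have "\<bar>?Zn n - ?Y\<bar> < 5 * \<delta>" using Yb elim(1) unfolding dist_real_def by linarith
  then show ?case using e unfolding \<delta>_def by simp
 qed
 then show "\<exists>no. \<forall>n\<ge>no. norm (?Zn n - ?Y) < e" by (simp add: eventually_sequentially)
qed

lemma sup_process_eq_tgrid:
 assumes "levy_process N Y" "w \<in> space N" "0 \<le> t"
 shows "sup_process Y t w = (SUP u\<in>tgrid t. Y u w)"
proof -
 interpret levy_process N Y by fact
 have c: "cadlag (\<lambda>s. Y s w)" by (rule cadlag_paths) fact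
 have bdd: "bdd_above ((\<lambda>s. Y s w) ` {0..t})"
  by (rule bounded_imp_bdd_above[OF cadlag_bounded[OF c assms(3)]])
 have sub: "tgrid t \<subseteq> {0..t}" using tgrid_bounds[OF assms(3)] by auto
 have bddg: "bdd_above ((\<lambda>s. Y s w) ` tgrid t)" by (rule bdd_above_mono[OF bdd image_mono[OF sub]])
 have ne: "tgrid t \<noteq> {}" using tgrid_0 by blast
 have le: "(SUP u\<in>tgrid t. Y u w) \<le> (SUP s\<in>{0..t}. Y s w)" by (rule cSUP_subset_mono[OF ne bdd sub]) simp
 have ge: "(SUP s\<in>{0..t}. Y s w) \<le> (SUP u\<in>tgrid t. Y u w)"
 proof (rule cSUP_least)
  fix s assume s: "s \<in> {0..t}"
  have grid: "Y u w \<in> {..SUP u\<in>tgrid t. Y u w}" if "u \<in> tgrid t" for u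
   using cSUP_upper[OF that bddg] by simp
  have "Y s w \<in> {..SUP u\<in>tgrid t. Y u w}"
   by (rule cadlag_closed_tgrid[where t=t, OF c closed_atMost], erule grid) (use s in simp_all)
  then show "Y s w \<le> (SUP u\<in>tgrid t. Y u w)" by simp
 qed (use assms(3) in auto)
 show ?thesis using le ge unfolding sup_process_def by simp
qed

lemma sup_process_eq_gsup:
 assumes "levy_process N Y" "w \<in> space N" "Y 0 w = 0" "0 \<le> t"
 shows "sup_process Y t w = gsup Y t w"
proof -
 interpret levy_process N Y by fact
 have "bdd_above ((\<lambda>s. Y s w) ` {0..t})"
  by (rule bounded_imp_bdd_above[OF cadlag_bounded[OF cadlag_paths[OF assms(2)] assms(4)]])
 then have "Y 0 w \<le> sup_process Y t w" unfolding sup_process_def by (intro cSUP_upper) (use assms(4) in auto)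
 then show ?thesis using assms(3) sup_process_eq_tgrid[OF assms(1,2,4)] unfolding gsup_def by simp
qed

section \<open>Scaling and uniform tails\<close>

lemma doubling_iterate:
 fixes f :: "real => real"
 assumes dbl: "\<And>a b. 0 \<le> b ==> b \<le> 2 * a ==> f b \<le> 4 * f a" and y: "0 \<le> y"
 shows "f (2 ^ k * y) \<le> 4 ^ k * f y"
proof (induction k)
 case (Suc k)
 have "f (2 ^ Suc k * y) \<le> 4 * f (2 ^ k * y)" by (rule dbl) (use y in auto)
 then show ?case using Suc by simp
qed simp

lemma regularly_varying_tendsto_at_top:
 fixes f :: "real => real"
 assumes dbl: "\<And>a b. 0 \<le> b ==> b \<le> 2 * a ==> f b \<le> 4 * f a" and nn: "\<And>b. 0 \<le> b ==> 0 \<le> f b"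
  and rv: "regularly_varying \<alpha> f" and \<alpha>: "0 < \<alpha>"
 shows "filterlim f at_top at_top"
proof -
 define \<beta> where "\<beta> = \<alpha> / 2"
 have \<beta>: "0 \<le> \<beta>" "\<beta> < \<alpha>" using \<alpha> by (auto simp: \<beta>_def)
 obtain y0 where y0: "1 \<le> y0" "\<And>y. y0 \<le> y ==> 0 < f y" "\<And>y. y0 \<le> y ==> 2 powr \<beta> * f y \<le> f (2 * y)"
  using regularly_varying_at_top[OF rv nn \<beta>] by blast
 have it: "(2 powr \<beta>) ^ k * f y0 \<le> f (2 ^ k * y0)" for k
 proof (induction k)
  case (Suc k)
  have "1 * y0 \<le> 2 ^ k * y0" using y0(1) by (intro mult_right_mono) auto
  then have "2 powr \<beta> * f (2 ^ k * y0) \<le> f (2 * (2 ^ k * y0))" by (intro y0(3)) simp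
  moreover have "2 powr \<beta> * ((2 powr \<beta>) ^ k * f y0) \<le> 2 powr \<beta> * f (2 ^ k * y0)" by (rule mult_left_mono[OF Suc]) simp
  ultimately have "2 powr \<beta> * ((2 powr \<beta>) ^ k * f y0) \<le> f (2 * (2 ^ k * y0))" by linarith
  then show ?case by (simp only: power_Suc mult.assoc)
 qed simp
 have g: "1 < (2::real) powr \<beta>" using \<alpha> by (simp add: \<beta>_def)
 have f0: "0 < f y0" by (rule y0(2)) simp
 show ?thesis unfolding filterlim_at_top
 proof
  fix Z :: real
  obtain k where "4 * Z / f y0 < (2 powr \<beta>) ^ k" using real_arch_pow[OF g] by blast
  then have k: "4 * Z < f (2 ^ k * y0)" using f0 it[of k] by (simp add: pos_divide_less_eq)
  have "Z \<le> f b" if "2 ^ k * y0 \<le> b" for b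
  proof -
   have "0 \<le> 2 ^ k * y0" using y0(1) by simp
   then have "f (2 ^ k * y0) \<le> 4 * f b" using that by (intro dbl) auto
   then show ?thesis using k by simp
  qed
  then show "\<forall>\<^sub>F b in at_top. Z \<le> f b" unfolding eventually_at_top_linorder by blast
 qed
qed

text \<open>The scale at which the exponent equals \<open>1 / t\<close>.  Regular variation turns ratios of \<open>f\<close> at this scale into the stable exponent.\<close>
lemma inverse_scale:
 fixes f :: "real => real"
 assumes dbl: "\<And>a b. 0 \<le> b ==> b \<le> 2 * a ==> f b \<le> 4 * f a" and nn: "\<And>b. 0 \<le> b ==> 0 \<le> f b"
  and cont: "\<And>b. isCont (\<lambda>b. f \<bar>b\<bar>) b" and f0: "f 0 = 0"
  and rv: "regularly_varying \<alpha> f" and \<alpha>: "0 < \<alpha>"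
  and tn: "\<And>n. 0 < tn n" "tn \<longlonglongrightarrow> 0"
 defines "b \<equiv> \<lambda>n. gen_inverse f (1 / tn n)"
 shows "\<And>n. 0 < b n" "\<And>n. tn n * f (b n) = 1" "filterlim b at_top sequentially"
  "\<And>x. 0 < x ==> (\<lambda>n. tn n * f (b n * x)) \<longlonglongrightarrow> x powr \<alpha>"
proof -
 note top = regularly_varying_tendsto_at_top[OF dbl nn rv \<alpha>]
 have s: "0 < 1 / tn n" for n using tn(1)[of n] by simp
 show b0: "0 < b n" for n unfolding b_def by (rule gen_inverse_properties(1)[OF cont f0 top s])
 have fb: "f (b n) = 1 / tn n" for n unfolding b_def by (rule gen_inverse_properties(2)[OF cont f0 top s])
 show tf: "tn n * f (b n) = 1" for n using tn(1)[of n] by (simp add: fb)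
 show bt: "filterlim b at_top sequentially"
  unfolding filterlim_at_top
 proof
  fix Z :: real
  have "(\<lambda>n. tn n * (4 * f Z)) \<longlonglongrightarrow> 0 * (4 * f Z)" by (intro tendsto_mult_right tn(2))
  then have "\<forall>\<^sub>F n in sequentially. tn n * (4 * f Z) < 1" by (rule order_tendstoD(2)) simp
  then show "\<forall>\<^sub>F n in sequentially. Z \<le> b n"
  proof eventually_elim
   case (elim n)
   show ?case
   proof (rule ccontr)
    assume "\<not> Z \<le> b n"
    then have "f (b n) \<le> 4 * f Z" using b0[of n] by (intro dbl) auto
    then have "tn n * f (b n) \<le> tn n * (4 * f Z)" using tn(1)[of n] by (intro mult_left_mono) auto
    then show False using elim tf[of n] by simp
   qed
  qed
 qed
 show "(\<lambda>n. tn n * f (b n * x)) \<longlonglongrightarrow> x powr \<alpha>" if x: "0 < x" for x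
 proof -
  have "((\<lambda>y. f (x * y) / f y) \<longlongrightarrow> x powr \<alpha>) at_top" using rv x unfolding regularly_varying_def by blast
  from filterlim_compose[OF this bt] have "(\<lambda>n. f (x * b n) / f (b n)) \<longlonglongrightarrow> x powr \<alpha>" .
  moreover have "f (x * b n) / f (b n) = tn n * f (b n * x)" for n by (simp add: fb mult.commute)
  ultimately show ?thesis by simp
 qed
qed

lemma (in prob_space) polynomial_tail:
 fixes W :: "'a => real"
 assumes W[measurable]: "W \<in> borel_measurable M" and W0: "\<And>w. 0 \<le> W w" and \<beta>: "1 < \<beta>" and C: "0 \<le> C"
  and tail: "\<And>x. 1 \<le> x ==> prob {w\<in>space M. x < W w} \<le> C * x powr (- \<beta>)"
 shows "\<And>a. 1 \<le> a ==> integrable M (\<lambda>w. max (W w - a) 0)"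
  "\<And>a. 1 \<le> a ==> expectation (\<lambda>w. max (W w - a) 0) \<le> C / (\<beta> - 1) * a powr (1 - \<beta>)"
  "integrable M W" "expectation W \<le> 1 + C / (\<beta> - 1)"
proof -
 have nn: "(\<integral>\<^sup>+w. ennreal (max (W w - a) 0) \<partial>M) \<le> ennreal (C / (\<beta> - 1) * a powr (1 - \<beta>))" if a: "1 \<le> a" for a
 proof -
  have "(\<integral>\<^sup>+w. ennreal (max (W w - a) 0) \<partial>M) = (\<integral>\<^sup>+w. ennreal (W w - a) \<partial>M)"
   by (rule nn_integral_cong) (auto simp: max_def ennreal_neg)
  also have "\<dots> \<le> ennreal (C / (\<beta> - 1) * a powr (1 - \<beta>))"
   by (rule expectation_tail_le[OF W \<beta> C]) (use a tail in auto)
  finally show ?thesis .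
 qed
 show int: "integrable M (\<lambda>w. max (W w - a) 0)" if a: "1 \<le> a" for a
 proof (rule integrableI_nonneg)
  show "(\<integral>\<^sup>+w. ennreal (max (W w - a) 0) \<partial>M) < \<infinity>" by (rule le_less_trans[OF nn[OF a]]) simp
  show "(\<lambda>w. max (W w - a) 0) \<in> borel_measurable M" by measurable
 qed simp
 show E: "expectation (\<lambda>w. max (W w - a) 0) \<le> C / (\<beta> - 1) * a powr (1 - \<beta>)" if a: "1 \<le> a" for a
 proof -
  have "ennreal (expectation (\<lambda>w. max (W w - a) 0)) \<le> ennreal (C / (\<beta> - 1) * a powr (1 - \<beta>))"
   using nn[OF a] by (subst (asm) nn_integral_eq_integral[OF int[OF a]]) auto
  moreover have "0 \<le> C / (\<beta> - 1) * a powr (1 - \<beta>)" using C \<beta> by simp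
  ultimately show ?thesis by (simp only: ennreal_le_iff)
 qed
 have i1: "integrable M (\<lambda>w. 1 + max (W w - 1) 0)" using int[of 1] by simp
 show iW: "integrable M W"
  by (rule Bochner_Integration.integrable_bound[OF i1]) (use W0 in \<open>auto simp: max_def\<close>)
 have "expectation W \<le> expectation (\<lambda>w. 1 + max (W w - 1) 0)"
  by (rule integral_mono[OF iW i1]) simp
 also have "\<dots> = 1 + expectation (\<lambda>w. max (W w - 1) 0)" using int[of 1] by (simp add: prob_space)
 finally show "expectation W \<le> 1 + C / (\<beta> - 1)" using E[of 1] by simp
qed

definition nsup :: "(real => 'w => 'a::real_normed_vector) => real => 'w => real" where
 "nsup X t w = (SUP u\<in>tgrid t. norm (X u w))"

context levy_process
begin

lemma bdd_above_norm_tgrid: "w \<in> space M ==> 0 \<le> t ==> bdd_above ((\<lambda>u. norm (X u w)) ` tgrid t)"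
proof -
 assume w: "w \<in> space M" and t: "0 \<le> t"
 obtain B where B: "\<And>x. x \<in> (\<lambda>s. X s w) ` {0..t} ==> norm x \<le> B"
  using cadlag_bounded[OF cadlag_paths[OF w] t] unfolding bounded_iff by blast
 show ?thesis
 proof (rule bdd_aboveI2)
  fix u assume "u \<in> tgrid t"
  then have "u \<in> {0..t}" using tgrid_bounds[OF t, of u] by simp
  then show "norm (X u w) \<le> B" by (intro B imageI)
 qed
qed

lemma nsup_greater_iff:
 assumes "w \<in> space M" "0 \<le> t"
 shows "x < nsup X t w \<longleftrightarrow> (\<exists>u\<in>tgrid t. x < norm (X u w))"
proof -
 have ne: "tgrid t \<noteq> {}" using tgrid_0 by blast
 show ?thesis unfolding nsup_def by (rule less_cSUP_iff[OF ne bdd_above_norm_tgrid[OF assms]])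
qed

lemma norm_le_nsup: "w \<in> space M ==> 0 \<le> t ==> u \<in> tgrid t ==> norm (X u w) \<le> nsup X t w"
 unfolding nsup_def by (rule cSUP_upper[OF _ bdd_above_norm_tgrid])

lemma nsup_event: "0 \<le> t ==> {w\<in>space M. x < nsup X t w} = (\<Union>u\<in>tgrid t. {w\<in>space M. x < norm (X u w)})"
proof -
 assume t: "0 \<le> t"
 show ?thesis
 proof (rule set_eqI)
  fix w
  show "w \<in> {w\<in>space M. x < nsup X t w} \<longleftrightarrow> w \<in> (\<Union>u\<in>tgrid t. {w\<in>space M. x < norm (X u w)})"
   using nsup_greater_iff[OF _ t, of w x] by (cases "w \<in> space M") (simp_all only: mem_Collect_eq UN_iff, simp_all)
 qed
qed

lemma nsup_measurable: "0 \<le> t ==> nsup X t \<in> borel_measurable M"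
proof (rule borel_measurableI_greater)
 fix x assume t: "0 \<le> t"
 show "{w\<in>space M. x < nsup X t w} \<in> events"
  unfolding nsup_event[OF t]
 proof (rule sets.countable_UN''[OF countable_tgrid])
  fix u assume "u \<in> tgrid t"
  then have [measurable]: "X u \<in> borel_measurable M" using tgrid_bounds[OF t] by (intro measurable_X) blast
  show "{w\<in>space M. x < norm (X u w)} \<in> events" by measurable
 qed
qed

end

text \<open>A large norm forces one of finitely many coordinates to be large in one of two directions.\<close>
lemma nsup_tail:
 fixes X :: "real => 'w => real^'n"
 assumes L: "levy_process M X" and proj: "\<And>\<nu>. norm \<nu> = 1 ==> doubling_levy M (\<lambda>t w. X t w \<bullet> \<nu>) f"
  and t: "0 \<le> t" and x: "0 < x"
 shows "measure M {w\<in>space M. x < nsup X t w} \<le> 32 * real CARD('n) * t * f (2 * real CARD('n) / x)"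
proof -
 interpret levy_process M X by fact
 define c where "c = real CARD('n)"
 have c: "0 < c" by (simp add: c_def)
 define F where "F s i = {w\<in>space M. \<exists>u\<in>tgrid t. x / c < X u w \<bullet> (s *\<^sub>R axis i 1)}" for s :: real and i :: 'n
 have F: "F s i \<in> events \<and> prob (F s i) \<le> 16 * t * f (2 * c / x)" if s: "\<bar>s\<bar> = 1" for s i
 proof -
  have "norm (s *\<^sub>R axis i 1 :: real^'n) = 1" using s by (simp add: norm_axis_1)
  then interpret Z: doubling_levy M "\<lambda>t w. X t w \<bullet> (s *\<^sub>R axis i 1)" f by (rule proj)
  have "0 < x / c" using x c by simp
  from Z.prob_sup_greater[OF t this] Z.tgrid_event_measurable[OF t, of "x / c"] show ?thesis
   unfolding F_def by simp
 qed
 have sub: "{w\<in>space M. x < nsup X t w} \<subseteq> (\<Union>i\<in>UNIV. F 1 i \<union> F (-1) i)"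
 proof
  fix w assume "w \<in> {w\<in>space M. x < nsup X t w}"
  then have w: "w \<in> space M" and "x < nsup X t w" by simp_all
  then obtain u where u: "u \<in> tgrid t" "x < norm (X u w)" using nsup_greater_iff[OF w t] by blast
  have "\<exists>i. x / c < \<bar>X u w $ i\<bar>"
  proof (rule ccontr)
   assume "\<not> ?thesis"
   then have "(\<Sum>i\<in>UNIV. \<bar>X u w $ i\<bar>) \<le> (\<Sum>i\<in>(UNIV::'n set). x / c)" by (intro sum_mono) (simp add: not_less)
   also have "\<dots> = x" using c by (simp add: c_def)
   finally show False using norm_le_l1_cart[of "X u w"] u(2) by linarith
  qed
  then obtain i where i: "x / c < \<bar>X u w $ i\<bar>" by blast
  have ia: "X u w \<bullet> (s *\<^sub>R axis i 1) = s * X u w $ i" for s by (simp add: inner_axis)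
  have "x / c < X u w \<bullet> (1 *\<^sub>R axis i 1) \<or> x / c < X u w \<bullet> ((-1) *\<^sub>R axis i 1)"
   unfolding ia using i by linarith
  then have "w \<in> F 1 i \<or> w \<in> F (-1) i" unfolding F_def using w u(1) by blast
  then show "w \<in> (\<Union>i\<in>UNIV. F 1 i \<union> F (-1) i)" by blast
 qed
 have "prob {w\<in>space M. x < nsup X t w} \<le> prob (\<Union>i\<in>UNIV. F 1 i \<union> F (-1) i)"
  by (rule finite_measure_mono[OF sub]) (use F[of 1] F[of "-1"] in auto)
 also have "\<dots> \<le> (\<Sum>i\<in>(UNIV::'n set). prob (F 1 i \<union> F (-1) i))"
  by (rule finite_measure_subadditive_finite) (use F[of 1] F[of "-1"] in auto)
 also have "\<dots> \<le> (\<Sum>i\<in>(UNIV::'n set). 32 * t * f (2 * c / x))"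
 proof (rule sum_mono)
  fix i :: 'n
  have "prob (F 1 i \<union> F (-1) i) \<le> prob (F 1 i) + prob (F (-1) i)"
   by (rule measure_Un_le) (use F[of 1 i] F[of "-1" i] in auto)
  then show "prob (F 1 i \<union> F (-1) i) \<le> 32 * t * f (2 * c / x)" using F[of 1 i] F[of "-1" i] by simp
 qed
 finally show ?thesis by (simp add: c_def mult_ac)
qed

text \<open>The deterministic part of the truncation argument.  If the displacement \<open>S\<close> is small, the geometric estimate holds and
truncating at \<open>A\<close> costs at most \<open>T\<close>; if it is not, then \<open>T\<close> is of order \<open>b\<close> and dominates everything, since the volume is at most \<open>v\<close>.\<close>
lemma truncation_bounds:
 fixes h a a' :: "nat => real" and N :: nat
 assumes h: "\<And>i. i < N ==> 0 \<le> h i \<and> h i \<le> S" and a: "\<And>i. 0 \<le> a i" "\<And>i. 0 \<le> a' i"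
  and V: "0 \<le> V" "V \<le> v" and R: "0 < R" "R \<le> 1" and \<eta>: "0 \<le> \<eta>" and S: "0 \<le> S"
  and lo: "S < R ==> (\<Sum>i<N. a i * h i) - \<eta> * S \<le> V" and up: "S < R ==> V \<le> (\<Sum>i<N. a' i * h i) + \<eta> * S"
  and b: "0 < b" and A: "0 \<le> A" "A < b * R"
 defines "U \<equiv> min (b * S) b"
 defines "T \<equiv> 2 * max (U - A / 2) 0"
 shows "b * V \<le> (\<Sum>i<N. a' i * min (b * h i) A) + \<eta> * U + ((\<Sum>i<N. a' i) + v / R) * T"
  "(\<Sum>i<N. a i * min (b * h i) A) - \<eta> * U - (\<Sum>i<N. a i) * T \<le> b * V"
proof -
 have T0: "0 \<le> T" by (simp add: T_def)
 have U0: "0 \<le> U" using b S by (simp add: U_def)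
 have v0: "0 \<le> v" using V by simp
 have vR: "0 \<le> v / R * T" using v0 R T0 by simp
 have UT: "U \<le> T" if "A < U" using that A unfolding T_def by (simp add: max_def)
 have a's: "0 \<le> (\<Sum>i<N. a' i)" "0 \<le> (\<Sum>i<N. a i)" using a by (simp_all add: sum_nonneg)
 have mn: "0 \<le> min (b * h i) A" if "i < N" for i using h[OF that] b A by simp
 have ha: "(\<Sum>i<N. a i * (b * h i)) = b * (\<Sum>i<N. a i * h i)" for a :: "nat => real" by (simp add: sum_distrib_left mult_ac)
 have "(b * V \<le> (\<Sum>i<N. a' i * min (b * h i) A) + \<eta> * U + ((\<Sum>i<N. a' i) + v / R) * T) \<and>
  ((\<Sum>i<N. a i * min (b * h i) A) - \<eta> * U - (\<Sum>i<N. a i) * T \<le> b * V)"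
 proof (cases "S < R")
  case True
  have "b * S \<le> b * 1" using True R b by (intro mult_left_mono) auto
  then have U: "U = b * S" by (simp add: U_def)
  have le: "b * h i \<le> min (b * h i) A + T" if "i < N" for i
  proof (cases "b * h i \<le> A")
   case True
   then show ?thesis using T0 by simp
  next
   case False
   have "b * h i \<le> U" unfolding U using h[OF that] b by (intro mult_left_mono) auto
   then show ?thesis using False UT A by simp
  qed
  have "b * V \<le> b * ((\<Sum>i<N. a' i * h i) + \<eta> * S)" using up[OF True] b by (intro mult_left_mono) auto
  also have "\<dots> = (\<Sum>i<N. a' i * (b * h i)) + \<eta> * U" unfolding ha U by (simp add: algebra_simps)
  also have "(\<Sum>i<N. a' i * (b * h i)) \<le> (\<Sum>i<N. a' i * (min (b * h i) A + T))"
   by (intro sum_mono mult_left_mono a) (use le in auto)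
  also have "\<dots> = (\<Sum>i<N. a' i * min (b * h i) A) + (\<Sum>i<N. a' i) * T"
   by (simp add: distrib_left sum.distrib sum_distrib_right)
  finally have 1: "b * V \<le> (\<Sum>i<N. a' i * min (b * h i) A) + \<eta> * U + ((\<Sum>i<N. a' i) + v / R) * T"
   using vR by (simp add: distrib_right)
  have "(\<Sum>i<N. a i * min (b * h i) A) \<le> (\<Sum>i<N. a i * (b * h i))"
   by (intro sum_mono mult_left_mono a) simp
  also have "\<dots> = b * ((\<Sum>i<N. a i * h i) - \<eta> * S) + \<eta> * U" unfolding ha U by (simp add: algebra_simps)
  also have "\<dots> \<le> b * V + \<eta> * U" using lo[OF True] b by simp
  finally have 2: "(\<Sum>i<N. a i * min (b * h i) A) - \<eta> * U \<le> b * V" by simp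
  have "0 \<le> (\<Sum>i<N. a i) * T" using a's T0 by simp
  then show ?thesis using 1 2 by linarith
 next
  case False
  have "b * R \<le> U" unfolding U_def using False R b by simp
  then have AU: "A < U" and bT: "b * R \<le> T" using A UT by linarith+
  have "b * V \<le> b * v" using V b by (intro mult_left_mono) auto
  also have "b * v = v / R * (b * R)" using R by simp
  also have "\<dots> \<le> v / R * T" using bT v0 R by (intro mult_left_mono) auto
  finally have 1: "b * V \<le> v / R * T" .
  have "0 \<le> (\<Sum>i<N. a' i * min (b * h i) A)" by (intro sum_nonneg mult_nonneg_nonneg a) (use mn in auto)
  moreover have "0 \<le> \<eta> * U" "0 \<le> (\<Sum>i<N. a' i) * T" using \<eta> U0 a's T0 by simp_all
  moreover have "(\<Sum>i<N. a i * min (b * h i) A) \<le> (\<Sum>i<N. a i * T)"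
   by (intro sum_mono mult_left_mono a) (use AU UT in auto)
  moreover have "(\<Sum>i<N. a i * T) = (\<Sum>i<N. a i) * T" by (simp add: sum_distrib_right)
  moreover have "0 \<le> b * V" using b V by simp
  ultimately show ?thesis using 1 unfolding distrib_right by linarith
 qed
 then show "b * V \<le> (\<Sum>i<N. a' i * min (b * h i) A) + \<eta> * U + ((\<Sum>i<N. a' i) + v / R) * T"
  "(\<Sum>i<N. a i * min (b * h i) A) - \<eta> * U - (\<Sum>i<N. a i) * T \<le> b * V" by blast+
qed

lemma symmetric_stable_doubling:
 assumes st: "symmetric_stable_process \<alpha> N Y" and \<alpha>: "1 < \<alpha>" "\<alpha> \<le> 2"
 shows "doubling_levy N Y (\<lambda>x. x powr \<alpha>)"
proof (intro doubling_levy.intro symmetric_levy.intro symmetric_levy_axioms.intro doubling_levy_axioms.intro)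
 have L: "levy_process N Y" and ce: "char_exponent N Y (\<lambda>\<xi>. complex_of_real (\<bar>\<xi>\<bar> powr \<alpha>))"
  using st unfolding symmetric_stable_process_def by blast+
 show "levy_process N Y" by (rule L)
 fix t b :: real assume t: "0 \<le> t"
 have "char (distr N borel (\<lambda>w. Y t w \<bullet> 1)) b = exp (- (complex_of_real t * complex_of_real (\<bar>b *\<^sub>R 1\<bar> powr \<alpha>)))"
  unfolding char_projection[OF L t] by (rule char_exponentD[OF ce t])
 then show "char (distr N borel (Y t)) b = complex_of_real (exp (- (t * \<bar>b\<bar> powr \<alpha>)))"
  by (simp flip: of_real_mult of_real_minus exp_of_real)
next
 fix a b :: real assume ab: "0 \<le> b" "b \<le> 2 * a"
 then have a: "0 \<le> a" by simp
 have "b powr \<alpha> \<le> (2 * a) powr \<alpha>" using ab \<alpha> by (intro powr_mono2) auto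
 also have "\<dots> = 2 powr \<alpha> * a powr \<alpha>" using a by (simp add: powr_mult)
 also have "\<dots> \<le> 2 powr 2 * a powr \<alpha>" using \<alpha> by (intro mult_right_mono powr_mono) auto
 finally show "b powr \<alpha> \<le> 4 * a powr \<alpha>" by simp
qed

lemma stable_sup_expectation:
 assumes Y: "doubling_levy N Y (\<lambda>x. x powr \<alpha>)" and \<alpha>: "1 < \<alpha>"
 shows "((\<lambda>A. integral\<^sup>L N (\<lambda>w. min (gsup Y 1 w) A)) \<longlongrightarrow> integral\<^sup>L N (gsup Y 1)) at_top"
  "A \<ge> 1 ==> integral\<^sup>L N (\<lambda>w. min (gsup Y 1 w) A) \<le> integral\<^sup>L N (gsup Y 1)"
  "integral\<^sup>L N (gsup Y 1) = integral\<^sup>L N (sup_process Y 1)"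
proof -
 interpret doubling_levy N Y "\<lambda>x. x powr \<alpha>" by fact
 let ?W = "gsup Y 1" and ?C = "16 * 2 powr \<alpha>"
 have Wm[measurable]: "?W \<in> borel_measurable N" by (rule gsup_measurable) simp
 have tail: "prob {w\<in>space N. x < ?W w} \<le> ?C * x powr (- \<alpha>)" if x: "1 \<le> x" for x
 proof -
  have "prob {w\<in>space N. x < ?W w} \<le> 16 * 1 * (2 / x) powr \<alpha>"
   using prob_sup_greater[of 1 x] gsup_event[of 1 x] x by simp
  then show ?thesis using x by (simp add: powr_divide powr_minus field_simps)
 qed
 note pt = polynomial_tail[OF Wm gsup_nonneg \<alpha> _ tail]
 have iW: "integrable N ?W" by (rule pt(3)) auto
 have iM: "integrable N (\<lambda>w. max (?W w - A) 0)" if "1 \<le> A" for A by (rule pt(1)) (use that in auto)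
 have bM: "expectation (\<lambda>w. max (?W w - A) 0) \<le> ?C / (\<alpha> - 1) * A powr (1 - \<alpha>)" if "1 \<le> A" for A
  by (rule pt(2)) (use that in auto)
 have im: "integrable N (\<lambda>w. min (?W w) A)" if "1 \<le> A" for A
  by (rule expectation_min_nn(1)) (use that gsup_nonneg in auto)
 have eq: "expectation ?W - expectation (\<lambda>w. min (?W w) A) = expectation (\<lambda>w. max (?W w - A) 0)" if A: "1 \<le> A" for A
 proof -
  have "max (?W w - A) 0 = ?W w - min (?W w) A" for w by (simp add: max_def min_def)
  then show ?thesis using iW im[OF A] by (simp add: Bochner_Integration.integral_diff)
 qed
 show le: "expectation (\<lambda>w. min (?W w) A) \<le> expectation ?W" if "1 \<le> A" for A
  by (rule integral_mono[OF im[OF that] iW]) simp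
 show "((\<lambda>A. expectation (\<lambda>w. min (?W w) A)) \<longlongrightarrow> expectation ?W) at_top"
 proof (rule tendsto_sandwich)
  have "((\<lambda>A. expectation ?W - ?C / (\<alpha> - 1) * A powr (1 - \<alpha>)) \<longlongrightarrow> expectation ?W - ?C / (\<alpha> - 1) * 0) at_top"
   by (intro tendsto_intros tendsto_neg_powr filterlim_ident) (use \<alpha> in simp)
  then show "((\<lambda>A. expectation ?W - ?C / (\<alpha> - 1) * A powr (1 - \<alpha>)) \<longlongrightarrow> expectation ?W) at_top" by simp
  show "\<forall>\<^sub>F A in at_top. expectation ?W - ?C / (\<alpha> - 1) * A powr (1 - \<alpha>) \<le> expectation (\<lambda>w. min (?W w) A)"
   using eventually_ge_at_top[of 1]
  proof eventually_elim
   case (elim A)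
   then show ?case using eq[OF elim] bM[OF elim] by linarith
  qed
  show "\<forall>\<^sub>F A in at_top. expectation (\<lambda>w. min (?W w) A) \<le> expectation ?W"
   using eventually_ge_at_top[of 1] by eventually_elim (rule le)
 qed simp
 show "expectation ?W = expectation (sup_process Y 1)"
 proof (rule integral_cong_AE[OF Wm])
  show ae: "AE w in N. gsup Y 1 w = sup_process Y 1 w"
   using start_0 AE_space by eventually_elim (rule sup_process_eq_gsup[OF levy_process_axioms, symmetric], auto)
  have eqs: "sup_process Y 1 w = (SUP u\<in>tgrid 1. Y u w)" if w: "w \<in> space N" for w
   by (rule sup_process_eq_tgrid[OF levy_process_axioms w]) simp
  have "(\<lambda>w. SUP u\<in>tgrid 1. Y u w) \<in> borel_measurable N"
  proof (rule borel_measurable_cSUP[OF countable_tgrid])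
   show "Y u \<in> borel_measurable N" if "u \<in> tgrid 1" for u
    using tgrid_bounds[OF zero_le_one that] by (intro measurable_X) simp
   show "bdd_above ((\<lambda>u. Y u w) ` tgrid 1)" if "w \<in> space N" for w
    by (rule bdd_above_tgrid[OF that]) simp
  qed
  then show "sup_process Y 1 \<in> borel_measurable N"
   by (rule measurable_cong[THEN iffD2, rotated]) (rule eqs)
 qed
qed

text \<open>Paths that start at zero satisfy the hypotheses on \<open>K\<close> in the geometric estimate.\<close>
lemma AE_hgt_path_range:
 fixes X :: "real => 'w => 'a::euclidean_space"
 assumes "levy_process M X" and t: "0 \<le> t"
 shows "AE w in M. 0 \<in> path_range X t w \<and> path_range X t w \<subseteq> cball 0 (nsup X t w) \<and> 0 \<le> nsup X t w \<and>
   (\<forall>\<nu>. norm \<nu> = 1 \<longrightarrow> hgt (path_range X t w) \<nu> = gsup (\<lambda>t w. X t w \<bullet> (- \<nu>)) t w)"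
proof -
 interpret levy_process M X by fact
 show ?thesis using start_0 AE_space
 proof eventually_elim
  case (elim w)
  let ?K = "path_range X t w"
  have z: "0 \<in> ?K" unfolding path_range_def using elim(1) tgrid_0 by (intro image_eqI[of _ _ 0]) auto
  have nb: "norm (X u w) \<le> nsup X t w" if "u \<in> tgrid t" for u by (rule norm_le_nsup[OF elim(2) t that])
  have sub: "?K \<subseteq> cball 0 (nsup X t w)"
  proof
   fix k assume "k \<in> ?K"
   then obtain u where "k = X u w" "u \<in> tgrid t" unfolding path_range_def by blast
   then show "k \<in> cball 0 (nsup X t w)" using nb by (simp add: dist_norm)
  qed
  have nn: "0 \<le> nsup X t w" using nb[OF tgrid_0] norm_ge_zero by (rule order_trans[rotated])
  have "hgt ?K \<nu> = gsup (\<lambda>t w. X t w \<bullet> (- \<nu>)) t w" if "norm \<nu> = 1" for \<nu>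
  proof -
   have "hgt ?K \<nu> = (SUP u\<in>tgrid t. X u w \<bullet> (- \<nu>))"
    unfolding hgt_def path_range_def image_image by simp
   moreover have "0 \<le> hgt ?K \<nu>" by (rule hgt_bounds(1)[OF that sub z])
   ultimately show ?thesis unfolding gsup_def by simp
  qed
  then show ?case using z sub nn by blast
 qed
qed

section \<open>Bounds for the heat content\<close>

text \<open>The expectation of the deterministic bounds.  The error terms are controlled by the tail of \<open>min (b * sup |X|) b\<close>.\<close>
lemma heat_content_bounds:
 fixes X :: "real => 'w => real^'n" and D :: "(real^'n) set" and N :: nat and \<nu> :: "nat => real^'n" and a a' :: "nat => real"
 assumes L: "levy_process M X" and proj: "\<And>\<nu>. norm \<nu> = 1 ==> doubling_levy M (\<lambda>t w. X t w \<bullet> \<nu>) f"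
  and oD: "open D" and bD: "bounded D" and flat: "flat_boundary D" and t: "0 < t"
  and r0: "0 < r0" and \<nu>: "\<And>i. i < N ==> norm (\<nu> i) = 1" and a: "\<And>i. 0 \<le> a i" "\<And>i. 0 \<le> a' i" and \<eta>: "0 \<le> \<eta>"
  and lo: "\<And>K r. K \<subseteq> cball 0 r ==> 0 \<in> K ==> countable K ==> 0 \<le> r ==> r < r0 ==>
    (\<Sum>i<N. a i * hgt K (\<nu> i)) - \<eta> * r \<le> measure lebesgue (bad D K)"
  and up: "\<And>K r. K \<subseteq> cball 0 r ==> 0 \<in> K ==> countable K ==> 0 \<le> r ==> r < r0 ==>
    measure lebesgue (bad D K) \<le> (\<Sum>i<N. a' i * hgt K (\<nu> i)) + \<eta> * r"
  and b: "0 < b" and \<beta>: "1 < \<beta>" and C: "0 \<le> C"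
  and tail: "\<And>x. 1 \<le> x ==> x < b ==> measure M {w\<in>space M. x / b < nsup X t w} \<le> C * x powr (- \<beta>)"
  and A: "2 \<le> A" "A < b * min r0 1"
 defines "E \<equiv> \<lambda>i. integral\<^sup>L M (\<lambda>w. min (b * gsup (\<lambda>t w. X t w \<bullet> (- \<nu> i)) t w) A)"
  and "\<kappa> \<equiv> 2 * (C / (\<beta> - 1) * (A / 2) powr (1 - \<beta>))"
 shows "b * (measure lebesgue D - spectral_heat_content M X D t)
   \<le> (\<Sum>i<N. a' i * E i) + \<eta> * (1 + C / (\<beta> - 1)) + ((\<Sum>i<N. a' i) + measure lebesgue D / min r0 1) * \<kappa>"
  "(\<Sum>i<N. a i * E i) - \<eta> * (1 + C / (\<beta> - 1)) - (\<Sum>i<N. a i) * \<kappa>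
   \<le> b * (measure lebesgue D - spectral_heat_content M X D t)"
proof -
 interpret levy_process M X by fact
 have t0: "0 \<le> t" using t by simp
 define R where "R = min r0 1"
 have R: "0 < R" "R \<le> 1" using r0 by (auto simp: R_def)
 define v where "v = measure lebesgue D"
 have v0: "0 \<le> v" by (simp add: v_def)
 define V where "V w = measure lebesgue (bad D (path_range X t w))" for w
 define H where "H i w = gsup (\<lambda>t w. X t w \<bullet> (- \<nu> i)) t w" for i w
 define W where "W w = max 0 (min (b * nsup X t w) b)" for w
 define T where "T w = 2 * max (W w - A / 2) 0" for w
 have Vm: "V \<in> borel_measurable M" unfolding V_def by (rule heat_content_deficit(1)[OF oD bD flat t])
 have VE: "v - spectral_heat_content M X D t = expectation V"
  unfolding V_def v_def by (rule heat_content_deficit(2)[OF oD bD flat t])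
 have V01: "0 \<le> V w" "V w \<le> v" for w
 proof -
  show "0 \<le> V w" by (simp add: V_def)
  show "V w \<le> v" unfolding V_def v_def
  proof (rule measure_mono_fmeasurable)
   show "bad D (path_range X t w) \<subseteq> D" unfolding bad_def by (rule Collect_restrict)
   have "bad D (path_range X t w) \<in> sets borel" by (rule bad_borel[OF oD countable_path_range])
   then show "bad D (path_range X t w) \<in> sets lebesgue" by simp
   show "D \<in> lmeasurable" by (rule lmeasurable_open[OF bD oD])
  qed
 qed
 have iV: "integrable M V"
  by (rule integrable_const_bound[where B=v]) (use Vm V01 in auto)
 have [measurable]: "nsup X t \<in> borel_measurable M" by (rule nsup_measurable[OF t0])
 have Wm: "W \<in> borel_measurable M" unfolding W_def by measurable
 have W0: "0 \<le> W w" for w by (simp add: W_def)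
 have Wt: "prob {w\<in>space M. x < W w} \<le> C * x powr (- \<beta>)" if x: "1 \<le> x" for x
 proof (cases "x < b")
  case True
  have "{w\<in>space M. x < W w} = {w\<in>space M. x / b < nsup X t w}"
   unfolding W_def less_max_iff_disj min_less_iff_conj using x b True by (simp add: pos_divide_less_eq mult.commute)
  then show ?thesis using tail[OF x True] by simp
 next
  case False
  have e: "{w\<in>space M. x < W w} = {}" unfolding W_def less_max_iff_disj min_less_iff_conj using x False by simp
  show ?thesis unfolding e using C by simp
 qed
 note pt = polynomial_tail[OF Wm W0 \<beta> C Wt]
 have iW: "integrable M W" and EW: "expectation W \<le> 1 + C / (\<beta> - 1)" by (rule pt(3), simp) (rule pt(4), simp)
 have iT: "integrable M T" and ET: "expectation T \<le> \<kappa>"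
 proof -
  have A2: "1 \<le> A / 2" using A by simp
  show "integrable M T" unfolding T_def by (rule integrable_mult_right, rule pt(1)) (use A2 in auto)
  have "expectation (\<lambda>w. max (W w - A / 2) 0) \<le> C / (\<beta> - 1) * (A / 2) powr (1 - \<beta>)" by (rule pt(2)) (use A2 in auto)
  then show "expectation T \<le> \<kappa>" unfolding T_def \<kappa>_def by simp
 qed
 have A0: "0 \<le> A" using A by simp
 have iH: "integrable M (\<lambda>w. min (b * H i w) A)" if "i < N" for i
 proof -
  have "norm (- \<nu> i) = 1" using \<nu>[OF that] by simp
  then interpret Z: doubling_levy M "\<lambda>t w. X t w \<bullet> (- \<nu> i)" f by (rule proj)
  have [measurable]: "H i \<in> borel_measurable M" unfolding H_def by (rule Z.gsup_measurable[OF t0])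
  show ?thesis
   by (rule expectation_min_nn(1)[OF _ _ A0]) (measurable, simp add: H_def gsup_nonneg b less_imp_le)
 qed
 have ae: "AE w in M. b * V w \<le> (\<Sum>i<N. a' i * min (b * H i w) A) + \<eta> * W w + ((\<Sum>i<N. a' i) + v / R) * T w \<and>
   (\<Sum>i<N. a i * min (b * H i w) A) - \<eta> * W w - (\<Sum>i<N. a i) * T w \<le> b * V w"
  using AE_hgt_path_range[OF L t0]
 proof eventually_elim
  case (elim w)
  let ?K = "path_range X t w" and ?S = "nsup X t w"
  have z: "0 \<in> ?K" and sub: "?K \<subseteq> cball 0 ?S" and S0: "0 \<le> ?S"
   and h: "\<And>\<nu>. norm \<nu> = 1 ==> hgt ?K \<nu> = gsup (\<lambda>t w. X t w \<bullet> (- \<nu>)) t w" using elim by blast+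
  have hH: "H i w = hgt ?K (\<nu> i)" if "i < N" for i unfolding H_def by (rule h[OF \<nu>[OF that], symmetric])
  have hb: "0 \<le> H i w \<and> H i w \<le> ?S" if "i < N" for i
   unfolding hH[OF that] using hgt_bounds(1,2)[OF \<nu>[OF that] sub z] by (rule conjI)
  have sm: "(\<Sum>i<N. c i * H i w) = (\<Sum>i<N. c i * hgt ?K (\<nu> i))" for c :: "nat => real"
   by (rule sum.cong) (simp_all add: hH)
  have U: "W w = min (b * ?S) b" unfolding W_def using S0 b by simp
  have l: "(\<Sum>i<N. a i * H i w) - \<eta> * ?S \<le> V w" if "?S < R"
   unfolding sm V_def by (rule lo[OF sub z countable_path_range S0]) (use that in \<open>simp add: R_def\<close>)
  have u: "V w \<le> (\<Sum>i<N. a' i * H i w) + \<eta> * ?S" if "?S < R"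
   unfolding sm V_def by (rule up[OF sub z countable_path_range S0]) (use that in \<open>simp add: R_def\<close>)
  have AR: "A < b * R" using A(2) by (simp add: R_def)
  note tb = truncation_bounds[where h="\<lambda>i. H i w" and a=a and a'=a', OF hb a V01 R \<eta> S0 l u b A0 AR]
  show ?case unfolding T_def U using tb(1) tb(2) by (rule conjI)
 qed
 have iS: "integrable M (\<lambda>w. \<Sum>i<N. c i * min (b * H i w) A)"
  "expectation (\<lambda>w. \<Sum>i<N. c i * min (b * H i w) A) = (\<Sum>i<N. c i * E i)" for c :: "nat => real"
 proof -
  have i: "integrable M (\<lambda>w. c i * min (b * H i w) A)" if "i < N" for i by (rule integrable_mult_right[OF iH[OF that]])
  show "integrable M (\<lambda>w. \<Sum>i<N. c i * min (b * H i w) A)" by (rule Bochner_Integration.integrable_sum) (use i in simp)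
  have "expectation (\<lambda>w. \<Sum>i<N. c i * min (b * H i w) A) = (\<Sum>i<N. expectation (\<lambda>w. c i * min (b * H i w) A))"
   by (rule Bochner_Integration.integral_sum) (use i in simp)
  then show "expectation (\<lambda>w. \<Sum>i<N. c i * min (b * H i w) A) = (\<Sum>i<N. c i * E i)" by (simp add: E_def H_def)
 qed
 have ibV: "integrable M (\<lambda>w. b * V w)" by (rule integrable_mult_right[OF iV])
 have E: "b * (v - spectral_heat_content M X D t) = expectation (\<lambda>w. b * V w)" unfolding VE by simp
 let ?c = "(\<Sum>i<N. a' i) + v / R"
 have c0: "0 \<le> ?c" "0 \<le> (\<Sum>i<N. a i)" using a v0 R by (auto intro!: add_nonneg_nonneg sum_nonneg)
 have "expectation (\<lambda>w. b * V w) \<le> expectation (\<lambda>w. (\<Sum>i<N. a' i * min (b * H i w) A) + \<eta> * W w + ?c * T w)"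
 proof (rule integral_mono_AE[OF ibV])
  show "integrable M (\<lambda>w. (\<Sum>i<N. a' i * min (b * H i w) A) + \<eta> * W w + ?c * T w)"
   by (intro Bochner_Integration.integrable_add integrable_mult_right iS(1) iW iT)
  show "AE w in M. b * V w \<le> (\<Sum>i<N. a' i * min (b * H i w) A) + \<eta> * W w + ?c * T w"
   using ae by eventually_elim (rule conjunct1)
 qed
 also have "\<dots> = (\<Sum>i<N. a' i * E i) + \<eta> * expectation W + ?c * expectation T"
  by (subst Bochner_Integration.integral_add Bochner_Integration.integral_add[OF iS(1)] |
    intro Bochner_Integration.integrable_add integrable_mult_right iS(1) iW iT |
    simp only: iS(2) integral_mult_right_zero)+
 also have "\<dots> \<le> (\<Sum>i<N. a' i * E i) + \<eta> * (1 + C / (\<beta> - 1)) + ?c * \<kappa>"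
  by (intro add_mono order_refl mult_left_mono EW ET \<eta> c0)
 finally show "b * (measure lebesgue D - spectral_heat_content M X D t)
   \<le> (\<Sum>i<N. a' i * E i) + \<eta> * (1 + C / (\<beta> - 1)) + ((\<Sum>i<N. a' i) + measure lebesgue D / min r0 1) * \<kappa>"
  unfolding E[symmetric] v_def R_def .
 have "expectation (\<lambda>w. (\<Sum>i<N. a i * min (b * H i w) A) - \<eta> * W w - (\<Sum>i<N. a i) * T w) \<le> expectation (\<lambda>w. b * V w)"
 proof (rule integral_mono_AE[OF _ ibV])
  show "integrable M (\<lambda>w. (\<Sum>i<N. a i * min (b * H i w) A) - \<eta> * W w - (\<Sum>i<N. a i) * T w)"
   by (intro Bochner_Integration.integrable_diff integrable_mult_right iS(1) iW iT)
  show "AE w in M. (\<Sum>i<N. a i * min (b * H i w) A) - \<eta> * W w - (\<Sum>i<N. a i) * T w \<le> b * V w"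
   using ae by eventually_elim (rule conjunct2)
 qed
 moreover have "expectation (\<lambda>w. (\<Sum>i<N. a i * min (b * H i w) A) - \<eta> * W w - (\<Sum>i<N. a i) * T w)
   = (\<Sum>i<N. a i * E i) - \<eta> * expectation W - (\<Sum>i<N. a i) * expectation T"
  by (subst Bochner_Integration.integral_diff Bochner_Integration.integral_diff[OF iS(1)] |
    intro Bochner_Integration.integrable_diff integrable_mult_right iS(1) iW iT |
    simp only: iS(2) integral_mult_right_zero)+
 moreover have "\<eta> * expectation W \<le> \<eta> * (1 + C / (\<beta> - 1))" "(\<Sum>i<N. a i) * expectation T \<le> (\<Sum>i<N. a i) * \<kappa>"
  by (intro mult_left_mono EW ET \<eta> c0)+
 ultimately show "(\<Sum>i<N. a i * E i) - \<eta> * (1 + C / (\<beta> - 1)) - (\<Sum>i<N. a i) * \<kappa>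
   \<le> b * (measure lebesgue D - spectral_heat_content M X D t)"
  unfolding E[symmetric] v_def by linarith
qed

section \<open>The limit\<close>

text \<open>The tail of the norm at level \<open>x / b\<close> is governed by \<open>t * f (b / x)\<close> up to constants, and \<open>t * f b = 1\<close>.\<close>
lemma uniform_tail:
 fixes X :: "real => 'w => real^'n"
 assumes L: "levy_process M X" and proj: "\<And>\<nu>. norm \<nu> = 1 ==> doubling_levy M (\<lambda>t w. X t w \<bullet> \<nu>) f"
  and rv: "regularly_varying \<alpha> f" and \<beta>: "0 \<le> \<beta>" "\<beta> < \<alpha>"
  and nn: "\<And>b. 0 \<le> b ==> 0 \<le> f b" and dbl: "\<And>a b. 0 \<le> b ==> b \<le> 2 * a ==> f b \<le> 4 * f a"
 obtains C y0 where "0 \<le> C" "1 \<le> y0"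
  "\<And>t b x. 0 < t ==> t * f b = 1 ==> y0 \<le> b ==> 1 \<le> x ==> x < b ==>
   measure M {w\<in>space M. x / b < nsup X t w} \<le> C * x powr (- \<beta>)"
proof -
 obtain C0 y0 where C0: "0 \<le> C0" and y0: "1 \<le> y0"
  and pot: "\<And>b x. y0 \<le> b ==> 1 \<le> x ==> x \<le> b ==> f (b / x) \<le> C0 * x powr (- \<beta>) * f b"
  by (rule potter_bound[OF dbl nn rv \<beta>]) (assumption | rule that)+
 define c where "c = real CARD('n)"
 \<comment> \<open>Enough doublings to absorb the factor \<open>2 * c\<close> in the argument of \<open>f\<close>.\<close>
 define k where "k = CARD('n) + 1"
 have c: "0 < c" by (simp add: c_def)
 have ck: "2 * c \<le> 2 ^ k"
 proof -
  have "CARD('n) \<le> 2 ^ CARD('n)" by (rule less_imp_le[OF less_exp])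
  then have "real CARD('n) \<le> real (2 ^ CARD('n))" by (simp only: of_nat_le_iff)
  then show ?thesis by (simp add: c_def k_def)
 qed
 show thesis
 proof (rule that[of "32 * c * (4 * 4 ^ k) * C0" y0])
  show "0 \<le> 32 * c * (4 * 4 ^ k) * C0" using c C0 by simp
  show "1 \<le> y0" by (rule y0)
  fix t b x :: real assume t: "0 < t" and tf: "t * f b = 1" and b: "y0 \<le> b" and x: "1 \<le> x" "x < b"
  have bp: "0 < b" using x by simp
  have "measure M {w\<in>space M. x / b < nsup X t w} \<le> 32 * c * t * f (2 * c / (x / b))"
   unfolding c_def by (rule nsup_tail[OF L proj]) (use t x bp in auto)
  also have "f (2 * c / (x / b)) \<le> 4 * 4 ^ k * (C0 * x powr (- \<beta>) * f b)"
  proof -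
   have y: "0 \<le> b / x" using bp x by simp
   have "2 * c / (x / b) = 2 * c * (b / x)" by simp
   also have "\<dots> \<le> 2 ^ k * (b / x)" using ck y by (rule mult_right_mono)
   also have "\<dots> \<le> 2 * (2 ^ k * (b / x))" proof -
    have "0 \<le> 2 ^ k * (b / x)" by (rule mult_nonneg_nonneg[OF _ y]) simp
    then show ?thesis by linarith
   qed
   finally have "f (2 * c / (x / b)) \<le> 4 * f (2 ^ k * (b / x))" using c bp x by (intro dbl) auto
   also have "f (2 ^ k * (b / x)) \<le> 4 ^ k * f (b / x)" by (rule doubling_iterate[OF dbl y])
   also have "f (b / x) \<le> C0 * x powr (- \<beta>) * f b" by (rule pot) (use b x in auto)
   finally show ?thesis by simp
  qed
  finally have "measure M {w\<in>space M. x / b < nsup X t w} \<le> 32 * c * t * (4 * 4 ^ k * (C0 * x powr (- \<beta>) * f b))"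
   using c t by simp
  also have "\<dots> = 32 * c * (4 * 4 ^ k) * C0 * x powr (- \<beta>) * (t * f b)" by (simp only: mult_ac)
  finally show "measure M {w\<in>space M. x / b < nsup X t w} \<le> 32 * c * (4 * 4 ^ k) * C0 * x powr (- \<beta>)"
   unfolding tf by simp
 qed
qed

text \<open>The order of the limits: first \<open>n \<rightarrow> \<infinity>\<close>, then the truncation level \<open>A \<rightarrow> \<infinity>\<close> while \<open>\<eta>\<close> and hence \<open>K1\<close> stay fixed, and finally \<open>\<eta> \<rightarrow> 0\<close>.\<close>
lemma two_parameter_squeeze:
 fixes x :: "nat => real" and g :: "real => real"
 assumes P: "0 \<le> P" and m: "0 \<le> m" and K0: "0 \<le> K0" and \<beta>: "1 < \<beta>"
  and g: "(g \<longlongrightarrow> m) at_top" and gm: "\<And>A. 2 \<le> A ==> g A \<le> m"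
  and bounds: "\<And>\<eta>. 0 < \<eta> ==> \<exists>K1. \<forall>A\<ge>2. \<forall>\<^sub>F n in sequentially.
   (P - \<eta>) * g A - \<eta> - \<eta> * K0 - K1 * (A / 2) powr (1 - \<beta>) \<le> x n \<and>
   x n \<le> (P + \<eta>) * g A + \<eta> + \<eta> * K0 + K1 * (A / 2) powr (1 - \<beta>)"
 shows "x \<longlonglongrightarrow> P * m"
proof (rule LIMSEQ_I)
 fix e :: real assume e: "0 < e"
 \<comment> \<open>All terms of order \<open>\<eta>\<close> together stay below \<open>e / 2\<close>.\<close>
 define \<eta> where "\<eta> = e / (2 * (m + 1 + K0 + 1))"
 have d: "0 < m + 1 + K0 + 1" using m K0 by simp
 have \<eta>: "0 < \<eta>" using e d by (simp add: \<eta>_def)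
 have \<eta>e: "\<eta> * (m + 1 + K0 + 1) = e / 2" using d by (simp add: \<eta>_def field_simps)
 obtain K1 where K1: "\<And>A. 2 \<le> A ==> \<forall>\<^sub>F n in sequentially.
   (P - \<eta>) * g A - \<eta> - \<eta> * K0 - K1 * (A / 2) powr (1 - \<beta>) \<le> x n \<and>
   x n \<le> (P + \<eta>) * g A + \<eta> + \<eta> * K0 + K1 * (A / 2) powr (1 - \<beta>)" using bounds[OF \<eta>] by blast
 have half: "filterlim (\<lambda>A::real. A / 2) at_top at_top" by real_asymp
 have "((\<lambda>A. (A / 2) powr (1 - \<beta>)) \<longlongrightarrow> 0) at_top"
  by (rule tendsto_neg_powr[OF _ half]) (use \<beta> in simp)
 then have t1: "((\<lambda>A. P * (m - g A) + K1 * (A / 2) powr (1 - \<beta>)) \<longlongrightarrow> P * (m - m) + K1 * 0) at_top"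
  and t2: "((\<lambda>A. K1 * (A / 2) powr (1 - \<beta>)) \<longlongrightarrow> K1 * 0) at_top"
  by (intro tendsto_intros g, assumption)+
 have "\<forall>\<^sub>F A in at_top. P * (m - g A) + K1 * (A / 2) powr (1 - \<beta>) < e / 2"
  by (rule order_tendstoD(2)[OF t1]) (use e in simp)
 moreover have "\<forall>\<^sub>F A in at_top. K1 * (A / 2) powr (1 - \<beta>) < e / 2"
  by (rule order_tendstoD(2)[OF t2]) (use e in simp)
 ultimately have "\<forall>\<^sub>F A in at_top. P * (m - g A) + K1 * (A / 2) powr (1 - \<beta>) < e / 2 \<and> K1 * (A / 2) powr (1 - \<beta>) < e / 2 \<and> 2 \<le> A"
  using eventually_ge_at_top[of 2] by eventually_elim simp
 then obtain A where A: "P * (m - g A) + K1 * (A / 2) powr (1 - \<beta>) < e / 2" "K1 * (A / 2) powr (1 - \<beta>) < e / 2" "2 \<le> A"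
  by (auto simp: eventually_at_top_linorder)
 have "\<forall>\<^sub>F n in sequentially. norm (x n - P * m) < e"
  using K1[OF A(3)]
 proof eventually_elim
  case (elim n)
  have 1: "\<eta> * g A \<le> \<eta> * m" "P * g A \<le> P * m" using gm[OF A(3)] \<eta> P by (auto intro!: mult_left_mono)
  have 2: "\<eta> * m + \<eta> + \<eta> * K0 < e / 2"
   using \<eta>e \<eta> by (simp add: algebra_simps)
  show ?case using elim A(1,2) 1 2 unfolding real_norm_def abs_less_iff
   by (simp add: left_diff_distrib distrib_right right_diff_distrib)
 qed
 then show "\<exists>no. \<forall>n\<ge>no. norm (x n - P * m) < e" by (simp add: eventually_sequentially)
qed

theorem theorem3p1:
 fixes D :: "(real^'n) set"
  and M :: "'w measure" and X :: "real \<Rightarrow> 'w \<Rightarrow> real^'n"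
  and \<psi> :: "real^'n \<Rightarrow> complex" and \<alpha> :: real
  and N :: "'v measure" and Y :: "real \<Rightarrow> 'v \<Rightarrow> real"
 assumes "CARD('n) \<ge> 2"
  and "bounded D" and "c11_open D"
  and "levy_process M X" and "isotropic M X"
  and "char_exponent M X \<psi>"
  and "1 < \<alpha>" and "\<alpha> \<le> 2"
  and "regularly_varying \<alpha> (radial_profile \<psi>)"
  and "symmetric_stable_process \<alpha> N Y"
 shows "((\<lambda>t. gen_inverse (radial_profile \<psi>) (1 / t) *
      (measure lebesgue D - spectral_heat_content M X D t))
     \<longlongrightarrow> perimeter D * integral\<^sup>L N (sup_process Y 1)) (at_right 0)"
proof (rule tendsto_at_right_sequentially[of 0 1])
 note dim = assms(1) and bD = assms(2) and L = assms(4) and iso = assms(5) and ce = assms(6) and rv = assms(9)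
 let ?f = "radial_profile \<psi>"
 have oD: "open D" using assms(3) unfolding c11_open_def by blast
 have flat: "flat_boundary D" by (rule c11_open_imp_flat_boundary) fact
 have dbl: "?f b \<le> 4 * ?f a" if "0 \<le> b" "b \<le> 2 * a" for a b
  by (rule profile_doubling[OF L iso ce dim that])
 have proj: "doubling_levy M (\<lambda>t w. X t w \<bullet> \<nu>) ?f" if "norm \<nu> = 1" for \<nu>
  by (intro doubling_levy.intro doubling_levy_axioms.intro isotropic_projection[OF L iso ce dim that] dbl)
 obtain i :: 'n where True by blast
 have "norm (axis i 1 :: real^'n) = 1" by (simp add: norm_axis_1)
 then interpret Z1: doubling_levy M "\<lambda>t w. X t w \<bullet> axis i 1" ?f by (rule proj)
 have Y: "doubling_levy N Y (\<lambda>x. x powr \<alpha>)" by (rule symmetric_stable_doubling[OF assms(10,7,8)])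
 \<comment> \<open>An exponent above \<open>1\<close>, so that the tails are integrable, and below \<open>\<alpha>\<close>, so that the Potter bound holds.\<close>
 define \<beta> where "\<beta> = (1 + \<alpha>) / 2"
 have \<beta>: "1 < \<beta>" "0 \<le> \<beta>" "\<beta> < \<alpha>" using assms(7) by (auto simp: \<beta>_def)
 obtain C y0 where C: "0 \<le> C" and y0: "1 \<le> y0" and
  tail: "\<And>t b x. 0 < t ==> t * ?f b = 1 ==> y0 \<le> b ==> 1 \<le> x ==> x < b ==>
   measure M {w\<in>space M. x / b < nsup X t w} \<le> C * x powr (- \<beta>)"
  by (rule uniform_tail[OF L proj rv \<beta>(2,3) Z1.f_nonneg dbl]) (assumption | rule that)+
 have P0: "0 \<le> perimeter D" by (simp add: perimeter_def)
 note supY = stable_sup_expectation[OF Y assms(7)]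
 have a0: "0 < \<alpha>" using assms(7) by simp
 fix tn :: "nat => real"
 assume tn: "\<And>n. 0 < tn n" "tn \<longlonglongrightarrow> 0"
 let ?b = "\<lambda>n. gen_inverse ?f (1 / tn n)"
 note sc = inverse_scale[OF dbl Z1.f_nonneg Z1.f_continuous Z1.f_0 rv a0 tn]
 show "(\<lambda>n. ?b n * (measure lebesgue D - spectral_heat_content M X D (tn n))) \<longlonglongrightarrow> perimeter D * integral\<^sup>L N (sup_process Y 1)"
  unfolding supY(3)[symmetric]
 proof (rule two_parameter_squeeze[OF P0 _ _ \<beta>(1) supY(1)])
  show "0 \<le> integral\<^sup>L N (gsup Y 1)" by (rule integral_nonneg_AE) (simp add: gsup_nonneg)
  show "0 \<le> 1 + C / (\<beta> - 1)" using C \<beta> by simp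
  show "integral\<^sup>L N (\<lambda>w. min (gsup Y 1 w) A) \<le> integral\<^sup>L N (gsup Y 1)" if "2 \<le> A" for A
   by (rule supY(2)) (use that in simp)
  fix \<eta> :: real assume \<eta>: "0 < \<eta>"
  obtain I :: nat and \<nu> :: "nat => real^'n" and a a' :: "nat => real" and r0 :: real where
   r0: "0 < r0" and \<nu>: "\<And>i. i < I ==> norm (\<nu> i) = 1" and a: "\<And>i. 0 \<le> a i" "\<And>i. 0 \<le> a' i"
   and sa: "perimeter D - \<eta> \<le> (\<Sum>i<I. a i)" "(\<Sum>i<I. a' i) \<le> perimeter D + \<eta>"
   and lo: "\<And>K r. K \<subseteq> cball 0 r ==> 0 \<in> K ==> countable K ==> 0 \<le> r ==> r < r0 ==>
    (\<Sum>i<I. a i * hgt K (\<nu> i)) - \<eta> * r \<le> measure lebesgue (bad D K)"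
   and up: "\<And>K r. K \<subseteq> cball 0 r ==> 0 \<in> K ==> countable K ==> 0 \<le> r ==> r < r0 ==>
    measure lebesgue (bad D K) \<le> (\<Sum>i<I. a' i * hgt K (\<nu> i)) + \<eta> * r"
   by (rule boundary_layer_volume[OF oD bD dim flat \<eta>]) (assumption | rule that)+
  define K1 where "K1 = ((\<Sum>i<I. a i) + (\<Sum>i<I. a' i) + measure lebesgue D / min r0 1) * (2 * (C / (\<beta> - 1)))"
  show "\<exists>K1. \<forall>A\<ge>2. \<forall>\<^sub>F n in sequentially.
   (perimeter D - \<eta>) * integral\<^sup>L N (\<lambda>w. min (gsup Y 1 w) A) - \<eta> - \<eta> * (1 + C / (\<beta> - 1)) - K1 * (A / 2) powr (1 - \<beta>)
    \<le> ?b n * (measure lebesgue D - spectral_heat_content M X D (tn n)) \<and>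
   ?b n * (measure lebesgue D - spectral_heat_content M X D (tn n))
    \<le> (perimeter D + \<eta>) * integral\<^sup>L N (\<lambda>w. min (gsup Y 1 w) A) + \<eta> + \<eta> * (1 + C / (\<beta> - 1)) + K1 * (A / 2) powr (1 - \<beta>)"
  proof (intro exI[of _ K1] allI impI)
   fix A :: real assume A: "2 \<le> A"
   let ?E = "\<lambda>n i. integral\<^sup>L M (\<lambda>w. min (?b n * gsup (\<lambda>t w. X t w \<bullet> (- \<nu> i)) (tn n) w) A)"
   let ?g = "integral\<^sup>L N (\<lambda>w. min (gsup Y 1 w) A)"
   let ?x = "\<lambda>n. ?b n * (measure lebesgue D - spectral_heat_content M X D (tn n))"
   define p where "p = (A / 2) powr (1 - \<beta>)"
   have p: "0 \<le> p" by (simp add: p_def)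
   have g0: "0 \<le> ?g" using A gsup_nonneg[of Y 1] by (intro integral_nonneg_AE AE_I2) simp
   have E: "(\<lambda>n. ?E n i) \<longlonglongrightarrow> ?g" if "i < I" for i
    by (rule truncated_sup_limit[OF proj Y]) (use \<nu>[OF that] sc(1,4) tn(1) A in \<open>auto intro: less_imp_le\<close>)
   have S: "(\<lambda>n. \<Sum>i<I. c i * ?E n i) \<longlonglongrightarrow> (\<Sum>i<I. c i * ?g)" for c :: "nat => real"
    by (intro tendsto_sum tendsto_mult_left E) simp
   have e1: "\<forall>\<^sub>F n in sequentially. (\<Sum>i<I. a' i * ?E n i) < (\<Sum>i<I. a' i * ?g) + \<eta>"
    by (rule order_tendstoD(2)[OF S]) (use \<eta> in simp)
   have e2: "\<forall>\<^sub>F n in sequentially. (\<Sum>i<I. a i * ?g) - \<eta> < (\<Sum>i<I. a i * ?E n i)"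
    by (rule order_tendstoD(1)[OF S]) (use \<eta> in simp)
   have r1: "0 < min r0 1" using r0 by simp
   have e3: "\<forall>\<^sub>F n in sequentially. max y0 (A / min r0 1 + 1) \<le> ?b n"
    using sc(3) unfolding filterlim_at_top by blast
   show "\<forall>\<^sub>F n in sequentially. (perimeter D - \<eta>) * ?g - \<eta> - \<eta> * (1 + C / (\<beta> - 1)) - K1 * (A / 2) powr (1 - \<beta>) \<le> ?x n \<and>
     ?x n \<le> (perimeter D + \<eta>) * ?g + \<eta> + \<eta> * (1 + C / (\<beta> - 1)) + K1 * (A / 2) powr (1 - \<beta>)"
    using e1 e2 e3
   proof eventually_elim
    case (elim n)
    have by0: "y0 \<le> ?b n" and "A / min r0 1 < ?b n" using elim(3) by auto
    \<comment> \<open>Displacements of size at least \<open>r0\<close> thus belong to the truncated part.\<close>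
    then have bA: "A < ?b n * min r0 1" using r1 by (simp only: pos_divide_less_eq)
    have tl: "measure M {w\<in>space M. x / ?b n < nsup X (tn n) w} \<le> C * x powr (- \<beta>)" if "1 \<le> x" "x < ?b n" for x
     by (rule tail[OF tn(1) sc(2) by0 that])
    note hb = heat_content_bounds[OF L proj oD bD flat tn(1) r0 \<nu> a less_imp_le[OF \<eta>] lo up sc(1) \<beta>(1) C tl A bA]
    define q where "q = 2 * (C / (\<beta> - 1))"
    have q: "0 \<le> q" using C \<beta> by (simp add: q_def)
    have qp: "2 * (C / (\<beta> - 1) * (A / 2) powr (1 - \<beta>)) = q * p" by (simp add: q_def p_def)
    define s s' w where "s = (\<Sum>i<I. a i)" and "s' = (\<Sum>i<I. a' i)" and "w = measure lebesgue D / min r0 1"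
    have s0: "0 \<le> s" "0 \<le> s'" unfolding s_def s'_def using a by (simp_all add: sum_nonneg)
    have w0: "0 \<le> w" unfolding w_def using r1 by simp
    have K1: "K1 * (A / 2) powr (1 - \<beta>) = (s + s' + w) * (q * p)" unfolding K1_def s_def s'_def w_def q_def p_def by simp
    have qp0: "0 \<le> q * p" using q p by simp
    have m1: "(s' + w) * (q * p) \<le> (s + s' + w) * (q * p)" "s * (q * p) \<le> (s + s' + w) * (q * p)"
     by (rule mult_right_mono[OF _ qp0], use s0 w0 in simp)+
    have m2: "(\<Sum>i<I. a' i * ?g) \<le> (perimeter D + \<eta>) * ?g" "(perimeter D - \<eta>) * ?g \<le> (\<Sum>i<I. a i * ?g)"
     unfolding sum_distrib_right[symmetric] by (rule mult_right_mono[OF _ g0], rule sa)+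
    show ?case
    proof (rule conjI)
     show "?x n \<le> (perimeter D + \<eta>) * ?g + \<eta> + \<eta> * (1 + C / (\<beta> - 1)) + K1 * (A / 2) powr (1 - \<beta>)"
      using hb(1) elim(1) m1(1) m2(1) unfolding K1 qp s'_def[symmetric] w_def[symmetric] by linarith
     show "(perimeter D - \<eta>) * ?g - \<eta> - \<eta> * (1 + C / (\<beta> - 1)) - K1 * (A / 2) powr (1 - \<beta>) \<le> ?x n"
      using hb(2) elim(2) m1(2) m2(2) unfolding K1 qp s_def[symmetric] by linarith
    qed
   qed
  qed
 qed
qed simp

end
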